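(* Slot-Laminar Paging with $k$ slots and a laminar requestable family of height $h$ admits the following polynomial-time algorithms: a deterministic $3h^2k$-competitive online algorithm, a randomized $3h^2H_k$-competitive online algorithm, and an offline $3h^2$-approximation algorithm, where $H_k=\sum_{i=1}^k1/i$.
   Context: Slot-Heterogenous Paging: cache slots $[k]$, family $\mathcal{F}\subseteq 2^{[k]}\setminus\{\emptyset\}$ of requestable slot sets, requests $(p,S)$ with $p$ a page and $S\in\mathcal{F}$. A configuration assigns to each slot a single page or nothing and satisfies $(p,S)$ if some slot in $S$ holds $p$. A solution is a sequence of configurations satisfying the requests in order; cost is the number of retrievals (page $p$ retrieved in slot $s$ at time $t$ if $C_t$ assigns $p$ to $s$ but $C_{t-1}$ does not, or $t=1$). Slot-Laminar Paging is the case where $\mathcal{F}$ is laminar (any two members disjoint or nested); its height $h$ is the maximum number of strictly nested sets $R_1\subsetneq\dots\subsetneq R_h$ in $\mathcal{F}$. An algorithm is a $c$-approximation if its (expected) cost is at most $c\cdot\mathrm{OPT}+b$ on every instance, with $b$ a constant independent of the instance ($b=0$ for offline algorithms); an online $c$-approximation algorithm is called $c$-competitive. *)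

theory Defs
  imports "HOL-Probability.Probability" "HOL-Computational_Algebra.Polynomial"
begin

section \<open>Slot-Heterogenous and Slot-Laminar Paging\<close>

type_synonym slot = nat
type_synonym page = nat
type_synonym request = "page \<times> slot set"
type_synonym config = "slot \<Rightarrow> page option"

text \<open>
  The slots are \<open>{1..slots I}\<close>. An algorithm receives the requestable family in some order, so an
  instance carries an enumeration of it; the family itself is \<open>set (family I)\<close>. Values of a
  configuration outside the slots are never looked at.
\<close>

record paging_instance =
  slots :: nat
  family :: "slot set list"
  requests :: "request list"

definition laminar :: "'a set set \<Rightarrow> bool" where
  "laminar F \<longleftrightarrow> (\<forall>A\<in>F. \<forall>B\<in>F. A \<inter> B = {} \<or> A \<subseteq> B \<or> B \<subseteq> A)"

definition laminar_height :: "'a set set \<Rightarrow> nat" where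
  "laminar_height F = Max {length Rs |Rs. set Rs \<subseteq> F \<and> sorted_wrt (\<subset>) Rs}"

definition slot_heterogenous :: "paging_instance set" where
  "slot_heterogenous = {I. distinct (family I) \<and> set (family I) \<subseteq> Pow {1..slots I} - {{}} \<and>
     (\<forall>(p, S)\<in>set (requests I). S \<in> set (family I))}"

definition slot_laminar :: "paging_instance set" where
  "slot_laminar = {I \<in> slot_heterogenous. laminar (set (family I))}"

fun satisfies :: "config \<Rightarrow> request \<Rightarrow> bool" where
  "satisfies C (p, S) \<longleftrightarrow> (\<exists>s\<in>S. C s = Some p)"

definition solution :: "paging_instance \<Rightarrow> config list \<Rightarrow> bool" where
  "solution I Cs \<longleftrightarrow> list_all2 satisfies Cs (requests I)"

text \<open>Times are counted from 0 here, so the first configuration is \<open>Cs ! 0\<close>.\<close>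

definition retrieved :: "config list \<Rightarrow> nat \<Rightarrow> page \<Rightarrow> slot \<Rightarrow> bool" where
  "retrieved Cs t p s \<longleftrightarrow> (Cs ! t) s = Some p \<and> (t = 0 \<or> (Cs ! (t - 1)) s \<noteq> Some p)"

definition cost :: "paging_instance \<Rightarrow> config list \<Rightarrow> nat" where
  "cost I Cs = (\<Sum>t<length Cs. card {(p, s). s \<in> {1..slots I} \<and> retrieved Cs t p s})"

definition opt :: "paging_instance \<Rightarrow> nat" where
  "opt I = (LEAST c. \<exists>Cs. solution I Cs \<and> cost I Cs = c)"


section \<open>Polynomial time\<close>

text \<open>
  The machine model is a while-language over binary trees. Evaluating any program node on input
  \<open>x\<close> is charged \<open>1 + size x\<close> on top of its sub-evaluations, so that (up to a factor depending
  only on the program) no tree larger than the running time is ever built. With this charge a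
  Turing machine and a program simulate each other with polynomial overhead.
\<close>

datatype bintree = Tip | Pair bintree bintree

fun left :: "bintree \<Rightarrow> bintree" where
  "left Tip = Tip"
| "left (Pair x y) = x"

fun right :: "bintree \<Rightarrow> bintree" where
  "right Tip = Tip"
| "right (Pair x y) = y"

fun enc_bool :: "bool \<Rightarrow> bintree" where
  "enc_bool False = Tip"
| "enc_bool True = Pair Tip Tip"

datatype prog =
    Ident
  | Const bintree
  | Left
  | Right
  | Equal
  | Fork prog prog
  | Seq prog prog
  | Cond prog prog prog
  | While prog prog

text \<open>\<open>exec P x y n\<close>: on input \<open>x\<close> the program \<open>P\<close> halts with output \<open>y\<close> after time \<open>n\<close>.\<close>

inductive exec :: "prog \<Rightarrow> bintree \<Rightarrow> bintree \<Rightarrow> nat \<Rightarrow> bool" where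
  "exec Ident x x (1 + size x)"
| "exec (Const c) x c (1 + size x)"
| "exec Left x (left x) (1 + size x)"
| "exec Right x (right x) (1 + size x)"
| "exec Equal x (enc_bool (left x = right x)) (1 + size x)"
| "exec P x y m \<Longrightarrow> exec Q x z n \<Longrightarrow> exec (Fork P Q) x (Pair y z) (1 + size x + m + n)"
| "exec P x y m \<Longrightarrow> exec Q y z n \<Longrightarrow> exec (Seq P Q) x z (1 + size x + m + n)"
| "exec B x b l \<Longrightarrow> b \<noteq> Tip \<Longrightarrow> exec P x y m \<Longrightarrow> exec (Cond B P Q) x y (1 + size x + l + m)"
| "exec B x Tip l \<Longrightarrow> exec Q x y m \<Longrightarrow> exec (Cond B P Q) x y (1 + size x + l + m)"
| "exec B x Tip l \<Longrightarrow> exec (While B P) x x (1 + size x + l)"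
| "exec B x b l \<Longrightarrow> b \<noteq> Tip \<Longrightarrow> exec P x y m \<Longrightarrow> exec (While B P) y z n \<Longrightarrow>
     exec (While B P) x z (1 + size x + l + m + n)"

text \<open>
  On the inputs in \<open>D\<close>, presented as \<open>inp x\<close>, the (encoded) result \<open>out x\<close> is computed by one
  program in time polynomial in the size of the presentation.
\<close>

definition poly_time :: "'a set \<Rightarrow> ('a \<Rightarrow> bintree) \<Rightarrow> ('a \<Rightarrow> bintree) \<Rightarrow> bool" where
  "poly_time D inp out \<longleftrightarrow>
     (\<exists>P. \<exists>q :: nat poly. \<forall>x\<in>D. \<exists>n \<le> poly q (size (inp x)). exec P (inp x) (out x) n)"

text \<open>Numbers are written in binary, least significant digit first.\<close>

fun enc_nat :: "nat \<Rightarrow> bintree" where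
  "enc_nat n = (if n = 0 then Tip else Pair (enc_bool (odd n)) (enc_nat (n div 2)))"

declare enc_nat.simps [simp del]

definition enc_list :: "('a \<Rightarrow> bintree) \<Rightarrow> 'a list \<Rightarrow> bintree" where
  "enc_list e xs = foldr (\<lambda>x. Pair (e x)) xs Tip"

fun enc_option :: "('a \<Rightarrow> bintree) \<Rightarrow> 'a option \<Rightarrow> bintree" where
  "enc_option e None = Tip"
| "enc_option e (Some x) = Pair Tip (e x)"

definition enc_slots :: "slot set \<Rightarrow> bintree" where
  "enc_slots S = enc_list enc_nat (sorted_list_of_set S)"

definition enc_instance :: "paging_instance \<Rightarrow> bintree" where
  "enc_instance I =
     Pair (enc_slots {1..slots I})
       (Pair (enc_list enc_slots (family I))
             (enc_list (\<lambda>(p, S). Pair (enc_nat p) (enc_slots S)) (requests I)))"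

definition enc_config :: "paging_instance \<Rightarrow> config \<Rightarrow> bintree" where
  "enc_config I C = enc_list (\<lambda>s. enc_option enc_nat (C s)) [1..<Suc (slots I)]"


section \<open>Offline algorithms\<close>

type_synonym offline_alg = "paging_instance \<Rightarrow> config list"

definition poly_time_offline :: "offline_alg \<Rightarrow> bool" where
  "poly_time_offline A \<longleftrightarrow>
     poly_time slot_laminar enc_instance (\<lambda>I. enc_list (enc_config I) (A I))"

text \<open>The ratio \<open>c\<close> may depend on parameters of the instance such as \<open>k\<close> and \<open>h\<close>.\<close>

definition approximation :: "(paging_instance \<Rightarrow> real) \<Rightarrow> offline_alg \<Rightarrow> bool" where
  "approximation c A \<longleftrightarrow>
     (\<forall>I\<in>slot_laminar. solution I (A I) \<and> real (cost I (A I)) \<le> c I * real (opt I))"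


section \<open>Deterministic online algorithms\<close>

text \<open>
  An online algorithm maps the instance revealed so far (slots, family and the requests up to and
  including the current one) to the current configuration. Any internal state is a function of
  this history, and computing every configuration in time polynomial in the history amounts to
  polynomial total time.
\<close>

type_synonym online_alg = "paging_instance \<Rightarrow> config"

definition revealed :: "paging_instance \<Rightarrow> nat \<Rightarrow> paging_instance" where
  "revealed I t = I\<lparr>requests := take t (requests I)\<rparr>"

definition online_run :: "online_alg \<Rightarrow> paging_instance \<Rightarrow> config list" where
  "online_run A I = map (\<lambda>t. A (revealed I t)) [1..<Suc (length (requests I))]"

definition poly_time_online :: "online_alg \<Rightarrow> bool" where
  "poly_time_online A \<longleftrightarrow> poly_time slot_laminar enc_instance (\<lambda>I. enc_config I (A I))"

definition competitive :: "(paging_instance \<Rightarrow> real) \<Rightarrow> online_alg \<Rightarrow> bool" where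
  "competitive c A \<longleftrightarrow>
     (\<exists>b :: real. \<forall>I\<in>slot_laminar. solution I (online_run A I) \<and>
        real (cost I (online_run A I)) \<le> c I * real (opt I) + b)"


section \<open>Randomized online algorithms\<close>

text \<open>
  A randomized algorithm has access to an infinite tape of independent fair coin flips, fixed
  once for the whole run. Polynomial time means that each configuration is computed in polynomial
  time from the history and a polynomially long initial segment of the tape.
\<close>

type_synonym rand_online_alg = "(nat \<Rightarrow> bool) \<Rightarrow> online_alg"

definition coins :: "(nat \<Rightarrow> bool) measure" where
  "coins = PiM UNIV (\<lambda>_. measure_pmf (bernoulli_pmf (1/2)))"

definition poly_time_rand_online :: "rand_online_alg \<Rightarrow> bool" where
  "poly_time_rand_online A \<longleftrightarrow>
     (\<exists>r :: nat poly. poly_time (UNIV \<times> slot_laminar)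
        (\<lambda>(\<omega>, I). Pair (enc_instance I)
           (enc_list enc_bool (map \<omega> [0..<poly r (size (enc_instance I))])))
        (\<lambda>(\<omega>, I). enc_config I (A \<omega> I)))"

definition rand_competitive :: "(paging_instance \<Rightarrow> real) \<Rightarrow> rand_online_alg \<Rightarrow> bool" where
  "rand_competitive c A \<longleftrightarrow>
     (\<exists>b :: real. \<forall>I\<in>slot_laminar. (\<forall>\<omega>. solution I (online_run (A \<omega>) I)) \<and>
        integrable coins (\<lambda>\<omega>. real (cost I (online_run (A \<omega>) I))) \<and>
        (LINT \<omega>|coins. real (cost I (online_run (A \<omega>) I))) \<le> c I * real (opt I) + b)"

end

theory Submission
  imports Defs
begin

text \<open>
  Requests are first relabelled: a request \<open>(p, S)\<close> is attached to the item of the latest request for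
  \<open>p\<close> made inside \<open>S\<close>, and opens a new item if there is none. Every set \<open>R\<close> of the family then runs
  ordinary paging with \<open>card R\<close> slots on the items requested inside \<open>R\<close>. Each of these caches is
  governed by the offset (work) function of paging, which counts \<open>F\<^sub>R\<close> fresh requests; the choice of
  the evicted items costs at most \<open>k F\<^sub>R\<close> (arbitrary choice), \<open>H\<^sub>k F\<^sub>R\<close> (random keys) or \<open>F\<^sub>R\<close>
  (furthest next use) loads.

  A solution of the original instance yields, for each \<open>R\<close>, a paging solution for the items of \<open>R\<close>
  that pays at most \<open>h\<close> for each retrieval into a slot of \<open>R\<close>; hence \<open>F\<^sub>R\<close> is at most \<open>h\<close> times the
  retrievals of the optimum in \<open>R\<close>. Every slot lies in at most \<open>h\<close> sets, so the \<open>F\<^sub>R\<close> sum up to at most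
  \<open>h\<^sup>2\<close> times the optimum. Conversely the caches of all \<open>R\<close> are realised simultaneously by placing
  their items in slots such that sets adjacent in the laminar order agree on common items; one load
  in some \<open>R\<close> then causes at most three retrievals in the maximal sets, which are the ones displayed.
\<close>

section \<open>Paging with pools\<close>

text \<open>A copy of a page elsewhere in \<open>R\<close> does not serve a request confined to a
  smaller set, so the pages themselves do not form a paging problem on \<open>R\<close>; items do.
  The price is that one retrieval of the optimum may stand for several items in turn without paying
  again. The changes it can be forced to make are bounded by the number of sets around its slot:
  this is the first factor \<open>h\<close>. The second arises because the same retrieval is charged
  separately in every set around its slot.

  The pools evolve with the item sequence alone, whatever is evicted. So one lower bound serves all
  three algorithms, and random keys are independent of the pools that use them.

  Rounding works because the caches are lazy: a request adds at most the requested item. A set that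
  misses the item can break the alignment with the next smaller and the next larger set of the
  chain, so each miss allows two exchanges of slots. Together with the slot that receives the item
  this gives the constant 3.\<close>

text \<open>
  A pool consists of data fixed at its creation (random bits or the future), the support \<open>N\<close> at that
  time, and its members; each pool withholds one further member from the cache.
\<close>

type_synonym ('x, 'i) pool = "'x \<times> 'i list \<times> 'i list"

definition members :: "('x, 'i) pool \<Rightarrow> 'i list" where
  "members P = snd (snd P)"

definition restrict_pool :: "('i \<Rightarrow> bool) \<Rightarrow> ('x, 'i) pool \<Rightarrow> ('x, 'i) pool" where
  "restrict_pool f P = (fst P, fst (snd P), filter f (snd (snd P)))"

text \<open>\<open>n\<close> is the number of pools already passed, so the rank of the head is
  \<open>Suc n\<close>. The last full pool is the one wanted, because by nesting it contains the
  members of all earlier pools.\<close>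

fun last_full :: "nat \<Rightarrow> 'i list list \<Rightarrow> 'i list \<Rightarrow> 'i list" where
  "last_full n [] E = E"
| "last_full n (S # Ss) E = last_full (Suc n) Ss (if length S = Suc n then S else E)"

text \<open>When a pool has as many members as its rank, it and its predecessors withhold distinct
  members of it, hence all of them. None of these items is cached, whatever the choices, and so they
  leave the support.\<close>

definition prune :: "'i list \<times> ('x, 'i) pool list \<Rightarrow> 'i list \<times> ('x, 'i) pool list" where
  "prune st = (let E = last_full 0 (map members (snd st)) [] in
     (filter (\<lambda>y. y \<notin> set E) (fst st),
      filter (\<lambda>P. members P \<noteq> []) (map (restrict_pool (\<lambda>y. y \<notin> set E)) (snd st))))"

text \<open>\<open>K\<close> is the cache size and \<open>a\<close> the data given to a new pool. A
  cache of minimal cost lies in the support, so a request outside it raises the minimum by one. Once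
  the support is full, one more of the old items must then be missing, and the new pool stands for
  this. A request inside the support forces the item to be present, hence no pool may withhold
  it.\<close>

definition engine_move ::
    "nat \<Rightarrow> 'x \<Rightarrow> 'i \<Rightarrow> 'i list \<times> ('x, 'i) pool list \<Rightarrow> 'i list \<times> ('x, 'i) pool list" where
  "engine_move K a x st =
     (if x \<notin> set (fst st)
      then (fst st @ [x], if length (fst st) < K then snd st else snd st @ [(a, fst st, fst st)])
      else (fst st, map (restrict_pool (\<lambda>y. y \<noteq> x)) (snd st)))"

definition engine_step ::
    "nat \<Rightarrow> 'x \<Rightarrow> 'i \<Rightarrow> 'i list \<times> ('x, 'i) pool list \<Rightarrow> 'i list \<times> ('x, 'i) pool list" where
  "engine_step K a x st = prune (engine_move K a x st)"

text \<open>A layered description of the work function: a cache of minimal cost lies in the support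
  and misses at least \<open>Suc j\<close> members of pool \<open>j\<close>. This weak form holds
  between a move and the pruning, when a pool may have shrunk to its rank.\<close>

definition engine_inv0 :: "nat \<Rightarrow> 'i list \<times> ('x, 'i) pool list \<Rightarrow> bool" where
  "engine_inv0 K st \<longleftrightarrow> distinct (fst st) \<and>
     (\<forall>P\<in>set (snd st). distinct (members P) \<and> set (members P) \<subseteq> set (fst st)) \<and>
     sorted_wrt (\<lambda>P Q. set (members P) \<subseteq> set (members Q)) (snd st) \<and>
     (\<forall>j<length (snd st). Suc j \<le> length (members (snd st ! j))) \<and>
     length (fst st) \<le> K + length (snd st) \<and>
     (snd st \<noteq> [] \<longrightarrow> length (fst st) = K + length (snd st))"

definition engine_inv :: "nat \<Rightarrow> 'i list \<times> ('x, 'i) pool list \<Rightarrow> bool" where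
  "engine_inv K st \<longleftrightarrow> engine_inv0 K st \<and> (\<forall>j<length (snd st). Suc j < length (members (snd st ! j)))"

lemma members_simps [simp]:
  "members (a, N, S) = S" "members (restrict_pool f P) = filter f (members P)"
  by (auto simp: members_def restrict_pool_def)

lemma last_full_cases:
  "last_full n Ss E = E \<and> (\<forall>j<length Ss. length (Ss ! j) \<noteq> Suc (n + j)) \<or>
   (\<exists>j<length Ss. last_full n Ss E = Ss ! j \<and> length (Ss ! j) = Suc (n + j) \<and>
      (\<forall>i<length Ss. j < i \<longrightarrow> length (Ss ! i) \<noteq> Suc (n + i)))"
proof (induction Ss arbitrary: n E)
  case (Cons S Ss)
  define E' where "E' = (if length S = Suc n then S else E)"
  have e: "last_full n (S # Ss) E = last_full (Suc n) Ss E'" by (simp add: E'_def)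
  have sh: "(\<forall>i<length (S # Ss). j < i \<longrightarrow> length ((S # Ss) ! i) \<noteq> Suc (n + i)) \<longleftrightarrow>
      (\<forall>i<length Ss. j < Suc i \<longrightarrow> length (Ss ! i) \<noteq> Suc (Suc n + i))" for j
    by (auto simp: less_Suc_eq_0_disj)
  from Cons.IH [of "Suc n" E'] show ?case
  proof (elim disjE exE conjE)
    assume a: "last_full (Suc n) Ss E' = E'" "\<forall>j<length Ss. length (Ss ! j) \<noteq> Suc (Suc n + j)"
    show ?thesis
    proof (cases "length S = Suc n")
      case True
      then have "last_full n (S # Ss) E = (S # Ss) ! 0 \<and> length ((S # Ss) ! 0) = Suc (n + 0) \<and>
          (\<forall>i<length (S # Ss). 0 < i \<longrightarrow> length ((S # Ss) ! i) \<noteq> Suc (n + i))"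
        unfolding sh e using a by (simp add: E'_def)
      then show ?thesis by blast
    next
      case False
      have "\<forall>i<length (S # Ss). length ((S # Ss) ! i) \<noteq> Suc (n + i)"
        using a(2) False by (auto simp: less_Suc_eq_0_disj)
      with False a(1) e show ?thesis by (simp add: E'_def)
    qed
  next
    fix j assume a: "j < length Ss" "last_full (Suc n) Ss E' = Ss ! j" "length (Ss ! j) = Suc (Suc n + j)"
      "\<forall>i<length Ss. j < i \<longrightarrow> length (Ss ! i) \<noteq> Suc (Suc n + i)"
    have "last_full n (S # Ss) E = (S # Ss) ! Suc j \<and> length ((S # Ss) ! Suc j) = Suc (n + Suc j) \<and>
          (\<forall>i<length (S # Ss). Suc j < i \<longrightarrow> length ((S # Ss) ! i) \<noteq> Suc (n + i))"
      unfolding sh e using a by simp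
    moreover have "Suc j < length (S # Ss)" using a(1) by simp
    ultimately show ?thesis by blast
  qed
qed simp

lemma prune_unfull:
  assumes "\<And>j. j < length Ps \<Longrightarrow> Suc j < length (members (Ps ! j))"
  shows "prune (N, Ps) = (N, Ps)"
proof -
  have "last_full 0 (map members Ps) [] = []"
    using last_full_cases [of 0 "map members Ps" "[]"] assms by fastforce
  moreover have "restrict_pool (\<lambda>_. True) P = P" for P :: "('a, 'b) pool"
    by (simp add: restrict_pool_def)
  moreover have "members P \<noteq> []" if "P \<in> set Ps" for P
    using that assms by (metis in_set_conv_nth length_0_conv not_less_zero)
  ultimately show ?thesis by (simp add: prune_def map_idI cong: filter_cong)
qed

text \<open>After removing the requested item, pools of cardinality equal to their rank may appear; the
  last of them and all earlier ones are discarded together with their members.\<close>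

lemma prune_cases:
  assumes d: "\<forall>P\<in>set Ps. distinct (members P)"
    and s: "sorted_wrt (\<lambda>P Q. set (members P) \<subseteq> set (members Q)) Ps"
    and l: "\<forall>j<length Ps. Suc j \<le> length (members (Ps ! j))"
  obtains "prune (N, Ps) = (N, Ps)" "\<And>j. j < length Ps \<Longrightarrow> Suc j < length (members (Ps ! j))"
  | l E where "0 < l" "l \<le> length Ps" "E = members (Ps ! (l - 1))" "length E = l"
      "prune (N, Ps) = (filter (\<lambda>y. y \<notin> set E) N,
         map (restrict_pool (\<lambda>y. y \<notin> set E)) (drop l Ps))"
      "\<And>j. j < length Ps - l \<Longrightarrow> Suc j + l < length (members (Ps ! (l + j)))"
      "\<And>P. P \<in> set (take l Ps) \<Longrightarrow> set (members P) \<subseteq> set E"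
      "\<And>P. P \<in> set (drop l Ps) \<Longrightarrow> set E \<subseteq> set (members P)"
proof (cases "\<forall>j<length Ps. length (members (Ps ! j)) \<noteq> Suc j")
  case True
  then have "\<And>j. j < length Ps \<Longrightarrow> Suc j < length (members (Ps ! j))"
    using l by (metis le_neq_implies_less)
  with prune_unfull [of Ps N] that(1) show ?thesis by blast
next
  case False
  then obtain j where j: "j < length Ps" "last_full 0 (map members Ps) [] = members (Ps ! j)"
      "length (members (Ps ! j)) = Suc j"
      and g: "\<And>i. i < length Ps \<Longrightarrow> j < i \<Longrightarrow> length (members (Ps ! i)) \<noteq> Suc i"
    using last_full_cases [of 0 "map members Ps" "[]"] by fastforce
  define E where "E = members (Ps ! j)"
  have g': "Suc i < length (members (Ps ! i))" if "i < length Ps" "j < i" for i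
    using g [OF that] l that(1) by (metis le_neq_implies_less)
  have lo: "set (members P) \<subseteq> set E" if "P \<in> set (take (Suc j) Ps)" for P
  proof -
    from that obtain i where "i < Suc j" "P = Ps ! i" by (auto simp: in_set_conv_nth)
    with s j(1) show ?thesis unfolding E_def
      by (metis less_SucE order_refl sorted_wrt_nth_less)
  qed
  have hi: "set E \<subseteq> set (members P) \<and> filter (\<lambda>y. y \<notin> set E) (members P) \<noteq> []"
    if "P \<in> set (drop (Suc j) Ps)" for P
  proof -
    from that obtain i' where "i' < length (drop (Suc j) Ps)" "P = drop (Suc j) Ps ! i'"
      by (metis in_set_conv_nth)
    then have i: "Suc j + i' < length Ps" "j < Suc j + i'" "P = Ps ! (Suc j + i')" by simp_all
    have 1: "set E \<subseteq> set (members P)"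
      using sorted_wrt_nth_less [OF s i(2,1)] i(3) unfolding E_def by simp
    \<comment> \<open>Later pools are larger than their ranks, hence strictly larger than
      \<open>E\<close>, so they survive the removal of \<open>E\<close>.\<close>
    have "card (set (members P)) > card (set E)"
      using g' [OF i(1,2)] i j(1,3) d by (simp add: distinct_card E_def)
    then have "\<not> set (members P) \<subseteq> set E"
      by (metis card_mono leD List.finite_set)
    with 1 show ?thesis by (auto simp: filter_empty_conv)
  qed
  have "filter (\<lambda>P. members P \<noteq> []) (map (restrict_pool (\<lambda>y. y \<notin> set E)) Ps) =
    filter (\<lambda>P. members P \<noteq> []) (map (restrict_pool (\<lambda>y. y \<notin> set E)) (take (Suc j) Ps)) @
    filter (\<lambda>P. members P \<noteq> []) (map (restrict_pool (\<lambda>y. y \<notin> set E)) (drop (Suc j) Ps))"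
    by (metis append_take_drop_id filter_append map_append)
  also have "\<dots> = [] @ map (restrict_pool (\<lambda>y. y \<notin> set E)) (drop (Suc j) Ps)"
  proof (rule arg_cong2 [where f = "(@)"])
    show "filter (\<lambda>P. members P \<noteq> []) (map (restrict_pool (\<lambda>y. y \<notin> set E)) (take (Suc j) Ps)) = []"
      using lo by (auto simp: filter_empty_conv subset_iff)
    show "filter (\<lambda>P. members P \<noteq> []) (map (restrict_pool (\<lambda>y. y \<notin> set E)) (drop (Suc j) Ps)) =
      map (restrict_pool (\<lambda>y. y \<notin> set E)) (drop (Suc j) Ps)"
      using hi by (auto simp: filter_id_conv)
  qed
  finally have "prune (N, Ps) = (filter (\<lambda>y. y \<notin> set E) N,
         map (restrict_pool (\<lambda>y. y \<notin> set E)) (drop (Suc j) Ps))"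
    using j(2) by (simp add: prune_def E_def Let_def)
  moreover have "Suc i + Suc j < length (members (Ps ! (Suc j + i)))" if "i < length Ps - Suc j" for i
    using g' [of "Suc j + i"] that by (auto simp: add.commute)
  ultimately show ?thesis
    using that(2) [of "Suc j" E] j E_def lo hi by auto
qed

lemma length_filter_neq:
  assumes "distinct A"
  shows "length (filter (\<lambda>y. y \<noteq> x) A) = length A - (if x \<in> set A then 1 else 0)"
  using assms
proof (induction A)
  case (Cons a A)
  then show ?case by (cases "x \<in> set A"; cases A) (auto simp: filter_id_conv)
qed simp

lemma distinct_filter_notin_length:
  assumes "distinct A" "distinct E" "set E \<subseteq> set A"
  shows "length (filter (\<lambda>y. y \<notin> set E) A) = length A - length E"
proof -
  have "set (filter (\<lambda>y. y \<notin> set E) A) = set A - set E" by auto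
  then show ?thesis
    using assms by (metis List.finite_set card_Diff_subset distinct_card distinct_filter)
qed

lemma engine_inv0_cases:
  assumes "engine_inv0 K (N, Ps)"
  obtains "prune (N, Ps) = (N, Ps)" "engine_inv K (N, Ps)"
  | l E where "0 < l" "l \<le> length Ps" "E = members (Ps ! (l - 1))" "length E = l"
      "prune (N, Ps) = (filter (\<lambda>y. y \<notin> set E) N,
         map (restrict_pool (\<lambda>y. y \<notin> set E)) (drop l Ps))"
      "distinct E" "set E \<subseteq> set N"
      "\<And>P. P \<in> set (take l Ps) \<Longrightarrow> set (members P) \<subseteq> set E"
      "\<And>j. j < length Ps - l \<Longrightarrow> Suc j + l < length (members (Ps ! (l + j))) \<and>
         set E \<subseteq> set (members (Ps ! (l + j))) \<and>
         length (filter (\<lambda>y. y \<notin> set E) (members (Ps ! (l + j)))) = length (members (Ps ! (l + j))) - l"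
proof -
  note I = assms [unfolded engine_inv0_def fst_conv snd_conv]
  have d: "\<forall>P\<in>set Ps. distinct (members P)" using I by auto
  have s: "sorted_wrt (\<lambda>P Q. set (members P) \<subseteq> set (members Q)) Ps" using I by auto
  have l: "\<forall>j<length Ps. Suc j \<le> length (members (Ps ! j))" using I by auto
  show ?thesis
  proof (cases rule: prune_cases [OF d s l, where N = N])
    case 1
    with that(1) assms show ?thesis by (auto simp: engine_inv_def)
  next
    case (2 l E)
    have E: "distinct E" "set E \<subseteq> set N"
      using I 2 by (auto dest!: bspec [of _ _ "Ps ! (l - 1)"])
    have "Suc j + l < length (members (Ps ! (l + j))) \<and>
         set E \<subseteq> set (members (Ps ! (l + j))) \<and>
         length (filter (\<lambda>y. y \<notin> set E) (members (Ps ! (l + j)))) = length (members (Ps ! (l + j))) - l"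
      if j: "j < length Ps - l" for j
    proof -
      have "Ps ! (l + j) = drop l Ps ! j" using j by simp
      then have m: "Ps ! (l + j) \<in> set (drop l Ps)" "Ps ! (l + j) \<in> set Ps"
        using j nth_mem [of j "drop l Ps"] by (auto dest: in_set_dropD)
      then show ?thesis
        using distinct_filter_notin_length [of "members (Ps ! (l + j))" E] d m E 2(4) 2(6) [OF j] 2(8) by auto
    qed
    with that(2) [of l E] 2 E show ?thesis by blast
  qed
qed

text \<open>As many pools disappear as items, so the support still exceeds the cache by the number
  of pools. For the remaining pools rank and cardinality drop by the same amount.\<close>

lemma engine_inv_prune:
  assumes "engine_inv0 K st"
  shows "engine_inv K (prune st)"
proof -
  obtain N Ps where st: "st = (N, Ps)" by force
  note I = assms [unfolded engine_inv0_def st fst_conv snd_conv]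
  show ?thesis
  proof (cases rule: engine_inv0_cases [OF assms [unfolded st]])
    case 1
    then show ?thesis by (simp add: st)
  next
    case (2 l E)
    have lenN: "length N = K + length Ps" using I 2(1,2) by auto
    have lenF: "length (filter (\<lambda>y. y \<notin> set E) N) = length N - l"
      using distinct_filter_notin_length [of N E] 2 I by auto
    have "sorted_wrt (\<lambda>P Q. set (members P) \<subseteq> set (members Q)) (drop l Ps)"
      using I by (simp add: sorted_wrt_drop)
    then have "sorted_wrt (\<lambda>P Q. set (members P) \<subseteq> set (members Q))
       (map (restrict_pool (\<lambda>y. y \<notin> set E)) (drop l Ps))"
      unfolding sorted_wrt_map by (rule sorted_wrt_mono_rel [rotated]) auto
    moreover have "distinct (members P) \<and> set (members P) \<subseteq> set (filter (\<lambda>y. y \<notin> set E) N)"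
      if "P \<in> set (map (restrict_pool (\<lambda>y. y \<notin> set E)) (drop l Ps))" for P
    proof -
      from that obtain Q where "Q \<in> set Ps" "P = restrict_pool (\<lambda>y. y \<notin> set E) Q"
        by (auto dest: in_set_dropD)
      with I show ?thesis by (auto dest: bspec)
    qed
    moreover have "Suc j < length (members (map (restrict_pool (\<lambda>y. y \<notin> set E)) (drop l Ps) ! j))"
      if "j < length (map (restrict_pool (\<lambda>y. y \<notin> set E)) (drop l Ps))" for j
      using 2(9) [of j] that by auto
    ultimately show ?thesis
      unfolding st 2(5) engine_inv_def engine_inv0_def using lenN lenF 2(1,2) I
      by (auto simp: less_imp_le)
  qed
qed

lemma engine_inv0_move:
  assumes "engine_inv K st" "0 < K"
  shows "engine_inv0 K (engine_move K a x st)"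
proof -
  obtain N Ps where st: "st = (N, Ps)" by force
  note I = assms(1) [unfolded engine_inv_def engine_inv0_def st fst_conv snd_conv]
  show ?thesis
  proof (cases "x \<in> set N")
    case False
    show ?thesis
    proof (cases "length N < K")
      case True
      with I have "Ps = []" by auto
      with False True I show ?thesis by (simp add: engine_move_def st engine_inv0_def)
    next
      case F2: False
      then have len: "length N = K + length Ps" using I by (cases "Ps = []") auto
      \<comment> \<open>The new pool has rank \<open>Suc (length Ps)\<close> and
        \<open>K + length Ps\<close> members; here \<open>0 < K\<close> enters.\<close>
      have "Suc j \<le> length (members ((Ps @ [(a, N, N)]) ! j))" if "j < Suc (length Ps)" for j
        using that I len assms(2) by (auto simp: nth_append less_Suc_eq)
      with False F2 I len show ?thesis
        by (auto simp: engine_move_def st engine_inv0_def sorted_wrt_append)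
    qed
  next
    case True
    have "sorted_wrt (\<lambda>P Q. set (members P) \<subseteq> set (members Q)) (map (restrict_pool (\<lambda>y. y \<noteq> x)) Ps)"
      using I unfolding sorted_wrt_map by (auto elim!: sorted_wrt_mono_rel [rotated])
    moreover have "Suc j \<le> length (members (map (restrict_pool (\<lambda>y. y \<noteq> x)) Ps ! j))"
      if "j < length Ps" for j
    proof -
      have "distinct (members (Ps ! j))" "Suc j < length (members (Ps ! j))" using that I by auto
      then show ?thesis using that by (auto simp: length_filter_neq)
    qed
    moreover have "distinct (members P) \<and> set (members P) \<subseteq> set N"
      if "P \<in> set (map (restrict_pool (\<lambda>y. y \<noteq> x)) Ps)" for P
    proof -
      from that obtain Q where "Q \<in> set Ps" "P = restrict_pool (\<lambda>y. y \<noteq> x) Q" by auto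
      with I show ?thesis by (auto dest: bspec)
    qed
    ultimately show ?thesis using True I by (simp add: engine_move_def st engine_inv0_def)
  qed
qed

lemma engine_inv_step:
  assumes "engine_inv K st" "0 < K"
  shows "engine_inv K (engine_step K a x st)"
  unfolding engine_step_def by (intro engine_inv_prune engine_inv0_move assms)

section \<open>The work function as a lower bound for every solution\<close>

definition fresh :: "'i \<Rightarrow> 'i list \<times> ('x, 'i) pool list \<Rightarrow> nat" where
  "fresh x st = (if x \<in> set (fst st) then 0 else 1)"

text \<open>\<open>n\<close> is the cost an arbitrary solution has paid on reaching the cache \<open>Y\<close>, \<open>F\<close> the number
  of fresh requests: the invariant of the work function of paging.\<close>

definition offset_inv :: "nat \<Rightarrow> nat \<Rightarrow> nat \<Rightarrow> 'i list \<times> ('x, 'i) pool list \<Rightarrow> 'i set \<Rightarrow> bool" where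
  "offset_inv K F n st Y \<longleftrightarrow> finite Y \<and> card Y \<le> K \<and> F + card (Y - set (fst st)) \<le> n \<and>
     (\<forall>j<length (snd st). F + card (Y - (set (fst st) - set (members (snd st ! j)))) + Suc j
        \<le> n + length (members (snd st ! j)))"

lemma card_Diff_le_add:
  assumes "finite Y" "finite Y'"
  shows "card (Y' - A) \<le> card (Y - A) + card (Y' - Y)"
proof -
  have "card (Y' - A) \<le> card ((Y - A) \<union> (Y' - Y))"
    using assms by (intro card_mono) auto
  also have "\<dots> \<le> card (Y - A) + card (Y' - Y)" by (rule card_Un_le)
  finally show ?thesis .
qed

text \<open>Each of the counted differences grows by at most the number of loads when the cache
  changes.\<close>

lemma offset_inv_change:
  assumes "offset_inv K F n st Y" "finite Y'" "card Y' \<le> K"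
  shows "offset_inv K F (n + card (Y' - Y)) st Y'"
proof -
  have k: "card (Y' - A) \<le> card (Y - A) + card (Y' - Y)" for A
    using card_Diff_le_add [of Y Y'] assms by (simp add: offset_inv_def)
  have c: "F + card (Y' - A) + c \<le> n + card (Y' - Y) + d"
    if "F + card (Y - A) + c \<le> n + d" for A c d
    using that k [of A] by linarith
  have "F + card (Y' - (set (fst st) - set (members (snd st ! j)))) + Suc j
      \<le> n + card (Y' - Y) + length (members (snd st ! j))" if "j < length (snd st)" for j
    using assms(1) that unfolding offset_inv_def by (intro c) blast
  then show ?thesis
    using assms c [of "set (fst st)" 0 0] unfolding offset_inv_def by simp
qed

text \<open>A fresh \<open>x\<close> lies in \<open>Y\<close> and is counted as outside the support
  before the move but not after it, which absorbs the increment of \<open>F\<close>. If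
  \<open>x\<close> belongs to the support, then for every pool containing it both sides of the
  inequality drop by one.\<close>

lemma offset_inv_move:
  assumes "offset_inv K F n st Y" "engine_inv K st" "x \<in> Y"
  shows "offset_inv K (F + fresh x st) n (engine_move K a x st) Y"
proof -
  obtain N Ps where st: "st = (N, Ps)" by force
  note I = assms(2) [unfolded engine_inv_def engine_inv0_def st fst_conv snd_conv]
  note O = assms(1) [unfolded offset_inv_def st fst_conv snd_conv]
  have fin: "finite Y" using O by simp
  show ?thesis
  proof (cases "x \<in> set N")
    case False
    have c: "card (Y - (insert x (set N) - A)) + 1 = card (Y - (set N - A))" if "x \<notin> A" for A
    proof -
      have "Y - (set N - A) = insert x (Y - (insert x (set N) - A))"
        using False assms(3) that by auto
      then show ?thesis using fin that by simp
    qed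
    have 1: "F + 1 + card (Y - insert x (set N)) \<le> n"
      using c [of "{}"] O by simp
    have 2: "F + 1 + card (Y - (insert x (set N) - set (members (Ps ! j)))) + Suc j
        \<le> n + length (members (Ps ! j))" if "j < length Ps" for j
    proof -
      have "x \<notin> set (members (Ps ! j))" using I that False by (meson nth_mem subsetD)
      from c [OF this] O that show ?thesis by fastforce
    qed
    \<comment> \<open>For the new pool, \<open>card Y \<le> K\<close> is decisive: apart from
      \<open>x\<close> at most \<open>K - 1\<close> items of \<open>Y\<close> count, while the pool
      has \<open>K + length Ps\<close> members and rank \<open>Suc (length Ps)\<close>.\<close>
    have 3: "F + 1 + card (Y - (insert x (set N) - set N)) + Suc (length Ps) \<le> n + length N"
      if "\<not> length N < K"
    proof -
      have len: "length N = K + length Ps" using I that by (cases "Ps = []") auto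
      have "Y - (insert x (set N) - set N) = Y - {x}" using False by auto
      then have "card (Y - (insert x (set N) - set N)) = card Y - 1"
        using assms(3) fin by simp
      moreover have "0 < card Y" using assms(3) fin card_gt_0_iff by blast
      ultimately show ?thesis using O len 1 by linarith
    qed
    have "F + 1 + card (Y - (insert x (set N) - set (members ((Ps @ [(a, N, N)]) ! j)))) + Suc j
        \<le> n + length (members ((Ps @ [(a, N, N)]) ! j))" if "\<not> length N < K" "j < Suc (length Ps)" for j
      using 2 [of j] 3 [OF that(1)] that(2) by (cases "j = length Ps") (auto simp: nth_append)
    with 1 2 O False show ?thesis
      by (simp add: offset_inv_def engine_move_def st fresh_def)
  next
    case True
    have Q: "F + card (Y - (set N - set (filter (\<lambda>y. y \<noteq> x) (members (Ps ! j))))) + Suc j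
        \<le> n + length (filter (\<lambda>y. y \<noteq> x) (members (Ps ! j)))"
      if "j < length Ps" for j
    proof (cases "x \<in> set (members (Ps ! j))")
      case False
      then have "filter (\<lambda>y. y \<noteq> x) (members (Ps ! j)) = members (Ps ! j)"
        by (auto simp: filter_id_conv)
      with that O show ?thesis by simp
    next
      case T: True
      have 1: "distinct (members (Ps ! j))" using that I by auto
      have 2: "0 < length (members (Ps ! j))" using T by (metis length_pos_if_in_set)
      have "Y - (set N - set (members (Ps ! j))) =
          insert x (Y - (set N - set (filter (\<lambda>y. y \<noteq> x) (members (Ps ! j)))))"
        using T assms(3) by auto
      moreover have "x \<notin> Y - (set N - set (filter (\<lambda>y. y \<noteq> x) (members (Ps ! j))))"
        using True by auto
      ultimately have "card (Y - (set N - set (members (Ps ! j)))) =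
          Suc (card (Y - (set N - set (filter (\<lambda>y. y \<noteq> x) (members (Ps ! j))))))"
        using fin by (metis card_insert_disjoint finite_Diff)
      moreover have "F + card (Y - (set N - set (members (Ps ! j)))) + Suc j \<le> n + length (members (Ps ! j))"
        using O that by auto
      ultimately show ?thesis using length_filter_neq [OF 1, of x] T 2 by simp
    qed
    with O True show ?thesis by (simp add: offset_inv_def engine_move_def st fresh_def)
  qed
qed

text \<open>For the full pool \<open>E\<close> cardinality and rank cancel, and its inequality
  becomes the one for the reduced support. For later pools the complement in the support is
  unchanged, and rank and cardinality both drop by \<open>l\<close>.\<close>

lemma offset_inv_prune:
  assumes "offset_inv K F n st Y" "engine_inv0 K st"
  shows "offset_inv K F n (prune st) Y"
proof -
  obtain N Ps where st: "st = (N, Ps)" by force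
  note O = assms(1) [unfolded offset_inv_def st fst_conv snd_conv]
  show ?thesis
  proof (cases rule: engine_inv0_cases [OF assms(2) [unfolded st]])
    case 1
    with assms show ?thesis by (simp add: st)
  next
    case (2 l E)
    have "l - 1 < length Ps" using 2(1,2) by simp
    with O have "F + card (Y - (set N - set E)) + Suc (l - 1) \<le> n + length E"
      unfolding 2(3) by blast
    moreover have "set (filter (\<lambda>y. y \<notin> set E) N) = set N - set E" by auto
    ultimately have a: "F + card (Y - set (filter (\<lambda>y. y \<notin> set E) N)) \<le> n" using 2(1,4) by simp
    have b: "F + card (Y - (set (filter (\<lambda>y. y \<notin> set E) N) -
         set (filter (\<lambda>y. y \<notin> set E) (members (Ps ! (l + j)))))) + Suc j
       \<le> n + length (filter (\<lambda>y. y \<notin> set E) (members (Ps ! (l + j))))"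
      if "j < length Ps - l" for j
    proof -
      have "set (filter (\<lambda>y. y \<notin> set E) N) - set (filter (\<lambda>y. y \<notin> set E) (members (Ps ! (l + j))))
         = set N - set (members (Ps ! (l + j)))" using 2(9) [OF that] by auto
      moreover have "F + card (Y - (set N - set (members (Ps ! (l + j))))) + Suc (l + j)
          \<le> n + length (members (Ps ! (l + j)))"
        using O that by auto
      ultimately show ?thesis using 2(9) [OF that] by simp
    qed
    show ?thesis
      unfolding st 2(5) offset_inv_def using a b O by simp
  qed
qed

lemma offset_inv_step:
  assumes "offset_inv K F n st Y" "engine_inv K st" "x \<in> Y" "0 < K"
  shows "offset_inv K (F + fresh x st) n (engine_step K a x st) Y"
  unfolding engine_step_def by (intro offset_inv_prune offset_inv_move engine_inv0_move assms)

section \<open>Caches that withhold one item per pool\<close>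

fun drops :: "('x \<Rightarrow> 'i list \<Rightarrow> 'i list \<Rightarrow> 'i) \<Rightarrow> 'i list \<Rightarrow> ('x, 'i) pool list \<Rightarrow> 'i list" where
  "drops ch acc [] = acc"
| "drops ch acc (P # Ps) = (let c = filter (\<lambda>y. y \<notin> set acc) (members P) in
     drops ch (if c = [] then acc else ch (fst P) (fst (snd P)) c # acc) Ps)"

definition cache :: "('x \<Rightarrow> 'i list \<Rightarrow> 'i list \<Rightarrow> 'i) \<Rightarrow> 'i list \<times> ('x, 'i) pool list \<Rightarrow> 'i list" where
  "cache ch st = filter (\<lambda>y. y \<notin> set (drops ch [] (snd st))) (fst st)"

text \<open>The second clause is independence of irrelevant alternatives: deleting rejected
  candidates does not alter the choice. It is what makes the caches lazy.\<close>

definition choice_ok :: "('x \<Rightarrow> 'i list \<Rightarrow> 'i list \<Rightarrow> 'i) \<Rightarrow> bool" where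
  "choice_ok ch \<longleftrightarrow> (\<forall>a N c. c \<noteq> [] \<longrightarrow> ch a N c \<in> set c) \<and>
     (\<forall>a N c Q. c \<noteq> [] \<longrightarrow> Q (ch a N c) \<longrightarrow> ch a N (filter Q c) = ch a N c)"

lemma drops_append: "drops ch acc (Ps @ Qs) = drops ch (drops ch acc Ps) Qs"
  by (induction Ps arbitrary: acc) (simp_all add: Let_def)

lemma drops_mono: "set acc \<subseteq> set (drops ch acc Ps)"
  by (induction Ps arbitrary: acc) (auto simp: Let_def subset_iff)

text \<open>Items other than \<open>x\<close> that were withheld stay withheld. A pool whose old
  choice is still among its candidates repeats it by the second clause of \<open>choice_ok\<close>;
  a choice that is no longer available is either \<open>x\<close> or withheld already.\<close>

lemma drops_remove:
  assumes "choice_ok ch" "set acc - {x} \<subseteq> set acc'"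
  shows "set (drops ch acc Ps) - {x} \<subseteq> set (drops ch acc' (map (restrict_pool (\<lambda>y. y \<noteq> x)) Ps))"
  using assms(2)
proof (induction Ps arbitrary: acc acc')
  case (Cons P Ps)
  define c where "c = filter (\<lambda>y. y \<notin> set acc) (members P)"
  define c' where "c' = filter (\<lambda>y. y \<notin> set acc') (filter (\<lambda>y. y \<noteq> x) (members P))"
  let ?ch = "ch (fst P) (fst (snd P))"
  have cc: "c' = filter (\<lambda>y. y \<notin> set acc' \<and> y \<noteq> x) c"
    using Cons.prems unfolding c_def c'_def filter_filter by (intro filter_cong) auto
  have "set (if c = [] then acc else ?ch c # acc) - {x} \<subseteq> set (if c' = [] then acc' else ?ch c' # acc')"
  proof (cases "c = [] \<or> ?ch c = x \<or> ?ch c \<in> set acc'")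
    case True
    then show ?thesis using Cons.prems by auto
  next
    case False
    define Q where "Q = (\<lambda>y. y \<notin> set acc' \<and> y \<noteq> x)"
    have "?ch c \<in> set c" "Q (?ch c)" using False assms(1) by (auto simp: choice_ok_def Q_def)
    moreover from this have "?ch (filter Q c) = ?ch c" using False assms(1) unfolding choice_ok_def by blast
    moreover have "c' = filter Q c" unfolding cc Q_def ..
    ultimately have "?ch c' = ?ch c" "c' \<noteq> []" by (auto simp: filter_empty_conv)
    then show ?thesis using Cons.prems False by auto
  qed
  moreover have "drops ch acc (P # Ps) = drops ch (if c = [] then acc else ?ch c # acc) Ps"
    by (simp only: drops.simps Let_def c_def)
  moreover have "drops ch acc' (map (restrict_pool (\<lambda>y. y \<noteq> x)) (P # Ps)) =
      drops ch (if c' = [] then acc' else ?ch c' # acc') (map (restrict_pool (\<lambda>y. y \<noteq> x)) Ps)"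
    unfolding c'_def drops.simps list.map Let_def members_simps by (simp only: restrict_pool_def fst_conv snd_conv)
  ultimately show ?case using Cons.IH by presburger
qed auto

lemma drops_subset:
  assumes "choice_ok ch" "set acc \<subseteq> A" "\<And>P. P \<in> set Ps \<Longrightarrow> set (members P) \<subseteq> A"
  shows "set (drops ch acc Ps) \<subseteq> A"
  using assms(2,3)
proof (induction Ps arbitrary: acc)
  case (Cons P Ps)
  let ?c = "filter (\<lambda>y. y \<notin> set acc) (members P)"
  have "ch (fst P) (fst (snd P)) ?c \<in> A" if "?c \<noteq> []"
  proof -
    have "ch (fst P) (fst (snd P)) ?c \<in> set ?c" using assms(1) that unfolding choice_ok_def by blast
    then show ?thesis using Cons.prems(2) [of P] by auto
  qed
  then have "set (if ?c = [] then acc else ch (fst P) (fst (snd P)) ?c # acc) \<subseteq> A"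
    using Cons.prems(1) by (cases "?c = []") simp_all
  then show ?case unfolding drops.simps Let_def using Cons.IH Cons.prems(2) by simp
qed simp

text \<open>When it is the turn of a pool, fewer items have been withheld than it has members, so a
  candidate always remains.\<close>

lemma drops_distinct:
  assumes "choice_ok ch" "distinct acc"
    "\<And>P. P \<in> set Ps \<Longrightarrow> distinct (members P)"
    "\<And>j. j < length Ps \<Longrightarrow> length acc + j < length (members (Ps ! j))"
  shows "distinct (drops ch acc Ps) \<and> length (drops ch acc Ps) = length acc + length Ps"
  using assms(2-)
proof (induction Ps arbitrary: acc)
  case (Cons P Ps)
  define c where "c = filter (\<lambda>y. y \<notin> set acc) (members P)"
  have "c \<noteq> []"
  proof
    assume "c = []"
    then have "set (members P) \<subseteq> set acc" by (auto simp: c_def filter_empty_conv)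
    then have "card (set (members P)) \<le> card (set acc)" by (simp add: card_mono)
    then have "length (members P) \<le> length acc"
      using Cons.prems(1,2) by (simp add: distinct_card)
    with Cons.prems(3) [of 0] show False by simp
  qed
  then have m: "ch (fst P) (fst (snd P)) c \<in> set c"
    using assms(1) by (simp add: choice_ok_def)
  have "distinct (drops ch (ch (fst P) (fst (snd P)) c # acc) Ps) \<and>
      length (drops ch (ch (fst P) (fst (snd P)) c # acc) Ps) =
      length (ch (fst P) (fst (snd P)) c # acc) + length Ps"
  proof (rule Cons.IH)
    show "distinct (ch (fst P) (fst (snd P)) c # acc)" using m Cons.prems(1) by (auto simp: c_def)
    show "length (ch (fst P) (fst (snd P)) c # acc) + j < length (members (Ps ! j))"
      if "j < length Ps" for j using Cons.prems(3) [of "Suc j"] that by auto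
  qed (use Cons.prems(2) in auto)
  with \<open>c \<noteq> []\<close> show ?case by (simp add: Let_def c_def [symmetric])
qed simp

lemma drops_distinct_Nil:
  assumes "choice_ok ch" "\<And>P. P \<in> set Ps \<Longrightarrow> distinct (members P)"
    "\<And>j. j < length Ps \<Longrightarrow> j < length (members (Ps ! j))"
  shows "distinct (drops ch [] Ps) \<and> length (drops ch [] Ps) = length Ps"
  using drops_distinct [OF assms(1), of "[]" Ps] assms(2,3) by auto

text \<open>Used with \<open>E\<close> the set withheld by the full pool and its predecessors, which
  can then be cut off.\<close>

lemma drops_filter:
  "set (drops ch (acc @ E) Ps) = set E \<union> set (drops ch acc (map (restrict_pool (\<lambda>y. y \<notin> set E)) Ps))"
proof (induction Ps arbitrary: acc)
  case (Cons P Ps)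
  have eq: "filter (\<lambda>y. y \<notin> set (acc @ E)) (members P) =
      filter (\<lambda>y. y \<notin> set acc) (members (restrict_pool (\<lambda>y. y \<notin> set E) P))"
    by (auto simp: filter_filter intro!: filter_cong)
  let ?c = "filter (\<lambda>y. y \<notin> set (acc @ E)) (members P)"
  have "drops ch (acc @ E) (P # Ps) =
      drops ch ((if ?c = [] then acc else ch (fst P) (fst (snd P)) ?c # acc) @ E) Ps"
    unfolding drops.simps Let_def by (cases "?c = []") simp_all
  moreover have "drops ch acc (map (restrict_pool (\<lambda>y. y \<notin> set E)) (P # Ps)) =
      drops ch (if ?c = [] then acc else ch (fst P) (fst (snd P)) ?c # acc)
        (map (restrict_pool (\<lambda>y. y \<notin> set E)) Ps)"
    unfolding drops.simps list.map Let_def eq [symmetric] by (simp only: restrict_pool_def fst_conv snd_conv)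
  ultimately show ?case by (simp only: Cons.IH)
qed (simp add: Un_commute)

text \<open>The first \<open>l\<close> pools withhold \<open>l\<close> distinct members of
  \<open>E\<close>, which has exactly \<open>l\<close> elements. So they withhold all of
  \<open>E\<close>, and pruning is invisible in the cache.\<close>

lemma cache_prune:
  assumes "choice_ok ch" "engine_inv0 K st"
  shows "set (cache ch (prune st)) = set (cache ch st)"
proof -
  obtain N Ps where st: "st = (N, Ps)" by force
  note I = assms(2) [unfolded engine_inv0_def st fst_conv snd_conv]
  show ?thesis
  proof (cases rule: engine_inv0_cases [OF assms(2) [unfolded st]])
    case 1
    then show ?thesis by (simp add: st)
  next
    case (2 l E)
    have "distinct (drops ch [] (take l Ps)) \<and> length (drops ch [] (take l Ps)) = length (take l Ps)"
    proof (rule drops_distinct_Nil [OF assms(1)])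
      show "distinct (members P)" if "P \<in> set (take l Ps)" for P
        using I in_set_takeD [OF that] by blast
      show "j < length (members (take l Ps ! j))" if "j < length (take l Ps)" for j
        using I that by (auto simp: Suc_le_eq)
    qed
    moreover have "set (drops ch [] (take l Ps)) \<subseteq> set E"
      by (rule drops_subset [OF assms(1)]) (use 2(8) in auto)
    ultimately have E: "set (drops ch [] (take l Ps)) = set E"
      using 2(2,4,6) by (metis List.finite_set card_subset_eq distinct_card length_take min.absorb2)
    have "set (drops ch [] Ps) = set (drops ch ([] @ drops ch [] (take l Ps)) (drop l Ps))"
      by (metis append_Nil append_take_drop_id drops_append)
    also have "\<dots> = set E \<union> set (drops ch [] (map (restrict_pool (\<lambda>y. y \<notin> set E)) (drop l Ps)))"
      unfolding drops_filter E ..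
    finally show ?thesis unfolding st 2(5) cache_def by auto
  qed
qed

text \<open>One item is withheld per pool, and the support exceeds \<open>K\<close> by the number of
  pools.\<close>

lemma length_cache:
  assumes "choice_ok ch" "engine_inv K st"
  shows "length (cache ch st) \<le> K" "distinct (cache ch st)" "set (cache ch st) \<subseteq> set (fst st)"
proof -
  note I = assms(2) [unfolded engine_inv_def engine_inv0_def]
  have 1: "distinct (drops ch [] (snd st)) \<and> length (drops ch [] (snd st)) = length (snd st)"
  proof (rule drops_distinct_Nil [OF assms(1)])
    show "j < length (members (snd st ! j))" if "j < length (snd st)" for j
      using I that by (auto dest: Suc_lessD)
  qed (use I in blast)
  moreover have "set (drops ch [] (snd st)) \<subseteq> set (fst st)"
    by (rule drops_subset [OF assms(1)]) (use I in auto)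
  ultimately have "length (cache ch st) = length (fst st) - length (snd st)"
    using distinct_filter_notin_length [of "fst st" "drops ch [] (snd st)"] I by (simp add: cache_def)
  then show "length (cache ch st) \<le> K" using I by linarith
  show "distinct (cache ch st)" "set (cache ch st) \<subseteq> set (fst st)" using I by (auto simp: cache_def)
qed

text \<open>Laziness: a new pool only withholds more, and deleting \<open>x\<close> from the pools
  releases at most \<open>x\<close>.\<close>

lemma cache_step:
  assumes "choice_ok ch" "engine_inv K st" "0 < K"
  shows "x \<in> set (cache ch (engine_step K a x st))"
    and "set (cache ch (engine_step K a x st)) \<subseteq> insert x (set (cache ch st))"
proof -
  obtain N Ps where st: "st = (N, Ps)" by force
  note I = assms(2) [unfolded engine_inv_def engine_inv0_def st fst_conv snd_conv]
  have "x \<in> set (cache ch (engine_move K a x st)) \<and>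
    set (cache ch (engine_move K a x st)) \<subseteq> insert x (set (cache ch st))"
  proof (cases "x \<in> set N")
    case False
    have "set (drops ch [] (Ps @ [(a, N, N)])) \<subseteq> set N" "set (drops ch [] Ps) \<subseteq> set N"
      by (rule drops_subset [OF assms(1)]; use I in auto)+
    moreover have "set (drops ch [] Ps) \<subseteq> set (drops ch [] (Ps @ [(a, N, N)]))"
      unfolding drops_append by (rule drops_mono)
    ultimately show ?thesis using False by (auto simp: engine_move_def st cache_def)
  next
    case True
    define Qs where "Qs = map (restrict_pool (\<lambda>y. y \<noteq> x)) Ps"
    have "set (drops ch [] Ps) - {x} \<subseteq> set (drops ch [] Qs)"
      unfolding Qs_def by (rule drops_remove [OF assms(1)]) auto
    moreover have "set (drops ch [] Qs) \<subseteq> - {x}"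
      by (rule drops_subset [OF assms(1)]) (auto simp: Qs_def)
    ultimately show ?thesis using True by (auto simp: cache_def st engine_move_def Qs_def)
  qed
  then show "x \<in> set (cache ch (engine_step K a x st))"
    and "set (cache ch (engine_step K a x st)) \<subseteq> insert x (set (cache ch st))"
    using cache_prune [OF assms(1) engine_inv0_move [OF assms(2,3)]] by (auto simp: engine_step_def)
qed


section \<open>Amortised cost of the eviction rules\<close>

definition miss :: "('x \<Rightarrow> 'i list \<Rightarrow> 'i list \<Rightarrow> 'i) \<Rightarrow> 'i \<Rightarrow> 'i list \<times> ('x, 'i) pool list \<Rightarrow> nat" where
  "miss ch x st = (if x \<in> set (cache ch st) then 0 else 1)"

text \<open>The argument of \<open>g\<close> is the slack of a pool: how many of its members can
  still be requested before it is full. The price of slack may depend on the data of the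
  pool.\<close>

definition potential :: "('x \<Rightarrow> nat \<Rightarrow> real) \<Rightarrow> 'i list \<times> ('x, 'i) pool list \<Rightarrow> real" where
  "potential g st = (\<Sum>j<length (snd st). g (fst (snd st ! j)) (length (members (snd st ! j)) - Suc j))"

lemma fst_restrict_pool [simp]: "fst (restrict_pool f P) = fst P"
  by (simp add: restrict_pool_def)

lemma potential_prune:
  assumes "engine_inv0 K st" "\<And>a s. 0 \<le> g a s"
  shows "potential g (prune st) \<le> potential g st"
proof -
  obtain N Ps where st: "st = (N, Ps)" by force
  show ?thesis
  proof (cases rule: engine_inv0_cases [OF assms(1) [unfolded st]])
    case 1
    then show ?thesis by (simp add: st)
  next
    case (2 l E)
    let ?t = "\<lambda>j. g (fst (Ps ! j)) (length (members (Ps ! j)) - Suc j)"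
    have "potential g (prune st) = (\<Sum>j<length Ps - l. ?t (j + l))"
      unfolding potential_def st 2(5) using 2(9) by (intro sum.cong) (auto simp: add.commute)
    also have "\<dots> = sum ?t ((\<lambda>j. j + l) ` {..<length Ps - l})"
      by (subst sum.reindex) (auto simp: inj_on_def)
    also have "\<dots> \<le> sum ?t {..<length Ps}"
      using assms(2) by (intro sum_mono2) auto
    finally show ?thesis by (simp add: potential_def st)
  qed
qed

text \<open>A request for a member lowers the slack of its pool by one, and a fresh request creates
  at most one pool, of slack \<open>K - 1\<close>. Pruning deletes nonnegative terms and leaves the
  other slacks as they are, since rank and cardinality shift together.\<close>

lemma potential_step:
  assumes "engine_inv K st" "0 < K" "\<And>a s. 0 \<le> g a s"
  shows "potential g (engine_step K a x st) +
      (\<Sum>j<length (snd st). if x \<in> set (members (snd st ! j))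
         then g (fst (snd st ! j)) (length (members (snd st ! j)) - Suc j) -
              g (fst (snd st ! j)) (length (members (snd st ! j)) - Suc j - 1) else 0)
    \<le> potential g st + real (fresh x st) * g a (K - 1)"
proof -
  obtain N Ps where st: "st = (N, Ps)" by force
  note I = assms(1) [unfolded engine_inv_def engine_inv0_def st fst_conv snd_conv]
  have "potential g (engine_step K a x st) \<le> potential g (engine_move K a x st)"
    unfolding engine_step_def by (rule potential_prune [OF engine_inv0_move [OF assms(1,2)] assms(3)])
  moreover have "potential g (engine_move K a x st) +
      (\<Sum>j<length (snd st). if x \<in> set (members (snd st ! j))
         then g (fst (snd st ! j)) (length (members (snd st ! j)) - Suc j) -
              g (fst (snd st ! j)) (length (members (snd st ! j)) - Suc j - 1) else 0)
    \<le> potential g st + real (fresh x st) * g a (K - 1)"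
  proof (cases "x \<in> set N")
    case False
    then have "x \<notin> set (members (Ps ! j))" if "j < length Ps" for j
      using I that by (meson nth_mem subsetD)
    then have 0: "(\<Sum>j<length Ps. if x \<in> set (members (Ps ! j))
         then g (fst (Ps ! j)) (length (members (Ps ! j)) - Suc j) -
              g (fst (Ps ! j)) (length (members (Ps ! j)) - Suc j - 1) else 0) = 0"
      by (intro sum.neutral) auto
    show ?thesis
    proof (cases "length N < K")
      case True
      with False 0 assms(3) show ?thesis unfolding st snd_conv by (simp add: engine_move_def potential_def)
    next
      case F2: False
      then have "length N = K + length Ps" using I by (cases "Ps = []") auto
      with False F2 0 show ?thesis unfolding st snd_conv
        by (simp add: engine_move_def potential_def fresh_def nth_append)
    qed
  next
    case True
    have "potential g (engine_move K a x st) = (\<Sum>j<length Ps. g (fst (Ps ! j))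
        (length (filter (\<lambda>y. y \<noteq> x) (members (Ps ! j))) - Suc j))"
      using True by (simp add: st engine_move_def potential_def)
    also have "\<dots> = (\<Sum>j<length Ps. g (fst (Ps ! j)) (length (members (Ps ! j)) - Suc j) -
        (if x \<in> set (members (Ps ! j))
         then g (fst (Ps ! j)) (length (members (Ps ! j)) - Suc j) -
              g (fst (Ps ! j)) (length (members (Ps ! j)) - Suc j - 1) else 0))"
      using I by (intro sum.cong) (auto simp: length_filter_neq diff_commute)
    finally show ?thesis using assms(3) unfolding st snd_conv by (simp add: sum_subtractf potential_def)
  qed
  ultimately show ?thesis by linarith
qed

lemma miss_in_pool:
  assumes "choice_ok ch" "x \<in> set (fst st)" "x \<notin> set (cache ch st)"
  obtains j where "j < length (snd st)" "x \<in> set (members (snd st ! j))"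
proof -
  have "x \<in> set (drops ch [] (snd st))" using assms by (simp add: cache_def)
  moreover have "set (drops ch [] (snd st)) \<subseteq> (\<Union>P\<in>set (snd st). set (members P))"
    by (rule drops_subset [OF assms(1)]) auto
  ultimately obtain P where "P \<in> set (snd st)" "x \<in> set (members P)" by auto
  then show ?thesis by (metis in_set_conv_nth that)
qed

text \<open>The potential is the total slack. A miss inside the support is paid by a pool containing
  the item; a fresh request pays one for itself and \<open>K - 1\<close> for its pool.\<close>

lemma miss_bound_deterministic:
  assumes "choice_ok ch" "engine_inv K st" "0 < K"
  shows "real (miss ch x st) + potential (\<lambda>_. real) (engine_step K a x st)
    \<le> potential (\<lambda>_. real) st + real K * real (fresh x st)"
proof -
  note I = assms(2) [unfolded engine_inv_def engine_inv0_def]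
  let ?t = "\<lambda>j. if x \<in> set (members (snd st ! j))
         then real (length (members (snd st ! j)) - Suc j) -
              real (length (members (snd st ! j)) - Suc j - 1) else 0"
  have "?t j = (if x \<in> set (members (snd st ! j)) then 1 else 0)" if "j < length (snd st)" for j
    using I that by auto
  then have eq: "sum ?t {..<length (snd st)} = (\<Sum>j<length (snd st). if x \<in> set (members (snd st ! j)) then 1 else 0)"
    by (intro sum.cong) auto
  have "real (miss ch x st) \<le> sum ?t {..<length (snd st)} + real (fresh x st)"
  proof (cases "x \<in> set (fst st) \<and> x \<notin> set (cache ch st)")
    case True
    then obtain j where j: "j < length (snd st)" "x \<in> set (members (snd st ! j))"
      using miss_in_pool [OF assms(1)] by blast
    have "(\<Sum>i\<in>{j}. if x \<in> set (members (snd st ! i)) then 1 else 0) \<le> sum ?t {..<length (snd st)}"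
      unfolding eq using j by (intro sum_mono2) auto
    with j show ?thesis by (simp add: miss_def)
  next
    case False
    moreover have "0 \<le> sum ?t {..<length (snd st)}" unfolding eq by (intro sum_nonneg) auto
    ultimately show ?thesis by (auto simp: miss_def fresh_def)
  qed
  moreover have "real (K - 1) = real K - 1" using assms(3) by simp
  ultimately show ?thesis
    using potential_step [OF assms(2,3), of "\<lambda>_. real" a x] by (simp add: algebra_simps)
qed

text \<open>Weaker than withholding the candidate used furthest in the future: only the one
  requested first is protected, and this is all that matters at the moment of its request.\<close>

definition furthest :: "('x \<Rightarrow> 'i list) \<Rightarrow> ('x \<Rightarrow> 'i list \<Rightarrow> 'i list \<Rightarrow> 'i) \<Rightarrow> bool" where
  "furthest f ch \<longleftrightarrow> (\<forall>a N c past x rest y. f a = past @ x # rest \<longrightarrow> set past \<inter> set c = {} \<longrightarrow>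
     y \<in> set c \<longrightarrow> y \<noteq> x \<longrightarrow> ch a N c \<noteq> x)"

text \<open>Members requested since the creation of a pool have left it. So the sequence it
  remembers splits into a part that avoids its members and the true future.\<close>

definition future_inv :: "('x \<Rightarrow> 'i list) \<Rightarrow> 'i list \<Rightarrow> 'i list \<times> ('x, 'i) pool list \<Rightarrow> bool" where
  "future_inv f fut st \<longleftrightarrow>
     (\<forall>P\<in>set (snd st). \<exists>past. f (fst P) = past @ fut \<and> set past \<inter> set (members P) = {})"

lemma future_inv_step:
  assumes "future_inv f (x # fut) st" "f a = fut" "engine_inv K st"
  shows "future_inv f fut (engine_step K a x st)"
proof -
  obtain N Ps where st: "st = (N, Ps)" by force
  note I = assms(3) [unfolded engine_inv_def engine_inv0_def st fst_conv snd_conv]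
  have prune: "future_inv f fut (prune st')" if "future_inv f fut st'" for st' :: "'b list \<times> ('a, 'b) pool list"
    using that unfolding future_inv_def prune_def Let_def
    by (force simp: disjoint_iff restrict_pool_def members_def)
  have "future_inv f fut (engine_move K a x st)"
  proof (cases "x \<in> set N")
    case True
    show ?thesis unfolding future_inv_def
    proof
      fix P assume "P \<in> set (snd (engine_move K a x st))"
      then obtain Q where Q: "Q \<in> set Ps" "P = restrict_pool (\<lambda>y. y \<noteq> x) Q"
        using True by (auto simp: engine_move_def st)
      with assms(1) obtain past where "f (fst Q) = past @ x # fut" "set past \<inter> set (members Q) = {}"
        unfolding future_inv_def st by auto
      with Q show "\<exists>past. f (fst P) = past @ fut \<and> set past \<inter> set (members P) = {}"
        by (intro exI [of _ "past @ [x]"]) auto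
    qed
  next
    case False
    have old: "\<exists>past. f (fst P) = past @ fut \<and> set past \<inter> set (members P) = {}" if "P \<in> set Ps" for P
    proof -
      from assms(1) that obtain past where "f (fst P) = past @ x # fut" "set past \<inter> set (members P) = {}"
        unfolding future_inv_def st by auto
      moreover have "x \<notin> set (members P)" using I that False by blast
      ultimately show ?thesis by (intro exI [of _ "past @ [x]"]) auto
    qed
    with False assms(2) show ?thesis
      by (auto simp: engine_move_def st future_inv_def)
  qed
  then show ?thesis unfolding engine_step_def by (rule prune)
qed

text \<open>Pools are larger than their ranks, so each has at least two candidates at its turn and
  never has to withhold the item requested next.\<close>

lemma miss_furthest:
  assumes "choice_ok ch" "engine_inv K st" "furthest f ch" "future_inv f (x # fut) st"
  shows "miss ch x st \<le> fresh x st"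
proof -
  note I = assms(2) [unfolded engine_inv_def engine_inv0_def]
  have "x \<notin> set (drops ch acc Ps)"
    if "x \<notin> set acc" "future_inv f (x # fut) (N, Ps)" "\<forall>P\<in>set Ps. distinct (members P)"
      "\<forall>j<length Ps. Suc (length acc + j) < length (members (Ps ! j))" for acc Ps N
    using that
  proof (induction Ps arbitrary: acc)
    case (Cons P Ps)
    define c where "c = filter (\<lambda>y. y \<notin> set acc) (members P)"
    have d: "distinct (members P)" using Cons.prems by auto
    have len: "Suc (length acc) < length (members P)" using Cons.prems(4) by force
    have "length (members P) - length acc \<le> length c"
    proof -
      have "card (set (members P)) \<le> card (set c \<union> set acc)" by (intro card_mono) (auto simp: c_def)
      also have "\<dots> \<le> card (set c) + card (set acc)" by (rule card_Un_le)
      also have "\<dots> \<le> length c + length acc" by (intro add_mono card_length)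
      finally show ?thesis using d by (simp add: distinct_card)
    qed
    then have "1 < length c" using len by linarith
    moreover have "distinct c" using d by (simp add: c_def)
    ultimately obtain y where y: "y \<in> set c" "y \<noteq> x"
      by (metis One_nat_def Suc_le_eq card_1_singleton_iff card_length distinct_card length_pos_if_in_set
        less_numeral_extra(4) list.set_intros(1) list.size(3) neq_Nil_conv not_less_zero singletonI subset_singletonD
        subsetI)
    obtain past where past: "f (fst P) = past @ x # fut" "set past \<inter> set (members P) = {}"
      using Cons.prems(2) by (auto simp: future_inv_def)
    then have "set past \<inter> set c = {}" by (auto simp: c_def)
    then have "ch (fst P) (fst (snd P)) c \<noteq> x"
      using assms(3) past(1) y unfolding furthest_def by blast
    then have "x \<notin> set (drops ch (ch (fst P) (fst (snd P)) c # acc) Ps)"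
      using Cons.prems by (intro Cons.IH) (force simp: future_inv_def)+
    moreover have "c \<noteq> []" using y by auto
    ultimately show ?case by (simp add: Let_def c_def [symmetric])
  qed simp
  from this [of "[]" "fst st" "snd st"] I assms(4)
  have "x \<notin> set (drops ch [] (snd st))" by auto
  then show ?thesis by (auto simp: miss_def fresh_def cache_def)
qed

section \<open>Paging solutions induced in one set\<close>

definition live :: "('s \<Rightarrow> 'p option) \<Rightarrow> 'p \<Rightarrow> 's set \<Rightarrow> bool" where
  "live C p A \<longleftrightarrow> (\<exists>s\<in>A. C s = Some p)"

text \<open>The redundant copies in \<open>A\<close>. Each is a unit held in reserve, spent when a
  copy is evicted and a redundant one takes over its duties.\<close>

definition surplus :: "('s \<Rightarrow> 'p option) \<Rightarrow> 's set \<Rightarrow> int" where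
  "surplus C A = int (card {s \<in> A. C s \<noteq> None}) - int (card {p. live C p A})"

text \<open>In the application \<open>\<T>\<close> consists of the members of the family inside
  \<open>R\<close>.\<close>

locale laminar_tree =
  fixes \<T> :: "'s set set" and R :: "'s set"
  assumes finite_R: "finite R" and R_in: "R \<in> \<T>" and sub_R: "\<And>A. A \<in> \<T> \<Longrightarrow> A \<subseteq> R"
    and lam: "\<And>A B. A \<in> \<T> \<Longrightarrow> B \<in> \<T> \<Longrightarrow> A \<inter> B = {} \<or> A \<subseteq> B \<or> B \<subseteq> A"
begin

lemma finite_T: "finite \<T>"
  using finite_R sub_R by (meson Pow_iff finite_Pow_iff finite_subset subsetI)

lemma finite_mem: "A \<in> \<T> \<Longrightarrow> finite A"
  using finite_R sub_R finite_subset by blast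

lemma comparable: "A \<in> \<T> \<Longrightarrow> B \<in> \<T> \<Longrightarrow> x \<in> A \<Longrightarrow> x \<in> B \<Longrightarrow> A \<subseteq> B \<or> B \<subseteq> A"
  using lam by blast

text \<open>By the second clause, the sets that a slot serves for its page form an initial segment
  of the chain of all sets around the slot.\<close>

definition holder_ok :: "('s \<Rightarrow> 'p option) \<Rightarrow> ('p \<Rightarrow> 's set \<Rightarrow> 's) \<Rightarrow> bool" where
  "holder_ok C des \<longleftrightarrow>
     (\<forall>p. \<forall>A\<in>\<T>. live C p A \<longrightarrow> des p A \<in> A \<and> C (des p A) = Some p) \<and>
     (\<forall>p. \<forall>A\<in>\<T>. \<forall>B\<in>\<T>. B \<subseteq> A \<longrightarrow> live C p A \<longrightarrow> des p A \<in> B \<longrightarrow> des p B = des p A)"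

definition held :: "('s \<Rightarrow> 'p option) \<Rightarrow> ('p \<Rightarrow> 's set \<Rightarrow> 's) \<Rightarrow> 's \<Rightarrow> 's set set" where
  "held C des r = {A \<in> \<T>. r \<in> A \<and> C r \<noteq> None \<and> des (the (C r)) A = r}"

text \<open>
  \<open>des p A\<close> is the slot designated to serve page \<open>p\<close> in \<open>A\<close>, \<open>c A\<close> the item currently wanted there. A slot
  stands for the item wanted in the largest set that it serves; \<open>rank\<close> prepays the changes of this item
  which future requests can force.
\<close>

definition rank :: "('s set \<Rightarrow> 'i option) \<Rightarrow> 's set set \<Rightarrow> nat" where
  "rank c D = card {A \<in> D. c A = None} + (card {i. \<exists>A\<in>D. c A = Some i} - 1)"

definition label :: "('s set \<Rightarrow> 'i option) \<Rightarrow> 's set set \<Rightarrow> 'i option" where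
  "label c D = (if D = {} then None else c (\<Union>D))"

definition labels :: "('s \<Rightarrow> 'p option) \<Rightarrow> ('p \<Rightarrow> 's set \<Rightarrow> 's) \<Rightarrow> ('p \<Rightarrow> 's set \<Rightarrow> 'i option) \<Rightarrow> 'i set" where
  "labels C des cur = {i. \<exists>r\<in>R. label (cur (the (C r))) (held C des r) = Some i}"

text \<open>The unspent part of the charge: item changes that may still be forced, and redundant
  copies.\<close>

definition account :: "('s \<Rightarrow> 'p option) \<Rightarrow> ('p \<Rightarrow> 's set \<Rightarrow> 's) \<Rightarrow> ('p \<Rightarrow> 's set \<Rightarrow> 'i option) \<Rightarrow> int" where
  "account C des cur = (\<Sum>r\<in>R. int (rank (cur (the (C r))) (held C des r))) + (\<Sum>A\<in>\<T>. surplus C A)"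

text \<open>Along a chain, the sets wanting the same item are consecutive. Hence the item wanted in
  the largest set of a chain is wanted in no smaller set below one that wants something
  else.\<close>

definition cur_ok :: "('p \<Rightarrow> 's set \<Rightarrow> 'i option) \<Rightarrow> bool" where
  "cur_ok cur \<longleftrightarrow>
     (\<forall>p. \<forall>A\<in>\<T>. \<forall>B\<in>\<T>. A \<subseteq> B \<longrightarrow> cur p A \<noteq> None \<longrightarrow> cur p B \<noteq> None) \<and>
     (\<forall>p. \<forall>A\<in>\<T>. \<forall>B\<in>\<T>. \<forall>D\<in>\<T>. A \<subseteq> B \<longrightarrow> B \<subseteq> D \<longrightarrow> cur p A \<noteq> None \<longrightarrow>
        cur p A = cur p D \<longrightarrow> cur p B = cur p A)"

lemma holder_okD:
  assumes "holder_ok C des" "A \<in> \<T>" "live C p A"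
  shows "des p A \<in> A" "C (des p A) = Some p"
    and "B \<in> \<T> \<Longrightarrow> B \<subseteq> A \<Longrightarrow> des p A \<in> B \<Longrightarrow> des p B = des p A"
proof -
  note 1 = assms(1) [unfolded holder_ok_def, THEN conjunct1, rule_format, OF assms(2,3)]
  show "des p A \<in> A" "C (des p A) = Some p" using 1 by simp_all
  assume "B \<in> \<T>" "B \<subseteq> A" "des p A \<in> B"
  then show "des p B = des p A"
    by (rule assms(1) [unfolded holder_ok_def, THEN conjunct2, rule_format, OF assms(2) _ _ assms(3)])
qed

lemma finite_held: "finite (held C des r)"
  using finite_T by (simp add: held_def)

lemma cur_okD:
  assumes "cur_ok cur" "A \<in> \<T>" "B \<in> \<T>" "A \<subseteq> B" "cur p A = Some i"
  shows "cur p B \<noteq> None" and "D \<in> \<T> \<Longrightarrow> B \<subseteq> D \<Longrightarrow> cur p D = Some i \<Longrightarrow> cur p B = Some i"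
proof -
  show "cur p B \<noteq> None"
    using assms(2-5) assms(1) [unfolded cur_ok_def, THEN conjunct1, rule_format, of A B p] by simp
  assume D: "D \<in> \<T>" "B \<subseteq> D" "cur p D = Some i"
  have "cur p A \<noteq> None" "cur p A = cur p D" using assms(5) D by auto
  then have "cur p B = cur p A"
    using assms(2-4) D(1,2) assms(1) [unfolded cur_ok_def, THEN conjunct2, rule_format, of A B D p] by simp
  then show "cur p B = Some i" using assms(5) by simp
qed

lemma heldD: "A \<in> held C des r \<Longrightarrow> A \<in> \<T> \<and> r \<in> A"
  by (simp add: held_def)

text \<open>Sets of a laminar family through a common point form a chain, so finitely many of them
  have a largest one.\<close>

lemma chain_Union:
  assumes "D \<subseteq> \<T>" "D \<noteq> {}" "\<And>A. A \<in> D \<Longrightarrow> r \<in> A"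
  shows "\<Union>D \<in> D"
proof -
  have "finite D" using assms(1) finite_T finite_subset by blast
  from this assms(2,1,3) show ?thesis
  proof (induction D rule: finite_ne_induct)
    case (insert A D)
    have "\<Union>D \<in> D" "A \<in> \<T>" "D \<subseteq> \<T>" using insert by auto
    then have "A \<subseteq> \<Union>D \<or> \<Union>D \<subseteq> A" using insert.prems comparable [of A "\<Union>D" r] by auto
    then show ?case
    proof
      assume "A \<subseteq> \<Union>D"
      then have "\<Union>(insert A D) = \<Union>D" by auto
      with \<open>\<Union>D \<in> D\<close> show ?case by simp
    next
      assume "\<Union>D \<subseteq> A"
      then have "\<Union>(insert A D) = A" by auto
      then show ?case by simp
    qed
  qed auto
qed

lemma chain_Inter:
  assumes "D \<subseteq> \<T>" "D \<noteq> {}" "\<And>A. A \<in> D \<Longrightarrow> r \<in> A"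
  shows "\<Inter>D \<in> D"
proof -
  have "finite D" using assms(1) finite_T finite_subset by blast
  from this assms(2,1,3) show ?thesis
  proof (induction D rule: finite_ne_induct)
    case (insert A D)
    have "\<Inter>D \<in> D" "A \<in> \<T>" "D \<subseteq> \<T>" using insert by auto
    then have "A \<subseteq> \<Inter>D \<or> \<Inter>D \<subseteq> A" using insert.prems comparable [of A "\<Inter>D" r] by auto
    then show ?case
    proof
      assume "A \<subseteq> \<Inter>D"
      then have "\<Inter>(insert A D) = A" by auto
      then show ?case by simp
    next
      assume "\<Inter>D \<subseteq> A"
      then have "\<Inter>(insert A D) = \<Inter>D" by auto
      with \<open>\<Inter>D \<in> D\<close> show ?case by simp
    qed
  qed auto
qed

lemma held_top: "held C des r \<noteq> {} \<Longrightarrow> \<Union>(held C des r) \<in> held C des r"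
  by (rule chain_Union [where r = r]) (auto simp: held_def)

lemma finite_labels: "finite (labels C des cur)" and card_labels: "card (labels C des cur) \<le> card R"
proof -
  have s: "labels C des cur \<subseteq> (\<lambda>r. the (label (cur (the (C r))) (held C des r))) ` R"
    by (force simp: labels_def)
  show "finite (labels C des cur)" using s finite_R by (meson finite_imageI finite_subset)
  show "card (labels C des cur) \<le> card R"
    using s finite_R surj_card_le by blast
qed

lemma finite_vals: "finite D \<Longrightarrow> finite {i. \<exists>A\<in>D. c A = Some i}"
  by (rule finite_subset [of _ "(\<lambda>A. the (c A)) ` D"]) force+

lemma surplus_nonneg:
  assumes "finite A"
  shows "0 \<le> surplus C A"
proof -
  have "{p. live C p A} \<subseteq> (\<lambda>s. the (C s)) ` {s \<in> A. C s \<noteq> None}" by (force simp: live_def)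
  then have "card {p. live C p A} \<le> card {s \<in> A. C s \<noteq> None}"
    using assms by (intro surj_card_le) auto
  then show ?thesis by (simp add: surplus_def)
qed

lemma account_nonneg: "0 \<le> account C des cur"
  unfolding account_def using surplus_nonneg finite_mem
  by (intro add_nonneg_nonneg sum_nonneg) auto

text \<open>A slot carries at most one label, so new labels can be charged slot by slot to the loss
  of rank.\<close>

lemma card_new_labels:
  assumes "\<And>r. r \<in> R \<Longrightarrow> rank (cur' (the (C' r))) (held C' des' r) +
      (case label (cur' (the (C' r))) (held C' des' r) of None \<Rightarrow> 0 | Some i \<Rightarrow> if i \<in> Z then 0 else 1)
      \<le> f r"
  shows "int (card (labels C' des' cur' - Z)) + (\<Sum>r\<in>R. int (rank (cur' (the (C' r))) (held C' des' r)))
    \<le> (\<Sum>r\<in>R. int (f r))"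
proof -
  let ?l = "\<lambda>r. label (cur' (the (C' r))) (held C' des' r)"
  let ?B = "{r \<in> R. \<exists>i. ?l r = Some i \<and> i \<notin> Z}"
  have "labels C' des' cur' - Z \<subseteq> (\<lambda>r. the (?l r)) ` ?B"
    by (force simp: labels_def)
  then have "card (labels C' des' cur' - Z) \<le> card ?B"
    using finite_R by (intro surj_card_le) auto
  also have "card ?B = (\<Sum>r\<in>R. if \<exists>i. ?l r = Some i \<and> i \<notin> Z then 1 else 0)"
    using finite_R by (simp add: sum.inter_filter [symmetric])
  also have "\<dots> = (\<Sum>r\<in>R. case ?l r of None \<Rightarrow> 0 | Some i \<Rightarrow> if i \<in> Z then 0 else 1)"
    by (intro sum.cong) (auto split: option.splits)
  finally have "int (card (labels C' des' cur' - Z)) \<le>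
      (\<Sum>r\<in>R. int (case ?l r of None \<Rightarrow> 0 | Some i \<Rightarrow> if i \<in> Z then 0 else 1))"
    by (simp flip: of_nat_sum)
  moreover have "(\<Sum>r\<in>R. int (case ?l r of None \<Rightarrow> 0 | Some i \<Rightarrow> if i \<in> Z then 0 else 1)) +
      (\<Sum>r\<in>R. int (rank (cur' (the (C' r))) (held C' des' r))) \<le> (\<Sum>r\<in>R. int (f r))"
    unfolding sum.distrib [symmetric] using assms by (intro sum_mono) (auto simp flip: of_nat_add simp: add.commute)
  ultimately show ?thesis by linarith
qed

text \<open>A new label outside \<open>Z\<close> differs from the old one. By the convexity in
  \<open>cur_ok\<close> the old label is then wanted in none of the remaining sets, so the rank
  loses a distinct value, and this pays for the new label.\<close>

lemma rank_shrink:
  assumes "cur_ok cur" "D \<subseteq> \<T>" "\<And>A. A \<in> D \<Longrightarrow> r \<in> A" "D' \<subseteq> D" "\<And>A. A \<in> D' \<Longrightarrow> c A = cur q A"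
    "\<And>i. label (cur q) D = Some i \<Longrightarrow> i \<in> Z"
  shows "rank c D' + (case label c D' of None \<Rightarrow> 0 | Some i \<Rightarrow> if i \<in> Z then 0 else 1) \<le> rank (cur q) D"
proof -
  have finD: "finite D" using finite_subset [OF assms(2) finite_T] .
  have fin: "finite D" "finite D'" using finD finite_subset [OF assms(4) finD] by blast+
  have "{A \<in> D'. c A = None} \<subseteq> {A \<in> D. cur q A = None}"
    using assms(4,5) by (auto simp: subset_iff)
  then have n: "card {A \<in> D'. c A = None} \<le> card {A \<in> D. cur q A = None}"
    using fin by (intro card_mono) auto
  have v: "{i. \<exists>A\<in>D'. c A = Some i} \<subseteq> {i. \<exists>A\<in>D. cur q A = Some i}"
  proof
    fix i assume "i \<in> {i. \<exists>A\<in>D'. c A = Some i}"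
    then obtain A where "A \<in> D'" "c A = Some i" by blast
    then show "i \<in> {i. \<exists>A\<in>D. cur q A = Some i}" using assms(4) assms(5) [of A] by auto
  qed
  have cv: "card {i. \<exists>A\<in>D'. c A = Some i} \<le> card {i. \<exists>A\<in>D. cur q A = Some i}"
    by (intro card_mono v finite_vals fin)
  show ?thesis
  proof (cases "\<exists>b. label c D' = Some b \<and> b \<notin> Z")
    case False
    with n cv show ?thesis by (auto simp: rank_def split: option.splits)
  next
    case True
    then obtain b where b: "label c D' = Some b" "b \<notin> Z" by blast
    then have ne: "D' \<noteq> {}" by (auto simp: label_def)
    have t': "\<Union>D' \<in> D'" by (rule chain_Union [where r = r]) (use ne assms in auto)
    have t: "\<Union>D \<in> D" by (rule chain_Union [where r = r]) (use ne assms in auto)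
    have cb: "cur q (\<Union>D') = Some b" using b ne t' assms(5) by (simp add: label_def)
    have tT: "\<Union>D' \<in> \<T>" "\<Union>D \<in> \<T>" "\<Union>D' \<subseteq> \<Union>D" using t t' assms(2,4) by blast+
    obtain a where a: "cur q (\<Union>D) = Some a"
      using cur_okD(1) [OF assms(1) tT cb] by blast
    then have "label (cur q) D = Some a" using t by (auto simp: label_def)
    then have "a \<in> Z" by (rule assms(6))
    then have "a \<noteq> b" using b by auto
    have "a \<notin> {i. \<exists>A\<in>D'. c A = Some i}"
    proof
      assume "a \<in> {i. \<exists>A\<in>D'. c A = Some i}"
      then obtain A where A: "A \<in> D'" "cur q A = Some a" using assms(5) by auto
      have "A \<in> \<T>" "A \<subseteq> \<Union>D'" using A assms(2,4) by blast+
      from cur_okD(2) [OF assms(1) this(1) tT(1) this(2) A(2) tT(2,3) a]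
      show False using cb \<open>a \<noteq> b\<close> by simp
    qed
    moreover have "a \<in> {i. \<exists>A\<in>D. cur q A = Some i}" using a t by auto
    ultimately have "{i. \<exists>A\<in>D'. c A = Some i} \<subset> {i. \<exists>A\<in>D. cur q A = Some i}" using v by auto
    then have "card {i. \<exists>A\<in>D'. c A = Some i} < card {i. \<exists>A\<in>D. cur q A = Some i}"
      by (intro psubset_card_mono finite_vals fin)
    moreover have "card {i. \<exists>A\<in>D'. c A = Some i} \<noteq> 0"
    proof -
      have "c (\<Union>D') = Some b" using b ne by (simp add: label_def)
      then have "b \<in> {i. \<exists>A\<in>D'. c A = Some i}" using t' by blast
      then show ?thesis using finite_vals [OF fin(2), of c] by auto
    qed
    ultimately show ?thesis using n b by (simp add: rank_def)
  qed
qed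

text \<open>The slot serving \<open>q\<close> in \<open>S\<close> takes over all larger sets up to
  \<open>R\<close>, so its label becomes \<open>\<theta>\<close>; the other slots only lose sets. If
  nothing was wanted in \<open>S\<close>, an unset entry of the rank disappears and pays. If
  \<open>\<theta>\<close> was wanted there without being a label, the slot had another label, which
  by convexity disappears from its values.\<close>

lemma request_step:
  assumes ok: "holder_ok C des" and cok: "cur_ok cur" and S: "S \<in> \<T>" "live C q S"
    and th: "cur q S = Some \<theta> \<or> cur q S = None"
    and cur': "\<And>p A. cur' p A = (if p = q \<and> S \<subseteq> A then Some \<theta> else cur p A)"
  obtains des' where "holder_ok C des'" "\<theta> \<in> labels C des' cur'"
    "int (card (labels C des' cur' - labels C des cur)) + account C des' cur' \<le> account C des cur"
proof -
  define r where "r = des q S"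
  define des' where "des' = (\<lambda>p A. if p = q \<and> S \<subseteq> A then r else des p A)"
  have r: "r \<in> S" "C r = Some q" using holder_okD [OF ok S] by (simp_all add: r_def)
  have rR: "r \<in> R" using r S sub_R by blast
  have ok': "holder_ok C des'"
    unfolding holder_ok_def
  proof (intro conjI allI ballI impI)
    fix p A assume A: "A \<in> \<T>" "live C p A"
    show "des' p A \<in> A" "C (des' p A) = Some p"
      using holder_okD(1,2) [OF ok A] r by (auto simp: des'_def)
  next
    fix p A B assume *: "A \<in> \<T>" "B \<in> \<T>" "B \<subseteq> A" "live C p A" "des' p A \<in> B"
    show "des' p B = des' p A"
    proof (cases "p = q \<and> S \<subseteq> A")
      case True
      then have rB: "r \<in> B" using * by (simp add: des'_def)
      show ?thesis
      proof (cases "S \<subseteq> B")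
        case False
        then have "B \<subseteq> S" using comparable [OF *(2) S(1) rB r(1)] by blast
        then have "des q B = des q S" using holder_okD(3) [OF ok S *(2)] rB unfolding r_def by blast
        with True False show ?thesis by (simp add: des'_def r_def)
      qed (use True in \<open>simp add: des'_def\<close>)
    next
      case False
      then have "\<not> (p = q \<and> S \<subseteq> B)" using *(3) by blast
      with False holder_okD(3) [OF ok *(1,4,2,3)] *(5) show ?thesis unfolding des'_def by (simp add: if_not_P)
    qed
  qed
  have hr: "held C des' r = {A \<in> held C des r. \<not> S \<subseteq> A} \<union> {A \<in> \<T>. S \<subseteq> A}"
    using r by (auto simp: held_def des'_def)
  have ho: "held C des' s = {A \<in> held C des s. \<not> (C s = Some q \<and> S \<subseteq> A)}" if "s \<noteq> r" for s
    using that r by (auto simp: held_def des'_def)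
  have Sh: "S \<in> held C des r" using r S by (simp add: held_def r_def)
  have Rh: "R \<in> held C des' r" unfolding hr using R_in sub_R [OF S(1)] by blast
  have "A \<subseteq> R" if "A \<in> held C des' r" for A using that sub_R by (simp add: held_def)
  then have top: "\<Union>(held C des' r) = R" using Rh by blast
  have lab: "label (cur' (the (C r))) (held C des' r) = Some \<theta>"
    unfolding label_def top using Rh sub_R [OF S(1)] r by (auto simp: cur')
  have Zin: "i \<in> labels C des cur" if "label (cur (the (C s))) (held C des s) = Some i" "s \<in> R" for s i
    using that by (auto simp: labels_def)
  have "rank (cur' (the (C s))) (held C des' s) +
      (case label (cur' (the (C s))) (held C des' s) of None \<Rightarrow> 0
       | Some i \<Rightarrow> if i \<in> labels C des cur then 0 else 1)
      \<le> rank (cur (the (C s))) (held C des s)" if s: "s \<in> R" for s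
  proof (cases "s = r")
    case False
    have 1: "held C des s \<subseteq> \<T>" by (auto simp: held_def)
    have 2: "s \<in> A" if "A \<in> held C des s" for A using that by (simp add: held_def)
    have 3: "held C des' s \<subseteq> held C des s" unfolding ho [OF False] by blast
    have 4: "cur' (the (C s)) A = cur (the (C s)) A" if "A \<in> held C des' s" for A
    proof -
      have "C s \<noteq> None" "\<not> (C s = Some q \<and> S \<subseteq> A)"
        using that unfolding ho [OF False] by (auto simp: held_def)
      then show ?thesis by (auto simp: cur')
    qed
    have 5: "i \<in> labels C des cur" if "label (cur (the (C s))) (held C des s) = Some i" for i
      using Zin [OF that s] .
    show ?thesis
      by (rule rank_shrink [of cur "held C des s" s "held C des' s" "cur' (the (C s))" "the (C s)" "labels C des cur",
        OF cok 1 2 3 4 5])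
  next
    case True
    let ?L = "{A \<in> held C des r. \<not> S \<subseteq> A}"
    have c: "cur' (the (C r)) = cur' q" using r by simp
    have LS: "A \<subseteq> S" if "A \<in> ?L" for A
      using that comparable [of A S r] S r by (auto simp: held_def)
    have n': "{A \<in> held C des' r. cur' q A = None} = {A \<in> ?L. cur q A = None}"
      by (auto simp: hr cur')
    have v': "{i. \<exists>A\<in>held C des' r. cur' q A = Some i} = insert \<theta> {i. \<exists>A\<in>?L. cur q A = Some i}"
      using R_in sub_R [OF S(1)] by (auto simp: hr cur')
    show ?thesis
    proof (cases "cur q S")
      case None
      \<comment> \<open>Nothing is wanted below \<open>S\<close> either, so the smaller sets count
        in the rank before and after, and \<open>S\<close> itself is the unit that is
        released.\<close>
      have "cur q A = None" if "A \<in> ?L" for A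
        using cur_okD(1) [OF cok _ S(1) LS [OF that]] heldD [of A] that None
        by (metis (no_types, lifting) mem_Collect_eq option.exhaust)
      then have "{i. \<exists>A\<in>?L. cur q A = Some i} = {}" "{A \<in> ?L. cur q A = None} = ?L" by auto
      then have "rank (cur' q) (held C des' r) = card ?L" by (simp only: rank_def n' v') simp
      moreover have "card (insert S ?L) \<le> card {A \<in> held C des r. cur q A = None}"
        using Sh None \<open>\<And>A. A \<in> ?L \<Longrightarrow> cur q A = None\<close> finite_held [of C des r]
        by (intro card_mono) auto
      moreover have "card (insert S ?L) = Suc (card ?L)" using finite_held [of C des r] by simp
      ultimately show ?thesis using True c r(2) lab
        by (auto simp: rank_def split: option.splits)
    next
      case (Some i)
      then have i: "cur q S = Some \<theta>" using th by auto
      have V: "insert \<theta> {i. \<exists>A\<in>?L. cur q A = Some i} \<subseteq> {i. \<exists>A\<in>held C des r. cur q A = Some i}"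
        using Sh i by auto
      have n: "card {A \<in> ?L. cur q A = None} \<le> card {A \<in> held C des r. cur q A = None}"
        using finite_held [of C des r] by (intro card_mono) auto
      have fV: "finite {i. \<exists>A\<in>held C des r. cur q A = Some i}" by (intro finite_vals finite_held)
      show ?thesis
      proof (cases "\<theta> \<in> labels C des cur")
        case T: True
        have "card (insert \<theta> {i. \<exists>A\<in>?L. cur q A = Some i}) \<le> card {i. \<exists>A\<in>held C des r. cur q A = Some i}"
          using V fV card_mono by blast
        then show ?thesis using True c r(2) lab T n by (simp add: rank_def n' v')
      next
        case F: False
        let ?t = "\<Union>(held C des r)"
        have t: "?t \<in> held C des r" using held_top Sh by blast
        have St: "S \<subseteq> ?t" using Sh by auto
        have tT: "?t \<in> \<T>" using heldD [OF t] by blast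
        obtain a where a: "cur q ?t = Some a"
          using cur_okD(1) [OF cok S(1) tT St i] by blast
        have "held C des r \<noteq> {}" using Sh by blast
        then have "label (cur (the (C r))) (held C des r) = Some a" using a r(2) by (simp add: label_def)
        then have "a \<in> labels C des cur" using Zin rR by blast
        then have "a \<noteq> \<theta>" using F by auto
        have "a \<notin> {i. \<exists>A\<in>?L. cur q A = Some i}"
        proof
          assume "a \<in> {i. \<exists>A\<in>?L. cur q A = Some i}"
          then obtain A where A: "A \<in> ?L" "cur q A = Some a" by auto
          then have "A \<in> \<T>" by (simp add: held_def)
          from cur_okD(2) [OF cok this S(1) LS [OF A(1)] A(2) tT St a]
          show False using i \<open>a \<noteq> \<theta>\<close> by simp
        qed
        then have "insert \<theta> {i. \<exists>A\<in>?L. cur q A = Some i} \<subset> {i. \<exists>A\<in>held C des r. cur q A = Some i}"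
          using V \<open>a \<noteq> \<theta>\<close> a t by blast
        then have "card (insert \<theta> {i. \<exists>A\<in>?L. cur q A = Some i}) < card {i. \<exists>A\<in>held C des r. cur q A = Some i}"
          by (intro psubset_card_mono fV)
        moreover have "card (insert \<theta> {i. \<exists>A\<in>?L. cur q A = Some i}) \<noteq> 0"
          using V fV by (meson card_0_eq finite_subset insert_not_empty)
        ultimately show ?thesis using True c r(2) lab F n by (simp add: rank_def n' v')
      qed
    qed
  qed
  from card_new_labels [OF this]
  have "int (card (labels C des' cur' - labels C des cur)) + account C des' cur' \<le> account C des cur"
    by (simp add: account_def)
  moreover have "\<theta> \<in> labels C des' cur'" using lab rR by (auto simp: labels_def)
  ultimately show ?thesis using that ok' by blast
qed

lemma live_update_None: "live (C(w := None)) p A \<Longrightarrow> live C p A"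
  by (auto simp: live_def split: if_splits)

lemma surplus_load:
  assumes "C w = None" "finite A"
  shows "surplus (C(w := Some p)) A = surplus C A + (if w \<in> A \<and> live C p A then 1 else 0)"
proof (cases "w \<in> A")
  case False
  then have "{s \<in> A. (C(w := Some p)) s \<noteq> None} = {s \<in> A. C s \<noteq> None}"
    "{q. live (C(w := Some p)) q A} = {q. live C q A}" by (auto simp: live_def)
  then show ?thesis using False by (simp add: surplus_def)
next
  case True
  have f: "finite {q. live C q A}"
    by (rule finite_subset [of _ "(\<lambda>s. the (C s)) ` A"]) (use assms in \<open>force simp: live_def\<close>)+
  have 1: "{s \<in> A. (C(w := Some p)) s \<noteq> None} = insert w {s \<in> A. C s \<noteq> None}" using True by auto
  have "live (C(w := Some p)) q A" if "live C q A" for q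
  proof -
    from that obtain s where "s \<in> A" "C s = Some q" by (auto simp: live_def)
    then show ?thesis using assms(1) unfolding live_def by (intro bexI [of _ s]) auto
  qed
  moreover have "live (C(w := Some p)) p A" using True by (auto simp: live_def)
  moreover have "q = p \<or> live C q A" if "live (C(w := Some p)) q A" for q
    using that by (auto simp: live_def split: if_splits)
  ultimately have 2: "{q. live (C(w := Some p)) q A} = insert p {q. live C q A}" by blast
  show ?thesis unfolding surplus_def 1 2 using True assms f by (simp add: card_insert_if)
qed

lemma surplus_evict:
  assumes "C w = Some p" "finite A"
  shows "surplus (C(w := None)) A = surplus C A - (if w \<in> A \<and> live (C(w := None)) p A then 1 else 0)"
  using surplus_load [of "C(w := None)" w A p] assms by (simp add: fun_upd_idem)

text \<open>In the sets around \<open>w\<close> without a copy of \<open>p\<close>, the slot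
  \<open>w\<close> takes over, and one unit for each covers its rank and its label. In the other
  sets around \<open>w\<close> the new copy is redundant and adds to the surplus. Together this is
  one unit for each set around \<open>w\<close>.\<close>

lemma load_step:
  assumes ok: "holder_ok C des" and cok: "cur_ok cur" and w: "w \<in> R" "C w = None"
  obtains des' where "holder_ok (C(w := Some p)) des'"
    "int (card (labels (C(w := Some p)) des' cur - labels C des cur)) + account (C(w := Some p)) des' cur
       \<le> account C des cur + int (card {A \<in> \<T>. w \<in> A})"
proof -
  let ?C = "C(w := Some p)"
  define V where "V = {A \<in> \<T>. w \<in> A \<and> \<not> live C p A}"
  define des' where "des' = (\<lambda>q A. if q = p \<and> A \<in> V then w else des q A)"
  have fV: "finite V" using finite_T by (simp add: V_def)
  have lv: "live C q A" if "live ?C q A" "A \<in> \<T>" "\<not> (q = p \<and> A \<in> V)" for q A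
    using that by (auto simp: live_def V_def split: if_splits)
  have ok': "holder_ok ?C des'"
    unfolding holder_ok_def
  proof (intro conjI allI ballI impI)
    fix q A assume A: "A \<in> \<T>" "live ?C q A"
    have "des' q A \<in> A \<and> ?C (des' q A) = Some q"
    proof (cases "q = p \<and> A \<in> V")
      case True
      then show ?thesis by (simp add: des'_def V_def)
    next
      case False
      then have "live C q A" using lv A by blast
      from holder_okD(1,2) [OF ok A(1) this] show ?thesis using False w by (auto simp: des'_def)
    qed
    then show "des' q A \<in> A" "?C (des' q A) = Some q" by auto
  next
    fix q A B assume *: "A \<in> \<T>" "B \<in> \<T>" "B \<subseteq> A" "live ?C q A" "des' q A \<in> B"
    show "des' q B = des' q A"
    proof (cases "q = p \<and> A \<in> V")
      case True
      then have "w \<in> B" using * by (simp add: des'_def)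
      moreover have "\<not> live C p B" using True *(3) by (auto simp: V_def live_def)
      ultimately show ?thesis using True *(2) by (simp add: des'_def V_def)
    next
      case False
      then have l: "live C q A" using lv * by blast
      have d: "des q A \<in> B" using False * by (simp add: des'_def if_not_P)
      then have "des q B = des q A" using holder_okD(3) [OF ok *(1) l *(2,3)] by blast
      moreover have "live C q B" using holder_okD(2) [OF ok *(1) l] d unfolding live_def by blast
      ultimately show ?thesis using False by (auto simp: des'_def V_def)
    qed
  qed
  have hw: "held ?C des' w = V"
  proof -
    have "des' p A = w \<longleftrightarrow> A \<in> V" if "A \<in> \<T>" "w \<in> A" for A
    proof (cases "A \<in> V")
      case False
      then have "live C p A" using that by (auto simp: V_def)
      then have "C (des p A) = Some p" using holder_okD(2) [OF ok that(1)] by blast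
      then show ?thesis using False w by (auto simp: des'_def)
    qed (simp add: des'_def)
    then show ?thesis by (auto simp: held_def V_def)
  qed
  have hw0: "held C des w = {}" using w by (simp add: held_def)
  have ho: "held ?C des' s = held C des s" if "s \<noteq> w" for s
    using that by (auto simp: held_def des'_def V_def live_def)
  have rest: "label (cur (the (?C s))) (held ?C des' s) = label (cur (the (C s))) (held C des s)"
    if "s \<noteq> w" for s using that ho by simp
  let ?l = "label (cur p) V"
  \<comment> \<open>The value that \<open>rank\<close> leaves free is the unit that pays for the
    label.\<close>
  have bound: "rank (cur p) V + (case ?l of None \<Rightarrow> 0 | Some i \<Rightarrow> 1) \<le> card V"
  proof -
    let ?I = "{i. \<exists>A\<in>V. cur p A = Some i}"
    have "?I \<subseteq> (\<lambda>A. the (cur p A)) ` {A \<in> V. cur p A \<noteq> None}" by force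
    then have "card ?I \<le> card {A \<in> V. cur p A \<noteq> None}" using fV by (intro surj_card_le) auto
    moreover have "card {A \<in> V. cur p A = None} + card {A \<in> V. cur p A \<noteq> None} = card V"
      using fV by (subst card_Un_disjoint [symmetric]) (auto intro!: arg_cong [where f = card])
    moreover have "card ?I \<noteq> 0" if "?l = Some i" for i
    proof -
      have "V \<noteq> {}" using that by (auto simp: label_def)
      then have "\<Union>V \<in> V" by (intro chain_Union [where r = w]) (auto simp: V_def)
      then have "?I \<noteq> {}" using that \<open>V \<noteq> {}\<close> by (auto simp: label_def)
      then show ?thesis using finite_vals [OF fV, of "cur p"] by (simp add: card_eq_0_iff)
    qed
    ultimately show ?thesis unfolding rank_def by (cases ?l) (simp, fastforce)
  qed
  have "rank (cur (the (?C s))) (held ?C des' s) +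
      (case label (cur (the (?C s))) (held ?C des' s) of None \<Rightarrow> 0
       | Some i \<Rightarrow> if i \<in> labels C des cur then 0 else 1)
      \<le> (if s = w then card V else rank (cur (the (C s))) (held C des s))" if s: "s \<in> R" for s
  proof (cases "s = w")
    case True
    then show ?thesis using bound by (auto simp: hw split: option.splits)
  next
    case False
    then show ?thesis using rest [OF False] ho [OF False] s
      by (auto simp: labels_def split: option.splits)
  qed
  from card_new_labels [OF this]
  have "int (card (labels ?C des' cur - labels C des cur)) + (\<Sum>r\<in>R. int (rank (cur (the (?C r))) (held ?C des' r)))
    \<le> (\<Sum>s\<in>R. int (if s = w then card V else rank (cur (the (C s))) (held C des s)))" .
  also have "\<dots> = (\<Sum>s\<in>R. (if s = w then int (card V) else 0) + int (rank (cur (the (C s))) (held C des s)))"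
    by (intro sum.cong) (auto simp: hw0 rank_def)
  also have "\<dots> = int (card V) + (\<Sum>s\<in>R. int (rank (cur (the (C s))) (held C des s)))"
    using w finite_R by (simp add: sum.distrib)
  finally have 1: "int (card (labels ?C des' cur - labels C des cur)) +
      (\<Sum>r\<in>R. int (rank (cur (the (?C r))) (held ?C des' r)))
    \<le> int (card V) + (\<Sum>s\<in>R. int (rank (cur (the (C s))) (held C des s)))" .
  have "(\<Sum>A\<in>\<T>. surplus ?C A) = (\<Sum>A\<in>\<T>. surplus C A + (if w \<in> A \<and> live C p A then 1 else 0))"
    using surplus_load [of C w _ p, OF w(2)] finite_mem by (intro sum.cong) auto
  also have "\<dots> = (\<Sum>A\<in>\<T>. surplus C A) + int (card {A \<in> \<T>. w \<in> A \<and> live C p A})"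
    using finite_T by (simp add: sum.distrib sum.inter_filter [symmetric])
  finally have 2: "(\<Sum>A\<in>\<T>. surplus ?C A) = (\<Sum>A\<in>\<T>. surplus C A) + int (card {A \<in> \<T>. w \<in> A \<and> live C p A})" .
  have "card V + card {A \<in> \<T>. w \<in> A \<and> live C p A} = card {A \<in> \<T>. w \<in> A}"
    unfolding V_def using finite_T
    by (subst card_Un_disjoint [symmetric]) (auto intro!: arg_cong [where f = card])
  with 1 2 have "int (card (labels ?C des' cur - labels C des cur)) + account ?C des' cur
       \<le> account C des cur + int (card {A \<in> \<T>. w \<in> A})"
    by (simp add: account_def)
  then show ?thesis using that ok' by blast
qed

text \<open>If \<open>p\<close> remains in some of the sets served by \<open>w\<close>, one other
  copy takes over all of these. It lies in the smallest of them, \<open>B\<close>, and already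
  serves every set strictly inside \<open>B\<close> around it, which keeps the choice consistent. It
  inherits the label of \<open>w\<close>; joining the two ranks costs one unit, supplied by the
  surplus of \<open>B\<close>.\<close>

lemma evict_step:
  assumes ok: "holder_ok C des" and cok: "cur_ok cur" and w: "w \<in> R" "C w = Some p"
  obtains des' where "holder_ok (C(w := None)) des'"
    "labels (C(w := None)) des' cur \<subseteq> labels C des cur"
    "account (C(w := None)) des' cur \<le> account C des cur"
proof -
  let ?C = "C(w := None)"
  define U where "U = {A \<in> held C des w. live ?C p A}"
  have hwp: "A \<in> held C des w \<longleftrightarrow> A \<in> \<T> \<and> w \<in> A \<and> des p A = w" for A using w by (auto simp: held_def)
  have lv: "live C q A" if "live ?C q A" for q A using that by (rule live_update_None)
  have notw: "des q A \<noteq> w" if "A \<in> \<T>" "live ?C q A" "\<not> (q = p \<and> A \<in> U)" for q A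
  proof
    assume d: "des q A = w"
    have "des q A \<in> A" "C (des q A) = Some q" using holder_okD(1,2) [OF ok that(1) lv [OF that(2)]] by blast+
    then have "q = p" "A \<in> U" using d w that by (auto simp: U_def hwp)
    then show False using that by simp
  qed
  have surp: "(\<Sum>A\<in>\<T>. surplus ?C A) = (\<Sum>A\<in>\<T>. surplus C A) - int (card {A \<in> \<T>. w \<in> A \<and> live ?C p A})"
  proof -
    have "(\<Sum>A\<in>\<T>. surplus ?C A) = (\<Sum>A\<in>\<T>. surplus C A - (if w \<in> A \<and> live ?C p A then 1 else 0))"
      using surplus_evict [of C w p, OF w(2)] finite_mem by (intro sum.cong) auto
    then show ?thesis using finite_T by (simp add: sum_subtractf sum.inter_filter [symmetric])
  qed
  have hw': "held ?C d w = {}" for d by (simp add: held_def)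
  show ?thesis
  proof (cases "U = {}")
    case True
    have "holder_ok ?C des" unfolding holder_ok_def
    proof (intro conjI allI ballI impI)
      fix q A assume A: "A \<in> \<T>" "live ?C q A"
      have "des q A \<in> A \<and> C (des q A) = Some q" using holder_okD(1,2) [OF ok A(1) lv [OF A(2)]] by blast
      moreover have "des q A \<noteq> w" using notw [OF A] True by simp
      ultimately show "des q A \<in> A" "?C (des q A) = Some q" by auto
    next
      fix q A B assume *: "A \<in> \<T>" "B \<in> \<T>" "B \<subseteq> A" "live ?C q A" "des q A \<in> B"
      then show "des q B = des q A" using holder_okD(3) [OF ok *(1) lv [OF *(4)] *(2,3,5)] by blast
    qed
    moreover have ho: "held ?C des s = (if s = w then {} else held C des s)" for s
      by (auto simp: held_def)
    moreover have "labels ?C des cur \<subseteq> labels C des cur"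
      unfolding labels_def ho by (auto simp: label_def split: if_splits)
    moreover have "(\<Sum>r\<in>R. int (rank (cur (the (?C r))) (held ?C des r))) \<le> (\<Sum>r\<in>R. int (rank (cur (the (C r))) (held C des r)))"
      unfolding ho by (intro sum_mono) (auto simp: rank_def)
    ultimately show ?thesis using that [of des] surp by (simp add: account_def)
  next
    case False
    define B where "B = \<Inter>U"
    have UT: "U \<subseteq> \<T>" by (auto simp: U_def hwp)
    have BU: "B \<in> U" unfolding B_def using False UT by (intro chain_Inter [where r = w]) (auto simp: U_def hwp)
    then have B: "B \<in> \<T>" "w \<in> B" "des p B = w" "live ?C p B" by (auto simp: U_def hwp)
    have Ueq: "A \<in> U \<longleftrightarrow> A \<in> \<T> \<and> B \<subseteq> A \<and> des p A = w" for A
    proof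
      assume "A \<in> U" then show "A \<in> \<T> \<and> B \<subseteq> A \<and> des p A = w" by (auto simp: U_def hwp B_def)
    next
      assume A: "A \<in> \<T> \<and> B \<subseteq> A \<and> des p A = w"
      then have "live ?C p A" using B(4) unfolding live_def by blast
      then show "A \<in> U" using A B(2) unfolding U_def by (simp add: hwp subset_iff)
    qed
    from B(4) obtain r0 where r0: "r0 \<in> B" "?C r0 = Some p" by (auto simp: live_def)
    \<comment> \<open>From any remaining copy \<open>r0\<close> in \<open>B\<close>, pass to the
      slot serving \<open>p\<close> in the largest set around \<open>r0\<close> strictly inside
      \<open>B\<close>. Consistency then settles the smaller sets around that slot.\<close>
    define L where "L = {A \<in> \<T>. r0 \<in> A \<and> A \<subset> B}"
    define r where "r = (if L = {} then r0 else des p (\<Union>L))"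
    have r: "r \<in> B \<and> ?C r = Some p \<and> (\<forall>A\<in>\<T>. A \<subset> B \<longrightarrow> r \<in> A \<longrightarrow> des p A = r)"
    proof (cases "L = {}")
      case True
      then show ?thesis using r0 by (auto simp: r_def L_def)
    next
      case F: False
      let ?T = "\<Union>L"
      have TL: "?T \<in> L" using F by (intro chain_Union [where r = r0]) (auto simp: L_def)
      then have T: "?T \<in> \<T>" "r0 \<in> ?T" "?T \<subset> B" by (auto simp: L_def)
      have lT: "live ?C p ?T" using T(2) r0(2) unfolding live_def by blast
      have rd: "r = des p ?T" using F by (simp add: r_def)
      have rr: "r \<in> ?T" "C r = Some p" using holder_okD(1,2) [OF ok T(1) lv [OF lT]] rd by auto
      have "?T \<notin> U" using T(3) B_def by blast
      then have "r \<noteq> w" using notw [OF T(1) lT] rd by simp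
      moreover have "des p A = r" if A: "A \<in> \<T>" "A \<subset> B" "r \<in> A" for A
      proof (cases "A \<subseteq> ?T")
        case True
        then show ?thesis using holder_okD(3) [OF ok T(1) lv [OF lT] A(1)] A(3) rd by blast
      next
        case False
        then have "?T \<subseteq> A" using comparable [OF A(1) T(1) A(3) rr(1)] by blast
        then have "A \<in> L" using A T(2) by (auto simp: L_def)
        then show ?thesis using False by blast
      qed
      ultimately show ?thesis using rr T(3) by auto
    qed
    have rB: "r \<in> B" and rC: "?C r = Some p" and rA: "\<And>A. A \<in> \<T> \<Longrightarrow> A \<subset> B \<Longrightarrow> r \<in> A \<Longrightarrow> des p A = r"
      using r by blast+
    have rw: "r \<noteq> w" using rC by auto
    have Cr: "C r = Some p" using rC rw by simp
    have rR: "r \<in> R" using rB B(1) sub_R by blast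
    \<comment> \<open>Otherwise consistency would make \<open>r\<close> the server of
      \<open>B\<close>, which is \<open>w\<close>.\<close>
    have up: "des p A \<noteq> r" if "A \<in> \<T>" "B \<subseteq> A" for A
    proof
      assume d: "des p A = r"
      have "live C p A" using Cr rB that(2) unfolding live_def by blast
      then have "des p B = des p A" using holder_okD(3) [OF ok that(1) _ B(1) that(2)] d rB by blast
      with d B(3) rw show False by simp
    qed
    define des' where "des' = (\<lambda>q A. if q = p \<and> A \<in> U then r else des q A)"
    have ok': "holder_ok ?C des'" unfolding holder_ok_def
    proof (intro conjI allI ballI impI)
      fix q A assume A: "A \<in> \<T>" "live ?C q A"
      have "des' q A \<in> A \<and> ?C (des' q A) = Some q"
      proof (cases "q = p \<and> A \<in> U")
        case True
        then show ?thesis using rB rC Ueq [of A] by (auto simp: des'_def)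
      next
        case F: False
        have "des q A \<in> A \<and> C (des q A) = Some q" using holder_okD(1,2) [OF ok A(1) lv [OF A(2)]] by blast
        then show ?thesis using notw [OF A F] F by (auto simp: des'_def)
      qed
      then show "des' q A \<in> A" "?C (des' q A) = Some q" by auto
    next
      fix q A D assume *: "A \<in> \<T>" "D \<in> \<T>" "D \<subseteq> A" "live ?C q A" "des' q A \<in> D"
      show "des' q D = des' q A"
      proof (cases "q = p \<and> A \<in> U")
        case True
        then have rD: "r \<in> D" using * by (simp add: des'_def)
        show ?thesis
        proof (cases "B \<subseteq> D")
          case T: True
          have "des p A = w" "live C p A" using True Ueq [of A] *(4) lv by auto
          then have "des p D = des p A" using holder_okD(3) [OF ok *(1) _ *(2,3)] B(2) T by blast
          then have "D \<in> U" using T * True Ueq [of A] Ueq [of D] by simp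
          then show ?thesis using True by (simp add: des'_def)
        next
          case F: False
          then have "D \<subset> B" using comparable [OF *(2) B(1) rD rB] by blast
          then have "des p D = r" "D \<notin> U" using rA [OF *(2) _ rD] F Ueq [of D] by blast+
          then show ?thesis using True by (simp add: des'_def)
        qed
      next
        case F: False
        have d: "des q A \<in> D" using F * by (simp add: des'_def if_not_P)
        then have e: "des q D = des q A" using holder_okD(3) [OF ok *(1) lv [OF *(4)] *(2,3)] by blast
        have "\<not> (q = p \<and> D \<in> U)"
        proof
          assume D: "q = p \<and> D \<in> U"
          then have "des p A = w" "B \<subseteq> A" using e Ueq [of D] *(3) by auto
          then have "A \<in> U" using Ueq [of A] *(1) by simp
          then show False using F D by simp
        qed
        then show ?thesis using F e by (auto simp: des'_def)
      qed
    qed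
    have hr: "held ?C des' r = held C des r \<union> U"
    proof (intro set_eqI iffI)
      fix A assume "A \<in> held ?C des' r"
      then show "A \<in> held C des r \<union> U" using rw Cr by (auto simp: held_def des'_def split: if_splits)
    next
      fix A assume A: "A \<in> held C des r \<union> U"
      then show "A \<in> held ?C des' r"
      proof
        assume "A \<in> U"
        then show ?thesis using Ueq [of A] rB rw Cr by (auto simp: held_def des'_def)
      next
        assume h: "A \<in> held C des r"
        then have "A \<notin> U" using up [of A] Ueq [of A] Cr by (auto simp: held_def)
        then show ?thesis using h rw by (simp add: held_def des'_def)
      qed
    qed
    have ho: "held ?C des' s = held C des s" if s: "s \<noteq> r" "s \<noteq> w" for s
    proof -
      have "des' q A = s \<longleftrightarrow> des q A = s" for q A
        using s Ueq [of A] by (auto simp: des'_def)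
      then show ?thesis using s(2) by (simp add: held_def)
    qed
    have hB: "A \<subseteq> B" if "A \<in> held C des r" for A
    proof -
      have A: "A \<in> \<T>" "r \<in> A" "des p A = r" using that Cr by (auto simp: held_def)
      then have "\<not> B \<subseteq> A" using up by blast
      then show ?thesis using comparable [OF A(1) B(1) A(2) rB] by blast
    qed
    \<comment> \<open>The old sets of \<open>r\<close> all lie inside \<open>B\<close>, so the
      largest set it serves from now on is the one that gave \<open>w\<close> its label.\<close>
    have topU: "\<Union>(held C des r \<union> U) = \<Union>(held C des w)"
    proof -
      have "held C des w \<noteq> {}" using BU by (auto simp: U_def)
      then have "\<Union>(held C des w) \<in> held C des w" by (rule held_top)
      moreover have "B \<subseteq> \<Union>(held C des w)" using BU by (auto simp: U_def)
      ultimately have "\<Union>(held C des w) \<in> U"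
        using Ueq [of "\<Union>(held C des w)"] hwp [of "\<Union>(held C des w)"] by blast
      moreover have "A \<subseteq> \<Union>(held C des w)" if "A \<in> held C des r \<union> U" for A
        using that hB [of A] \<open>B \<subseteq> \<Union>(held C des w)\<close> by (auto simp: U_def)
      ultimately show ?thesis by blast
    qed
    have lr: "label (cur (the (?C r))) (held ?C des' r) = label (cur (the (C w))) (held C des w)"
    proof -
      have "held C des w \<noteq> {}" "held C des r \<union> U \<noteq> {}" using BU by (auto simp: U_def)
      then show ?thesis unfolding label_def hr topU rC w(2) by (simp only: if_False)
    qed
    have "labels ?C des' cur \<subseteq> labels C des cur"
    proof
      fix i assume "i \<in> labels ?C des' cur"
      then obtain s where s: "s \<in> R" "label (cur (the (?C s))) (held ?C des' s) = Some i" by (auto simp: labels_def)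
      consider "s = w" | "s = r" | "s \<noteq> r" "s \<noteq> w" by blast
      then show "i \<in> labels C des cur"
      proof cases
        case 1
        with s hw' show ?thesis by (simp add: label_def)
      next
        case 2
        with s lr w(1) show ?thesis by (auto simp: labels_def)
      next
        case 3
        with s ho show ?thesis by (auto simp: labels_def)
      qed
    qed
    moreover have "account ?C des' cur \<le> account C des cur"
    proof -
      let ?rk = "\<lambda>s. int (rank (cur (the (C s))) (held C des s))"
      let ?rk' = "\<lambda>s. int (rank (cur (the (?C s))) (held ?C des' s))"
      \<comment> \<open>Each rank leaves one value free. The union has one free value instead of
        two, hence the extra unit.\<close>
      have "rank (cur p) (held C des r \<union> U) \<le> rank (cur p) (held C des r) + rank (cur p) (held C des w) + 1"
      proof -
        have fin: "finite (held C des r)" "finite (held C des w)" "finite U"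
          using finite_held finite_T UT finite_subset by blast+
        have "card {A \<in> held C des r \<union> U. cur p A = None} \<le>
            card ({A \<in> held C des r. cur p A = None} \<union> {A \<in> held C des w. cur p A = None})"
          using fin by (intro card_mono) (auto simp: U_def)
        also have "\<dots> \<le> card {A \<in> held C des r. cur p A = None} + card {A \<in> held C des w. cur p A = None}"
          by (rule card_Un_le)
        finally have 1: "card {A \<in> held C des r \<union> U. cur p A = None} \<le> \<dots>" .
        have "card {i. \<exists>A\<in>held C des r \<union> U. cur p A = Some i} \<le>
            card ({i. \<exists>A\<in>held C des r. cur p A = Some i} \<union> {i. \<exists>A\<in>held C des w. cur p A = Some i})"
          by (intro card_mono finite_UnI finite_vals fin) (auto simp: U_def)
        also have "\<dots> \<le> card {i. \<exists>A\<in>held C des r. cur p A = Some i} + card {i. \<exists>A\<in>held C des w. cur p A = Some i}"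
          by (rule card_Un_le)
        finally have 2: "card {i. \<exists>A\<in>held C des r \<union> U. cur p A = Some i} \<le> \<dots>" .
        from 1 2 show ?thesis unfolding rank_def by linarith
      qed
      then have a: "?rk' r \<le> ?rk r + ?rk w + 1" using hr Cr w rC by simp
      have split: "sum f R = f r + f w + sum f (R - {r, w})" for f :: "'s \<Rightarrow> int"
      proof -
        have "sum f R = f r + sum f (R - {r})" by (rule sum.remove [OF finite_R rR])
        also have "sum f (R - {r}) = f w + sum f (R - {r} - {w})"
          by (rule sum.remove) (use finite_R w(1) rw in auto)
        also have "R - {r} - {w} = R - {r, w}" by blast
        finally show ?thesis by simp
      qed
      have "sum ?rk' R = ?rk' r + ?rk' w + sum ?rk' (R - {r, w})" by (rule split)
      also have "sum ?rk' (R - {r, w}) = sum ?rk (R - {r, w})" using ho by (intro sum.cong) auto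
      also have "?rk' w = 0" by (simp add: hw' rank_def)
      finally have "sum ?rk' R \<le> ?rk r + ?rk w + 1 + sum ?rk (R - {r, w})" using a by linarith
      moreover have "sum ?rk R = ?rk r + ?rk w + sum ?rk (R - {r, w})" by (rule split)
      \<comment> \<open>\<open>B\<close> is such a set: in it the evicted copy was
        redundant.\<close>
      moreover have "1 \<le> card {A \<in> \<T>. w \<in> A \<and> live ?C p A}"
        using B finite_T by (auto simp: Suc_le_eq card_gt_0_iff)
      ultimately show ?thesis unfolding account_def surp by linarith
    qed
    ultimately show ?thesis using that ok' by blast
  qed
qed

end

section \<open>Charging the fresh requests in one set to the retrievals of a solution\<close>

context laminar_tree
begin

text \<open>\<open>B\<close> is the total charge collected so far. It covers what the derived paging
  solution has paid, \<open>n\<close>, and the reserve.\<close>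

definition charged :: "('s \<Rightarrow> 'p option) \<Rightarrow> ('p \<Rightarrow> 's set \<Rightarrow> 'i option) \<Rightarrow>
    'i list \<times> ('x, 'i) pool list \<Rightarrow> nat \<Rightarrow> nat \<Rightarrow> bool" where
  "charged C cur st F B \<longleftrightarrow> (\<exists>des n. holder_ok C des \<and> int n + account C des cur \<le> int B \<and>
     offset_inv (card R) F n st (labels C des cur))"

lemma charged_le: "charged C cur st F B \<Longrightarrow> F \<le> B"
proof -
  assume "charged C cur st F B"
  then obtain des n where "int n + account C des cur \<le> int B" "F \<le> n"
    unfolding charged_def offset_inv_def by force
  with account_nonneg [of C des cur] show ?thesis by linarith
qed

lemma charged_init: "charged (\<lambda>_. None) cur ([], []) 0 0"
proof -
  have h: "held (\<lambda>_. None) des r = {}" for des r by (simp add: held_def)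
  have "labels (\<lambda>_. None) des cur = {}" for des by (simp add: labels_def h label_def)
  moreover have "account (\<lambda>_. None) des cur = 0" for des
    by (simp add: account_def h rank_def surplus_def live_def)
  moreover have "holder_ok (\<lambda>_. None) des" for des by (simp add: holder_ok_def live_def)
  ultimately show ?thesis unfolding charged_def by (intro exI [of _ undefined] exI [of _ 0]) (simp add: offset_inv_def)
qed

lemma charged_evict:
  assumes "charged C cur st F B" "cur_ok cur" "w \<in> R"
  shows "charged (C(w := None)) cur st F B"
proof (cases "C w")
  case None
  with assms show ?thesis by (simp add: fun_upd_idem)
next
  case (Some p)
  from assms obtain des n where *: "holder_ok C des" "int n + account C des cur \<le> int B"
    "offset_inv (card R) F n st (labels C des cur)" by (auto simp: charged_def)
  obtain des' where d: "holder_ok (C(w := None)) des'"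
    "labels (C(w := None)) des' cur \<subseteq> labels C des cur"
    "account (C(w := None)) des' cur \<le> account C des cur"
    by (rule evict_step [where cur = cur, OF *(1) assms(2,3) Some])
  have "offset_inv (card R) F (n + card (labels (C(w := None)) des' cur - labels C des cur)) st
      (labels (C(w := None)) des' cur)"
    by (rule offset_inv_change [OF *(3) finite_labels card_labels])
  moreover have "labels (C(w := None)) des' cur - labels C des cur = {}" using d(2) by blast
  ultimately show ?thesis unfolding charged_def using d *(2)
    by (intro exI [of _ des'] exI [of _ n]) auto
qed

lemma charged_load:
  assumes "charged C cur st F B" "cur_ok cur" "w \<in> R" "C w = None"
  shows "charged (C(w := Some p)) cur st F (B + card {A \<in> \<T>. w \<in> A})"
proof -
  from assms obtain des n where *: "holder_ok C des" "int n + account C des cur \<le> int B"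
    "offset_inv (card R) F n st (labels C des cur)" by (auto simp: charged_def)
  obtain des' where d: "holder_ok (C(w := Some p)) des'"
    "int (card (labels (C(w := Some p)) des' cur - labels C des cur)) + account (C(w := Some p)) des' cur
       \<le> account C des cur + int (card {A \<in> \<T>. w \<in> A})"
    by (rule load_step [where cur = cur and p = p, OF *(1) assms(2-4)])
  have "offset_inv (card R) F (n + card (labels (C(w := Some p)) des' cur - labels C des cur)) st
      (labels (C(w := Some p)) des' cur)"
    by (rule offset_inv_change [OF *(3) finite_labels card_labels])
  then show ?thesis unfolding charged_def using d *(2)
    by (intro exI [of _ des'] exI [of _ "n + card (labels (C(w := Some p)) des' cur - labels C des cur)"]) auto
qed

text \<open>The slots are changed one at a time, each first emptied, which is free, and then
  loaded.\<close>

lemma charged_change: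
  assumes "charged C cur st F B" "cur_ok cur"
  shows "charged (override_on C C' R) cur st F
    (B + (\<Sum>w\<in>R. if C' w \<noteq> None \<and> C' w \<noteq> C w then card {A \<in> \<T>. w \<in> A} else 0))"
proof -
  have "charged (override_on C C' X) cur st F
    (B + (\<Sum>w\<in>X. if C' w \<noteq> None \<and> C' w \<noteq> C w then card {A \<in> \<T>. w \<in> A} else 0))" if "finite X" "X \<subseteq> R" for X
    using that
  proof (induction X rule: finite_induct)
    case empty
    then show ?case using assms(1) by simp
  next
    case (insert w X)
    let ?C = "override_on C C' X"
    let ?B = "B + (\<Sum>w\<in>X. if C' w \<noteq> None \<and> C' w \<noteq> C w then card {A \<in> \<T>. w \<in> A} else 0)"
    have w: "w \<in> R" using insert by auto
    have IH: "charged ?C cur st F ?B" using insert by auto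
    have Cw: "?C w = C w" using insert by simp
    have eq: "override_on C C' (insert w X) = ?C(w := C' w)" by (rule override_on_insert)
    show ?case
    proof (cases "C' w = C w")
      case True
      then have "?C(w := C' w) = ?C" using Cw by (intro fun_upd_idem) simp
      then show ?thesis unfolding eq using IH insert True by simp
    next
      case False
      have e: "charged (?C(w := None)) cur st F ?B" by (rule charged_evict [OF IH assms(2) w])
      show ?thesis
      proof (cases "C' w")
        case None
        then show ?thesis unfolding eq using e insert by (simp add: fun_upd_def)
      next
        case (Some p)
        have "charged ((?C(w := None))(w := Some p)) cur st F (?B + card {A \<in> \<T>. w \<in> A})"
          by (rule charged_load [OF e assms(2) w]) simp
        then have "charged (?C(w := C' w)) cur st F (?B + card {A \<in> \<T>. w \<in> A})"
          unfolding Some by (simp only: fun_upd_upd)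
        moreover have "B + (\<Sum>w\<in>insert w X. if C' w \<noteq> None \<and> C' w \<noteq> C w then card {A \<in> \<T>. w \<in> A} else 0) =
            ?B + card {A \<in> \<T>. w \<in> A}"
          using Some False insert by simp
        ultimately show ?thesis unfolding eq by (simp only:)
      qed
    qed
  qed
  from this [of R] show ?thesis using finite_R by simp
qed

lemma charged_request:
  assumes "charged C cur st F B" "cur_ok cur" "S \<in> \<T>" "live C q S" "engine_inv (card R) st"
    "cur q S = Some \<theta> \<or> cur q S = None"
    "\<And>p A. cur' p A = (if p = q \<and> S \<subseteq> A then Some \<theta> else cur p A)"
  shows "charged C cur' (engine_step (card R) a \<theta> st) (F + fresh \<theta> st) B"
proof -
  from assms obtain des n where *: "holder_ok C des" "int n + account C des cur \<le> int B"
    "offset_inv (card R) F n st (labels C des cur)" by (auto simp: charged_def)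
  obtain des' where d: "holder_ok C des'" "\<theta> \<in> labels C des' cur'"
    "int (card (labels C des' cur' - labels C des cur)) + account C des' cur' \<le> account C des cur"
    by (rule request_step [OF *(1) assms(2-4,6,7)])
  have R0: "0 < card R" using assms(3,4) sub_R [OF assms(3)] finite_R
    unfolding live_def by (auto simp: card_gt_0_iff)
  have "offset_inv (card R) F (n + card (labels C des' cur' - labels C des cur)) st (labels C des' cur')"
    by (rule offset_inv_change [OF *(3) finite_labels card_labels])
  from offset_inv_step [OF this assms(5) d(2) R0]
  show ?thesis unfolding charged_def using d(1,3) *(2)
    by (intro exI [of _ des'] exI [of _ "n + card (labels C des' cur' - labels C des cur)"]) auto
qed

end

section \<open>Rounding to slots\<close>

type_synonym item = "nat \<times> nat list"
type_synonym 'x node = "nat list \<times> (item list \<times> ('x, item) pool list) \<times> (nat \<times> item) list"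
type_synonym 'x chooser = "'x \<Rightarrow> item list \<Rightarrow> item list \<Rightarrow> item"

definition swap_cells :: "nat \<Rightarrow> nat \<Rightarrow> (nat \<times> item) list \<Rightarrow> (nat \<times> item) list" where
  "swap_cells u v c = map (\<lambda>x. (if fst x = u then v else if fst x = v then u else fst x, snd x)) c"

definition slots_of :: "item \<Rightarrow> (nat \<times> item) list \<Rightarrow> nat list" where
  "slots_of i c = map fst (filter (\<lambda>x. snd x = i) c)"

definition target :: "item \<Rightarrow> nat list \<Rightarrow> nat list \<Rightarrow> (nat \<times> item) list \<Rightarrow> nat" where
  "target i R u c = hd (slots_of i c @ filter (\<lambda>s. s \<notin> set (map fst c)) (u @ R))"

definition put :: "nat \<Rightarrow> item \<Rightarrow> (nat \<times> item) list \<Rightarrow> (nat \<times> item) list" where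
  "put w i c = (w, i) # filter (\<lambda>x. fst x \<noteq> w) c"

text \<open>
  The sets containing \<open>S\<close> are visited upwards and all receive item \<open>i\<close> in the same slot \<open>w\<close>. The
  exchanges of \<open>w\<close> with the slots \<open>vs\<close> made in smaller sets are repeated in the larger ones, so that
  adjacent sets remain aligned. Before \<open>S\<close> is reached, \<open>u\<close> remembers the slot of \<open>i\<close> in the largest proper
  subset of \<open>S\<close> that may contain \<open>i\<close>; as a list it is empty if there is no such slot.
\<close>

definition place_step :: "(nat list \<Rightarrow> 'x chooser) \<Rightarrow> nat list \<times> item \<times> 'x \<Rightarrow>
    nat list \<times> nat list \<times> 'x node list \<Rightarrow> 'x node \<Rightarrow> nat list \<times> nat list \<times> 'x node list" where
  "place_step ch r z n = (case (r, z, n) of ((S, i, a), (u, vs, ns), (R, e, c)) \<Rightarrow>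
     if set S \<subseteq> set R then
       (let e' = engine_step (length R) a i e;
            c1 = foldl (\<lambda>d v. swap_cells (hd u) v d) (filter (\<lambda>x. snd x \<in> set (cache (ch R) e')) c) vs;
            v = target i R u c1;
            w = hd (u @ [v])
        in ([w], vs @ [v], ns @ [(R, e', put w i (swap_cells w v c1))]))
     else (if set (snd i) \<subseteq> set R \<and> set R \<subseteq> set S then slots_of i c else u, vs, ns @ [(R, e, c)]))"

definition serve :: "(nat list \<Rightarrow> 'x chooser) \<Rightarrow> 'x node list \<Rightarrow> nat list \<times> item \<times> 'x \<Rightarrow> 'x node list" where
  "serve ch ns r = snd (snd (foldl (place_step ch r) ([], [], []) ns))"

text \<open>Smaller sets come first in the list, so the last set containing a slot is the maximal
  one. A list of length at most one stands for an option.\<close>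

definition shown :: "'x node list \<Rightarrow> nat \<Rightarrow> nat list" where
  "shown ns s = foldl (\<lambda>r n. if s \<in> set (fst n)
     then map (\<lambda>x. fst (snd x)) (filter (\<lambda>x. fst x = s) (snd (snd n))) else r) [] ns"

definition config_of :: "'x node list \<Rightarrow> config" where
  "config_of ns s = (if shown ns s = [] then None else Some (hd (shown ns s)))"

text \<open>The exchanges read backwards: a slot is sent to the slot from which its present content
  came.\<close>

fun perm_of :: "nat \<Rightarrow> nat list \<Rightarrow> nat \<Rightarrow> nat" where
  "perm_of u [] s = s"
| "perm_of u (v # vs) s = (let t = perm_of u vs s in if t = u then v else if t = v then u else t)"

lemma perm_of_snoc:
  "perm_of u (vs @ [v]) s = perm_of u vs (if s = u then v else if s = v then u else s)"
  by (induction vs) (simp_all add: Let_def)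

lemma perm_of_inj: "perm_of u vs s = perm_of u vs t \<longleftrightarrow> s = t"
  by (induction vs) (auto simp: Let_def split: if_splits)

lemma perm_of_outside: "s \<noteq> u \<Longrightarrow> s \<notin> set vs \<Longrightarrow> perm_of u vs s = s"
  by (induction vs) (auto simp: Let_def)

lemma perm_of_inside: "s \<in> A \<Longrightarrow> u \<in> A \<Longrightarrow> set vs \<subseteq> A \<Longrightarrow> perm_of u vs s \<in> A"
  by (induction vs) (auto simp: Let_def)

lemma perm_of_moved: "s \<noteq> u \<Longrightarrow> perm_of u vs s \<noteq> s \<Longrightarrow> s \<in> set (filter (\<lambda>v. v \<noteq> u) vs)"
  using perm_of_outside [of s u vs] by auto

lemma perm_of_trivial: "filter (\<lambda>v. v \<noteq> u) vs = [] \<Longrightarrow> perm_of u vs s = s"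
  by (induction vs) (auto simp: Let_def split: if_splits)

lemma swap_cells_mem:
  "(s, j) \<in> set (swap_cells u v c) \<longleftrightarrow> ((if s = u then v else if s = v then u else s), j) \<in> set c"
  unfolding swap_cells_def by (force split: if_splits)

lemma swap_cells_ok:
  assumes "distinct (map fst c)" "distinct (map snd c)" "fst ` set c \<subseteq> A" "u \<in> A" "v \<in> A"
  shows "distinct (map fst (swap_cells u v c))" "distinct (map snd (swap_cells u v c))"
    "fst ` set (swap_cells u v c) \<subseteq> A" "snd ` set (swap_cells u v c) = snd ` set c"
    "length (swap_cells u v c) = length c"
proof -
  let ?t = "\<lambda>s. if s = u then v else if s = v then u else s"
  have "inj ?t" by (auto simp: inj_def split: if_splits)
  then have "distinct (map ?t (map fst c))" using assms(1) by (subst distinct_map) (auto intro: inj_on_subset)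
  then show "distinct (map fst (swap_cells u v c))" by (simp add: swap_cells_def comp_def)
  show "distinct (map snd (swap_cells u v c))" using assms(2) by (simp add: swap_cells_def comp_def)
  show "fst ` set (swap_cells u v c) \<subseteq> A" using assms(3-5) by (auto simp: swap_cells_def)
  show "snd ` set (swap_cells u v c) = snd ` set c" by (auto simp: swap_cells_def image_image)
  show "length (swap_cells u v c) = length c" by (simp add: swap_cells_def)
qed

lemma fold_swap_mem:
  "(s, j) \<in> set (foldl (\<lambda>d v. swap_cells u v d) c vs) \<longleftrightarrow> (perm_of u vs s, j) \<in> set c"
proof (induction vs arbitrary: s rule: rev_induct)
  case (snoc v vs)
  show ?case
    by (simp only: foldl_append foldl.simps swap_cells_mem snoc perm_of_snoc)
qed simp

lemma fold_swap_ok: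
  assumes "distinct (map fst c)" "distinct (map snd c)" "fst ` set c \<subseteq> A" "u \<in> A" "set vs \<subseteq> A"
  shows "let d = foldl (\<lambda>d v. swap_cells u v d) c vs in distinct (map fst d) \<and> distinct (map snd d) \<and>
    fst ` set d \<subseteq> A \<and> snd ` set d = snd ` set c \<and> length d = length c"
  using assms
proof (induction vs arbitrary: c)
  case (Cons v vs)
  note s = swap_cells_ok [OF Cons.prems(1-4), of v]
  have "v \<in> A" "set vs \<subseteq> A" using Cons.prems by auto
  from Cons.IH [OF s(1-3) Cons.prems(4)] this s(4,5) show ?case by (simp add: Let_def)
qed simp

lemma slots_of_mem: "s \<in> set (slots_of i c) \<longleftrightarrow> (s, i) \<in> set c"
  by (force simp: slots_of_def)

lemma slots_of_unique:
  assumes "distinct (map snd c)" "(s, i) \<in> set c"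
  shows "slots_of i c = [s]"
  using assms
proof (induction c)
  case (Cons x c)
  show ?case
  proof (cases "snd x = i")
    case True
    then have "filter (\<lambda>x. snd x = i) c = []" using Cons.prems(1) by (auto simp: filter_empty_conv image_iff)
    moreover have "fst x = s" using Cons.prems True by (cases x) (auto simp: image_iff)
    ultimately show ?thesis using True by (simp add: slots_of_def)
  next
    case False
    with Cons show ?thesis by (auto simp: slots_of_def)
  qed
qed simp

lemma distinct_fstD: "distinct (map fst c) \<Longrightarrow> (s, i) \<in> set c \<Longrightarrow> (s, j) \<in> set c \<Longrightarrow> i = j"
  by (meson eq_key_imp_eq_value)

lemma distinct_sndD: "distinct (map snd c) \<Longrightarrow> (s, i) \<in> set c \<Longrightarrow> (t, i) \<in> set c \<Longrightarrow> s = t"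
  unfolding distinct_map by (metis inj_onD prod.inject snd_conv)

text \<open>One set of the upward sweep: the exchanges \<open>vs\<close> are repeated, then
  \<open>i\<close> is located or given a free slot \<open>v\<close>, and the exchange of
  \<open>v\<close> with \<open>w\<close> brings it to \<open>w\<close> while the content of
  \<open>w\<close> escapes to \<open>v\<close>. Thus nothing but \<open>i\<close> is added and
  nothing is lost. The last two facts trace an item that was cached before; if \<open>vs\<close>
  already bring it to \<open>w\<close>, the new exchange is void.\<close>

lemma target_put:
  assumes b: "distinct (map fst b)" "distinct (map snd b)" "fst ` set b \<subseteq> set R"
    and R: "distinct R" and room: "i \<in> snd ` set b \<or> length b < length R"
    and u: "u = [] \<and> vs = [] \<or> (\<exists>u0\<in>set R. u = [u0])" and vs: "set vs \<subseteq> set R"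
    and c1: "c1 = foldl (\<lambda>d v. swap_cells (hd u) v d) b vs"
    and v: "v = target i R u c1" and w: "w = hd (u @ [v])" and c': "c' = put w i (swap_cells w v c1)"
  shows "v \<in> set R" "w \<in> set R" "distinct (map fst c')" "distinct (map snd c')" "fst ` set c' \<subseteq> set R"
    "snd ` set c' = insert i (snd ` set b)"
    "\<And>s j. (s, j) \<in> set c' \<longleftrightarrow> (if s = w then j = i else (perm_of w (vs @ [v]) s, j) \<in> set b)"
    "\<And>y. (y, i) \<in> set b \<Longrightarrow> perm_of w (vs @ [v]) w = y"
    "\<And>y. (y, i) \<in> set b \<Longrightarrow> u \<noteq> [] \<Longrightarrow> perm_of w vs w = y \<Longrightarrow> v = w"
proof -
  have w0: "u = [] \<and> vs = [] \<or> u = [w]" using u w by auto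
  have c1w: "c1 = foldl (\<lambda>d v. swap_cells w v d) b vs" using w0 c1 by auto
  have c1: "distinct (map fst c1) \<and> distinct (map snd c1) \<and> fst ` set c1 \<subseteq> set R \<and>
      snd ` set c1 = snd ` set b \<and> length c1 = length b"
  proof (cases "u = []")
    case True
    then have "c1 = b" using u c1 by auto
    then show ?thesis using b by simp
  next
    case False
    then have "w \<in> set R" using u w by auto
    with fold_swap_ok [OF b, of w vs] vs show ?thesis unfolding c1w by (simp add: Let_def)
  qed
  have m1: "(s, j) \<in> set c1 \<longleftrightarrow> (perm_of w vs s, j) \<in> set b" for s j
    unfolding c1w by (rule fold_swap_mem)
  have v1: "v \<in> set R \<and> ((v, i) \<in> set c1 \<or> i \<notin> snd ` set c1 \<and> v \<notin> fst ` set c1) \<and>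
      (i \<in> snd ` set c1 \<longrightarrow> (v, i) \<in> set c1)"
  proof (cases "i \<in> snd ` set c1")
    case True
    then obtain y where y: "(y, i) \<in> set c1" by force
    then have "slots_of i c1 = [y]" using c1 slots_of_unique by blast
    then have "v = y" using v by (simp add: target_def)
    moreover have "y \<in> fst ` set c1" using y by (metis image_eqI fst_conv)
    ultimately show ?thesis using y c1 by blast
  next
    case False
    then have "slots_of i c1 = []" by (force simp: slots_of_def filter_empty_conv)
    then have v': "v = hd (filter (\<lambda>s. s \<notin> set (map fst c1)) (u @ R))" using v by (simp add: target_def)
    have "length c1 < length R" using room False c1 by auto
    then have "card (fst ` set c1) < card (set R)"
      using c1 R by (metis distinct_card length_map list.set_map)
    then obtain y where "y \<in> set R" "y \<notin> fst ` set c1"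
      by (metis List.finite_set card_mono finite_imageI leD subsetI)
    then have "filter (\<lambda>s. s \<notin> set (map fst c1)) (u @ R) \<noteq> []" by (auto simp: filter_empty_conv)
    from hd_in_set [OF this] have "v \<in> set (u @ R)" "v \<notin> set (map fst c1)" using v' by auto
    then show ?thesis using False u by auto
  qed
  show vR: "v \<in> set R" using v1 by blast
  show wR: "w \<in> set R" using u w vR by auto
  note s = swap_cells_ok [of c1 "set R" w v]
  have c1': "distinct (map fst c1)" "distinct (map snd c1)" "fst ` set c1 \<subseteq> set R" using c1 by auto
  note s = s [OF c1' wR vR]
  let ?d = "swap_cells w v c1"
  have md: "(s, j) \<in> set ?d \<longleftrightarrow> (perm_of w (vs @ [v]) s, j) \<in> set b" for s j
    by (simp only: swap_cells_mem m1 perm_of_snoc)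
  have dw: "(w, j) \<in> set ?d \<Longrightarrow> j = i" for j
  proof -
    assume "(w, j) \<in> set ?d"
    then have "(v, j) \<in> set c1" by (simp add: swap_cells_mem)
    moreover from this have "v \<in> fst ` set c1" by force
    ultimately show "j = i" using v1 distinct_fstD [OF c1'(1), of v j i] by blast
  qed
  have di: "(s, i) \<in> set ?d \<Longrightarrow> s = w" for s
  proof -
    assume a: "(s, i) \<in> set ?d"
    then have "i \<in> snd ` set ?d" by (metis image_eqI snd_conv)
    then have "i \<in> snd ` set c1" using s(4) by simp
    then have "(w, i) \<in> set ?d" using v1 by (simp add: swap_cells_mem)
    with distinct_sndD [OF s(2) a] show "s = w" by simp
  qed
  show mem: "(s, j) \<in> set c' \<longleftrightarrow> (if s = w then j = i else (perm_of w (vs @ [v]) s, j) \<in> set b)" for s j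
    unfolding c' put_def using md [of s j] by auto
  have di': "i \<notin> snd ` set (filter (\<lambda>x. fst x \<noteq> w) ?d)" 
  proof
    assume "i \<in> snd ` set (filter (\<lambda>x. fst x \<noteq> w) ?d)"
    then obtain t where "(t, i) \<in> set ?d" "t \<noteq> w" by force
    then show False using di by blast
  qed
  show "distinct (map fst c')" using s(1) unfolding c' put_def by (auto simp: distinct_map_filter)
  show "distinct (map snd c')" using s(2) di' unfolding c' put_def by (simp add: distinct_map_filter)
  show "fst ` set c' \<subseteq> set R" using s(3) wR unfolding c' put_def by auto
  have "snd ` set c' = insert i (snd ` set ?d)"
  proof
    show "snd ` set c' \<subseteq> insert i (snd ` set ?d)" unfolding c' put_def by auto
    show "insert i (snd ` set ?d) \<subseteq> snd ` set c'"
    proof (rule subsetI, elim insertE)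
      fix j assume "j = i" then show "j \<in> snd ` set c'" by (simp add: c' put_def)
    next
      fix j assume "j \<in> snd ` set ?d"
      then obtain s where sj: "(s, j) \<in> set ?d" by force
      show "j \<in> snd ` set c'"
      proof (cases "s = w")
        case True
        then have "j = i" using dw sj by blast
        then show ?thesis by (simp add: c' put_def)
      next
        case False
        then have "(s, j) \<in> set c'" using sj by (simp add: c' put_def)
        then show ?thesis by force
      qed
    qed
  qed
  then show "snd ` set c' = insert i (snd ` set b)" using s(4) c1 by simp
  fix y assume y: "(y, i) \<in> set b"
  then have "i \<in> snd ` set b" by (metis image_eqI snd_conv)
  then have "i \<in> snd ` set c1" using c1 by simp
  then have vi: "(v, i) \<in> set c1" using v1 by blast
  then have "(perm_of w vs v, i) \<in> set b" using m1 by blast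
  then have pv: "perm_of w vs v = y" using distinct_sndD [OF b(2) _ y] by simp
  then show "perm_of w (vs @ [v]) w = y" by (simp add: perm_of_snoc)
  assume "u \<noteq> []" "perm_of w vs w = y"
  then show "v = w" using pv perm_of_inj by metis
qed

lemma engine_step_support: "set (fst (engine_step K a x st)) \<subseteq> insert x (set (fst st))"
  by (auto simp: engine_step_def prune_def engine_move_def Let_def)

declare split_paired_All [simp del] split_paired_Ex [simp del]

section \<open>Nodes and their alignment\<close>

definition area :: "'x node \<Rightarrow> nat set" where "area n = set (fst n)"
definition engine :: "'x node \<Rightarrow> item list \<times> ('x, item) pool list" where "engine n = fst (snd n)"
definition cells :: "'x node \<Rightarrow> (nat \<times> item) list" where "cells n = snd (snd n)"

definition node_ok :: "(nat list \<Rightarrow> 'x chooser) \<Rightarrow> 'x node \<Rightarrow> bool" where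
  "node_ok ch n \<longleftrightarrow> distinct (fst n) \<and> fst n \<noteq> [] \<and> engine_inv (length (fst n)) (engine n) \<and>
     (\<forall>j\<in>set (fst (engine n)). set (snd j) \<subseteq> area n) \<and>
     distinct (map fst (cells n)) \<and> distinct (map snd (cells n)) \<and> fst ` set (cells n) \<subseteq> area n \<and>
     snd ` set (cells n) = set (cache (ch (fst n)) (engine n))"

definition adjacent :: "nat set set \<Rightarrow> nat set \<Rightarrow> nat set \<Rightarrow> bool" where
  "adjacent \<F> A B \<longleftrightarrow> A \<subset> B \<and> (\<forall>D\<in>\<F>. A \<subset> D \<longrightarrow> \<not> D \<subset> B)"

text \<open>Only neighbours in the laminar order have to agree. An item missing from an intermediate
  set may sit in different slots on the two sides.\<close>

definition coherent :: "nat set set \<Rightarrow> 'x node list \<Rightarrow> bool" where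
  "coherent \<F> ns \<longleftrightarrow> (\<forall>n\<in>set ns. \<forall>m\<in>set ns. adjacent \<F> (area n) (area m) \<longrightarrow>
     (\<forall>s t j. (s, j) \<in> set (cells n) \<longrightarrow> (t, j) \<in> set (cells m) \<longrightarrow> s = t))"

lemma coherentD:
  "coherent \<F> ns \<Longrightarrow> n \<in> set ns \<Longrightarrow> m \<in> set ns \<Longrightarrow> adjacent \<F> (area n) (area m) \<Longrightarrow>
     (s, j) \<in> set (cells n) \<Longrightarrow> (t, j) \<in> set (cells m) \<Longrightarrow> s = t"
  unfolding coherent_def by simp

lemma node_okD:
  assumes "node_ok ch n"
  shows "distinct (fst n)" "fst n \<noteq> []" "engine_inv (length (fst n)) (engine n)"
    "distinct (map fst (cells n))" "distinct (map snd (cells n))" "fst ` set (cells n) \<subseteq> area n"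
    "snd ` set (cells n) = set (cache (ch (fst n)) (engine n))"
    "\<And>j. j \<in> set (fst (engine n)) \<Longrightarrow> set (snd j) \<subseteq> area n"
  using assms unfolding node_ok_def by simp_all

lemma cells_area: "node_ok ch n \<Longrightarrow> (s, j) \<in> set (cells n) \<Longrightarrow> s \<in> area n"
  using node_okD(6) [of ch n] by (auto simp: image_subset_iff)

lemma cells_cache: "node_ok ch n \<Longrightarrow> (s, j) \<in> set (cells n) \<Longrightarrow> j \<in> set (cache (ch (fst n)) (engine n))"
  using node_okD(7) [of ch n] by (metis image_eqI snd_conv)

lemma cached_cell: "node_ok ch n \<Longrightarrow> j \<in> set (cache (ch (fst n)) (engine n)) \<Longrightarrow> \<exists>s. (s, j) \<in> set (cells n)"
  using node_okD(7) [of ch n] by (metis imageE prod.collapse)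

text \<open>Items are requested only in sets containing that of their opening request. So a set
  disjoint from a set containing the opening request never holds the item.\<close>

lemma cells_origin:
  assumes "choice_ok (ch (fst n))" "node_ok ch n" "(s, j) \<in> set (cells n)"
  shows "set (snd j) \<subseteq> area n"
  using length_cache(3) [OF assms(1) node_okD(3) [OF assms(2)]] cells_cache [OF assms(2,3)] node_okD(8) [OF assms(2)]
  by blast

locale rounding =
  fixes ch :: "nat list \<Rightarrow> 'x chooser" and S :: "nat list" and i :: item and a :: 'x and ns0 :: "'x node list"
  assumes choice: "\<And>R. choice_ok (ch R)"
    and nodes: "\<And>n. n \<in> set ns0 \<Longrightarrow> node_ok ch n"
    and lam: "\<And>n m x. n \<in> set ns0 \<Longrightarrow> m \<in> set ns0 \<Longrightarrow> x \<in> area n \<Longrightarrow> x \<in> area m \<Longrightarrow>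
      area n \<subseteq> area m \<or> area m \<subseteq> area n"
    and order: "sorted_wrt (\<lambda>m n. \<not> area n \<subseteq> area m) ns0"
    and coh: "coherent (area ` set ns0) ns0"
    and S_in: "\<exists>n\<in>set ns0. area n = set S"
    and org: "snd i \<noteq> []" "set (snd i) \<subseteq> set S"
begin

abbreviation "\<F> \<equiv> area ` set ns0"

abbreviation loss :: "'x node \<Rightarrow> nat" where
  "loss n \<equiv> (if set S \<subseteq> area n then miss (ch (fst n)) i (engine n) else 0)"

definition updated :: "'x node \<Rightarrow> 'x node \<Rightarrow> bool" where
  "updated n n' \<longleftrightarrow> fst n' = fst n \<and> (if set S \<subseteq> area n
     then engine n' = engine_step (length (fst n)) a i (engine n) else n' = n)"

text \<open>The state before \<open>S\<close> is reached. The sets between the opening request of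
  \<open>i\<close> and \<open>S\<close> form a chain, and only the largest can be a lower neighbour
  of \<open>S\<close> that holds \<open>i\<close>; its slot of \<open>i\<close> must be reused in
  \<open>S\<close>.\<close>

definition start_ok :: "'x node list \<Rightarrow> nat list \<Rightarrow> nat list \<Rightarrow> bool" where
  "start_ok pre u vs \<longleftrightarrow> vs = [] \<and>
     (u = [] \<and> (\<forall>n\<in>set pre. set (snd i) \<subseteq> area n \<longrightarrow> \<not> area n \<subseteq> set S) \<or>
      (\<exists>n\<in>set pre. set (snd i) \<subseteq> area n \<and> area n \<subseteq> set S \<and> u = slots_of i (cells n) \<and>
        (\<forall>m\<in>set pre. set (snd i) \<subseteq> area m \<longrightarrow> area m \<subseteq> set S \<longrightarrow> area m \<subseteq> area n)))"

text \<open>The state from \<open>S\<close> on, with \<open>n\<close> the largest superset of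
  \<open>S\<close> treated so far. Exchanges of \<open>w\<close> with itself are void and not
  counted. A loss pays for an exchange in its own set and for one in the next larger set;
  \<open>loss n\<close> in the last inequality is the credit for the latter.\<close>

definition chain_ok :: "'x node list \<Rightarrow> nat list \<Rightarrow> nat list \<Rightarrow> 'x node list \<Rightarrow> nat \<Rightarrow> 'x node \<Rightarrow> bool" where
  "chain_ok pre u vs ns w n \<longleftrightarrow> u = [w] \<and> w \<in> set S \<and> n \<in> set pre \<and> set S \<subseteq> area n \<and>
     (\<forall>m\<in>set pre. set S \<subseteq> area m \<longrightarrow> area m \<subseteq> area n) \<and> set vs \<subseteq> area n \<and>
     (\<forall>n'\<in>set ns. fst n' = fst n \<longrightarrow> (\<forall>s j. (s, j) \<in> set (cells n') \<longleftrightarrow>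
        (if s = w then j = i else (perm_of w vs s, j) \<in> set (cells n) \<and> j \<in> set (cache (ch (fst n)) (engine n'))))) \<and>
     (\<forall>y. (y, i) \<in> set (cells n) \<longrightarrow> perm_of w vs w = y) \<and>
     length (filter (\<lambda>v. v \<noteq> w) vs) + loss n \<le> 2 * sum_list (map loss pre)"

definition loop_inv :: "'x node list \<Rightarrow> nat list \<times> nat list \<times> 'x node list \<Rightarrow> bool" where
  "loop_inv pre z \<longleftrightarrow> (case z of (u, vs, ns) \<Rightarrow> list_all2 updated pre ns \<and> (\<forall>n\<in>set ns. node_ok ch n) \<and> coherent \<F> ns \<and>
     (if \<exists>n\<in>set pre. set S \<subseteq> area n then \<exists>w n. chain_ok pre u vs ns w n else start_ok pre u vs))"

lemma chain_okD:
  assumes "chain_ok pre u vs ns w n"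
  shows "u = [w]" "w \<in> set S" "n \<in> set pre" "set S \<subseteq> area n"
    "\<And>m. m \<in> set pre \<Longrightarrow> set S \<subseteq> area m \<Longrightarrow> area m \<subseteq> area n" "set vs \<subseteq> area n"
    "\<And>n' s j. n' \<in> set ns \<Longrightarrow> fst n' = fst n \<Longrightarrow> (s, j) \<in> set (cells n') \<longleftrightarrow>
        (if s = w then j = i else (perm_of w vs s, j) \<in> set (cells n) \<and> j \<in> set (cache (ch (fst n)) (engine n')))"
    "\<And>y. (y, i) \<in> set (cells n) \<Longrightarrow> perm_of w vs w = y"
    "length (filter (\<lambda>v. v \<noteq> w) vs) + loss n \<le> 2 * sum_list (map loss pre)"
  using assms [unfolded chain_ok_def] by (blast | metis)+

lemma S_ne: "set S \<noteq> {}" using org by auto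

lemma later:
  assumes "ns0 = pre @ n # post" "m \<in> set pre"
  shows "\<not> area n \<subseteq> area m"
  using order assms by (auto simp: sorted_wrt_append)

lemma earlier:
  assumes "ns0 = pre @ n # post" "m \<in> set ns0" "area m \<subset> area n"
  shows "m \<in> set pre"
  using order assms by (auto simp: sorted_wrt_append)

lemma area_inj: "m \<in> set ns0 \<Longrightarrow> n \<in> set ns0 \<Longrightarrow> area m = area n \<Longrightarrow> m = n"
  using order
proof (induction ns0)
  case (Cons k ns)
  then show ?case by auto
qed simp

lemma updated_in:
  assumes "list_all2 updated pre ns" "n' \<in> set ns"
  obtains n where "n \<in> set pre" "updated n n'"
  using assms by (metis in_set_conv_nth list_all2_conv_all_nth)

lemma coherent_snoc:
  assumes "coherent \<F> ns" "\<And>m. m \<in> set ns \<Longrightarrow> \<not> area n \<subset> area m"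
    "\<And>m s t j. m \<in> set ns \<Longrightarrow> adjacent \<F> (area m) (area n) \<Longrightarrow> (s, j) \<in> set (cells m) \<Longrightarrow>
       (t, j) \<in> set (cells n) \<Longrightarrow> s = t"
  shows "coherent \<F> (ns @ [n])"
  unfolding coherent_def
proof (intro ballI impI allI)
  fix k m s t j
  assume h: "k \<in> set (ns @ [n])" "m \<in> set (ns @ [n])" "adjacent \<F> (area k) (area m)"
    "(s, j) \<in> set (cells k)" "(t, j) \<in> set (cells m)"
  have lt: "area k \<subset> area m" using h(3) by (simp add: adjacent_def)
  consider "k \<in> set ns" "m \<in> set ns" | "k \<in> set ns" "m = n" | "k = n" using h(1,2) by auto
  then show "s = t"
  proof cases
    case 1
    then show ?thesis using coherentD [OF assms(1) 1 h(3-5)] by simp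
  next
    case 2
    then show ?thesis using assms(3) [OF 2(1)] h by blast
  next
    case 3
    then show ?thesis using assms(2) lt h(2) by (metis Un_iff empty_iff insert_iff less_irrefl list.set(1,2) set_append)
  qed
qed

text \<open>A set that does not contain \<open>S\<close> stays as it is; it matters only as a
  possible source of the slot \<open>u\<close>.\<close>

lemma loop_inv_skip:
  assumes inv: "loop_inv pre (u, vs, ns)" and split: "ns0 = pre @ n # post" and out: "\<not> set S \<subseteq> area n"
  shows "loop_inv (pre @ [n]) (place_step ch (S, i, a) (u, vs, ns) n)"
proof -
  define u' where "u' = (if set (snd i) \<subseteq> area n \<and> area n \<subseteq> set S then slots_of i (cells n) else u)"
  have z: "place_step ch (S, i, a) (u, vs, ns) n = (u', vs, ns @ [n])"
    using out by (cases n) (simp add: place_step_def u'_def area_def cells_def)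
  have n0: "n \<in> set ns0" and pre0: "set pre \<subseteq> set ns0" using split by auto
  have l2: "list_all2 updated pre ns" and ok: "\<forall>n\<in>set ns. node_ok ch n" and co: "coherent \<F> ns"
    using inv by (simp_all add: loop_inv_def)
  have 1: "list_all2 updated (pre @ [n]) (ns @ [n])"
    using l2 out by (auto intro!: list_all2_appendI simp: updated_def)
  have 2: "\<forall>k\<in>set (ns @ [n]). node_ok ch k" using ok nodes [OF n0] by auto
  have 3: "coherent \<F> (ns @ [n])"
  proof (rule coherent_snoc [OF co])
    fix m' assume m': "m' \<in> set ns"
    obtain m where m: "m \<in> set pre" "updated m m'" by (rule updated_in [OF l2 m'])
    have am: "area m' = area m" using m(2) by (simp add: updated_def area_def)
    show "\<not> area n \<subset> area m'" using later [OF split m(1)] am by auto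
    fix s t j assume h: "adjacent \<F> (area m') (area n)" "(s, j) \<in> set (cells m')" "(t, j) \<in> set (cells n)"
    have "area m \<subseteq> area n" using h(1) am by (auto simp: adjacent_def)
    then have "\<not> set S \<subseteq> area m" using out by auto
    then have e: "m' = m" using m(2) by (simp add: updated_def)
    have "m \<in> set ns0" using m(1) pre0 by auto
    from coherentD [OF coh this n0, of s j t] h e show "s = t" by simp
  qed
  have 4: "if \<exists>k\<in>set (pre @ [n]). set S \<subseteq> area k then \<exists>w k. chain_ok (pre @ [n]) u' vs (ns @ [n]) w k
      else start_ok (pre @ [n]) u' vs"
  proof (cases "\<exists>k\<in>set pre. set S \<subseteq> area k")
    case True
    then obtain w k where c: "chain_ok pre u vs ns w k" using inv by (auto simp: loop_inv_def)
    note D = chain_okD [OF c]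
    have "\<not> area n \<subseteq> set S" using later [OF split D(3)] D(4) by auto
    then have u': "u' = u" by (simp add: u'_def)
    have "fst n \<noteq> fst k" using later [OF split D(3)] by (auto simp: area_def)
    then have "chain_ok (pre @ [n]) u' vs (ns @ [n]) w k"
      using c out unfolding chain_ok_def u' by auto
    then have "\<exists>w k. chain_ok (pre @ [n]) u' vs (ns @ [n]) w k" by blast
    moreover have "\<exists>k\<in>set (pre @ [n]). set S \<subseteq> area k" using True by auto
    ultimately show ?thesis by simp
  next
    case False
    then have st: "start_ok pre u vs" using inv by (auto simp: loop_inv_def)
    have "start_ok (pre @ [n]) u' vs"
    proof (cases "set (snd i) \<subseteq> area n \<and> area n \<subseteq> set S")
      case True
      have "area m \<subseteq> area n" if "m \<in> set pre" "set (snd i) \<subseteq> area m" for m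
      proof -
        have "hd (snd i) \<in> area m" "hd (snd i) \<in> area n" using org(1) that(2) True by auto
        then have "area m \<subseteq> area n \<or> area n \<subseteq> area m" using that(1) pre0 n0 lam [of m n] by blast
        then show ?thesis using later [OF split that(1)] by blast
      qed
      then show ?thesis using st True unfolding start_ok_def u'_def by auto
    next
      case F: False
      then have u': "u' = u" unfolding u'_def by argo
      show ?thesis using st F unfolding start_ok_def u' by auto
    qed
    then show ?thesis using False out by auto
  qed
  show ?thesis using 1 2 3 4 unfolding loop_inv_def z by simp
qed

text \<open>Two points need proof: the new node is aligned with all its lower neighbours, and its
  exchange is void unless \<open>i\<close> is missing here or in the previous set of the
  chain.\<close>

lemma loop_inv_place:
  assumes inv: "loop_inv pre (u, vs, ns)" and split: "ns0 = pre @ n # post" and sub: "set S \<subseteq> area n"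
  shows "loop_inv (pre @ [n]) (place_step ch (S, i, a) (u, vs, ns) n)"
proof -
  define R where "R = fst n"
  define e where "e = engine_step (length R) a i (engine n)"
  define X where "X = set (cache (ch R) e)"
  define b where "b = filter (\<lambda>x. snd x \<in> X) (cells n)"
  define c1 where "c1 = foldl (\<lambda>d v. swap_cells (hd u) v d) b vs"
  define v where "v = target i R u c1"
  define w where "w = hd (u @ [v])"
  define n' where "n' = (R, e, put w i (swap_cells w v c1))"
  have z: "place_step ch (S, i, a) (u, vs, ns) n = ([w], vs @ [v], ns @ [n'])"
    using sub by (cases n)
      (simp add: place_step_def Let_def n'_def w_def v_def c1_def b_def X_def e_def R_def area_def engine_def cells_def)
  have aR: "area n = set R" "area n' = set R" "fst n' = R" "engine n' = e"
    by (simp_all add: area_def R_def n'_def engine_def)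
  have cn': "cells n' = put w i (swap_cells w v c1)" by (simp add: n'_def cells_def)
  have n0: "n \<in> set ns0" and pre0: "set pre \<subseteq> set ns0" using split by auto
  note nok = node_okD [OF nodes [OF n0], folded R_def]
  have R0: "0 < length R" using nok(2) by simp
  have l2: "list_all2 updated pre ns" and ok: "\<forall>n\<in>set ns. node_ok ch n" and co: "coherent \<F> ns"
    using inv by (simp_all add: loop_inv_def)
  have iX: "i \<in> X" and Xsub: "X \<subseteq> insert i (snd ` set (cells n))"
    using cache_step [OF choice [of R] nok(3) R0, where x = i and a = a] nok(7) by (auto simp: X_def e_def)
  have einv: "engine_inv (length R) e" unfolding e_def by (rule engine_inv_step [OF nok(3) R0])
  note lc = length_cache [OF choice [of R] einv]
  have bm: "(s, j) \<in> set b \<longleftrightarrow> (s, j) \<in> set (cells n) \<and> j \<in> X" for s j by (auto simp: b_def)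
  have bd: "distinct (map fst b)" "distinct (map snd b)"
    using nok(4,5) by (simp_all add: b_def distinct_map_filter)
  have bR: "fst ` set b \<subseteq> set R" using nok(6) aR(1) by (auto simp: b_def)
  have bX: "snd ` set b \<subseteq> X" by (auto simp: b_def)
  \<comment> \<open>The new cache contains \<open>i\<close> and has at most \<open>length R\<close>
    items, so cells without \<open>i\<close> hold fewer.\<close>
  have room: "i \<in> snd ` set b \<or> length b < length R"
  proof (cases "i \<in> snd ` set b")
    case False
    then have "snd ` set b \<subset> X" using bX iX by auto
    then have "card (snd ` set b) < card X" unfolding X_def by (intro psubset_card_mono) auto
    also have "card X = length (cache (ch R) e)" unfolding X_def using lc(2) by (rule distinct_card)
    also have "\<dots> \<le> length R" by (rule lc(1))
    finally show ?thesis using bd(2) by (metis distinct_card length_map list.set_map)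
  qed simp
  have uvs: "(u = [] \<and> vs = [] \<or> (\<exists>u0\<in>set S. u = [u0])) \<and> set vs \<subseteq> set R"
  proof (cases "\<exists>k\<in>set pre. set S \<subseteq> area k")
    case True
    then obtain w k where c: "chain_ok pre u vs ns w k" using inv by (auto simp: loop_inv_def)
    note D = chain_okD [OF c]
    obtain x where "x \<in> set S" using S_ne by (metis all_not_in_conv)
    then have "area k \<subseteq> area n \<or> area n \<subseteq> area k" using lam [of k n x] D(3,4) n0 pre0 sub by blast
    then have "area k \<subseteq> area n" using later [OF split D(3)] by blast
    then show ?thesis using D(1,2,6) aR by auto
  next
    case False
    then have st: "start_ok pre u vs" using inv by (auto simp: loop_inv_def)
    have "u = [] \<or> (\<exists>u0\<in>set S. u = [u0])"
    proof (cases "u = []")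
      case False
      then obtain m where m: "m \<in> set pre" "area m \<subseteq> set S" "u = slots_of i (cells m)"
        using st by (auto simp: start_ok_def)
      have mok: "node_ok ch m" using m(1) pre0 nodes by blast+
      obtain y where "y \<in> set (slots_of i (cells m))" using False m(3) by (metis list.set_sel(1))
      then have y: "(y, i) \<in> set (cells m)" by (simp add: slots_of_mem)
      then have "u = [y]" using m(3) slots_of_unique node_okD(5) [OF mok] by simp
      moreover have "y \<in> set S" using cells_area [OF mok y] m(2) by auto
      ultimately show ?thesis by blast
    qed simp
    then show ?thesis using st by (auto simp: start_ok_def)
  qed
  then have u: "u = [] \<and> vs = [] \<or> (\<exists>u0\<in>set R. u = [u0])" and vsR: "set vs \<subseteq> set R"
    using sub aR by auto
  note T = target_put [OF bd bR nok(1) room u vsR c1_def v_def w_def cn']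
  have w0: "u = [] \<and> vs = [] \<or> u = [w]" using u by (auto simp: w_def)
  \<comment> \<open>In the order \<open>S\<close> precedes its proper supersets, so the first set
    met that contains \<open>S\<close> is \<open>S\<close> itself.\<close>
  have first: "area n = set S" if "\<not> (\<exists>k\<in>set pre. set S \<subseteq> area k)"
  proof -
    obtain k where k: "k \<in> set ns0" "area k = set S" using S_in by blast
    then have "k \<notin> set pre" using that by blast
    then have "\<not> area k \<subset> area n" using earlier [OF split k(1)] by blast
    with k sub show ?thesis by blast
  qed
  have wS: "w \<in> set S"
  proof (cases "u = []")
    case True
    have "\<not> (\<exists>k\<in>set pre. set S \<subseteq> area k)"
    proof
      assume "\<exists>k\<in>set pre. set S \<subseteq> area k"
      then obtain w k where "chain_ok pre u vs ns w k" using inv by (auto simp: loop_inv_def)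
      from chain_okD(1) [OF this] True show False by simp
    qed
    from first [OF this] T(2) aR show ?thesis by simp
  next
    case False
    then show ?thesis using uvs by (auto simp: w_def)
  qed
  have 1: "list_all2 updated (pre @ [n]) (ns @ [n'])"
    using l2 sub aR by (auto intro!: list_all2_appendI simp: updated_def e_def R_def)
  have "node_ok ch n'"
    unfolding node_ok_def aR
  proof (intro conjI ballI)
    fix j assume "j \<in> set (fst e)"
    then have "j = i \<or> j \<in> set (fst (engine n))" using engine_step_support unfolding e_def by fastforce
    then show "set (snd j) \<subseteq> set R" using nok(8) [of j] org(2) sub aR by auto
  next
    have "snd ` set b = snd ` set (cells n) \<inter> X" by (force simp: b_def)
    then show "snd ` set (cells n') = set (cache (ch R) e)"
      using T(6) iX Xsub by (auto simp: X_def)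
  qed (use nok(1,2) einv T(3,4,5) in auto)
  then have 2: "\<forall>k\<in>set (ns @ [n']). node_ok ch k" using ok by auto
  have old: "\<not> area n \<subseteq> area m'" if m': "m' \<in> set ns" for m'
  proof -
    obtain m where "m \<in> set pre" "updated m m'" by (rule updated_in [OF l2 m'])
    then show ?thesis using later [OF split, of m] by (simp add: updated_def area_def)
  qed
  have cn: "(s, j) \<in> set (cells n') \<longleftrightarrow>
        (if s = w then j = i else (perm_of w (vs @ [v]) s, j) \<in> set (cells n) \<and> j \<in> X)" for s j
    using T(7) [of s j] bm by simp
  have ib: "(y, i) \<in> set b \<longleftrightarrow> (y, i) \<in> set (cells n)" for y using bm iX by simp
  have chainI: "chain_ok (pre @ [n]) [w] (vs @ [v]) (ns @ [n']) w n"
    if big: "\<And>m. m \<in> set pre \<Longrightarrow> set S \<subseteq> area m \<Longrightarrow> area m \<subseteq> area n"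
      and cnt: "length (filter (\<lambda>v. v \<noteq> w) (vs @ [v])) + loss n \<le> 2 * sum_list (map loss (pre @ [n]))"
    unfolding chain_ok_def
  proof (intro conjI ballI impI allI)
    show "w \<in> set S" "set S \<subseteq> area n" "n \<in> set (pre @ [n])" using wS sub by simp_all
    show "set (vs @ [v]) \<subseteq> area n" using vsR T(1) aR by auto
  next
    fix m assume "m \<in> set (pre @ [n])" "set S \<subseteq> area m"
    then show "area m \<subseteq> area n" using big [of m] by auto
  next
    fix k s j assume k: "k \<in> set (ns @ [n'])" "fst k = fst n"
    then have "k = n'" using old [of k] by (auto simp: area_def)
    then show "(s, j) \<in> set (cells k) \<longleftrightarrow> (if s = w then j = i
        else (perm_of w (vs @ [v]) s, j) \<in> set (cells n) \<and> j \<in> set (cache (ch (fst n)) (engine k)))"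
      using cn [of s j] aR by (simp add: X_def R_def)
  next
    fix y assume "(y, i) \<in> set (cells n)"
    then show "perm_of w (vs @ [v]) w = y" using T(8) ib by blast
  qed (use cnt in simp_all)
  have miss0: "\<exists>y. (y, i) \<in> set (cells k)" if "k \<in> set ns0" "miss (ch (fst k)) i (engine k) = 0" for k
    using that cached_cell [OF nodes [OF that(1)]] by (auto simp: miss_def split: if_splits)
  have miss1: "miss (ch (fst k)) i (engine k) \<le> 1" for k by (simp add: miss_def)
  have main: "coherent \<F> (ns @ [n']) \<and> chain_ok (pre @ [n]) [w] (vs @ [v]) (ns @ [n']) w n"
  proof (cases "\<exists>k\<in>set pre. set S \<subseteq> area k")
    case F0: False
    note False = F0
    have RS: "set R = set S" using first [OF False] aR by simp
    have st: "start_ok pre u vs" using inv False by (auto simp: loop_inv_def)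
    then have vs: "vs = []" by (simp add: start_ok_def)
    have upos: "\<exists>m\<in>set pre. (w, i) \<in> set (cells m) \<and> set (snd i) \<subseteq> area m \<and> area m \<subset> set S \<and>
        (\<forall>k\<in>set pre. set (snd i) \<subseteq> area k \<longrightarrow> area k \<subseteq> set S \<longrightarrow> area k \<subseteq> area m)" if une: "u \<noteq> []"
    proof -
      obtain m where m: "m \<in> set pre" "set (snd i) \<subseteq> area m" "area m \<subseteq> set S" "u = slots_of i (cells m)"
        "\<forall>k\<in>set pre. set (snd i) \<subseteq> area k \<longrightarrow> area k \<subseteq> set S \<longrightarrow> area k \<subseteq> area m"
        using st une unfolding start_ok_def by blast
      have "u = [w]" using w0 une by simp
      then have "w \<in> set (slots_of i (cells m))" using m(4) by (metis list.set_intros(1))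
      then have "(w, i) \<in> set (cells m)" by (simp add: slots_of_mem)
      moreover have "area m \<noteq> set S" using False m(1) by auto
      ultimately show ?thesis using m by (intro bexI [of _ m]) auto
    qed
    have uv: "u = [] \<Longrightarrow> w = v" by (simp add: w_def)
    have A: "coherent \<F> (ns @ [n'])"
    proof (rule coherent_snoc [OF co])
      fix m' assume m': "m' \<in> set ns"
      then show "\<not> area n' \<subset> area m'" using old [OF m'] unfolding aR by blast
      obtain m where m: "m \<in> set pre" "updated m m'" by (rule updated_in [OF l2 m'])
      then have e: "m' = m" using False by (auto simp: updated_def)
      have mok: "node_ok ch m" and m0: "m \<in> set ns0" using m(1) pre0 nodes by blast+
      fix s t j assume h: "adjacent \<F> (area m') (area n')" "(s, j) \<in> set (cells m')" "(t, j) \<in> set (cells n')"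
      have adj: "adjacent \<F> (area m) (area n)" using h(1) e aR by simp
      have mS: "area m \<subset> set S" using adj RS aR by (auto simp: adjacent_def)
      have sm: "(s, j) \<in> set (cells m)" using h(2) e by simp
      show "s = t"
      proof (cases "j = i")
        case True
        have si: "(s, i) \<in> set (cells m)" using sm True by simp
        have om: "set (snd i) \<subseteq> area m" using cells_origin [OF choice mok si] .
        have "t = w"
        proof (rule ccontr)
          assume "t \<noteq> w"
          then have "(w, i) \<in> set (cells n')" "(t, i) \<in> set (cells n')" using cn h(3) True by auto
          then show False using distinct_sndD [OF T(4)] \<open>t \<noteq> w\<close> by blast
        qed
        moreover have "u = [s]"
        proof -
          obtain k where k: "k \<in> set pre" "area k \<subseteq> set S" "u = slots_of i (cells k)" "area m \<subseteq> area k"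
            using st om mS m(1) unfolding start_ok_def by blast
          have k0: "k \<in> set ns0" using k(1) pre0 by auto
          have "area k \<subset> area n" using k(1,2) F0 RS aR by blast
          then have "\<not> area m \<subset> area k" using adj k0 by (auto simp: adjacent_def)
          then have "m = k" using k(4) area_inj m0 k0 by blast
          then show ?thesis using slots_of_unique [OF node_okD(5) [OF mok] si] k(3) by simp
        qed
        ultimately show ?thesis using w0 by auto
      next
        case False
        then have tw: "t \<noteq> w" using cn h(3) by auto
        then have tn: "(perm_of w [v] t, j) \<in> set (cells n)" using cn h(3) vs by auto
        have st: "s = perm_of w [v] t" using coherentD [OF coh m0 n0 adj sm tn] .
        show ?thesis
        proof (cases "t = v")
          case True
          \<comment> \<open>Here the exchange moved \<open>j\<close> from \<open>w\<close> to
            \<open>v\<close>, and the neighbour \<open>m\<close> holds \<open>j\<close> in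
            \<open>w\<close>. The set \<open>k\<close> that prescribed \<open>w\<close> holds
            \<open>i\<close> there. Both contain \<open>w\<close>, hence are comparable, and the
            choice of \<open>k\<close> forces \<open>m = k\<close> and \<open>i = j\<close>.\<close>
          then have sw: "s = w" using st tw by simp
          have "u \<noteq> []" using uv True tw by auto
          from upos [OF this] obtain k where k: "k \<in> set pre" "(w, i) \<in> set (cells k)" "set (snd i) \<subseteq> area k"
            "area k \<subset> set S" "\<forall>m\<in>set pre. set (snd i) \<subseteq> area m \<longrightarrow> area m \<subseteq> set S \<longrightarrow> area m \<subseteq> area k" by blast
          have k0: "k \<in> set ns0" using k(1) pre0 by auto
          have "w \<in> area k" "w \<in> area m" using cells_area [OF nodes [OF k0] k(2)] cells_area [OF mok sm] sw by auto
          then have "area k \<subseteq> area m \<or> area m \<subseteq> area k" using lam [OF k0 m0] by blast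
          moreover have "area m \<subseteq> area k" if "area k \<subseteq> area m" using k(3,5) m(1) mS that by blast
          moreover have "\<not> area m \<subset> area k" using adj k0 k(4) RS aR by (auto simp: adjacent_def)
          ultimately have "area m = area k" by blast
          then have "m = k" using area_inj m0 k0 by blast
          then have "i = j" using distinct_fstD [OF node_okD(4) [OF mok]] k(2) sm sw by blast
          with False show ?thesis by simp
        next
          case F: False
          then show ?thesis using st tw by simp
        qed
      qed
    qed
    \<comment> \<open>If \<open>i\<close> is cached in \<open>S\<close>, alignment with the set that
      prescribed \<open>w\<close> shows that it already sits in \<open>w\<close>.\<close>
    have B: "v = w" if z: "loss n = 0"
    proof (cases "u = []")
      case False
      obtain y where y: "(y, i) \<in> set (cells n)" using miss0 [OF n0] z sub by auto
      from upos [OF False] obtain k where k: "k \<in> set pre" "(w, i) \<in> set (cells k)" "set (snd i) \<subseteq> area k"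
            "area k \<subset> set S" "\<forall>m\<in>set pre. set (snd i) \<subseteq> area m \<longrightarrow> area m \<subseteq> set S \<longrightarrow> area m \<subseteq> area k" by blast
      have k0: "k \<in> set ns0" using k(1) pre0 by auto
      have "adjacent \<F> (area k) (area n)"
        unfolding adjacent_def
      proof (intro conjI ballI impI notI)
        show "area k \<subset> area n" using k(4) RS aR by simp
        fix D assume "D \<in> \<F>" and D: "area k \<subset> D" "D \<subset> area n"
        then obtain d where d: "d \<in> set ns0" "D = area d" by blast
        then have "d \<in> set pre" using earlier [OF split] D by blast
        then have "area d \<subseteq> area k" using k(3,5) D RS aR d(2) by auto
        then show False using D d by blast
      qed
      from coherentD [OF coh k0 n0 this k(2) y] have "perm_of w vs w = y" using vs by simp
      then show ?thesis using T(9) ib y False by blast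
    qed (use uv in simp)
    have "length (filter (\<lambda>v. v \<noteq> w) (vs @ [v])) + loss n \<le> 2 * sum_list (map loss (pre @ [n]))"
      using B vs sub miss1 [of n] by (cases "loss n = 0") auto
    then have "chain_ok (pre @ [n]) [w] (vs @ [v]) (ns @ [n']) w n"
      using False by (intro chainI) auto
    with A show ?thesis by blast
  next
    case True
    then obtain w' k where c: "chain_ok pre u vs ns w' k" using inv by (auto simp: loop_inv_def)
    then have "w' = w" using w0 chain_okD(1) [OF c] by simp
    note D = chain_okD [OF c [unfolded this]]
    have k0: "k \<in> set ns0" using D(3) pre0 by auto
    obtain x where x: "x \<in> set S" using S_ne by (metis all_not_in_conv)
    have cmp: "area m \<subset> area n" if "m \<in> set pre" "set S \<subseteq> area m" for m
      using lam [of m n x] that n0 pre0 sub x later [OF split that(1)] by blast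
    have kn: "area k \<subset> area n" using cmp D(3,4) by blast
    have adjk: "adjacent \<F> (area k) (area n)"
      unfolding adjacent_def
    proof (intro conjI ballI impI notI)
      fix E assume "E \<in> \<F>" and E: "area k \<subset> E" "E \<subset> area n"
      then obtain d where d: "d \<in> set ns0" "E = area d" by blast
      then have "d \<in> set pre" using earlier [OF split] E by blast
      then have "area d \<subseteq> area k" using D(4) E d(2) by (intro D(5)) auto
      then show False using E d by blast
    qed (rule kn)
    have A: "coherent \<F> (ns @ [n'])"
    proof (rule coherent_snoc [OF co])
      fix m' assume m': "m' \<in> set ns"
      then show "\<not> area n' \<subset> area m'" using old [OF m'] unfolding aR by blast
      obtain m where m: "m \<in> set pre" "updated m m'" by (rule updated_in [OF l2 m'])
      have mok: "node_ok ch m" and m0: "m \<in> set ns0" using m(1) pre0 nodes by blast+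
      have am: "area m' = area m" and fm: "fst m' = fst m" using m(2) by (simp_all add: updated_def area_def)
      fix s t j assume h: "adjacent \<F> (area m') (area n')" "(s, j) \<in> set (cells m')" "(t, j) \<in> set (cells n')"
      have adj: "adjacent \<F> (area m) (area n)" using h(1) am aR by simp
      show "s = t"
      proof (cases "set S \<subseteq> area m")
        case True
        have "area m \<subseteq> area k" using D(5) m(1) True by blast
        moreover have "\<not> area m \<subset> area k" using adj kn k0 by (auto simp: adjacent_def)
        ultimately have "m = k" using area_inj m0 k0 by blast
        then have m'k: "(s, j) \<in> set (cells m') \<longleftrightarrow> (if s = w then j = i
           else (perm_of w vs s, j) \<in> set (cells k) \<and> j \<in> set (cache (ch (fst k)) (engine m')))" for s
          using D(7) [OF m'] fm by simp
        show ?thesis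
        proof (cases "j = i")
          case True
          have "(w, i) \<in> set (cells m')" "(w, i) \<in> set (cells n')" using m'k [of w] cn [of w i] True by auto
          then have "s = w" "t = w"
            using distinct_sndD [OF node_okD(5) [OF bspec [OF ok m']]] distinct_sndD [OF T(4)] h True by blast+
          then show ?thesis by simp
        next
          case False
          have sw: "s \<noteq> w" "t \<noteq> w" using m'k [of s] cn [of t j] h False by auto
          have "(perm_of w vs s, j) \<in> set (cells k)" "(perm_of w (vs @ [v]) t, j) \<in> set (cells n)"
            using m'k [of s] cn [of t j] h sw by auto
          \<comment> \<open>Both nodes have undergone the exchanges \<open>vs\<close>, so the old
            alignment of \<open>k\<close> and \<open>n\<close> persists up to the last exchange.
            That one could only relate \<open>t = v\<close> to \<open>s = w\<close>, which is
            excluded.\<close>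
          from coherentD [OF coh k0 n0 adjk this]
          have "s = (if t = w then v else if t = v then w else t)" unfolding perm_of_snoc perm_of_inj .
          then show ?thesis using sw by (auto split: if_splits)
        qed
      next
        case False
        then have e: "m' = m" using m(2) by (simp add: updated_def)
        have disj: "area m \<inter> area k = {}"
        proof (rule ccontr)
          assume "area m \<inter> area k \<noteq> {}"
          then have "area m \<subseteq> area k \<or> area k \<subseteq> area m" using lam [OF m0 k0] by blast
          then have "area m \<subset> area k" using False D(4) by blast
          then show False using adj kn k0 by (auto simp: adjacent_def)
        qed
        have sm: "(s, j) \<in> set (cells m)" and sA: "s \<in> area m" using h(2) e cells_area [OF mok] by auto
        have ji: "j \<noteq> i"
        proof
          assume "j = i"
          then have "set (snd i) \<subseteq> area m" using cells_origin [OF choice mok] sm by blast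
          then show False using disj org D(4) by (cases "snd i") auto
        qed
        then have tw: "t \<noteq> w" using cn [of t j] h(3) by auto
        have tn: "(perm_of w (vs @ [v]) t, j) \<in> set (cells n)" using cn [of t j] tw h(3) by auto
        have st: "s = perm_of w (vs @ [v]) t" using coherentD [OF coh m0 n0 adj sm tn] .
        \<comment> \<open>The exchanges \<open>vs\<close> stay inside \<open>area k\<close>, and
          what the last one brings to \<open>v\<close> comes from there as well. Since
          \<open>s\<close> lies outside, the content of \<open>t\<close> has not moved.\<close>
        have wk: "w \<in> area k" using D(2,4) by blast
        have "perm_of w vs y \<in> area k" if "y \<in> area k" for y using perm_of_inside [OF that wk D(6)] .
        moreover have "perm_of w vs y = y" if "y \<notin> area k" for y
          using perm_of_outside [of y w vs] that wk D(6) by auto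
        moreover have "s \<notin> area k" using disj sA by blast
        ultimately show ?thesis using st tw wk unfolding perm_of_snoc by (metis (full_types))
      qed
    qed
    \<comment> \<open>An item cached in both neighbours had the same slot in both, so the exchanges
      that brought it to \<open>w\<close> in \<open>k\<close> also bring it to \<open>w\<close> in
      \<open>n\<close>.\<close>
    have B: "v = w" if z: "loss n = 0" "loss k = 0"
    proof -
      obtain y y' where y: "(y, i) \<in> set (cells n)" "(y', i) \<in> set (cells k)"
        using miss0 [OF n0] miss0 [OF k0] z sub D(4) by auto
      then have "y' = y" using coherentD [OF coh k0 n0 adjk] by blast
      then have "perm_of w vs w = y" using D(8) y by blast
      then show ?thesis using T(9) ib y D(1) by blast
    qed
    have "length (filter (\<lambda>v. v \<noteq> w) (vs @ [v])) + loss n \<le> 2 * sum_list (map loss (pre @ [n]))"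
    proof -
      have arith: "x + l \<le> 2 * z" if "v \<noteq> w \<Longrightarrow> 0 < l \<or> 0 < l'" "x = y + (if v \<noteq> w then 1 else 0)"
        "z = z0 + l" "y + l' \<le> 2 * z0" for x y z z0 l l' :: nat
        using that by (cases "v = w") auto
      have 1: "v \<noteq> w \<Longrightarrow> 0 < loss n \<or> 0 < loss k" using B by blast
      have 2: "length (filter (\<lambda>v. v \<noteq> w) (vs @ [v])) =
          length (filter (\<lambda>v. v \<noteq> w) vs) + (if v \<noteq> w then 1 else 0)" by simp
      have 3: "sum_list (map loss (pre @ [n])) = sum_list (map loss pre) + loss n" by simp
      show ?thesis by (rule arith [OF _ 2 3 D(9)]) (rule 1)
    qed
    then have "chain_ok (pre @ [n]) [w] (vs @ [v]) (ns @ [n']) w n"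
      using cmp by (intro chainI) blast+
    with A show ?thesis by blast
  qed
  show ?thesis using 1 2 main sub unfolding loop_inv_def z by auto
qed

lemma serve_inv: "loop_inv ns0 (foldl (place_step ch (S, i, a)) ([], [], []) ns0)"
proof -
  have "loop_inv pre (foldl (place_step ch (S, i, a)) ([], [], []) pre)" if "\<exists>post. ns0 = pre @ post" for pre
    using that
  proof (induction pre rule: rev_induct)
    case Nil
    show ?case by (simp add: loop_inv_def coherent_def start_ok_def)
  next
    case (snoc n pre)
    obtain post where post: "ns0 = pre @ n # post" using snoc.prems by auto
    obtain u vs ns where z: "foldl (place_step ch (S, i, a)) ([], [], []) pre = (u, vs, ns)"
      by (metis prod_cases3)
    have "loop_inv pre (u, vs, ns)" using snoc.IH post z by auto
    then show ?case using loop_inv_skip [OF _ post] loop_inv_place [OF _ post] z by (cases "set S \<subseteq> area n") simp_all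
  qed
  then show ?thesis by simp
qed

lemma serve_facts:
  obtains w vs t where "list_all2 updated ns0 (serve ch ns0 (S, i, a))"
    "\<And>n. n \<in> set (serve ch ns0 (S, i, a)) \<Longrightarrow> node_ok ch n" "coherent \<F> (serve ch ns0 (S, i, a))"
    "chain_ok ns0 [w] vs (serve ch ns0 (S, i, a)) w t"
proof -
  obtain u vs ns where z: "foldl (place_step ch (S, i, a)) ([], [], []) ns0 = (u, vs, ns)" by (metis prod_cases3)
  have ns: "serve ch ns0 (S, i, a) = ns" by (simp add: serve_def z)
  have ex: "\<exists>n\<in>set ns0. set S \<subseteq> area n" using S_in by blast
  obtain w t where c: "chain_ok ns0 u vs ns w t" using serve_inv ex by (auto simp: loop_inv_def z)
  have "chain_ok ns0 [w] vs ns w t" using c chain_okD(1) [OF c] by simp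
  then show ?thesis using that serve_inv ns by (auto simp: loop_inv_def z)
qed

end

section \<open>The displayed configuration\<close>

lemma cell_unique:
  assumes "distinct (map fst c)" "(s, j) \<in> set c"
  shows "filter (\<lambda>x. fst x = s) c = [(s, j)]"
  using assms
proof (induction c)
  case (Cons x c)
  show ?case
  proof (cases "fst x = s")
    case True
    then have "filter (\<lambda>x. fst x = s) c = []" using Cons.prems(1) by (auto simp: filter_empty_conv image_iff)
    moreover have "x = (s, j)" using Cons.prems True by (cases x) (auto simp: image_iff)
    ultimately show ?thesis by simp
  next
    case False
    with Cons show ?thesis by auto
  qed
qed simp

lemma shown_outside: "(\<And>n. n \<in> set ns \<Longrightarrow> s \<notin> area n) \<Longrightarrow> shown ns s = []"
  by (induction ns rule: rev_induct) (simp_all add: shown_def area_def)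

lemma shown_nth:
  assumes "k < length ns" "s \<in> area (ns ! k)" "\<forall>l. k < l \<longrightarrow> l < length ns \<longrightarrow> s \<notin> area (ns ! l)"
  shows "shown ns s = map (\<lambda>x. fst (snd x)) (filter (\<lambda>x. fst x = s) (cells (ns ! k)))"
  using assms
proof (induction ns rule: rev_induct)
  case (snoc n ns)
  show ?case
  proof (cases "k = length ns")
    case True
    then show ?thesis using snoc.prems(2) by (simp add: shown_def area_def cells_def)
  next
    case False
    then have k: "k < length ns" using snoc.prems(1) by simp
    have "s \<notin> area n" using snoc.prems(3) [rule_format, of "length ns"] k by simp
    then have "shown (ns @ [n]) s = shown ns s" by (simp add: shown_def area_def)
    moreover have "s \<notin> area (ns ! l)" if "k < l" "l < length ns" for l
      using snoc.prems(3) [rule_format, of l] that by (simp add: nth_append)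
    ultimately show ?thesis using snoc.IH [OF k] snoc.prems(2) k by (simp add: nth_append)
  qed
qed simp

lemma config_of_nth:
  assumes "k < length ns" "s \<in> area (ns ! k)" "\<forall>l. k < l \<longrightarrow> l < length ns \<longrightarrow> s \<notin> area (ns ! l)"
    and d: "distinct (map fst (cells (ns ! k)))"
  shows "config_of ns s = Some p \<longleftrightarrow> (\<exists>j. (s, j) \<in> set (cells (ns ! k)) \<and> fst j = p)"
proof (cases "\<exists>j. (s, j) \<in> set (cells (ns ! k))")
  case True
  then obtain j where j: "(s, j) \<in> set (cells (ns ! k))" by blast
  have "shown ns s = [fst j]" unfolding shown_nth [OF assms(1-3)] cell_unique [OF d j] by simp
  moreover have "j' = j" if "(s, j') \<in> set (cells (ns ! k))" for j' using distinct_fstD [OF d that j] .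
  ultimately show ?thesis using j unfolding config_of_def by (metis list.discI list.sel(1) option.inject)
next
  case False
  then have "filter (\<lambda>x. fst x = s) (cells (ns ! k)) = []"
    by (metis (mono_tags, lifting) filter_False prod.collapse)
  then have "shown ns s = []" unfolding shown_nth [OF assms(1-3)] by simp
  then show ?thesis using False by (auto simp: config_of_def)
qed

definition nodes_ok :: "(nat list \<Rightarrow> 'x chooser) \<Rightarrow> 'x node list \<Rightarrow> bool" where
  "nodes_ok ch ns \<longleftrightarrow> (\<forall>n\<in>set ns. node_ok ch n) \<and> laminar (area ` set ns) \<and>
     sorted_wrt (\<lambda>A B. \<not> B \<subseteq> A) (map area ns) \<and> coherent (area ` set ns) ns"

text \<open>Only the maximal set above \<open>S\<close> is displayed differently, and there only
  \<open>w\<close> and the slots really exchanged with it. Let \<open>L\<close> be the number of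
  sets that miss \<open>i\<close>. For \<open>L = 0\<close> all exchanges are void and
  \<open>i\<close> was in \<open>w\<close> already; otherwise at most
  \<open>1 + 2 * L \<le> 3 * L\<close> slots change.\<close>

theorem serve_step:
  fixes ns :: "'x node list" and a :: 'x
  assumes choice: "\<And>R. choice_ok (ch R)" and ok: "nodes_ok ch ns" and S: "set S \<in> area ` set ns"
    and org: "snd i \<noteq> []" "set (snd i) \<subseteq> set S"
  defines "ns' \<equiv> serve ch ns (S, i, a)"
  shows "nodes_ok ch ns'"
    and "map (\<lambda>n. (fst n, engine n)) ns' = map (\<lambda>n. (fst n, if set S \<subseteq> area n
           then engine_step (length (fst n)) a i (engine n) else engine n)) ns"
    and "satisfies (config_of ns') (fst i, set S)"
    and "finite {s. config_of ns' s \<noteq> None \<and> config_of ns' s \<noteq> config_of ns s}"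
    and "card {s. config_of ns' s \<noteq> None \<and> config_of ns' s \<noteq> config_of ns s} \<le>
           3 * (\<Sum>n\<leftarrow>ns. if set S \<subseteq> area n then miss (ch (fst n)) i (engine n) else 0)"
proof -
  have cmp: "area n \<subseteq> area m \<or> area m \<subseteq> area n" if "n \<in> set ns" "m \<in> set ns" "x \<in> area n" "x \<in> area m" for n m x
    using ok that unfolding nodes_ok_def laminar_def by blast
  interpret rounding ch S i a ns
  proof
    show "\<exists>n\<in>set ns. area n = set S" using S by blast
    show "sorted_wrt (\<lambda>m n. \<not> area n \<subseteq> area m) ns" using ok by (simp add: nodes_ok_def sorted_wrt_map)
  qed (use assms(1,2) org cmp in \<open>auto simp: nodes_ok_def\<close>)
  obtain w vs t where F: "list_all2 updated ns ns'" "\<And>n. n \<in> set ns' \<Longrightarrow> node_ok ch n"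
    "coherent (area ` set ns) ns'" and c: "chain_ok ns [w] vs ns' w t"
    unfolding ns'_def using serve_facts by metis
  note D = chain_okD [OF c]
  have len: "length ns' = length ns" using F(1) by (simp add: list_all2_lengthD)
  have up: "updated (ns ! k) (ns' ! k)" if "k < length ns" for k using F(1) that by (simp add: list_all2_conv_all_nth)
  have ar: "area (ns' ! k) = area (ns ! k)" if "k < length ns" for k
    using up [OF that] by (simp add: updated_def area_def)
  have mapa: "map area ns' = map area ns" using len ar by (simp add: list_eq_iff_nth_eq)
  then have seta: "area ` set ns' = area ` set ns" by (metis list.set_map)
  show "nodes_ok ch ns'" using ok F(2,3) unfolding nodes_ok_def seta mapa by blast
  show "map (\<lambda>n. (fst n, engine n)) ns' = map (\<lambda>n. (fst n, if set S \<subseteq> area n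
           then engine_step (length (fst n)) a i (engine n) else engine n)) ns"
    using len up by (auto simp: list_eq_iff_nth_eq updated_def)
  obtain kt where kt: "kt < length ns" "ns ! kt = t" using D(3) by (metis in_set_conv_nth)
  have ord: "\<not> area (ns ! l) \<subseteq> area (ns ! k)" if "k < l" "l < length ns" for k l
    using sorted_wrt_nth_less [OF order that] .
  have fst_t: "fst (ns' ! kt) = fst t" and in_t: "ns' ! kt \<in> set ns'" using up kt len by (auto simp: updated_def)
  note C = D(7) [OF in_t fst_t]
  have dk: "distinct (map fst (cells (ns ! k)))" "distinct (map fst (cells (ns' ! k)))" if "k < length ns" for k
    using node_okD(4) nodes F(2) that len by (metis nth_mem)+
  have last: "\<exists>k<length ns. s \<in> area (ns ! k) \<and> (\<forall>l. k < l \<longrightarrow> l < length ns \<longrightarrow> s \<notin> area (ns ! l))"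
    if "k0 < length ns" "s \<in> area (ns ! k0)" for s k0
  proof -
    let ?K = "{k. k < length ns \<and> s \<in> area (ns ! k)}"
    have f: "finite ?K" by simp
    have m: "Max ?K \<in> ?K" by (rule Max_in [OF f]) (use that in blast)
    have "l \<notin> ?K" if "Max ?K < l" for l using Max_ge [OF f] that by (meson leD)
    with m show ?thesis by blast
  qed
  have conf: "config_of ns s = Some p \<longleftrightarrow> (\<exists>j. (s, j) \<in> set (cells (ns ! k)) \<and> fst j = p)"
    "config_of ns' s = Some p \<longleftrightarrow> (\<exists>j. (s, j) \<in> set (cells (ns' ! k)) \<and> fst j = p)"
    if k: "k < length ns" "s \<in> area (ns ! k)" "\<forall>l. k < l \<longrightarrow> l < length ns \<longrightarrow> s \<notin> area (ns ! l)" for k s p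
    using config_of_nth [OF k(1,2), of p] config_of_nth [of k ns' s p] k dk [OF k(1)] len ar by auto
  have wt: "w \<in> area (ns ! kt)" using D(2,4) kt(2) by blast
  have wlast: "\<forall>l. kt < l \<longrightarrow> l < length ns \<longrightarrow> w \<notin> area (ns ! l)"
  proof (intro allI impI notI)
    fix l assume l: "kt < l" "l < length ns" "w \<in> area (ns ! l)"
    have n: "\<not> area (ns ! l) \<subseteq> area t" using ord [OF l(1,2)] kt(2) by simp
    then have "area t \<subseteq> area (ns ! l)" using cmp [of "ns ! l" t w] l wt kt(2) D(3) by (metis nth_mem)
    then have "area (ns ! l) \<subseteq> area t" using D(4) D(5) [of "ns ! l"] l(2) by auto
    with n show False by blast
  qed
  have "(w, i) \<in> set (cells (ns' ! kt))" using C [of w i] by simp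
  then have "config_of ns' w = Some (fst i)" using conf(2) [OF kt(1) wt wlast] by blast
  then show "satisfies (config_of ns') (fst i, set S)" using D(2) by auto
  define L where "L = (\<Sum>n\<leftarrow>ns. if set S \<subseteq> area n then miss (ch (fst n)) i (engine n) else 0)"
  let ?D = "{s. config_of ns' s \<noteq> None \<and> config_of ns' s \<noteq> config_of ns s}"
  \<comment> \<open>A node that changes contains \<open>S\<close>, and a displayed one of this kind
    is the maximal node \<open>t\<close>. In \<open>t\<close>, a slot other than \<open>w\<close>
    gets a new item only by an exchange that moves it.\<close>
  have D1: "s = w \<and> (w, i) \<notin> set (cells t) \<or> s \<in> set (filter (\<lambda>v. v \<noteq> w) vs)" if s: "s \<in> ?D" for s
  proof -
    obtain p where p: "config_of ns' s = Some p" "config_of ns s \<noteq> Some p" using s by auto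
    have "\<exists>n\<in>set ns'. s \<in> area n"
      using p(1) shown_outside [of ns' s] by (auto simp: config_of_def split: if_splits)
    then obtain k0 where "k0 < length ns" "s \<in> area (ns ! k0)" using len ar by (metis in_set_conv_nth)
    from last [OF this] obtain k where k: "k < length ns" "s \<in> area (ns ! k)"
      "\<forall>l. k < l \<longrightarrow> l < length ns \<longrightarrow> s \<notin> area (ns ! l)" by blast
    have "set S \<subseteq> area (ns ! k)"
    proof (rule ccontr)
      assume "\<not> ?thesis"
      then have "ns' ! k = ns ! k" using up [OF k(1)] by (simp add: updated_def)
      then show False using p conf [OF k, of p] by simp
    qed
    then have sub: "area (ns ! k) \<subseteq> area t" using D(5) [of "ns ! k"] k(1) by simp
    have "kt = k"
    proof (rule linorder_cases [of kt k])
      assume "kt < k" then show ?thesis using ord [OF _ k(1)] sub kt(2) by blast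
    next
      assume "k < kt" then show ?thesis using k(2,3) kt sub by blast
    qed
    then have nk: "ns ! k = t" and nk': "ns' ! k = ns' ! kt" using kt(2) by auto
    obtain j where j: "(s, j) \<in> set (cells (ns' ! kt))" "fst j = p" using p(1) conf(2) [OF k] nk' by auto
    have no: "(s, j) \<notin> set (cells t)" using p(2) conf(1) [OF k] j(2) nk by blast
    show ?thesis
    proof (cases "s = w")
      case True
      then show ?thesis using C [of s j] j no by simp
    next
      case False
      then have "(perm_of w vs s, j) \<in> set (cells t)" using C [of s j] j by simp
      then have "perm_of w vs s \<noteq> s" using no by metis
      then show ?thesis using perm_of_moved [OF False] by blast
    qed
  qed
  then have D2: "?D \<subseteq> set (w # filter (\<lambda>v. v \<noteq> w) vs)" by auto
  then show fD: "finite ?D" by (rule finite_subset) simp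
  show "card ?D \<le> 3 * L"
  proof (cases "L = 0")
    case True
    have cnt: "length (filter (\<lambda>v. v \<noteq> w) vs) + loss t \<le> 2 * L" using D(9) by (simp add: L_def)
    then have nil: "filter (\<lambda>v. v \<noteq> w) vs = []" and "loss t = 0" using True by auto
    then have "miss (ch (fst t)) i (engine t) = 0" using D(4) by auto
    then have "i \<in> set (cache (ch (fst t)) (engine t))" by (simp add: miss_def split: if_splits)
    then obtain y where y: "(y, i) \<in> set (cells t)" using cached_cell nodes [OF D(3)] by blast
    then have yw: "y = w" using D(8) [OF y] perm_of_trivial [OF nil] by simp
    have "s \<notin> ?D" for s
    proof
      assume "s \<in> ?D"
      from D1 [OF this] show False using yw y unfolding nil by simp
    qed
    then have "?D = {}" by blast
    then show ?thesis by (metis card.empty zero_le)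
  next
    case False
    have "card ?D \<le> card (set (w # filter (\<lambda>v. v \<noteq> w) vs))" by (rule card_mono) (use D2 in auto)
    also have "\<dots> \<le> 1 + length (filter (\<lambda>v. v \<noteq> w) vs)" using card_length [of "w # filter (\<lambda>v. v \<noteq> w) vs"] by simp
    also have "\<dots> \<le> 1 + 2 * L" using D(9) by (simp add: L_def)
    finally show ?thesis using False by linarith
  qed
qed

section \<open>Items and the cost of a run\<close>

text \<open>An item is the page together with the set of the request that opened it.\<close>

definition records :: "(nat \<times> nat list \<times> item) list \<Rightarrow> nat \<Rightarrow> nat set \<Rightarrow> item list" where
  "records h p A = map (\<lambda>x. snd (snd x)) (filter (\<lambda>x. fst x = p \<and> set (fst (snd x)) \<subseteq> A) h)"

text \<open>The log is kept newest first, so the head is the latest request. Appending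
  \<open>r\<close> makes a request without predecessor the name of its own new item.\<close>

definition item_of :: "(nat \<times> nat list \<times> item) list \<Rightarrow> nat \<times> nat list \<Rightarrow> item" where
  "item_of h r = hd (records h (fst r) (set (snd r)) @ [r])"

definition log_request :: "(nat \<times> nat list \<times> item) list \<Rightarrow> nat \<times> nat list \<Rightarrow> (nat \<times> nat list \<times> item) list" where
  "log_request h r = (fst r, snd r, item_of h r) # h"

definition current :: "(nat \<times> nat list \<times> item) list \<Rightarrow> nat \<Rightarrow> nat set \<Rightarrow> item option" where
  "current h p A = (if records h p A = [] then None else Some (hd (records h p A)))"

lemma current_log:
  "current (log_request h r) p A =
     (if p = fst r \<and> set (snd r) \<subseteq> A then Some (item_of h r) else current h p A)"
  by (auto simp: current_def log_request_def records_def)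

lemma item_of_current:
  "item_of h (p, S) = (case current h p (set S) of None \<Rightarrow> (p, S) | Some i \<Rightarrow> i)"
  by (simp add: item_of_def current_def)

text \<open>The condition on \<open>set (snd i)\<close> says that the opening request is on record,
  so that no item is opened twice. The second conjunct is the convexity demanded by
  \<open>cur_ok\<close>.\<close>

definition history_ok :: "nat set set \<Rightarrow> (nat \<times> nat list \<times> item) list \<Rightarrow> bool" where
  "history_ok \<F> h \<longleftrightarrow>
     (\<forall>p A i. current h p A = Some i \<longrightarrow> fst i = p \<and> snd i \<noteq> [] \<and> set (snd i) \<subseteq> A \<and> current h p (set (snd i)) \<noteq> None) \<and>
     (\<forall>p. \<forall>A\<in>\<F>. \<forall>B\<in>\<F>. \<forall>D\<in>\<F>. A \<subseteq> B \<longrightarrow> B \<subseteq> D \<longrightarrow> current h p A \<noteq> None \<longrightarrow>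
        current h p A = current h p D \<longrightarrow> current h p B = current h p A)"

lemma history_okD:
  assumes "history_ok \<F> h" "current h p A = Some i"
  shows "fst i = p" "snd i \<noteq> []" "set (snd i) \<subseteq> A" "current h p (set (snd i)) \<noteq> None"
    and "A \<in> \<F> \<Longrightarrow> B \<in> \<F> \<Longrightarrow> D \<in> \<F> \<Longrightarrow> A \<subseteq> B \<Longrightarrow> B \<subseteq> D \<Longrightarrow> current h p D = Some i \<Longrightarrow> current h p B = Some i"
proof -
  note 1 = assms(1) [unfolded history_ok_def, THEN conjunct1, rule_format, OF assms(2)]
  show "fst i = p" "snd i \<noteq> []" "set (snd i) \<subseteq> A" "current h p (set (snd i)) \<noteq> None" using 1 by blast+
  assume h: "A \<in> \<F>" "B \<in> \<F>" "D \<in> \<F>" "A \<subseteq> B" "B \<subseteq> D" "current h p D = Some i"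
  have "current h p B = current h p A"
    by (rule assms(1) [unfolded history_ok_def, THEN conjunct2, rule_format, OF h(1-5)]) (use assms(2) h(6) in simp_all)
  with assms(2) show "current h p B = Some i" by simp
qed

lemma current_mono: "A \<subseteq> B \<Longrightarrow> current h p A \<noteq> None \<Longrightarrow> current h p B \<noteq> None"
  by (auto simp: current_def records_def filter_empty_conv split: if_splits)

lemma history_ok_Nil: "history_ok \<F> []"
  by (simp add: history_ok_def current_def records_def)

lemma item_of_ok:
  assumes "history_ok \<F> h" "snd r \<noteq> []"
  shows "fst (item_of h r) = fst r" "snd (item_of h r) \<noteq> []" "set (snd (item_of h r)) \<subseteq> set (snd r)"
    "current h (fst r) (set (snd r)) = Some (item_of h r) \<or> current h (fst r) (set (snd r)) = None \<and> item_of h r = r"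
proof -
  show *: "current h (fst r) (set (snd r)) = Some (item_of h r) \<or> current h (fst r) (set (snd r)) = None \<and> item_of h r = r"
    using item_of_current [of h "fst r" "snd r"] by (cases "current h (fst r) (set (snd r))") simp_all
  then show "fst (item_of h r) = fst r" "snd (item_of h r) \<noteq> []" "set (snd (item_of h r)) \<subseteq> set (snd r)"
    using history_okD(1-3) [OF assms(1)] assms(2) by (metis order_refl)+
qed

text \<open>Convexity is at stake only if the new set \<open>T\<close> lies in \<open>D\<close> but
  not in \<open>A\<close>. Then \<open>B\<close> and \<open>T\<close> meet in the set of the opening
  request, so they are comparable. If \<open>B\<close> is contained in \<open>T\<close>, the old
  convexity between \<open>A\<close> and \<open>T\<close> applies.\<close>

lemma history_ok_log:
  assumes ok: "history_ok \<F> h" and lam: "laminar \<F>" and S: "set (snd r) \<in> \<F>" and ne: "snd r \<noteq> []"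
  shows "history_ok \<F> (log_request h r)"
proof -
  define q T \<theta> where "q = fst r" and "T = set (snd r)" and "\<theta> = item_of h r"
  have cn: "current (log_request h r) p A = (if p = q \<and> T \<subseteq> A then Some \<theta> else current h p A)" for p A
    by (simp add: current_log q_def T_def \<theta>_def)
  note I = item_of_ok [OF ok ne, folded q_def T_def \<theta>_def]
  have up: "current (log_request h r) p A \<noteq> None" if "current h p A \<noteq> None" for p A using that cn by simp
  have 1: "fst i = p \<and> snd i \<noteq> [] \<and> set (snd i) \<subseteq> A \<and> current (log_request h r) p (set (snd i)) \<noteq> None"
    if c: "current (log_request h r) p A = Some i" for p A i
  proof (cases "p = q \<and> T \<subseteq> A")
    case True
    then have i: "i = \<theta>" using c cn by simp
    have "current (log_request h r) q (set (snd \<theta>)) \<noteq> None"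
      using I(4)
    proof
      assume "current h q T = Some \<theta>"
      from history_okD(4) [OF ok this] up show ?thesis by blast
    next
      assume "current h q T = None \<and> \<theta> = r"
      then show ?thesis using cn [of q T] by (simp add: T_def)
    qed
    then show ?thesis using i True I(1-3) by auto
  next
    case False
    have "current h p A = Some i" using c unfolding cn if_not_P [OF False] .
    from history_okD(1-4) [OF ok this] up show ?thesis by blast
  qed
  have 2: "current (log_request h r) p B = current (log_request h r) p A"
    if h: "A \<in> \<F>" "B \<in> \<F>" "D \<in> \<F>" "A \<subseteq> B" "B \<subseteq> D" "current (log_request h r) p A \<noteq> None"
      "current (log_request h r) p A = current (log_request h r) p D" for p A B D
  proof (cases "p = q \<and> T \<subseteq> D")
    case False
    then have "current (log_request h r) p A = current h p A" "current (log_request h r) p B = current h p B"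
      "current (log_request h r) p D = current h p D" using cn h(4,5) by auto
    then show ?thesis using history_okD(5) [OF ok, of p A] h by (metis not_Some_eq)
  next
    case TD: True
    show ?thesis
    proof (cases "T \<subseteq> A")
      case True
      then show ?thesis using TD cn h(4) by auto
    next
      case F: False
      have A: "current h q A = Some \<theta>" using h(7) cn TD F by simp
      note O = history_okD(2-4) [OF ok A]
      \<comment> \<open>If \<open>\<theta>\<close> were opened only now, \<open>A\<close> could not
        want it already, since its opening request would be on record.\<close>
      have TS: "current h q T = Some \<theta>" using I(4) O(3) T_def by metis
      obtain x where x: "x \<in> set (snd \<theta>)" using O(1) by (metis last_in_set)
      have xT: "x \<in> T" "x \<in> A" "x \<in> B" using x I(3) O(2) h(4) by auto
      show ?thesis
      proof (cases "T \<subseteq> B")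
        case True
        then show ?thesis using TD cn A F by simp
      next
        case False
        have TF: "T \<in> \<F>" using S T_def by simp
        have "B \<inter> T = {} \<or> B \<subseteq> T \<or> T \<subseteq> B" using lam h(2) TF unfolding laminar_def by blast
        then have "B \<subseteq> T" using False xT by blast
        from history_okD(5) [OF ok A h(1,2) TF h(4) this TS] show ?thesis using TD cn A F False by simp
      qed
    qed
  qed
  show ?thesis unfolding history_ok_def using 1 2 by blast
qed

section \<open>A linear extension of inclusion, and cost counted by loads\<close>

lemma sorted_wrt_neq: "sorted_wrt (\<lambda>A B. A \<noteq> B) xs \<longleftrightarrow> distinct xs"
  by (induction xs) auto

definition insert_set :: "nat list list \<Rightarrow> nat list \<Rightarrow> nat list list" where
  "insert_set Rs R = filter (\<lambda>A. set A \<subseteq> set R) Rs @ R # filter (\<lambda>A. \<not> set A \<subseteq> set R) Rs"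

definition order_sets :: "nat list list \<Rightarrow> nat list list" where
  "order_sets Rs = foldl insert_set [] Rs"

lemma order_sets_snoc: "order_sets (Rs @ [R]) = insert_set (order_sets Rs) R"
  by (simp add: order_sets_def)

lemma set_order_sets: "set (order_sets Rs) = set Rs"
  by (induction Rs rule: rev_induct) (auto simp: order_sets_snoc insert_set_def, simp add: order_sets_def)

text \<open>Moving the subsets of \<open>R\<close> to the front is harmless: a set that stays behind
  is contained in none of them, as it would then be contained in \<open>R\<close>.\<close>

lemma sorted_order_sets:
  "distinct (map set Rs) \<Longrightarrow> sorted_wrt (\<lambda>A B. \<not> set B \<subseteq> set A) (order_sets Rs)"
proof (induction Rs rule: rev_induct)
  case Nil
  then show ?case by (simp add: order_sets_def)
next
  case (snoc R Rs)
  then have IH: "sorted_wrt (\<lambda>A B. \<not> set B \<subseteq> set A) (order_sets Rs)" by simp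
  have R: "set A \<noteq> set R" if "A \<in> set (order_sets Rs)" for A
    using snoc.prems that by (auto simp: set_order_sets)
  show ?case
    unfolding order_sets_snoc insert_set_def sorted_wrt_append sorted_wrt.simps
  proof (intro conjI ballI)
    fix A B assume A: "A \<in> set (filter (\<lambda>A. set A \<subseteq> set R) (order_sets Rs))"
      and B: "B \<in> set (R # filter (\<lambda>A. \<not> set A \<subseteq> set R) (order_sets Rs))"
    show "\<not> set B \<subseteq> set A"
    proof (cases "B = R")
      case True
      then show ?thesis using A R [of A] by auto
    next
      case False
      then show ?thesis using A B by auto
    qed
  qed (auto intro: sorted_wrt_filter [OF IH])
qed

definition initial_nodes :: "nat list list \<Rightarrow> 'x node list" where
  "initial_nodes FL = map (\<lambda>R. (R, ([], []), [])) (order_sets FL)"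

definition loads :: "config \<Rightarrow> config \<Rightarrow> nat set \<Rightarrow> nat set" where
  "loads C C' A = {s \<in> A. C' s \<noteq> None \<and> C' s \<noteq> C s}"

definition before :: "config list \<Rightarrow> nat \<Rightarrow> config" where
  "before Cs t = (if t = 0 then \<lambda>_. None else Cs ! (t - 1))"

lemma cost_loads: "cost I Cs = (\<Sum>t<length Cs. card (loads (before Cs t) (Cs ! t) {1..slots I}))"
proof -
  have "card {(p, s). s \<in> {1..slots I} \<and> retrieved Cs t p s} = card (loads (before Cs t) (Cs ! t) {1..slots I})" for t
  proof -
    have "bij_betw snd {(p, s). s \<in> {1..slots I} \<and> retrieved Cs t p s} (loads (before Cs t) (Cs ! t) {1..slots I})"
      by (rule bij_betwI [where g = "\<lambda>s. (the ((Cs ! t) s), s)"])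
        (auto simp: retrieved_def loads_def before_def)
    then show ?thesis by (rule bij_betw_same_card)
  qed
  then show ?thesis by (simp add: cost_def)
qed

context laminar_tree
begin

text \<open>For requests not contained in \<open>R\<close>: they alter the wanted item of no set
  inside \<open>R\<close>.\<close>

lemma charged_cong:
  assumes "charged C cur st F B" "\<And>p A. A \<in> \<T> \<Longrightarrow> cur' p A = cur p A"
  shows "charged C cur' st F B"
proof -
  have r: "rank (cur' p) (held C des r) = rank (cur p) (held C des r)" for p des r
  proof -
    have "{A \<in> held C des r. cur' p A = None} = {A \<in> held C des r. cur p A = None}"
      "{i. \<exists>A\<in>held C des r. cur' p A = Some i} = {i. \<exists>A\<in>held C des r. cur p A = Some i}"
      using assms(2) by (auto simp: held_def)
    then show ?thesis by (simp add: rank_def)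
  qed
  have l: "label (cur' p) (held C des r) = label (cur p) (held C des r)" for p des r
  proof (cases "held C des r = {}")
    case False
    then have "\<Union>(held C des r) \<in> \<T>" using held_top heldD by blast
    then show ?thesis using False assms(2) by (simp add: label_def)
  qed (simp add: label_def)
  have "account C des cur' = account C des cur" "labels C des cur' = labels C des cur" for des
    by (simp_all add: account_def labels_def r l)
  then show ?thesis using assms(1) by (simp add: charged_def)
qed

end

section \<open>Runs on an instance given by lists\<close>

locale paging_lists =
  fixes k :: nat and FL :: "nat list list" and reqs :: "(nat \<times> nat list) list"
  assumes FL_ok: "\<And>R. R \<in> set FL \<Longrightarrow> R \<noteq> [] \<and> distinct R \<and> set R \<subseteq> {1..k}"
    and FL_distinct: "distinct (map set FL)"
    and FL_laminar: "laminar (set ` set FL)"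
    and reqs_FL: "\<And>r. r \<in> set reqs \<Longrightarrow> snd r \<in> set FL"
begin

definition hist :: "nat \<Rightarrow> (nat \<times> nat list \<times> item) list" where
  "hist t = foldl log_request [] (take t reqs)"

definition S :: "nat \<Rightarrow> nat list" where "S t = snd (reqs ! t)"
definition q :: "nat \<Rightarrow> nat" where "q t = fst (reqs ! t)"
definition item :: "nat \<Rightarrow> item" where "item t = item_of (hist t) (reqs ! t)"

text \<open>The pools of \<open>R\<close> see neither the placement in slots nor the other sets, so
  they can be analysed for each \<open>R\<close> separately.\<close>

primrec eng :: "(nat \<Rightarrow> 'x) \<Rightarrow> nat list \<Rightarrow> nat \<Rightarrow> item list \<times> ('x, item) pool list" where
  "eng aux R 0 = ([], [])"
| "eng aux R (Suc t) = (if set (S t) \<subseteq> set R then engine_step (length R) (aux t) (item t) (eng aux R t) else eng aux R t)"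

primrec nodes_at :: "(nat list \<Rightarrow> 'x chooser) \<Rightarrow> (nat \<Rightarrow> 'x) \<Rightarrow> nat \<Rightarrow> 'x node list" where
  "nodes_at ch aux 0 = initial_nodes FL"
| "nodes_at ch aux (Suc t) = serve ch (nodes_at ch aux t) (S t, item t, aux t)"

lemma hist_0 [simp]: "hist 0 = []" by (simp add: hist_def)

lemma hist_Suc: "t < length reqs \<Longrightarrow> hist (Suc t) = log_request (hist t) (reqs ! t)"
  by (simp add: hist_def take_Suc_conv_app_nth)

lemma S_FL: "t < length reqs \<Longrightarrow> S t \<in> set FL"
  using reqs_FL by (simp add: S_def)

lemma S_ne: "t < length reqs \<Longrightarrow> S t \<noteq> []"
  using S_FL FL_ok by blast

lemma hist_ok: "t \<le> length reqs \<Longrightarrow> history_ok (set ` set FL) (hist t)"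
proof (induction t)
  case (Suc t)
  then have t: "t < length reqs" by simp
  show ?case unfolding hist_Suc [OF t]
    by (rule history_ok_log) (use Suc t FL_laminar S_FL [OF t] S_ne [OF t] in \<open>auto simp: S_def\<close>)
qed (simp add: history_ok_Nil)

lemma item_facts:
  assumes "t < length reqs"
  shows "fst (item t) = q t" "snd (item t) \<noteq> []" "set (snd (item t)) \<subseteq> set (S t)"
    "current (hist t) (q t) (set (S t)) = Some (item t) \<or> current (hist t) (q t) (set (S t)) = None"
  using item_of_ok [OF hist_ok, of t "reqs ! t"] assms S_ne [OF assms] by (auto simp: item_def q_def S_def)

lemma eng_inv: "R \<in> set FL \<Longrightarrow> engine_inv (length R) (eng aux R t)"
proof (induction t)
  case 0
  then show ?case by (simp add: engine_inv_def engine_inv0_def)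
next
  case (Suc t)
  then show ?case using FL_ok [of R] engine_inv_step [of "length R" "eng aux R t"] by auto
qed

lemma nodes_at_inv:
  assumes choice: "\<And>R. choice_ok (ch R)" and "t \<le> length reqs"
  shows "nodes_ok ch (nodes_at ch aux t) \<and>
    map (\<lambda>n. (fst n, engine n)) (nodes_at ch aux t) = map (\<lambda>R. (R, eng aux R t)) (order_sets FL)"
  using assms(2)
proof (induction t)
  case 0
  have a: "map area (initial_nodes FL :: 'b node list) = map set (order_sets FL)"
    by (simp add: initial_nodes_def area_def)
  then have b: "area ` set (initial_nodes FL :: 'b node list) = set ` set FL"
    by (metis list.set_map set_order_sets)
  have "node_ok ch n" if n: "n \<in> set (initial_nodes FL)" for n
  proof -
    obtain R where "R \<in> set FL" "n = (R, ([], []), [])" using n by (auto simp: initial_nodes_def set_order_sets)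
    with FL_ok [of R] show ?thesis
      by (simp add: node_ok_def engine_def cells_def area_def engine_inv_def engine_inv0_def cache_def)
  qed
  moreover have "coherent (set ` set FL) (initial_nodes FL :: 'b node list)"
    by (auto simp: coherent_def initial_nodes_def cells_def)
  ultimately have "nodes_ok ch (initial_nodes FL)"
    unfolding nodes_ok_def a b using sorted_order_sets [OF FL_distinct] FL_laminar by (simp add: sorted_wrt_map)
  then show ?case by (simp add: initial_nodes_def engine_def)
next
  case (Suc t)
  let ?ns = "nodes_at ch aux t"
  have t: "t < length reqs" using Suc.prems by simp
  have ok: "nodes_ok ch ?ns" and m: "map (\<lambda>n. (fst n, engine n)) ?ns = map (\<lambda>R. (R, eng aux R t)) (order_sets FL)"
    using Suc by simp_all
  have "map fst (map (\<lambda>n. (fst n, engine n)) ?ns) = order_sets FL" unfolding m by (simp add: comp_def)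
  then have f: "map fst ?ns = order_sets FL" by (simp add: comp_def)
  have "area ` set ?ns = set ` fst ` set ?ns" by (auto simp: area_def)
  also have "\<dots> = set ` set FL" using f by (metis list.set_map set_order_sets)
  finally have SA: "set (S t) \<in> area ` set ?ns" using S_FL [OF t] by simp
  note st = serve_step [OF choice ok SA item_facts(2,3) [OF t], of "aux t"]
  have "map (\<lambda>n. (fst n, engine n)) (nodes_at ch aux (Suc t)) =
      map (\<lambda>x. (fst x, if set (S t) \<subseteq> set (fst x) then engine_step (length (fst x)) (aux t) (item t) (snd x) else snd x))
        (map (\<lambda>n. (fst n, engine n)) ?ns)"
    using st(2) by (simp add: area_def)
  also have "\<dots> = map (\<lambda>R. (R, eng aux R (Suc t))) (order_sets FL)" unfolding m by simp
  finally show ?case using st(1) by simp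
qed

lemma distinct_order_sets: "distinct (order_sets FL)"
proof -
  have "sorted_wrt (\<lambda>A B. A \<noteq> B) (order_sets FL)"
    by (rule sorted_wrt_mono_rel [OF _ sorted_order_sets [OF FL_distinct]]) auto
  then show ?thesis by (simp add: sorted_wrt_neq)
qed

lemma finite_loads: "finite A \<Longrightarrow> finite (loads C C' A)" by (simp add: loads_def)

lemma step_cost:
  assumes choice: "\<And>R. choice_ok (ch R)" and t: "t < length reqs"
  shows "satisfies (config_of (nodes_at ch aux (Suc t))) (q t, set (S t))"
    and "card (loads (config_of (nodes_at ch aux t)) (config_of (nodes_at ch aux (Suc t))) {1..k})
      \<le> 3 * (\<Sum>R\<in>set FL. if set (S t) \<subseteq> set R then miss (ch R) (item t) (eng aux R t) else 0)"
proof -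
  let ?ns = "nodes_at ch aux t"
  have inv: "nodes_ok ch ?ns \<and> map (\<lambda>n. (fst n, engine n)) ?ns = map (\<lambda>R. (R, eng aux R t)) (order_sets FL)"
    by (rule nodes_at_inv [OF choice]) (use t in simp)
  note ok = conjunct1 [OF inv] and m = conjunct2 [OF inv]
  have "map fst (map (\<lambda>n. (fst n, engine n)) ?ns) = order_sets FL" unfolding m by (simp add: comp_def)
  then have f: "map fst ?ns = order_sets FL" by (simp add: comp_def)
  have "area ` set ?ns = set ` fst ` set ?ns" by (auto simp: area_def)
  also have "\<dots> = set ` set FL" using f by (metis list.set_map set_order_sets)
  finally have SA: "set (S t) \<in> area ` set ?ns" using S_FL [OF t] by simp
  note st = serve_step [OF choice ok SA item_facts(2,3) [OF t], of "aux t"]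
  show "satisfies (config_of (nodes_at ch aux (Suc t))) (q t, set (S t))"
    using st(3) item_facts(1) [OF t] by simp
  have "card (loads (config_of ?ns) (config_of (nodes_at ch aux (Suc t))) {1..k}) \<le>
     card {s. config_of (nodes_at ch aux (Suc t)) s \<noteq> None \<and> config_of (nodes_at ch aux (Suc t)) s \<noteq> config_of ?ns s}"
    using st(4) by (intro card_mono) (auto simp: loads_def)
  also have "\<dots> \<le> 3 * sum_list (map (\<lambda>x. if set (S t) \<subseteq> set (fst x) then miss (ch (fst x)) (item t) (snd x) else 0)
        (map (\<lambda>n. (fst n, engine n)) ?ns))"
    using st(5) by (simp only: area_def map_map comp_def fst_conv snd_conv nodes_at.simps)
  also have "sum_list (map (\<lambda>x. if set (S t) \<subseteq> set (fst x) then miss (ch (fst x)) (item t) (snd x) else 0)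
        (map (\<lambda>n. (fst n, engine n)) ?ns)) =
      (\<Sum>R\<leftarrow>order_sets FL. if set (S t) \<subseteq> set R then miss (ch R) (item t) (eng aux R t) else 0)"
    unfolding m by (simp only: map_map comp_def fst_conv snd_conv)
  also have "\<dots> = (\<Sum>R\<in>set FL. if set (S t) \<subseteq> set R then miss (ch R) (item t) (eng aux R t) else 0)"
    using distinct_order_sets by (simp add: sum_list_distinct_conv_sum_set set_order_sets)
  finally show "card (loads (config_of ?ns) (config_of (nodes_at ch aux (Suc t))) {1..k})
      \<le> 3 * (\<Sum>R\<in>set FL. if set (S t) \<subseteq> set R then miss (ch R) (item t) (eng aux R t) else 0)" .
qed

definition misses :: "(nat list \<Rightarrow> 'x chooser) \<Rightarrow> (nat \<Rightarrow> 'x) \<Rightarrow> nat list \<Rightarrow> nat" where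
  "misses ch aux R = (\<Sum>t<length reqs. if set (S t) \<subseteq> set R then miss (ch R) (item t) (eng aux R t) else 0)"

definition freshes :: "(nat \<Rightarrow> 'x) \<Rightarrow> nat list \<Rightarrow> nat" where
  "freshes aux R = (\<Sum>t<length reqs. if set (S t) \<subseteq> set R then fresh (item t) (eng aux R t) else 0)"

lemma config_of_initial: "config_of (initial_nodes FL) = (\<lambda>_. None)"
proof
  fix s
  have "shown (map (\<lambda>R. (R, ([], []), [])) Rs :: 'x node list) s = []" for Rs
    by (induction Rs rule: rev_induct) (auto simp: shown_def)
  then show "config_of (initial_nodes FL :: 'x node list) s = None" by (simp add: config_of_def initial_nodes_def)
qed

lemma run_cost:
  assumes choice: "\<And>R. choice_ok (ch R)"
    and I: "slots I = k" "requests I = map (\<lambda>r. (fst r, set (snd r))) reqs"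
    and Cs: "Cs = map (\<lambda>t. config_of (nodes_at ch aux t)) [1..<Suc (length reqs)]"
  shows "solution I Cs" and "cost I Cs \<le> 3 * (\<Sum>R\<in>set FL. misses ch aux R)"
proof -
  have len: "length Cs = length reqs" by (simp add: Cs del: upt_Suc)
  have nth: "Cs ! t = config_of (nodes_at ch aux (Suc t))" if "t < length reqs" for t
    using that by (simp add: Cs del: upt_Suc nodes_at.simps)
  \<comment> \<open>The empty display before the first request matches the convention that
    everything present in the first configuration has been retrieved.\<close>
  have bef: "before Cs t = config_of (nodes_at ch aux t)" if "t < length reqs" for t
    using that nth [of "t - 1"] by (cases t) (simp_all add: before_def config_of_initial del: nodes_at.simps(2))
  show "solution I Cs"
    unfolding solution_def list_all2_conv_all_nth
    using step_cost(1) [OF choice] nth len I(2) by (auto simp: q_def S_def simp del: nodes_at.simps)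
  have "cost I Cs = (\<Sum>t<length reqs. card (loads (config_of (nodes_at ch aux t)) (config_of (nodes_at ch aux (Suc t))) {1..k}))"
    unfolding cost_loads len I(1) by (rule sum.cong) (simp_all add: bef nth del: nodes_at.simps)
  also have "\<dots> \<le> (\<Sum>t<length reqs. 3 * (\<Sum>R\<in>set FL. if set (S t) \<subseteq> set R then miss (ch R) (item t) (eng aux R t) else 0))"
    by (rule sum_mono) (use step_cost(2) [OF choice] in auto)
  also have "\<dots> = 3 * (\<Sum>R\<in>set FL. misses ch aux R)"
    unfolding misses_def sum_distrib_left [symmetric] by (subst sum.swap) (rule refl)
  finally show "cost I Cs \<le> 3 * (\<Sum>R\<in>set FL. misses ch aux R)" .
qed

text \<open>At each time the solution first moves, which collects one unit per set inside
  \<open>R\<close> around every retrieved slot; then the request is served without any charge. The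
  reserve being nonnegative, the fresh requests cannot exceed what was collected.\<close>

lemma freshes_le:
  assumes R: "R \<in> set FL" and sol: "list_all2 satisfies Cs (map (\<lambda>r. (fst r, set (snd r))) reqs)"
  shows "freshes aux R \<le> (\<Sum>t<length reqs. \<Sum>w\<in>loads (before Cs t) (Cs ! t) (set R). card {A \<in> set ` set FL. A \<subseteq> set R \<and> w \<in> A})"
proof -
  define \<T> where "\<T> = {A \<in> set ` set FL. A \<subseteq> set R}"
  interpret laminar_tree \<T> "set R"
    using R FL_laminar by unfold_locales (auto simp: \<T>_def laminar_def)
  have len: "length Cs = length reqs" using sol by (simp add: list_all2_conv_all_nth)
  have cardR: "card (set R) = length R" using FL_ok [OF R] by (simp add: distinct_card)
  have cok: "cur_ok (current (hist t))" if "t \<le> length reqs" for t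
    unfolding cur_ok_def
  proof (intro conjI allI ballI impI)
    fix p A B assume "A \<in> \<T>" "B \<in> \<T>" "A \<subseteq> B" "current (hist t) p A \<noteq> None"
    then show "current (hist t) p B \<noteq> None" using current_mono by blast
  next
    fix p A B D assume h: "A \<in> \<T>" "B \<in> \<T>" "D \<in> \<T>" "A \<subseteq> B" "B \<subseteq> D"
      "current (hist t) p A \<noteq> None" "current (hist t) p A = current (hist t) p D"
    then obtain i where i: "current (hist t) p A = Some i" by blast
    show "current (hist t) p B = current (hist t) p A"
      using history_okD(5) [OF hist_ok [OF that] i, of B D] h i by (simp add: \<T>_def)
  qed
  \<comment> \<open>Only slots of \<open>R\<close> are ever updated, so the configuration in the
    invariant agrees with the solution on \<open>R\<close> and not elsewhere.\<close>
  have main: "\<exists>C. (\<forall>s\<in>set R. C s = before Cs t s) \<and>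
    charged C (current (hist t)) (eng aux R t) (\<Sum>u<t. if set (S u) \<subseteq> set R then fresh (item u) (eng aux R u) else 0)
      (\<Sum>u<t. \<Sum>w\<in>loads (before Cs u) (Cs ! u) (set R). card {A \<in> \<T>. w \<in> A})" if "t \<le> length reqs" for t
    using that
  proof (induction t)
    case 0
    show ?case using charged_init by (intro exI [of _ "\<lambda>_. None"]) (simp add: before_def)
  next
    case (Suc t)
    then have t: "t < length reqs" by simp
    let ?F = "\<Sum>u<t. if set (S u) \<subseteq> set R then fresh (item u) (eng aux R u) else 0"
    let ?B = "\<lambda>t. \<Sum>u<t. \<Sum>w\<in>loads (before Cs u) (Cs ! u) (set R). card {A \<in> \<T>. w \<in> A}"
    obtain C where C: "\<forall>s\<in>set R. C s = before Cs t s" and ch: "charged C (current (hist t)) (eng aux R t) ?F (?B t)"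
      using Suc t by auto
    define C' where "C' = override_on C (Cs ! t) (set R)"
    have "(\<Sum>w\<in>set R. if (Cs ! t) w \<noteq> None \<and> (Cs ! t) w \<noteq> C w then card {A \<in> \<T>. w \<in> A} else 0) =
        (\<Sum>w\<in>loads (before Cs t) (Cs ! t) (set R). card {A \<in> \<T>. w \<in> A})"
      unfolding loads_def using C by (subst sum.inter_filter) (auto intro!: sum.cong)
    then have ch1: "charged C' (current (hist t)) (eng aux R t) ?F (?B (Suc t))"
      using charged_change [OF ch cok, of "Cs ! t"] t by (simp add: C'_def)
    have C'R: "\<forall>s\<in>set R. C' s = before Cs (Suc t) s" by (simp add: C'_def before_def)
    have up: "current (hist (Suc t)) p A = (if p = q t \<and> set (S t) \<subseteq> A then Some (item t) else current (hist t) p A)" for p A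
      unfolding hist_Suc [OF t] current_log by (simp add: q_def S_def item_def)
    show ?case
    proof (cases "set (S t) \<subseteq> set R")
      case True
      have ST: "set (S t) \<in> \<T>" using True S_FL [OF t] by (simp add: \<T>_def)
      have "satisfies (Cs ! t) (q t, set (S t))"
        using sol t len by (simp add: list_all2_conv_all_nth q_def S_def)
      then obtain s where s: "s \<in> set (S t)" "(Cs ! t) s = Some (q t)" by auto
      then have "C' s = Some (q t)" using True by (auto simp: C'_def)
      then have lv: "live C' (q t) (set (S t))" using s(1) by (auto simp: live_def)
      have "charged C' (current (hist (Suc t))) (engine_step (card (set R)) (aux t) (item t) (eng aux R t))
          (?F + fresh (item t) (eng aux R t)) (?B (Suc t))"
        by (rule charged_request [OF ch1 cok ST lv _ item_facts(4) [OF t] up]) (use t eng_inv [OF R] cardR in simp_all)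
      then show ?thesis using True C'R cardR by (intro exI [of _ C']) simp
    next
      case False
      have "charged C' (current (hist (Suc t))) (eng aux R t) ?F (?B (Suc t))"
        by (rule charged_cong [OF ch1]) (use False up in \<open>auto simp: \<T>_def\<close>)
      then show ?thesis using False C'R by (intro exI [of _ C']) simp
    qed
  qed
  from main [of "length reqs"] charged_le have "freshes aux R \<le>
      (\<Sum>t<length reqs. \<Sum>w\<in>loads (before Cs t) (Cs ! t) (set R). card {A \<in> \<T>. w \<in> A})"
    unfolding freshes_def by blast
  moreover have "{A \<in> \<T>. w \<in> A} = {A \<in> set ` set FL. A \<subseteq> set R \<and> w \<in> A}" for w by (auto simp: \<T>_def)
  ultimately show ?thesis by simp
qed

end

text \<open>The sets through a point form a chain and can be listed in increasing order. The maximum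
  defining the height exists because such lists have no repetitions.\<close>

lemma card_chain_le_height:
  assumes fin: "finite F" and lam: "laminar F"
  shows "card {A \<in> F. w \<in> A} \<le> laminar_height F"
proof -
  have "\<exists>Rs. set Rs = D \<and> sorted_wrt (\<subset>) Rs \<and> length Rs = card D"
    if "finite D" "\<And>A B. A \<in> D \<Longrightarrow> B \<in> D \<Longrightarrow> A \<subseteq> B \<or> B \<subseteq> A" for D :: "'a set set"
    using that
  proof (induction D rule: finite_psubset_induct)
    case (psubset D)
    show ?case
    proof (cases "D = {}")
      case False
      then obtain M where M: "M \<in> D" "\<And>A. A \<in> D \<Longrightarrow> M \<subseteq> A \<Longrightarrow> A = M"
        using finite_has_maximal [OF psubset.hyps(1)] by metis
      then have le: "A \<subseteq> M" if "A \<in> D" for A using that psubset.prems by blast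
      obtain Rs where Rs: "set Rs = D - {M}" "sorted_wrt (\<subset>) Rs" "length Rs = card (D - {M})"
        using psubset.IH [of "D - {M}"] psubset.prems M(1) by (metis Diff_iff Diff_subset insertI1 psubsetI)
      have "sorted_wrt (\<subset>) (Rs @ [M])" using Rs le by (auto simp: sorted_wrt_append)
      moreover have "set (Rs @ [M]) = D" using Rs(1) M(1) by auto
      moreover have "length (Rs @ [M]) = card D" using Rs(3) card.remove [OF psubset.hyps(1) M(1)] by simp
      ultimately show ?thesis by blast
    qed simp
  qed
  from this [of "{A \<in> F. w \<in> A}"] obtain Rs where Rs: "set Rs = {A \<in> F. w \<in> A}" "sorted_wrt (\<subset>) Rs"
    "length Rs = card {A \<in> F. w \<in> A}"
    using fin lam by (auto simp: laminar_def)
  let ?L = "{length Rs |Rs. set Rs \<subseteq> F \<and> sorted_wrt (\<subset>) Rs}"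
  have "length Rs \<le> card F" if "set Rs \<subseteq> F" "sorted_wrt (\<subset>) Rs" for Rs :: "'a set list"
  proof -
    have "distinct Rs" unfolding sorted_wrt_neq [symmetric]
      by (rule sorted_wrt_mono_rel [OF _ that(2)]) auto
    then show ?thesis using that(1) fin by (metis card_mono distinct_card)
  qed
  then have "?L \<subseteq> {..card F}" by auto
  then have "finite ?L" by (rule finite_subset) simp
  moreover have "card {A \<in> F. w \<in> A} \<in> ?L" using Rs by (intro CollectI exI [of _ Rs]) auto
  ultimately show ?thesis unfolding laminar_height_def by (rule Max_ge)
qed

context paging_lists
begin

text \<open>One factor \<open>h\<close> bounds the charge of a retrieval within a single
  \<open>R\<close>; the other counts the sets \<open>R\<close> around its slot, in each of which it
  is charged.\<close>

lemma sum_freshes_le: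
  assumes I: "slots I = k" "requests I = map (\<lambda>r. (fst r, set (snd r))) reqs" and sol: "solution I Cs"
  shows "(\<Sum>R\<in>set FL. freshes aux R) \<le> (laminar_height (set ` set FL))\<^sup>2 * cost I Cs"
proof -
  define h where "h = laminar_height (set ` set FL)"
  have sol': "list_all2 satisfies Cs (map (\<lambda>r. (fst r, set (snd r))) reqs)" using sol I by (simp add: solution_def)
  have len: "length Cs = length reqs" using sol' by (simp add: list_all2_conv_all_nth)
  have ch: "card {A \<in> set ` set FL. w \<in> A} \<le> h" for w
    unfolding h_def by (rule card_chain_le_height) (simp_all add: FL_laminar)
  have inj: "inj_on set (set FL)" using FL_distinct by (simp add: distinct_map)
  have "(\<Sum>R\<in>set FL. freshes aux R) \<le>
      (\<Sum>R\<in>set FL. \<Sum>t<length reqs. \<Sum>w\<in>loads (before Cs t) (Cs ! t) (set R). h)"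
  proof (rule sum_mono)
    fix R assume R: "R \<in> set FL"
    have "freshes aux R \<le> (\<Sum>t<length reqs. \<Sum>w\<in>loads (before Cs t) (Cs ! t) (set R). card {A \<in> set ` set FL. A \<subseteq> set R \<and> w \<in> A})"
      by (rule freshes_le [OF R sol'])
    also have "\<dots> \<le> (\<Sum>t<length reqs. \<Sum>w\<in>loads (before Cs t) (Cs ! t) (set R). h)"
      by (intro sum_mono order_trans [OF _ ch] card_mono) auto
    finally show "freshes aux R \<le> (\<Sum>t<length reqs. \<Sum>w\<in>loads (before Cs t) (Cs ! t) (set R). h)" .
  qed
  also have "\<dots> = (\<Sum>t<length reqs. \<Sum>R\<in>set FL. \<Sum>w\<in>loads (before Cs t) (Cs ! t) (set R). h)"
    by (rule sum.swap)
  also have "\<dots> \<le> (\<Sum>t<length reqs. h\<^sup>2 * card (loads (before Cs t) (Cs ! t) {1..k}))"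
  proof (rule sum_mono)
    fix t
    let ?L = "loads (before Cs t) (Cs ! t)"
    have L: "?L (set R) = {w \<in> ?L {1..k}. w \<in> set R}" if "R \<in> set FL" for R
      using FL_ok [OF that] by (auto simp: loads_def)
    have "(\<Sum>R\<in>set FL. \<Sum>w\<in>?L (set R). h) = (\<Sum>R\<in>set FL. \<Sum>w\<in>?L {1..k}. if w \<in> set R then h else 0)"
    proof (rule sum.cong [OF refl])
      fix R assume "R \<in> set FL"
      show "(\<Sum>w\<in>?L (set R). h) = (\<Sum>w\<in>?L {1..k}. if w \<in> set R then h else 0)"
        unfolding L [OF \<open>R \<in> set FL\<close>] by (rule sum.inter_filter) (simp add: finite_loads)
    qed
    also have "\<dots> = (\<Sum>w\<in>?L {1..k}. \<Sum>R\<in>set FL. if w \<in> set R then h else 0)" by (rule sum.swap)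
    also have "\<dots> \<le> (\<Sum>w\<in>?L {1..k}. h * h)"
    proof (rule sum_mono)
      fix w
      have "(\<Sum>R\<in>set FL. if w \<in> set R then h else 0) = (\<Sum>A\<in>set ` set FL. if w \<in> A then h else 0)"
        using inj by (simp add: sum.reindex)
      also have "\<dots> = (\<Sum>A\<in>{A \<in> set ` set FL. w \<in> A}. h)" by (rule sum.inter_filter [symmetric]) simp
      also have "\<dots> = card {A \<in> set ` set FL. w \<in> A} * h" by simp
      also have "\<dots> \<le> h * h" using ch [of w] by (rule mult_right_mono) simp
      finally show "(\<Sum>R\<in>set FL. if w \<in> set R then h else 0) \<le> h * h" .
    qed
    also have "\<dots> = h\<^sup>2 * card (?L {1..k})" by (simp add: power2_eq_square)
    finally show "(\<Sum>R\<in>set FL. \<Sum>w\<in>?L (set R). h) \<le> h\<^sup>2 * card (?L {1..k})" .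
  qed
  also have "\<dots> = h\<^sup>2 * cost I Cs" unfolding cost_loads len I(1) by (simp add: sum_distrib_left)
  finally show ?thesis unfolding h_def .
qed

end

section \<open>Polynomial-time functions\<close>

text \<open>Injectivity lets the primitive \<open>Equal\<close>, which compares trees, decide
  equality of values.\<close>

class enc =
  fixes enc :: "'a \<Rightarrow> bintree"
  assumes enc_inj: "enc x = enc y \<Longrightarrow> x = y"

abbreviation sz :: "'a::enc \<Rightarrow> nat" where "sz x \<equiv> size (enc x)"

lemma enc_bool_inj: "enc_bool a = enc_bool b \<Longrightarrow> a = b"
  by (cases a; cases b) simp_all

lemma enc_nat_inj: "enc_nat m = enc_nat n \<Longrightarrow> m = n"
proof (induction m arbitrary: n rule: less_induct)
  case (less m)
  show ?case
  proof (cases "m = 0 \<or> n = 0")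
    case True
    then show ?thesis using less.prems
      by (subst (asm) enc_nat.simps, subst (asm) (2) enc_nat.simps) (auto split: if_splits)
  next
    case False
    then have "Pair (enc_bool (odd m)) (enc_nat (m div 2)) = Pair (enc_bool (odd n)) (enc_nat (n div 2))"
      using less.prems by (subst (asm) enc_nat.simps, subst (asm) (2) enc_nat.simps) simp
    then have "odd m = odd n" "m div 2 = n div 2"
      using enc_bool_inj less.IH [of "m div 2" "n div 2"] False by auto
    then show ?thesis by (metis div_mult_mod_eq odd_iff_mod_2_eq_one not_mod_2_eq_1_eq_0)
  qed
qed

lemma enc_list_simps [simp]: "enc_list e [] = Tip" "enc_list e (x # xs) = Pair (e x) (enc_list e xs)"
  by (simp_all add: enc_list_def)

lemma enc_list_inj: "(\<And>x y. e x = e y \<Longrightarrow> x = y) \<Longrightarrow> enc_list e xs = enc_list e ys \<Longrightarrow> xs = ys"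
proof (induction xs arbitrary: ys)
  case Nil then show ?case by (cases ys) simp_all
next
  case (Cons x xs) then show ?case by (cases ys) auto
qed

instantiation bool :: enc begin
definition "enc = enc_bool"
instance by standard (auto simp: enc_bool_def enc_bool_inj)
end

instantiation nat :: enc begin
definition "enc = enc_nat"
instance by standard (auto simp: enc_nat_def enc_nat_inj)
end

instantiation prod :: (enc, enc) enc begin
definition "enc z = Pair (enc (fst z)) (enc (snd z))"
instance by standard (auto simp: enc_prod_def prod_eq_iff dest: enc_inj)
end

instantiation list :: (enc) enc begin
definition "enc = enc_list enc"
instance
proof
  fix x y :: "'a list" assume "enc x = enc y"
  then show "x = y" unfolding enc_list_def by (rule enc_list_inj [rotated]) (rule enc_inj)
qed
end

instantiation option :: (enc) enc begin
definition "enc = enc_option enc"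
instance
proof
  fix x y :: "'a option" assume "enc x = enc y"
  then show "x = y" by (cases x; cases y) (auto simp: enc_option_def dest: enc_inj)
qed
end

lemma poly_nat_mono: "(x::nat) \<le> y \<Longrightarrow> poly q x \<le> poly q y"
  by (induction q) (auto intro: add_mono mult_mono)

definition run :: "prog \<Rightarrow> bintree \<Rightarrow> bintree \<Rightarrow> nat \<Rightarrow> bool" where
  "run P x y b \<longleftrightarrow> (\<exists>n\<le>b. exec P x y n)"

lemma run_mono: "run P x y b \<Longrightarrow> b \<le> c \<Longrightarrow> run P x y c"
  unfolding run_def by (meson order_trans)

lemma run_prim:
  "run Ident x x (1 + size x)" "run (Const c) x c (1 + size x)" "run Left x (left x) (1 + size x)"
  "run Right x (right x) (1 + size x)" "run Equal x (enc_bool (left x = right x)) (1 + size x)"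
  unfolding run_def by (blast intro: exec.intros)+

lemma run_Fork: "run P x y a \<Longrightarrow> run Q x z b \<Longrightarrow> run (Fork P Q) x (Pair y z) (1 + size x + a + b)"
  unfolding run_def by (meson add_mono exec.intros(6) order_refl)

lemma run_Seq: "run P x y a \<Longrightarrow> run Q y z b \<Longrightarrow> run (Seq P Q) x z (1 + size x + a + b)"
  unfolding run_def by (meson add_mono exec.intros(7) order_refl)

lemma run_Cond:
  "run B x c l \<Longrightarrow> (c \<noteq> Tip \<Longrightarrow> run P x y m) \<Longrightarrow> (c = Tip \<Longrightarrow> run Q x y m) \<Longrightarrow>
     run (Cond B P Q) x y (1 + size x + l + m)"
  unfolding run_def by (cases "c = Tip") (meson add_mono exec.intros(8,9) order_refl)+

lemma run_While_end: "run B x Tip l \<Longrightarrow> run (While B P) x x (1 + size x + l)"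
  unfolding run_def by (meson add_mono exec.intros(10) order_refl)

lemma run_While_step:
  "run B x c l \<Longrightarrow> c \<noteq> Tip \<Longrightarrow> run P x y m \<Longrightarrow> run (While B P) y z n \<Longrightarrow>
     run (While B P) x z (1 + size x + l + m + n)"
  unfolding run_def by (meson add_mono exec.intros(11) order_refl)

text \<open>The output size is bounded along with the time, so that compositions can be estimated
  without looking into programs. Every value of the type counts as an input, so default values such
  as \<open>hd []\<close> have to be computed too.\<close>

definition pt :: "('a::enc \<Rightarrow> 'b::enc) \<Rightarrow> bool" where
  "pt f \<longleftrightarrow> (\<exists>P. \<exists>q :: nat poly. \<forall>x. run P (enc x) (enc (f x)) (poly q (sz x)) \<and> sz (f x) \<le> poly q (sz x))"

lemma ptI:
  assumes "\<And>x. run P (enc x) (enc (f x)) (poly q (sz x))" "\<And>x. sz (f x) \<le> poly r (sz x)"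
  shows "pt f"
  unfolding pt_def
proof (intro exI allI conjI)
  fix x
  show "run P (enc x) (enc (f x)) (poly (q + r) (sz x))" by (rule run_mono [OF assms(1)]) simp
  show "sz (f x) \<le> poly (q + r) (sz x)" using assms(2) [of x] by simp
qed

lemma pt_size: "pt f \<Longrightarrow> \<exists>q. \<forall>x. sz (f x) \<le> poly q (sz x)"
  unfolding pt_def by blast

lemma pt_comp:
  assumes "pt f" "pt g"
  shows "pt (\<lambda>x. f (g x))"
proof -
  obtain P q where f': "\<forall>x. run P (enc x) (enc (f x)) (poly q (sz x)) \<and> sz (f x) \<le> poly q (sz x)"
    using assms(1) unfolding pt_def by blast
  note f = f' [rule_format, THEN conjunct1] f' [rule_format, THEN conjunct2]
  obtain Q r where g': "\<forall>x. run Q (enc x) (enc (g x)) (poly r (sz x)) \<and> sz (g x) \<le> poly r (sz x)"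
    using assms(2) unfolding pt_def by blast
  note g = g' [rule_format, THEN conjunct1] g' [rule_format, THEN conjunct2]
  have le: "poly q (sz (g x)) \<le> poly q (poly r (sz x))" for x by (rule poly_nat_mono [OF g(2)])
  show ?thesis
  proof (rule ptI [where P = "Seq Q P" and q = "[:1, 1:] + r + pcompose q r" and r = "pcompose q r"])
    fix x
    show "run (Seq Q P) (enc x) (enc (f (g x))) (poly ([:1, 1:] + r + pcompose q r) (sz x))"
      by (rule run_mono [OF run_Seq [OF g(1) f(1)]]) (use le [of x] in \<open>simp add: poly_pcompose\<close>)
    show "sz (f (g x)) \<le> poly (pcompose q r) (sz x)"
      using f(2) [of "g x"] le [of x] by (simp add: poly_pcompose)
  qed
qed

section \<open>Closure properties of the polynomial-time functions\<close>

named_theorems pt_intros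

lemma pt_id [pt_intros]: "pt (\<lambda>x. x)"
  by (rule ptI [where P = Ident and q = "[:1, 1:]" and r = "[:0, 1:]"]) (use run_prim(1) in simp_all)

lemma pt_const [pt_intros]: "pt (\<lambda>x. c)"
  by (rule ptI [where P = "Const (enc c)" and q = "[:1, 1:]" and r = "[:sz c:]"]) (use run_prim(2) in simp_all)

lemma pt_pair [pt_intros]:
  assumes "pt f" "pt g"
  shows "pt (\<lambda>x. (f x, g x))"
proof -
  obtain P q where f': "\<forall>x. run P (enc x) (enc (f x)) (poly q (sz x)) \<and> sz (f x) \<le> poly q (sz x)"
    using assms(1) unfolding pt_def by blast
  note f = f' [rule_format, THEN conjunct1] f' [rule_format, THEN conjunct2]
  obtain Q r where g': "\<forall>x. run Q (enc x) (enc (g x)) (poly r (sz x)) \<and> sz (g x) \<le> poly r (sz x)"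
    using assms(2) unfolding pt_def by blast
  note g = g' [rule_format, THEN conjunct1] g' [rule_format, THEN conjunct2]
  show ?thesis
  proof (rule ptI [where P = "Fork P Q" and q = "[:1, 1:] + q + r" and r = "1 + q + r"])
    fix x
    show "run (Fork P Q) (enc x) (enc (f x, g x)) (poly ([:1, 1:] + q + r) (sz x))"
      unfolding enc_prod_def fst_conv snd_conv by (rule run_mono [OF run_Fork [OF f(1) g(1)]]) simp
    show "sz (f x, g x) \<le> poly (1 + q + r) (sz x)"
      using f(2) [of x] g(2) [of x] by (simp add: enc_prod_def)
  qed
qed

lemma pt_fst [pt_intros]: assumes "pt f" shows "pt (\<lambda>x. fst (f x))"
proof (rule pt_comp [OF _ assms])
  show "pt (fst :: 'b \<times> 'c \<Rightarrow> 'b)"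
  proof (rule ptI [where P = Left and q = "[:1, 1:]" and r = "[:0, 1:]"])
    fix z :: "'b \<times> 'c"
    show "run Left (enc z) (enc (fst z)) (poly [:1, 1:] (sz z))"
      using run_prim(3) [of "enc z"] by (simp add: enc_prod_def)
  qed (simp add: enc_prod_def)
qed

lemma pt_snd [pt_intros]: assumes "pt f" shows "pt (\<lambda>x. snd (f x))"
proof (rule pt_comp [OF _ assms])
  show "pt (snd :: 'b \<times> 'c \<Rightarrow> 'c)"
  proof (rule ptI [where P = Right and q = "[:1, 1:]" and r = "[:0, 1:]"])
    fix z :: "'b \<times> 'c"
    show "run Right (enc z) (enc (snd z)) (poly [:1, 1:] (sz z))"
      using run_prim(4) [of "enc z"] by (simp add: enc_prod_def)
  qed (simp add: enc_prod_def)
qed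

lemma pt_let [pt_intros]:
  assumes "pt a" "pt (\<lambda>z. f (fst z) (snd z))"
  shows "pt (\<lambda>x. let y = a x in f x y)"
  using pt_comp [OF assms(2) pt_pair [OF pt_id assms(1)]] by (simp add: Let_def)

lemma pt_eq [pt_intros]:
  assumes "pt f" "pt g"
  shows "pt (\<lambda>x. f x = g x)"
proof -
  have "pt (\<lambda>z :: 'b \<times> 'b. fst z = snd z)"
  proof (rule ptI [where P = Equal and q = "[:1, 1:]" and r = "[:1:]"])
    fix z :: "'b \<times> 'b"
    have "(enc (fst z) = enc (snd z)) = (fst z = snd z)" by (auto dest: enc_inj)
    then show "run Equal (enc z) (enc (fst z = snd z)) (poly [:1, 1:] (sz z))"
      using run_prim(5) [of "enc z"] by (simp add: enc_prod_def enc_bool_def)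
    show "sz (fst z = snd z) \<le> poly [:1:] (sz z)" by (cases "fst z = snd z") (simp_all add: enc_bool_def)
  qed
  from pt_comp [OF this pt_pair [OF assms]] show ?thesis by simp
qed

lemma pt_if [pt_intros]:
  assumes "pt b" "pt f" "pt g"
  shows "pt (\<lambda>x. if b x then f x else g x)"
proof -
  obtain B p where b': "\<forall>x. run B (enc x) (enc (b x)) (poly p (sz x)) \<and> sz (b x) \<le> poly p (sz x)"
    using assms(1) unfolding pt_def by blast
  note b = b' [rule_format, THEN conjunct1] b' [rule_format, THEN conjunct2]
  obtain P q where f': "\<forall>x. run P (enc x) (enc (f x)) (poly q (sz x)) \<and> sz (f x) \<le> poly q (sz x)"
    using assms(2) unfolding pt_def by blast
  note f = f' [rule_format, THEN conjunct1] f' [rule_format, THEN conjunct2]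
  obtain Q r where g': "\<forall>x. run Q (enc x) (enc (g x)) (poly r (sz x)) \<and> sz (g x) \<le> poly r (sz x)"
    using assms(3) unfolding pt_def by blast
  note g = g' [rule_format, THEN conjunct1] g' [rule_format, THEN conjunct2]
  show ?thesis
  proof (rule ptI [where P = "Cond B P Q" and q = "[:1, 1:] + p + (q + r)" and r = "q + r"])
    fix x
    have "run (Cond B P Q) (enc x) (enc (if b x then f x else g x)) (1 + sz x + poly p (sz x) + poly (q + r) (sz x))"
    proof (rule run_Cond [OF b(1)])
      assume "enc (b x) \<noteq> Tip"
      then have "b x" by (cases "b x") (simp_all add: enc_bool_def)
      then show "run P (enc x) (enc (if b x then f x else g x)) (poly (q + r) (sz x))"
        using run_mono [OF f(1) [of x]] by simp
    next
      assume "enc (b x) = Tip"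
      then have "\<not> b x" by (cases "b x") (simp_all add: enc_bool_def)
      then show "run Q (enc x) (enc (if b x then f x else g x)) (poly (q + r) (sz x))"
        using run_mono [OF g(1) [of x]] by simp
    qed
    then show "run (Cond B P Q) (enc x) (enc (if b x then f x else g x)) (poly ([:1, 1:] + p + (q + r)) (sz x))"
      by (rule run_mono) simp
    show "sz (if b x then f x else g x) \<le> poly (q + r) (sz x)"
      using f(2) [of x] g(2) [of x] by simp
  qed
qed

lemma pt_not [pt_intros]: "pt b \<Longrightarrow> pt (\<lambda>x. \<not> b x)"
proof -
  assume "pt b"
  then have "pt (\<lambda>x. if b x then False else True)" by (intro pt_intros)
  moreover have "(\<lambda>x. if b x then False else True) = (\<lambda>x. \<not> b x)" by auto
  ultimately show ?thesis by simp
qed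

lemma pt_conj [pt_intros]: "pt b \<Longrightarrow> pt c \<Longrightarrow> pt (\<lambda>x. b x \<and> c x)"
proof -
  assume "pt b" "pt c"
  then have "pt (\<lambda>x. if b x then c x else False)" by (intro pt_intros)
  moreover have "(\<lambda>x. if b x then c x else False) = (\<lambda>x. b x \<and> c x)" by auto
  ultimately show ?thesis by simp
qed

lemma pt_disj [pt_intros]: "pt b \<Longrightarrow> pt c \<Longrightarrow> pt (\<lambda>x. b x \<or> c x)"
proof -
  assume "pt b" "pt c"
  then have "pt (\<lambda>x. if b x then True else c x)" by (intro pt_intros)
  moreover have "(\<lambda>x. if b x then True else c x) = (\<lambda>x. b x \<or> c x)" by auto
  ultimately show ?thesis by simp
qed

lemma sz_simps [simp]:
  "sz ([] :: 'a::enc list) = 0" "sz (x # xs) = Suc (sz x + sz xs)" "sz (a, b) = Suc (sz a + sz b)"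
  "sz (None :: 'a option) = 0" "sz (Some x) = Suc (sz x)" "sz True = 1" "sz False = 0"
  by (simp_all add: enc_list_def enc_prod_def enc_option_def enc_bool_def)

lemma pt_Cons [pt_intros]:
  assumes "pt f" "pt g"
  shows "pt (\<lambda>x. f x # g x)"
proof -
  have "pt (\<lambda>z :: 'b \<times> 'b list. fst z # snd z)"
  proof (rule ptI [where P = Ident and q = "[:1, 1:]" and r = "[:1, 1:]"])
    fix z :: "'b \<times> 'b list"
    show "run Ident (enc z) (enc (fst z # snd z)) (poly [:1, 1:] (sz z))"
      using run_prim(1) [of "enc z"] by (simp add: enc_prod_def enc_list_def)
  qed (simp add: enc_prod_def enc_list_def)
  from pt_comp [OF this pt_pair [OF assms]] show ?thesis by simp
qed

lemma pt_Some [pt_intros]: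
  assumes "pt f" shows "pt (\<lambda>x. Some (f x))"
proof (rule pt_comp [OF _ assms])
  show "pt (Some :: 'b \<Rightarrow> 'b option)"
  proof (rule ptI [where P = "Fork (Const Tip) Ident" and q = "[:3, 3:]" and r = "[:1, 1:]"])
    fix x :: 'b
    have "run (Fork (Const Tip) Ident) (enc x) (Pair Tip (enc x)) (1 + sz x + (1 + sz x) + (1 + sz x))"
      by (rule run_Fork [OF run_prim(2,1)])
    from run_mono [OF this, of "poly [:3, 3:] (sz x)"]
    show "run (Fork (Const Tip) Ident) (enc x) (enc (Some x)) (poly [:3, 3:] (sz x))"
      by (simp add: enc_option_def)
  qed simp
qed

lemma pt_tl [pt_intros]:
  assumes "pt f" shows "pt (\<lambda>x. tl (f x))"
proof (rule pt_comp [OF _ assms])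
  show "pt (tl :: 'b list \<Rightarrow> 'b list)"
  proof (rule ptI [where P = Right and q = "[:1, 1:]" and r = "[:0, 1:]"])
    fix xs :: "'b list"
    show "run Right (enc xs) (enc (tl xs)) (poly [:1, 1:] (sz xs))"
      using run_prim(4) [of "enc xs"] by (cases xs) (simp_all add: enc_list_def)
    show "sz (tl xs) \<le> poly [:0, 1:] (sz xs)" by (cases xs) simp_all
  qed
qed

text \<open>The unspecified but fixed value \<open>hd []\<close> is built into the program as a
  constant.\<close>

lemma pt_hd [pt_intros]:
  assumes "pt f" shows "pt (\<lambda>x. hd (f x))"
proof (rule pt_comp [OF _ assms])
  show "pt (hd :: 'b list \<Rightarrow> 'b)"
  proof (rule ptI [where P = "Cond Ident Left (Const (enc (hd [] :: 'b)))" and q = "[:3, 3:]" and r = "[:sz (hd [] :: 'b), 1:]"])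
    fix xs :: "'b list"
    have "run (Cond Ident Left (Const (enc (hd [] :: 'b)))) (enc xs) (enc (hd xs)) (1 + sz xs + (1 + sz xs) + (1 + sz xs))"
    proof (rule run_Cond [OF run_prim(1)])
      assume "enc xs \<noteq> Tip"
      then show "run Left (enc xs) (enc (hd xs)) (1 + sz xs)"
        using run_prim(3) [of "enc xs"] by (cases xs) (simp_all add: enc_list_def)
    next
      assume "enc xs = Tip"
      then show "run (Const (enc (hd [] :: 'b))) (enc xs) (enc (hd xs)) (1 + sz xs)"
        using run_prim(2) [of "enc (hd [] :: 'b)" "enc xs"] by (cases xs) (simp_all add: enc_list_def)
    qed
    then show "run (Cond Ident Left (Const (enc (hd [] :: 'b)))) (enc xs) (enc (hd xs)) (poly [:3, 3:] (sz xs))"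
      by (rule run_mono) simp
    show "sz (hd xs) \<le> poly [:sz (hd [] :: 'b), 1:] (sz xs)" by (cases xs) simp_all
  qed
qed

lemma length_le_sz: "length xs \<le> sz xs"
  by (induction xs) simp_all

lemma sz_mem: "x \<in> set xs \<Longrightarrow> sz x \<le> sz xs"
  by (induction xs) auto

lemma sz_list_le: "(\<And>x. x \<in> set xs \<Longrightarrow> sz x \<le> b) \<Longrightarrow> sz xs \<le> length xs * Suc b"
proof (induction xs)
  case (Cons x xs)
  have "sz x \<le> b" "sz xs \<le> length xs * Suc b" using Cons by auto
  then show ?case by simp
qed simp

lemma sz_append: "sz (xs @ ys) = sz xs + sz ys"
  by (induction xs) simp_all

lemma sz_filter: "sz (filter Q xs) \<le> sz xs"
  by (induction xs) simp_all

lemma sz_take: "sz (take n xs) \<le> sz xs"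
  by (metis append_take_drop_id le_add1 sz_append)

lemma sz_drop: "sz (drop n xs) \<le> sz xs"
  by (metis append_take_drop_id le_add2 sz_append)

text \<open>The only place where \<open>While\<close> is programmed. Polynomial steps alone would
  allow exponential growth of the accumulator, so a bound on all intermediate results is
  required.\<close>

lemma pt_foldl:
  fixes f :: "'e::enc \<Rightarrow> 's::enc \<Rightarrow> 'x::enc \<Rightarrow> 's"
  assumes "pt (\<lambda>z. f (fst z) (fst (snd z)) (snd (snd z)))" "pt s0" "pt xs"
    and bound: "\<And>e n. sz (foldl (f e) (s0 e) (take n (xs e))) \<le> poly b (sz e)"
  shows "pt (\<lambda>e. foldl (f e) (s0 e) (xs e))"
proof -
  obtain F p where f': "\<forall>z. run F (enc z) (enc (f (fst z) (fst (snd z)) (snd (snd z)))) (poly p (sz z))"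
    using assms(1) unfolding pt_def by blast
  note f = f' [rule_format]
  obtain G q where g': "\<forall>e. run G (enc e) (enc (s0 e)) (poly q (sz e))" using assms(2) unfolding pt_def by blast
  note g = g' [rule_format]
  obtain H r where h': "\<forall>e. run H (enc e) (enc (xs e)) (poly r (sz e)) \<and> sz (xs e) \<le> poly r (sz e)"
    using assms(3) unfolding pt_def by blast
  note h = h' [rule_format, THEN conjunct1] h' [rule_format, THEN conjunct2]
  \<comment> \<open>The loop works on environment, accumulator and remaining list. \<open>B\<close>
    returns that list, whose encoding is \<open>Tip\<close> exactly when it is empty;
    \<open>D\<close> consumes one element.\<close>
  define B where "B = Seq Right Right"
  define D where "D = Fork Left (Fork (Seq (Fork Left (Fork (Seq Right Left) (Seq (Seq Right Right) Left))) F)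
    (Seq (Seq Right Right) Right))"
  define T where "T = [:30, 30:] + p"
  have body: "run D (Pair (enc e) (Pair (enc s) (enc (x # ys)))) (Pair (enc e) (Pair (enc (f e s x)) (enc ys))) (poly T Z)"
    if Z: "sz e + sz s + sz (x # ys) + 2 \<le> Z" for e s x ys Z
  proof -
    let ?t = "Pair (enc e) (Pair (enc s) (Pair (enc x) (enc ys)))"
    have t: "Pair (enc e) (Pair (enc s) (enc (x # ys))) = ?t" by (simp add: enc_list_def)
    have szt: "size ?t \<le> Z" using Z by (simp add: enc_list_def)
    have l: "run Left ?t (enc e) (1 + Z)" by (rule run_mono [OF run_prim(3) [of ?t, simplified]]) (use szt in simp)
    have rt: "run Right ?t (Pair (enc s) (Pair (enc x) (enc ys))) (1 + Z)"
      by (rule run_mono [OF run_prim(4) [of ?t, simplified]]) (use szt in simp)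
    have rl: "run (Seq Right Left) ?t (enc s) (3 + 3 * Z)"
      by (rule run_mono [OF run_Seq [OF rt run_prim(3) [of "Pair (enc s) (Pair (enc x) (enc ys))", simplified]]])
        (use szt in simp)
    have rr: "run (Seq Right Right) ?t (Pair (enc x) (enc ys)) (3 + 3 * Z)"
      by (rule run_mono [OF run_Seq [OF rt run_prim(4) [of "Pair (enc s) (Pair (enc x) (enc ys))", simplified]]])
        (use szt in simp)
    have rrl: "run (Seq (Seq Right Right) Left) ?t (enc x) (5 + 5 * Z)"
      by (rule run_mono [OF run_Seq [OF rr run_prim(3) [of "Pair (enc x) (enc ys)", simplified]]]) (use szt in simp)
    have rrr: "run (Seq (Seq Right Right) Right) ?t (enc ys) (5 + 5 * Z)"
      by (rule run_mono [OF run_Seq [OF rr run_prim(4) [of "Pair (enc x) (enc ys)", simplified]]]) (use szt in simp)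
    have arg: "run (Fork Left (Fork (Seq Right Left) (Seq (Seq Right Right) Left))) ?t (enc (e, s, x)) (11 + 11 * Z)"
      unfolding enc_prod_def fst_conv snd_conv
      by (rule run_mono [OF run_Fork [OF l run_Fork [OF rl rrl]]]) (use szt in simp)
    have fa: "run F (enc (e, s, x)) (enc (f e s x)) (poly p Z)"
      by (rule run_mono [OF f [of "(e, s, x)", simplified]]) (rule poly_nat_mono, use Z in simp)
    have "run D ?t (Pair (enc e) (Pair (enc (f e s x)) (enc ys))) (poly T Z)"
      unfolding D_def T_def
      by (rule run_mono [OF run_Fork [OF l run_Fork [OF run_Seq [OF arg fa] rrr]]]) (use szt in simp)
    then show ?thesis unfolding t .
  qed
  have loop: "run (While B D) (Pair (enc e) (Pair (enc s) (enc ys)))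
      (Pair (enc e) (Pair (enc (foldl (f e) s ys)) Tip)) (Suc (length ys) * (4 + 4 * Z + poly T Z))"
    if "\<And>n. sz e + sz (foldl (f e) s (take n ys)) + sz ys + 2 \<le> Z" for e s ys Z
    using that
  proof (induction ys arbitrary: s)
    case Nil
    let ?t = "Pair (enc e) (Pair (enc s) Tip)"
    have szt: "size ?t \<le> Z" using Nil [of 0] by simp
    have "run B ?t Tip (1 + size ?t + (1 + size ?t) + (1 + size (right ?t)))"
      unfolding B_def by (rule run_Seq [OF run_prim(4)]) (use run_prim(4) [of "right ?t"] in simp)
    from run_While_end [OF this, of D] have "run (While B D) ?t ?t (4 + 4 * Z + poly T Z)"
      by (rule run_mono) (use szt in simp)
    then show ?case by (simp add: enc_list_def)
  next
    case (Cons y ys)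
    let ?t = "Pair (enc e) (Pair (enc s) (enc (y # ys)))"
    have z0: "sz e + sz s + sz (y # ys) + 2 \<le> Z" using Cons.prems [of 0] by simp
    then have szt: "size ?t \<le> Z" by simp
    have "run B ?t (enc (y # ys)) (1 + size ?t + (1 + size ?t) + (1 + size (right ?t)))"
      unfolding B_def by (rule run_Seq [OF run_prim(4)]) (use run_prim(4) [of "right ?t"] in simp)
    then have b: "run B ?t (enc (y # ys)) (3 + 3 * Z)"
      by (rule run_mono) (use szt in simp)
    have "sz e + sz (foldl (f e) (f e s y) (take n ys)) + sz ys + 2 \<le> Z" for n
      using Cons.prems [of "Suc n"] by simp
    from Cons.IH [OF this] have IH: "run (While B D) (Pair (enc e) (Pair (enc (f e s y)) (enc ys)))
      (Pair (enc e) (Pair (enc (foldl (f e) (f e s y) ys)) Tip)) (Suc (length ys) * (4 + 4 * Z + poly T Z))" .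
    have ne: "enc (y # ys) \<noteq> Tip" by (simp add: enc_list_def)
    have "run (While B D) ?t (Pair (enc e) (Pair (enc (foldl (f e) (f e s y) ys)) Tip))
      (1 + size ?t + (3 + 3 * Z) + poly T Z + Suc (length ys) * (4 + 4 * Z + poly T Z))"
      by (rule run_While_step [OF b ne body [OF z0] IH])
    then have "run (While B D) ?t (Pair (enc e) (Pair (enc (foldl (f e) (f e s y) ys)) Tip))
      (Suc (length (y # ys)) * (4 + 4 * Z + poly T Z))" by (rule run_mono) (use szt in simp)
    then show ?case by simp
  qed
  \<comment> \<open>\<open>zq\<close> bounds the loop state at every time, \<open>W\<close> the
    running time of the loop and \<open>Pq\<close> that of the whole program; the constants are
    generous.\<close>
  define zq where "zq = [:2, 1:] + b + r"
  define W where "W = (1 + r) * ([:4, 4:] + pcompose (T + [:0, 4:]) zq)"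
  define Pq where "Pq = [:20, 20:] + q + r + W + 10 * zq"
  show ?thesis
  proof (rule ptI [where P = "Seq (Fork Ident (Fork G H)) (Seq (While B D) (Seq Right Left))" and q = Pq and r = b])
    fix e :: 'e
    define Z where "Z = poly zq (sz e)"
    have z: "sz e + sz (foldl (f e) (s0 e) (take n (xs e))) + sz (xs e) + 2 \<le> Z" for n
      using bound [of e n] h(2) [of e] by (simp add: Z_def zq_def)
    let ?t0 = "Pair (enc e) (Pair (enc (s0 e)) (enc (xs e)))"
    let ?t1 = "Pair (enc e) (Pair (enc (foldl (f e) (s0 e) (xs e))) Tip)"
    have s0: "size ?t0 \<le> Z" using z [of 0] by simp
    have s1: "size ?t1 \<le> Z" using z [of "length (xs e)"] by simp
    have ini: "run (Fork Ident (Fork G H)) (enc e) ?t0 (3 + 3 * sz e + poly q (sz e) + poly r (sz e))"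
      by (rule run_mono [OF run_Fork [OF run_prim(1) run_Fork [OF g h(1)]]]) simp
    have fin: "run (Seq Right Left) ?t1 (enc (foldl (f e) (s0 e) (xs e))) (3 + 3 * Z)"
      by (rule run_mono [OF run_Seq [OF run_prim(4) [of ?t1, simplified]
            run_prim(3) [of "Pair (enc (foldl (f e) (s0 e) (xs e))) Tip", simplified]]]) (use s1 in simp)
    have "Suc (length (xs e)) * (4 + 4 * Z + poly T Z) \<le> poly W (sz e)"
    proof -
      have "Suc (length (xs e)) \<le> poly (1 + r) (sz e)" using length_le_sz [of "xs e"] h(2) [of e] by simp
      moreover have "4 + 4 * Z + poly T Z \<le> poly ([:4, 4:] + pcompose (T + [:0, 4:]) zq) (sz e)"
        by (simp add: poly_pcompose Z_def)
      ultimately show ?thesis unfolding W_def poly_mult by (rule mult_mono) simp_all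
    qed
    then have lp: "run (While B D) ?t0 ?t1 (poly W (sz e))" by (rule run_mono [OF loop [OF z]])
    show "run (Seq (Fork Ident (Fork G H)) (Seq (While B D) (Seq Right Left))) (enc e)
        (enc (foldl (f e) (s0 e) (xs e))) (poly Pq (sz e))"
      by (rule run_mono [OF run_Seq [OF ini run_Seq [OF lp fin]]]) (use s0 in \<open>simp add: Pq_def Z_def\<close>)
    show "sz (foldl (f e) (s0 e) (xs e)) \<le> poly b (sz e)" using bound [of e "length (xs e)"] by simp
  qed
qed

text \<open>An increment that is bounded independently of the accumulator sums up to a polynomial
  over the list.\<close>

lemma pt_foldl_additive:
  fixes f :: "'e::enc \<Rightarrow> 's::enc \<Rightarrow> 'x::enc \<Rightarrow> 's"
  assumes f: "pt (\<lambda>z. f (fst z) (fst (snd z)) (snd (snd z)))" and s0: "pt s0" and xs: "pt xs"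
    and add: "\<And>e s x. sz (f e s x) \<le> sz s + poly b (sz e + sz x)"
  shows "pt (\<lambda>e. foldl (f e) (s0 e) (xs e))"
proof -
  obtain q where q: "\<And>e. sz (s0 e) \<le> poly q (sz e)" using pt_size [OF s0] by blast
  obtain r where r: "\<And>e. sz (xs e) \<le> poly r (sz e)" using pt_size [OF xs] by blast
  have fold: "sz (foldl (f e) s ys) \<le> sz s + length ys * poly b (sz e + m)" if "\<forall>y\<in>set ys. sz y \<le> m" for e s ys m
    using that
  proof (induction ys arbitrary: s)
    case (Cons y ys)
    have "sz (f e s y) \<le> sz s + poly b (sz e + m)"
      using add [of e s y] poly_nat_mono [of "sz e + sz y" "sz e + m" b] Cons.prems by fastforce
    with Cons.IH [of "f e s y"] Cons.prems show ?case by simp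
  qed simp
  show ?thesis
  proof (rule pt_foldl [OF f s0 xs])
    fix e :: 'e and n
    have "\<forall>y\<in>set (take n (xs e)). sz y \<le> poly r (sz e)"
      using sz_mem in_set_takeD r [of e] by (metis le_trans)
    from fold [where s = "s0 e" and e = e, OF this] have "sz (foldl (f e) (s0 e) (take n (xs e))) \<le>
        poly q (sz e) + length (take n (xs e)) * poly b (sz e + poly r (sz e))" using q [of e] by simp
    also have "\<dots> \<le> poly q (sz e) + poly r (sz e) * poly b (sz e + poly r (sz e))"
      using length_le_sz [of "xs e"] r [of e] by (intro add_mono mult_mono) simp_all
    finally show "sz (foldl (f e) (s0 e) (take n (xs e))) \<le> poly (q + r * pcompose b ([:0, 1:] + r)) (sz e)"
      by (simp add: poly_pcompose)
  qed
qed

section \<open>List operations as left folds\<close>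

lemma foldl_Cons_rev: "foldl (\<lambda>a x. f x # a) ys xs = rev (map f xs) @ ys"
  by (induction xs arbitrary: ys) simp_all

lemma pt_rev [pt_intros]: assumes "pt xs" shows "pt (\<lambda>e. rev (xs e))"
proof -
  have "pt (\<lambda>e. foldl (\<lambda>a x. x # a) [] (xs e))"
    by (rule pt_foldl_additive [where b = "[:1, 1:]"]) (intro pt_intros assms | simp)+
  then show ?thesis by (simp add: foldl_Cons_rev)
qed

lemma pt_append [pt_intros]: assumes "pt xs" "pt ys" shows "pt (\<lambda>e. xs e @ ys e)"
proof -
  have "pt (\<lambda>e. foldl (\<lambda>a x. x # a) (ys e) (rev (xs e)))"
    by (rule pt_foldl_additive [where b = "[:1, 1:]"]) (intro pt_intros assms | simp)+
  then show ?thesis by (simp add: foldl_Cons_rev)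
qed

lemma pt_map [pt_intros]:
  assumes f: "pt (\<lambda>z. f (fst z) (snd z))" and xs: "pt xs"
  shows "pt (\<lambda>e. map (f e) (xs e))"
proof -
  obtain q where q: "\<And>z. sz (f (fst z) (snd z)) \<le> poly q (sz z)" using pt_size [OF f] by blast
  have "pt (\<lambda>e. foldl (\<lambda>a x. f e x # a) [] (xs e))"
  proof (rule pt_foldl_additive [where b = "1 + pcompose q [:1, 1:]"])
    show "pt (\<lambda>z. f (fst z) (snd (snd z)) # fst (snd z))"
      by (intro pt_intros pt_comp [OF f, of "\<lambda>z. (fst z, snd (snd z))", simplified])
    show "sz (f e x # s) \<le> sz s + poly (1 + pcompose q [:1, 1:]) (sz e + sz x)" for e s x
      using q [of "(e, x)"] by (simp add: poly_pcompose)
  qed (intro pt_intros xs)+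
  then have "pt (\<lambda>e. rev (foldl (\<lambda>a x. f e x # a) [] (xs e)))" by (rule pt_rev)
  then show ?thesis by (simp add: foldl_Cons_rev)
qed

lemma foldl_filter_rev: "foldl (\<lambda>a x. if Q x then x # a else a) ys xs = rev (filter Q xs) @ ys"
  by (induction xs arbitrary: ys) simp_all

lemma pt_filter [pt_intros]:
  assumes f: "pt (\<lambda>z. Q (fst z) (snd z))" and xs: "pt xs"
  shows "pt (\<lambda>e. filter (Q e) (xs e))"
proof -
  have "pt (\<lambda>e. foldl (\<lambda>a x. if Q e x then x # a else a) [] (xs e))"
  proof (rule pt_foldl_additive [where b = "[:1, 1:]"])
    show "pt (\<lambda>z. if Q (fst z) (snd (snd z)) then snd (snd z) # fst (snd z) else fst (snd z))"
      by (intro pt_intros pt_comp [OF f, of "\<lambda>z. (fst z, snd (snd z))", simplified])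
  qed (intro pt_intros xs | simp)+
  then have "pt (\<lambda>e. rev (foldl (\<lambda>a x. if Q e x then x # a else a) [] (xs e)))" by (rule pt_rev)
  then show ?thesis by (simp add: foldl_filter_rev)
qed

lemma pt_mem [pt_intros]:
  assumes "pt x" "pt xs"
  shows "pt (\<lambda>e. x e \<in> set (xs e))"
proof -
  have "pt (\<lambda>e. filter (\<lambda>y. y = x e) (xs e) \<noteq> [])"
    by (intro pt_intros assms(2) pt_comp [OF assms(1)])
  then show ?thesis by (simp add: filter_empty_conv)
qed

lemma pt_subset [pt_intros]:
  assumes "pt xs" "pt ys"
  shows "pt (\<lambda>e. set (xs e) \<subseteq> set (ys e))"
proof -
  have "pt (\<lambda>e. filter (\<lambda>y. \<not> y \<in> set (ys e)) (xs e) = [])"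
    by (intro pt_intros assms(1) pt_comp [OF assms(2)])
  then show ?thesis by (simp add: filter_empty_conv subset_eq)
qed

text \<open>No arithmetic is programmed: quantities are represented by lists of the right length,
  and counting means walking along such a list.\<close>

lemma pt_drop [pt_intros]:
  assumes "pt xs" "pt ys"
  shows "pt (\<lambda>e. drop (length (xs e)) (ys e))"
proof -
  have "pt (\<lambda>e. foldl (\<lambda>a _. tl a) (ys e) (xs e))"
  proof (rule pt_foldl_additive [where b = 0])
    show "sz (tl s) \<le> sz s + poly 0 (sz e + sz x)" for e :: 'a and s :: "'c list" and x :: 'b by (cases s) simp_all
  qed (intro pt_intros assms)+
  moreover have "foldl (\<lambda>a _. tl a) as bs = drop (length bs) as" for as :: "'c list" and bs :: "'b list"
    by (induction bs arbitrary: as) (simp_all add: drop_Suc)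
  ultimately show ?thesis by simp
qed

lemma pt_length_less [pt_intros]:
  assumes "pt xs" "pt ys"
  shows "pt (\<lambda>e. length (xs e) < length (ys e))"
proof -
  have "pt (\<lambda>e. drop (length (xs e)) (ys e) \<noteq> [])" by (intro pt_intros assms)
  then show ?thesis by (simp add: not_le)
qed

lemma pt_length_eq [pt_intros]:
  assumes "pt xs" "pt ys"
  shows "pt (\<lambda>e. length (xs e) = length (ys e))"
proof -
  have "pt (\<lambda>e. \<not> length (xs e) < length (ys e) \<and> \<not> length (ys e) < length (xs e))" by (intro pt_intros assms)
  moreover have "(\<not> length (xs e) < length (ys e) \<and> \<not> length (ys e) < length (xs e)) = (length (xs e) = length (ys e))" for e
    by auto
  ultimately show ?thesis by simp
qed

lemma foldl_zip: "foldl (\<lambda>a x. (tl (fst a), if fst a = [] then snd a else (x, hd (fst a)) # snd a)) (ys, zs) xs =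
    (drop (length xs) ys, rev (zip xs ys) @ zs)"
proof (induction xs arbitrary: ys zs)
  case (Cons x xs)
  then show ?case by (cases ys) simp_all
qed simp

lemma pt_zip [pt_intros]:
  assumes "pt xs" "pt ys"
  shows "pt (\<lambda>e. zip (xs e) (ys e))"
proof -
  have "pt (\<lambda>e. foldl (\<lambda>a x. (tl (fst a), if fst a = [] then snd a else (x, hd (fst a)) # snd a)) (ys e, []) (xs e))"
  proof (rule pt_foldl_additive [where b = "[:1, 1:]"])
    show "sz (tl (fst s), if fst s = [] then snd s else (x, hd (fst s)) # snd s) \<le> sz s + poly [:1, 1:] (sz e + sz x)"
      for e :: 'a and s :: "'c list \<times> ('b \<times> 'c) list" and x :: 'b
      by (cases s; cases "fst s") simp_all
  qed (intro pt_intros assms)+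
  then have "pt (\<lambda>e. rev (snd (foldl (\<lambda>a x. (tl (fst a), if fst a = [] then snd a else (x, hd (fst a)) # snd a)) (ys e, []) (xs e))))"
    by (intro pt_rev pt_snd)
  then show ?thesis by (simp add: foldl_zip)
qed

lemma take_zip: "take (length xs) ys = map snd (zip xs ys)"
proof (induction xs arbitrary: ys)
  case (Cons x xs)
  then show ?case by (cases ys) simp_all
qed simp

lemma pt_take [pt_intros]:
  assumes "pt xs" "pt ys"
  shows "pt (\<lambda>e. take (length (xs e)) (ys e))"
  unfolding take_zip by (intro pt_intros assms)

lemma poly_time_pt:
  assumes "pt f" "\<And>x. x \<in> D \<Longrightarrow> inp x = enc (g x)" "\<And>x. x \<in> D \<Longrightarrow> out x = enc (f (g x))"
  shows "poly_time D inp out"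
proof -
  obtain P q where "\<forall>x. run P (enc x) (enc (f x)) (poly q (sz x))" using assms(1) unfolding pt_def by blast
  with assms(2,3) show ?thesis unfolding poly_time_def run_def by (intro exI [of _ P] exI [of _ q]) auto
qed

section \<open>Running time\<close>

text \<open>A test that would reject all candidates is ignored, so the survivors are the
  lexicographically best ones for the sequence of tests.\<close>

definition winnow :: "('b \<Rightarrow> 'i \<Rightarrow> bool) \<Rightarrow> 'b list \<Rightarrow> 'i list \<Rightarrow> 'i list" where
  "winnow P bs c = foldl (\<lambda>c b. if filter (P b) c = [] then c else filter (P b) c) c bs"

lemma winnow_simps:
  "winnow P [] c = c" "winnow P (b # bs) c = winnow P bs (if filter (P b) c = [] then c else filter (P b) c)"
  by (simp_all add: winnow_def)

lemma winnow_subset: "set (winnow P bs c) \<subseteq> set c"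
proof (induction bs arbitrary: c)
  case (Cons b bs)
  have "set (if filter (P b) c = [] then c else filter (P b) c) \<subseteq> set c" by auto
  then show ?case unfolding winnow_simps using Cons.IH by blast
qed (simp add: winnow_simps)

lemma winnow_nonempty: "c \<noteq> [] \<Longrightarrow> winnow P bs c \<noteq> []"
  by (induction bs arbitrary: c) (simp_all add: winnow_simps)

lemma winnow_hd: "c \<noteq> [] \<Longrightarrow> hd (winnow P bs c) \<in> set c"
  by (rule subsetD [OF winnow_subset hd_in_set [OF winnow_nonempty]])

text \<open>As long as a final survivor belongs to the sublist, every test is ignored on the sublist
  exactly when it is ignored on the whole list.\<close>

lemma winnow_filter:
  "y \<in> set (winnow P bs c) \<Longrightarrow> Q y \<Longrightarrow> winnow P bs (filter Q c) = filter Q (winnow P bs c)"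
proof (induction bs arbitrary: c)
  case (Cons b bs)
  let ?d = "if filter (P b) c = [] then c else filter (P b) c"
  have y: "y \<in> set (winnow P bs ?d)" using Cons.prems(1) by (simp only: winnow_simps)
  have yd: "y \<in> set ?d" by (rule subsetD [OF winnow_subset y])
  have "(if filter (P b) (filter Q c) = [] then filter Q c else filter (P b) (filter Q c)) = filter Q ?d"
  proof (cases "filter (P b) c = []")
    case True
    then show ?thesis by (auto simp: filter_empty_conv)
  next
    case False
    then have "y \<in> set (filter (P b) (filter Q c))" using yd Cons.prems(2) by auto
    then have "filter (P b) (filter Q c) \<noteq> []" by (metis empty_iff list.set(1))
    then show ?thesis using False by (simp add: conj_commute)
  qed
  then show ?case unfolding winnow_simps using Cons.IH [OF y Cons.prems(2)] by simp
qed (simp add: winnow_simps)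

lemma winnow_hd_filter:
  assumes c: "c \<noteq> []" and Q: "Q (hd (winnow P bs c))"
  shows "hd (winnow P bs (filter Q c)) = hd (winnow P bs c)"
proof -
  obtain y ys where y: "winnow P bs c = y # ys"
    using winnow_nonempty [OF c, of P bs] by (cases "winnow P bs c") simp_all
  have Qy: "Q y" using Q unfolding y by simp
  have "y \<in> set (winnow P bs c)" unfolding y by simp
  from winnow_filter [where Q = Q, OF this Qy] show ?thesis unfolding y using Qy by simp
qed

lemma choice_ok_winnow: "choice_ok (\<lambda>a N c. hd (winnow (P a N) (f a) c))"
  unfolding choice_ok_def by (blast intro: winnow_hd winnow_hd_filter)

text \<open>\<open>a\<close> is a list of columns of bits, each aligned with the support
  \<open>N\<close> at the creation of the pool. The key of a member is its row, and a member with
  the least key is withheld. For \<open>a = []\<close> the first candidate is taken, which is the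
  arbitrary choice of the deterministic algorithm.\<close>

definition choose_bits :: "nat list \<Rightarrow> bool list list chooser" where
  "choose_bits R a N c = hd (winnow (\<lambda>col y. (y, True) \<notin> set (zip N col)) a c)"

definition seen_by :: "nat list \<Rightarrow> (nat list \<times> item) list \<Rightarrow> item list" where
  "seen_by R a = map snd (filter (\<lambda>r. set (fst r) \<subseteq> set R) a)"

text \<open>Candidates are struck out in the order of their next use until striking would leave
  none.\<close>

definition choose_future :: "nat list \<Rightarrow> (nat list \<times> item) list chooser" where
  "choose_future R a N c = hd (winnow (\<lambda>x y. y \<noteq> x) (seen_by R a) c)"

lemma choice_ok_bits: "choice_ok (choose_bits R)"
  using choice_ok_winnow [of "\<lambda>a N col y. (y, True) \<notin> set (zip N col)" "\<lambda>a. a"]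
  by (simp add: choose_bits_def [abs_def])

lemma choice_ok_future: "choice_ok (choose_future R)"
  using choice_ok_winnow [of "\<lambda>a N x y. y \<noteq> x" "seen_by R"]
  by (simp add: choose_future_def [abs_def])

lemma furthest_future: "furthest (seen_by R) (choose_future R)"
  unfolding furthest_def
proof (intro allI impI)
  fix a N c past x rest y
  assume a: "seen_by R a = past @ x # rest" and p: "set past \<inter> set c = {}" and y: "y \<in> set c" "y \<noteq> x"
  have "winnow (\<lambda>x y. y \<noteq> x) past c = c" using p
  proof (induction past)
    case (Cons z past)
    then have "filter (\<lambda>y. y \<noteq> z) c = c" by (auto simp: filter_id_conv)
    with Cons show ?case by (cases "c = []") (simp_all add: winnow_simps)
  qed (simp add: winnow_simps)
  then have "winnow (\<lambda>x y. y \<noteq> x) (past @ x # rest) c = winnow (\<lambda>x y. y \<noteq> x) (x # rest) c"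
    by (simp add: winnow_def)
  also have "\<dots> = winnow (\<lambda>x y. y \<noteq> x) rest (filter (\<lambda>y. y \<noteq> x) c)"
    using y by (auto simp: winnow_simps filter_empty_conv)
  finally have e: "choose_future R a N c = hd (winnow (\<lambda>x y. y \<noteq> x) rest (filter (\<lambda>y. y \<noteq> x) c))"
    unfolding choose_future_def a by simp
  have "filter (\<lambda>y. y \<noteq> x) c \<noteq> []" using y by (auto simp: filter_empty_conv)
  then have "choose_future R a N c \<in> set (filter (\<lambda>y. y \<noteq> x) c)"
    unfolding e by (rule winnow_hd)
  then show "choose_future R a N c \<noteq> x" by auto
qed

lemma pt_winnow [pt_intros]:
  assumes P: "pt (\<lambda>z. P (fst z) (fst (snd z)) (snd (snd z)))" and bs: "pt bs" and c: "pt c"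
  shows "pt (\<lambda>e. winnow (P e) (bs e) (c e))"
  unfolding winnow_def
proof (rule pt_foldl_additive [where b = 0])
  have "pt (\<lambda>w. (fst (fst w), snd (snd (fst w)), snd w))" by (intro pt_intros)
  from pt_comp [OF P this] have "pt (\<lambda>w. P (fst (fst w)) (snd (snd (fst w))) (snd w))" by simp
  then have F: "pt (\<lambda>z. filter (P (fst z) (snd (snd z))) (fst (snd z)))" by (intro pt_intros)
  show "pt (\<lambda>z. if filter (P (fst z) (snd (snd z))) (fst (snd z)) = [] then fst (snd z)
       else filter (P (fst z) (snd (snd z))) (fst (snd z)))"
    by (rule pt_if [OF pt_eq [OF F pt_const] _ F]) (intro pt_intros)
  show "sz (if filter (P e x) s = [] then s else filter (P e x) s) \<le> sz s + poly 0 (sz e + sz x)" for e s x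
    using sz_filter [of "P e x" s] by simp
qed (rule bs c)+

lemma pt_choose_bits:
  "pt (\<lambda>z. choose_bits (fst z) (fst (snd z)) (fst (snd (snd z))) (snd (snd (snd z))))"
  unfolding choose_bits_def by (intro pt_intros)

lemma pt_choose_future:
  "pt (\<lambda>z. choose_future (fst z) (fst (snd z)) (fst (snd (snd z))) (snd (snd (snd z))))"
  unfolding choose_future_def seen_by_def by (intro pt_intros)

lemma pt_swap_cells:
  assumes "pt u" "pt v" "pt c"
  shows "pt (\<lambda>x. swap_cells (u x) (v x) (c x))"
  unfolding swap_cells_def by (intro pt_intros pt_comp [OF assms(1)] pt_comp [OF assms(2)] assms(3))

lemma pt_slots_of:
  assumes "pt i" "pt c"
  shows "pt (\<lambda>x. slots_of (i x) (c x))"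
  unfolding slots_of_def by (intro pt_intros pt_comp [OF assms(1)] assms(2))

lemma pt_target:
  assumes "pt i" "pt R" "pt u" "pt c"
  shows "pt (\<lambda>x. target (i x) (R x) (u x) (c x))"
  unfolding target_def by (intro pt_intros pt_slots_of assms pt_comp [OF assms(4)])

lemma pt_put:
  assumes "pt w" "pt i" "pt c"
  shows "pt (\<lambda>x. put (w x) (i x) (c x))"
  unfolding put_def by (intro pt_intros assms pt_comp [OF assms(1)])

text \<open>The rank is carried along in unary, as a list of that length.\<close>

lemma last_full_foldl:
  "last_full n Ss E = snd (foldl (\<lambda>a S. (True # fst a, if length S = length (True # fst a) then S else snd a))
     (replicate n True, E) Ss)"
proof (induction Ss arbitrary: n E)
  case (Cons S Ss)
  have "(replicate (Suc n) True) = True # replicate n True" by simp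
  with Cons [of "Suc n"] show ?case by simp
qed simp

lemma pt_last_full:
  assumes "pt Ss"
  shows "pt (\<lambda>x. last_full 0 (Ss x) [])"
  unfolding last_full_foldl
proof (rule pt_snd, rule pt_foldl_additive [where b = "[:2, 1:]"])
  show "pt (\<lambda>z. (True # fst (fst (snd z)),
      if length (snd (snd z)) = length (True # fst (fst (snd z))) then snd (snd z) else snd (fst (snd z))))"
    by (intro pt_intros)
  show "sz (True # fst s, if length x = length (True # fst s) then x else snd s) \<le> sz s + poly [:2, 1:] (sz e + sz x)"
    for e :: 'a and s :: "bool list \<times> 'b list" and x :: "'b list"
    by (cases s) simp
qed (rule assms pt_const)+

lemma pt_prune:
  assumes "pt st"
  shows "pt (\<lambda>x. prune (st x))"
  unfolding prune_def members_def restrict_pool_def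
  by (intro pt_intros pt_last_full assms pt_comp [OF assms])

lemma pt_engine_step:
  assumes "pt R" "pt a" "pt x" "pt st"
  shows "pt (\<lambda>z. engine_step (length (R z)) (a z) (x z) (st z))"
  unfolding engine_step_def engine_move_def restrict_pool_def
  by (intro pt_intros pt_prune assms pt_comp [OF assms(3)])

lemma drops_foldl:
  "drops ch acc Ps = foldl (\<lambda>acc P. let c = filter (\<lambda>y. y \<notin> set acc) (snd (snd P)) in
     if c = [] then acc else ch (fst P) (fst (snd P)) c # acc) acc Ps"
  by (induction Ps arbitrary: acc) (simp_all add: Let_def members_def)

section \<open>Size bounds for the state of the algorithms\<close>

definition small :: "nat \<Rightarrow> nat \<Rightarrow> 'a::enc list \<Rightarrow> bool" where
  "small B n xs \<longleftrightarrow> length xs \<le> n \<and> (\<forall>x\<in>set xs. sz x \<le> B)"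

lemma small_sz: "small B n xs \<Longrightarrow> sz xs \<le> n * Suc B"
  using order_trans [OF sz_list_le [of xs B] mult_le_mono1 [of "length xs" n "Suc B"]] by (simp add: small_def)

lemma small_self: "sz xs \<le> B \<Longrightarrow> sz xs \<le> n \<Longrightarrow> small B n xs"
  unfolding small_def using length_le_sz [of xs] sz_mem [of _ xs] by fastforce

lemma small_mono: "small B n xs \<Longrightarrow> B \<le> B' \<Longrightarrow> n \<le> n' \<Longrightarrow> small B' n' xs"
  unfolding small_def by fastforce

lemma small_filter: "small B n xs \<Longrightarrow> small B n (filter Q xs)"
  unfolding small_def by (auto intro: order_trans [OF length_filter_le])

definition pools_small :: "nat \<Rightarrow> nat \<Rightarrow> ('x::enc, 'i::enc) pool list \<Rightarrow> bool" where
  "pools_small B t Ps \<longleftrightarrow> length Ps \<le> t \<and> (\<forall>P\<in>set Ps. sz (fst P) \<le> B \<and> small B t (fst (snd P)) \<and> small B t (snd (snd P)))"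

definition cells_small :: "nat \<Rightarrow> nat \<Rightarrow> (nat \<times> item) list \<Rightarrow> bool" where
  "cells_small B t c \<longleftrightarrow> length c \<le> t \<and> (\<forall>x\<in>set c. sz (fst x) \<le> B \<and> sz (snd x) \<le> B)"

text \<open>\<open>B\<close> bounds the set and the individual entries, \<open>t\<close> the lengths
  of the other lists. Only \<open>t\<close> grows, by one per request, and this keeps the whole run
  polynomial.\<close>

definition node_small :: "nat \<Rightarrow> nat \<Rightarrow> 'x::enc node \<Rightarrow> bool" where
  "node_small B t n \<longleftrightarrow> sz (fst n) \<le> B \<and> small B t (fst (engine n)) \<and> pools_small B t (snd (engine n)) \<and>
     cells_small B t (cells n)"

text \<open>Generic in the semiring, so that the same expression can be formed of numbers and of
  polynomials.\<close>

definition node_bound :: "'a::comm_semiring_1 \<Rightarrow> 'a \<Rightarrow> 'a" where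
  "node_bound B t = B + t * (B + 1) + t * (B + 2 * t * (B + 1) + 3) + t * (2 * B + 2) + 5"

lemma poly_node_bound: "poly (node_bound p q) x = node_bound (poly p x) (poly q x)"
  by (simp add: node_bound_def)

lemma node_small_sz:
  assumes "node_small B t n"
  shows "sz n \<le> node_bound B t"
proof -
  have R: "sz (fst n) \<le> B" and N: "small B t (fst (engine n))" and P: "pools_small B t (snd (engine n))"
    and C: "cells_small B t (cells n)" using assms by (simp_all add: node_small_def)
  have "sz Q \<le> B + 2 * t * (B + 1) + 2" if Q: "Q \<in> set (snd (engine n))" for Q
  proof -
    obtain a N0 M where Qe: "Q = (a, N0, M)" by (metis prod_cases3)
    have "sz a \<le> B" "small B t N0" "small B t M" using P Q Qe by (auto simp: pools_small_def)
    then show ?thesis using small_sz [of B t N0] small_sz [of B t M] Qe by simp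
  qed
  then have "small (B + 2 * t * (B + 1) + 2) t (snd (engine n))" using P by (simp add: small_def pools_small_def)
  note p = small_sz [OF this]
  have "sz x \<le> 2 * B + 1" if "x \<in> set (cells n)" for x
    using C that by (cases x) (fastforce simp: cells_small_def)
  then have "small (2 * B + 1) t (cells n)" using C by (simp add: small_def cells_small_def)
  note c = small_sz [OF this]
  obtain R' N' P' c' where n: "n = (R', (N', P'), c')" by (metis prod.collapse)
  show ?thesis using R small_sz [OF N] p c unfolding n node_bound_def
    by (simp add: engine_def cells_def algebra_simps)
qed

lemma node_small_self: "node_small (sz n) (sz n) n"
proof -
  obtain R N Ps c where n: "n = (R, (N, Ps), c)" by (metis prod.collapse)
  have "sz (fst P) \<le> sz n \<and> small (sz n) (sz n) (fst (snd P)) \<and> small (sz n) (sz n) (snd (snd P))" if "P \<in> set Ps" for P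
  proof -
    have "sz P \<le> sz n" using sz_mem [OF that] n by simp
    then show ?thesis by (cases P rule: prod_cases3) (auto intro!: small_self)
  qed
  moreover have "sz (fst x) \<le> sz n \<and> sz (snd x) \<le> sz n" if "x \<in> set c" for x
    using sz_mem [OF that] n by (cases x) simp
  ultimately show ?thesis
    unfolding node_small_def pools_small_def cells_small_def
    using length_le_sz [of Ps] length_le_sz [of c] n by (auto simp: engine_def cells_def intro!: small_self)
qed

lemma node_small_mono:
  assumes "node_small B t n" "B \<le> B'" "t \<le> t'"
  shows "node_small B' t' n"
  using assms unfolding node_small_def pools_small_def cells_small_def
  by (auto intro: small_mono order_trans)

lemma small_Suc: "small B t M \<Longrightarrow> small B (Suc t) M"
  by (auto simp: small_def)

lemma prune_small:
  assumes "small B s (fst st)" "pools_small B s (snd st)"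
  shows "small B s (fst (prune st))" "pools_small B s (snd (prune st))"
  using assms unfolding prune_def Let_def pools_small_def restrict_pool_def
  by (auto intro!: small_filter intro: order_trans [OF length_filter_le])

lemma engine_step_small:
  assumes "small B t (fst st)" "pools_small B t (snd st)" "sz a \<le> B" "sz x \<le> B"
  shows "small B (Suc t) (fst (engine_step K a x st))" "pools_small B (Suc t) (snd (engine_step K a x st))"
proof -
  have P: "sz (fst P) \<le> B" "small B (Suc t) (fst (snd P))" "small B (Suc t) (snd (snd P))" if "P \<in> set (snd st)" for P
    using assms(2) that small_Suc unfolding pools_small_def by blast+
  have l: "length (snd st) \<le> t" using assms(2) by (simp add: pools_small_def)
  have "small B (Suc t) (fst st @ [x])" using assms(1,4) by (auto simp: small_def)
  then have 1: "small B (Suc t) (fst (engine_move K a x st))"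
    using small_Suc [OF assms(1)] by (simp add: engine_move_def)
  have 2: "pools_small B (Suc t) (snd (engine_move K a x st))"
    unfolding pools_small_def
  proof (intro conjI ballI)
    show "length (snd (engine_move K a x st)) \<le> Suc t" using l by (simp add: engine_move_def)
    fix P assume P': "P \<in> set (snd (engine_move K a x st))"
    consider "P \<in> set (snd st)" | "P = (a, fst st, fst st)" | Q where "Q \<in> set (snd st)" "P = restrict_pool (\<lambda>y. y \<noteq> x) Q"
      using P' by (auto simp: engine_move_def split: if_splits)
    then have "sz (fst P) \<le> B \<and> small B (Suc t) (fst (snd P)) \<and> small B (Suc t) (snd (snd P))"
    proof cases
      case 1
      then show ?thesis using P by blast
    next
      case 2
      then show ?thesis using small_Suc [OF assms(1)] assms(3) by simp
    next
      case (3 Q)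
      then show ?thesis using P [OF 3(1)] small_filter by (simp add: restrict_pool_def)
    qed
    then show "sz (fst P) \<le> B" "small B (Suc t) (fst (snd P))" "small B (Suc t) (snd (snd P))" by blast+
  qed
  show "small B (Suc t) (fst (engine_step K a x st))" "pools_small B (Suc t) (snd (engine_step K a x st))"
    using prune_small [OF 1 2] by (simp_all add: engine_step_def)
qed

lemma swap_cells_small:
  "cells_small B t c \<Longrightarrow> sz u \<le> B \<Longrightarrow> sz v \<le> B \<Longrightarrow> cells_small B t (swap_cells u v c)"
  unfolding cells_small_def swap_cells_def by auto

lemma fold_swap_small:
  "cells_small B t c \<Longrightarrow> sz u \<le> B \<Longrightarrow> (\<And>v. v \<in> set vs \<Longrightarrow> sz v \<le> B) \<Longrightarrow>
     cells_small B t (foldl (\<lambda>d v. swap_cells u v d) c vs)"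
  by (induction vs arbitrary: c) (simp_all add: swap_cells_small)

definition place_small :: "nat \<Rightarrow> nat \<Rightarrow> nat \<Rightarrow> nat list \<times> nat list \<times> 'x::enc node list \<Rightarrow> bool" where
  "place_small B t m z \<longleftrightarrow> small B (Suc t) (fst z) \<and> small B m (fst (snd z)) \<and>
     length (snd (snd z)) \<le> m \<and> (\<forall>n\<in>set (snd (snd z)). node_small B (Suc t) n)"

text \<open>The value of \<open>hd []\<close> is unspecified but fixed, so its size enters the bounds as a constant.\<close>

lemma sz_hd: "sz (hd ([] :: nat list)) \<le> B \<Longrightarrow> (\<And>x. x \<in> set xs \<Longrightarrow> sz x \<le> B) \<Longrightarrow> sz (hd xs :: nat) \<le> B"
  by (cases xs) simp_all

text \<open>No new numbers arise: every slot comes from \<open>R\<close>, from earlier cells or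
  slots carried along, or from \<open>hd []\<close>. So the bound \<open>B\<close> on entries is
  kept.\<close>

lemma place_step_small:
  assumes z: "place_small B t m z" and n: "node_small B t n" and i: "sz i \<le> B" and a: "sz a \<le> B"
    and hd: "sz (hd ([] :: nat list)) \<le> B"
  shows "place_small B t (Suc m) (place_step ch (S, i, a) z n)"
proof -
  obtain u vs ns where z': "z = (u, vs, ns)" by (metis prod_cases3)
  obtain R e c where n': "n = (R, e, c)" by (metis prod_cases3)
  have R: "sz R \<le> B" and e: "small B t (fst e)" "pools_small B t (snd e)" and c: "cells_small B t c"
    using n by (simp_all add: node_small_def n' engine_def cells_def)
  have u: "small B (Suc t) u" and vs: "small B m vs" and ns: "length ns \<le> m" "\<And>n. n \<in> set ns \<Longrightarrow> node_small B (Suc t) n"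
    using z by (auto simp: place_small_def z')
  show ?thesis
  proof (cases "set S \<subseteq> set R")
    case True
    define e' where "e' = engine_step (length R) a i e"
    define c1 where "c1 = foldl (\<lambda>d v. swap_cells (hd u) v d) (filter (\<lambda>x. snd x \<in> set (cache (ch R) e')) c) vs"
    define v where "v = target i R u c1"
    define w where "w = hd (u @ [v])"
    have res: "place_step ch (S, i, a) z n = ([w], vs @ [v], ns @ [(R, e', put w i (swap_cells w v c1))])"
      using True by (simp add: place_step_def z' n' Let_def e'_def c1_def v_def w_def)
    have hu: "sz (hd u) \<le> B" using sz_hd [OF hd, of u] u by (auto simp: small_def)
    have "cells_small B t (filter (\<lambda>x. snd x \<in> set (cache (ch R) e')) c)"
      using c by (auto simp: cells_small_def intro: order_trans [OF length_filter_le])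
    then have c1: "cells_small B t c1" unfolding c1_def
      by (rule fold_swap_small [OF _ hu]) (use vs in \<open>auto simp: small_def\<close>)
    have v: "sz v \<le> B" unfolding v_def target_def
    proof (rule sz_hd [OF hd])
      fix x assume "x \<in> set (slots_of i c1 @ filter (\<lambda>s. s \<notin> set (map fst c1)) (u @ R))"
      then have "x \<in> fst ` set c1 \<or> x \<in> set u \<or> x \<in> set R" by (auto simp: slots_of_def)
      then show "sz x \<le> B" using c1 u R sz_mem [of x R] by (auto simp: cells_small_def small_def)
    qed
    have w: "sz w \<le> B" unfolding w_def by (rule sz_hd [OF hd]) (use u v in \<open>auto simp: small_def\<close>)
    have "cells_small B t (swap_cells w v c1)" by (rule swap_cells_small [OF c1 w v])
    then have "cells_small B (Suc t) (put w i (swap_cells w v c1))"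
      using w i by (auto simp: cells_small_def put_def intro: order_trans [OF length_filter_le])
    then have "node_small B (Suc t) (R, e', put w i (swap_cells w v c1))"
      using R engine_step_small [OF e a i, of "length R"] by (simp add: node_small_def engine_def cells_def e'_def)
    then show ?thesis unfolding res place_small_def using w v vs ns by (auto simp: small_def)
  next
    case False
    have res: "place_step ch (S, i, a) z n =
        (if set (snd i) \<subseteq> set R \<and> set R \<subseteq> set S then slots_of i c else u, vs, ns @ [n])"
      using False by (simp add: place_step_def z' n')
    have "small B (Suc t) (slots_of i c)"
      using c by (auto simp: small_def cells_small_def slots_of_def intro: order_trans [OF length_filter_le] le_SucI)
    then show ?thesis unfolding res place_small_def using u vs ns node_small_mono [OF n, of B "Suc t"]
      by (auto simp: small_def)
  qed
qed

lemma fold_place_small: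
  assumes "\<And>n. n \<in> set ns \<Longrightarrow> node_small B t n" "sz i \<le> B" "sz a \<le> B" "sz (hd ([] :: nat list)) \<le> B"
  shows "place_small B t (length ns) (foldl (place_step ch (S, i, a)) ([], [], []) ns)"
  using assms(1)
proof (induction ns rule: rev_induct)
  case Nil
  show ?case by (simp add: place_small_def small_def)
next
  case (snoc n ns)
  then have IH: "place_small B t (length ns) (foldl (place_step ch (S, i, a)) ([], [], []) ns)" by simp
  have "node_small B t n" using snoc.prems by simp
  from place_step_small [OF IH this assms(2-4)] show ?case by simp
qed

lemma serve_small:
  assumes "\<And>n. n \<in> set ns \<Longrightarrow> node_small B t n" "sz r \<le> B" "sz (hd ([] :: nat list)) \<le> B"
  shows "length (serve ch ns r) \<le> length ns" "\<And>n. n \<in> set (serve ch ns r) \<Longrightarrow> node_small B (Suc t) n"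
proof -
  obtain S i a where r: "r = (S, i, a)" by (metis prod_cases3)
  have "sz i \<le> B" "sz a \<le> B" using assms(2) r by simp_all
  from fold_place_small [OF assms(1) this assms(3), of ns ch S]
  show "length (serve ch ns r) \<le> length ns" "\<And>n. n \<in> set (serve ch ns r) \<Longrightarrow> node_small B (Suc t) n"
    by (simp_all add: place_small_def serve_def r)
qed

definition core :: "(nat list \<Rightarrow> 'x chooser) \<Rightarrow> nat list list \<Rightarrow> (nat list \<times> item \<times> 'x) list \<Rightarrow> 'x node list" where
  "core ch FL rs = foldl (serve ch) (initial_nodes FL) rs"

lemma length_order_sets: "length (order_sets FL) = length FL"
  by (induction FL rule: rev_induct) (simp_all add: order_sets_snoc insert_set_def sum_length_filter_compl, simp add: order_sets_def)

lemma core_small: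
  assumes "sz FL \<le> B" "sz rs \<le> B" "sz (hd ([] :: nat list)) \<le> B"
  shows "length (core ch FL rs) \<le> length FL \<and> (\<forall>n\<in>set (core ch FL rs). node_small B (length rs) n)"
  using assms(2)
proof (induction rs rule: rev_induct)
  case Nil
  have "sz R \<le> B" if "R \<in> set FL" for R using sz_mem [OF that] assms(1) by simp
  then show ?case
    by (auto simp: core_def initial_nodes_def node_small_def engine_def cells_def small_def pools_small_def
        cells_small_def length_order_sets set_order_sets)
next
  case (snoc r rs)
  have "sz rs \<le> B" "sz r \<le> B" using snoc.prems by (simp_all add: sz_append)
  with snoc.IH have IH: "length (core ch FL rs) \<le> length FL" "\<And>n. n \<in> set (core ch FL rs) \<Longrightarrow> node_small B (length rs) n" by auto
  have "core ch FL (rs @ [r]) = serve ch (core ch FL rs) r" by (simp add: core_def)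
  with serve_small [OF IH(2) \<open>sz r \<le> B\<close> assms(3), where ch = ch] IH(1) show ?case by force
qed

lemma pt_insert_set: "pt Rs \<Longrightarrow> pt R \<Longrightarrow> pt (\<lambda>x. insert_set (Rs x) (R x))"
proof -
  assume a: "pt Rs" "pt R"
  show ?thesis unfolding insert_set_def by (intro pt_intros a pt_comp [OF a(2)])
qed

lemma sz_partition: "sz (filter Q xs) + sz (filter (\<lambda>x. \<not> Q x) xs) = sz xs"
  by (induction xs) auto

lemma pt_initial_nodes:
  assumes "pt FL"
  shows "pt (\<lambda>x. initial_nodes (FL x) :: 'x::enc node list)"
proof -
  have "pt (\<lambda>x. order_sets (FL x))"
    unfolding order_sets_def
  proof (rule pt_foldl_additive [where b = "[:1, 1:]"])
    show "pt (\<lambda>z. insert_set (fst (snd z)) (snd (snd z)))" by (intro pt_intros pt_insert_set)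
    show "sz (insert_set s x) \<le> sz s + poly [:1, 1:] (sz e + sz x)" for e :: 'a and s x
      using sz_partition [of "\<lambda>A. set A \<subseteq> set x" s] by (simp add: insert_set_def sz_append)
  qed (rule assms pt_const)+
  then show ?thesis unfolding initial_nodes_def by (intro pt_intros)
qed

lemma sz_map_le: "(\<And>x. sz (f x) \<le> sz x) \<Longrightarrow> sz (map f xs) \<le> sz xs"
  by (induction xs) (auto intro: add_mono)

lemma pt_config_of:
  assumes "pt ns" "pt s"
  shows "pt (\<lambda>x. config_of (ns x) (s x))"
proof -
  have "pt (\<lambda>x. shown (ns x) (s x))"
    unfolding shown_def
  proof (rule pt_foldl_additive [where b = "[:0, 1:]"])
    show "pt (\<lambda>z. if s (fst z) \<in> set (fst (snd (snd z)))
        then map (\<lambda>x. fst (snd x)) (filter (\<lambda>x. fst x = s (fst z)) (snd (snd (snd (snd z))))) else fst (snd z))"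
      by (intro pt_intros pt_comp [OF assms(2)])
    fix e r and n :: "'b node"
    have "sz (fst (snd x)) \<le> sz x" for x :: "nat \<times> item" by (cases x) (auto simp: enc_prod_def)
    then have "sz (map (\<lambda>x. fst (snd x)) (filter (\<lambda>x. fst x = s e) (snd (snd n)))) \<le> sz (filter (\<lambda>x. fst x = s e) (snd (snd n)))"
      by (rule sz_map_le)
    also have "\<dots> \<le> sz (snd (snd n))" by (rule sz_filter)
    also have "\<dots> \<le> sz n" by (cases n) (simp add: enc_prod_def)
    finally show "sz (if s e \<in> set (fst n) then map (\<lambda>x. fst (snd x)) (filter (\<lambda>x. fst x = s e) (snd (snd n))) else r)
        \<le> sz r + poly [:0, 1:] (sz e + sz n)" by simp
  qed (rule assms pt_const)+
  then show ?thesis unfolding config_of_def by (intro pt_intros)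
qed

lemma cells_small_sz: "cells_small B t c \<Longrightarrow> sz c \<le> t * (2 * B + 2)"
proof -
  assume c: "cells_small B t c"
  have "sz x \<le> 2 * B + 1" if "x \<in> set c" for x
    using c that by (cases x) (fastforce simp: cells_small_def)
  then have "small (2 * B + 1) t c" using c by (simp add: small_def cells_small_def)
  from small_sz [OF this] show ?thesis by simp
qed

lemma cells_small_self: "sz c \<le> B \<Longrightarrow> cells_small B B c"
proof -
  assume c: "sz c \<le> B"
  have "sz (fst x) \<le> B \<and> sz (snd x) \<le> B" if "x \<in> set c" for x
    using sz_mem [OF that] c by (cases x) simp
  then show ?thesis using length_le_sz [of c] c by (simp add: cells_small_def)
qed

lemma pt_fold_swap:
  fixes u :: "'e::enc \<Rightarrow> nat"
  assumes "pt u" "pt c" "pt vs"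
  shows "pt (\<lambda>x. foldl (\<lambda>d v. swap_cells (u x) v d) (c x) (vs x))"
proof -
  obtain p where p: "\<And>x. sz (u x) \<le> poly p (sz x)" using pt_size [OF assms(1)] by blast
  obtain q where q: "\<And>x. sz (c x) \<le> poly q (sz x)" using pt_size [OF assms(2)] by blast
  obtain r where r: "\<And>x. sz (vs x) \<le> poly r (sz x)" using pt_size [OF assms(3)] by blast
  show ?thesis
  proof (rule pt_foldl [where b = "(p + q + r) * (2 * (p + q + r) + 2)"])
    show "pt (\<lambda>z. swap_cells (u (fst z)) (snd (snd z)) (fst (snd z)))"
      by (intro pt_intros pt_swap_cells pt_comp [OF assms(1)])
    fix x :: 'e and n
    let ?B = "poly (p + q + r) (sz x)"
    have "cells_small ?B ?B (foldl (\<lambda>d v. swap_cells (u x) v d) (c x) (take n (vs x)))"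
    proof (rule fold_swap_small)
      show "cells_small ?B ?B (c x)" using q [of x] by (intro cells_small_self) simp
      show "sz (u x) \<le> ?B" using p [of x] by simp
      fix v assume "v \<in> set (take n (vs x))"
      then have "sz v \<le> sz (vs x)" by (meson in_set_takeD sz_mem)
      then show "sz v \<le> ?B" using r [of x] by simp
    qed
    from cells_small_sz [OF this]
    show "sz (foldl (\<lambda>d v. swap_cells (u x) v d) (c x) (take n (vs x))) \<le> poly ((p + q + r) * (2 * (p + q + r) + 2)) (sz x)"
      by simp
  qed (rule assms)+
qed

section \<open>Running time for any polynomial-time choice\<close>

locale poly_chooser =
  fixes ch :: "nat list \<Rightarrow> 'x::enc chooser"
  assumes choice: "\<And>R. choice_ok (ch R)"
    and pt_ch: "pt (\<lambda>z. ch (fst z) (fst (snd z)) (fst (snd (snd z))) (snd (snd (snd z))))"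
begin

lemma pt_choose:
  assumes "pt R" "pt a" "pt N" "pt c"
  shows "pt (\<lambda>x. ch (R x) (a x) (N x) (c x))"
  using pt_comp [OF pt_ch pt_pair [OF assms(1) pt_pair [OF assms(2) pt_pair [OF assms(3,4)]]]] by simp

lemma pt_cache:
  assumes "pt R" "pt st"
  shows "pt (\<lambda>x. cache (ch (R x)) (st x))"
proof -
  have "pt (\<lambda>x. drops (ch (R x)) [] (snd (st x)))"
    unfolding drops_foldl
  proof (rule pt_foldl_additive [where b = "[:1, 1:]"])
    show "pt (\<lambda>z. let c = filter (\<lambda>y. y \<notin> set (fst (snd z))) (snd (snd (snd (snd z)))) in
        if c = [] then fst (snd z) else ch (R (fst z)) (fst (snd (snd z))) (fst (snd (snd (snd z)))) c # fst (snd z))"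
      by (intro pt_intros pt_choose pt_comp [OF assms(1)])
    fix e acc and P :: "('x, item) pool"
    let ?c = "filter (\<lambda>y. y \<notin> set acc) (snd (snd P))"
    have "sz (ch (R e) (fst P) (fst (snd P)) ?c) \<le> sz P" if "?c \<noteq> []"
    proof -
      have "ch (R e) (fst P) (fst (snd P)) ?c \<in> set ?c" using choice [of "R e"] that unfolding choice_ok_def by blast
      then have "sz (ch (R e) (fst P) (fst (snd P)) ?c) \<le> sz (snd (snd P))" by (intro sz_mem) auto
      also have "\<dots> \<le> sz P" by (cases P) (simp add: enc_prod_def)
      finally show ?thesis .
    qed
    then show "sz (let c = ?c in if c = [] then acc else ch (R e) (fst P) (fst (snd P)) c # acc)
        \<le> sz acc + poly [:1, 1:] (sz e + sz P)" by (auto simp: Let_def intro: trans_le_add2)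
  qed (intro pt_intros assms)+
  then show ?thesis unfolding cache_def by (intro pt_intros assms pt_comp [of "\<lambda>x. drops (ch (R x)) [] (snd (st x))" fst])
qed

lemma pt_place_step: "pt (\<lambda>z. place_step ch (snd (fst z)) (fst (snd z)) (snd (snd z)))"
  unfolding place_step_def case_prod_beta fst_conv snd_conv
  by (intro pt_intros pt_engine_step pt_cache pt_fold_swap pt_target pt_put pt_swap_cells pt_slots_of)

lemma pt_serve: "pt (\<lambda>z. serve ch (fst z) (snd z))"
  unfolding serve_def
proof (intro pt_snd, rule pt_foldl)
  show "pt (\<lambda>z. place_step ch (snd (fst z)) (fst (snd z)) (snd (snd z)))" by (rule pt_place_step)
  define C where "C = sz (hd ([] :: nat list))"
  define Bp :: "nat poly" where "Bp = [:C, 1:]"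
  define tp :: "nat poly" where "tp = [:1, 1:]"
  fix z :: "'x node list \<times> nat list \<times> item \<times> 'x" and n
  obtain ns S i a where z: "z = (ns, S, i, a)" by (metis prod_cases4)
  let ?f = "foldl (place_step ch (snd z)) ([], [], []) (take n (fst z))"
  have "place_small (sz z + C) (sz z) (length (take n ns)) (foldl (place_step ch (S, i, a)) ([], [], []) (take n ns))"
  proof (rule fold_place_small)
    fix m assume "m \<in> set (take n ns)"
    then have "sz m \<le> sz z" using sz_mem [of m ns] in_set_takeD [of m n ns] z by fastforce
    then show "node_small (sz z + C) (sz z) m" by (intro node_small_mono [OF node_small_self]) simp_all
  qed (use z C_def in simp_all)
  then have ps: "place_small (sz z + C) (sz z) (sz z) ?f"
    using length_le_sz [of ns] z unfolding place_small_def small_def by auto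
  obtain u vs ms where f: "?f = (u, vs, ms)" by (metis prod_cases3)
  have "sz m \<le> node_bound (sz z + C) (Suc (sz z))" if "m \<in> set ms" for m
    by (rule node_small_sz) (use ps f that in \<open>simp add: place_small_def\<close>)
  then have "small (node_bound (sz z + C) (Suc (sz z))) (sz z) ms"
    using ps f by (simp add: place_small_def small_def)
  then have "sz ms \<le> sz z * Suc (node_bound (sz z + C) (Suc (sz z)))" by (rule small_sz)
  moreover have "sz u \<le> Suc (sz z) * Suc (sz z + C)" "sz vs \<le> sz z * Suc (sz z + C)"
    using ps f small_sz unfolding place_small_def by fastforce+
  ultimately show "sz ?f \<le> poly (2 + tp * (1 + Bp) + [:0, 1:] * (1 + Bp) + [:0, 1:] * (1 + node_bound Bp tp)) (sz z)"
    unfolding f by (simp add: poly_node_bound Bp_def tp_def algebra_simps)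
qed (intro pt_intros)+

text \<open>A new pool copies the support, so the growth in one step depends on the state and the
  additive rule does not apply. The bound on the intermediate states is that of
  \<open>core_small\<close>.\<close>

lemma pt_core:
  fixes FL :: "'e::enc \<Rightarrow> nat list list"
  assumes "pt FL" "pt rs"
  shows "pt (\<lambda>x. core ch (FL x) (rs x))"
proof -
  obtain p where p: "\<And>x. sz (FL x) \<le> poly p (sz x)" using pt_size [OF assms(1)] by blast
  obtain q where q: "\<And>x. sz (rs x) \<le> poly q (sz x)" using pt_size [OF assms(2)] by blast
  define C where "C = sz (hd ([] :: nat list))"
  define Bp where "Bp = p + q + [:C:]"
  show ?thesis unfolding core_def
  proof (rule pt_foldl [where b = "p * (1 + node_bound Bp q)"])
  show "pt (\<lambda>z. serve ch (fst (snd z)) (snd (snd z)))"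
    using pt_comp [OF pt_serve pt_snd [OF pt_id]] by simp
  fix x :: 'e and n
  let ?B = "poly Bp (sz x)"
  have "length (core ch (FL x) (take n (rs x))) \<le> length (FL x) \<and>
      (\<forall>m\<in>set (core ch (FL x) (take n (rs x))). node_small ?B (length (take n (rs x))) m)"
    by (rule core_small) (use p [of x] q [of x] sz_take [of n "rs x"] in \<open>simp_all add: Bp_def C_def\<close>)
  moreover have "length (take n (rs x)) \<le> poly q (sz x)" "length (FL x) \<le> poly p (sz x)"
    using length_le_sz [of "rs x"] length_le_sz [of "FL x"] p [of x] q [of x] by auto
  ultimately have "small (node_bound ?B (poly q (sz x))) (poly p (sz x)) (core ch (FL x) (take n (rs x)))"
    unfolding small_def using node_small_sz node_small_mono [of ?B "length (take n (rs x))" _ ?B "poly q (sz x)"]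
    by (meson order_refl order_trans)
  from small_sz [OF this]
  show "sz (foldl (serve ch) (initial_nodes (FL x)) (take n (rs x))) \<le> poly (p * (1 + node_bound Bp q)) (sz x)"
    by (simp add: core_def poly_node_bound)
  qed (rule pt_initial_nodes assms)+
qed

lemma pt_pages:
  assumes "pt FL" "pt rs" "pt ss"
  shows "pt (\<lambda>x. map (config_of (core ch (FL x) (rs x))) (ss x))"
  by (intro pt_intros pt_config_of assms(3) pt_comp [OF pt_core [OF assms(1,2)]])

end

definition entries :: "(nat \<times> nat list) list \<Rightarrow> (nat list \<times> item) list" where
  "entries reqs = rev (map snd (foldl log_request [] reqs))"

text \<open>Logged items are themselves former requests, so their size is bounded by that of the
  input.\<close>

lemma log_subset:
  "x \<in> set (foldl log_request [] rs) \<Longrightarrow> (fst x, fst (snd x)) \<in> set rs \<and> snd (snd x) \<in> set rs"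
proof (induction rs arbitrary: x rule: rev_induct)
  case (snoc r rs)
  show ?case
  proof (cases "x \<in> set (foldl log_request [] rs)")
    case True
    with snoc.IH show ?thesis by auto
  next
    case False
    then have x: "x = (fst r, snd r, item_of (foldl log_request [] rs) r)" using snoc.prems by (simp add: log_request_def [of "foldl log_request [] rs" r])
    let ?L = "records (foldl log_request [] rs) (fst r) (set (snd r))"
    have "item_of (foldl log_request [] rs) r \<in> set (?L @ [r])" unfolding item_of_def by (rule hd_in_set) simp
    moreover have "i \<in> set rs" if "i \<in> set ?L" for i using that snoc.IH by (auto simp: records_def)
    ultimately have "item_of (foldl log_request [] rs) r \<in> set rs \<or> item_of (foldl log_request [] rs) r = r"
      by (metis Un_iff empty_iff insert_iff list.set(1,2) set_append)
    then show ?thesis using x by auto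
  qed
qed simp

lemma length_log: "length (foldl log_request [] rs) = length rs"
  by (induction rs rule: rev_induct) (simp_all add: log_request_def)

lemma pt_records:
  assumes "pt h" "pt r"
  shows "pt (\<lambda>x. records (h x) (fst (r x)) (set (snd (r x))))"
  unfolding records_def by (intro pt_intros assms(1) pt_comp [OF assms(2)])

lemma pt_log_request:
  assumes "pt h" "pt r"
  shows "pt (\<lambda>x. log_request (h x) (r x))"
  unfolding log_request_def item_of_def by (intro pt_intros pt_records assms)

lemma pt_entries [pt_intros]:
  assumes "pt rs"
  shows "pt (\<lambda>x. entries (rs x))"
proof -
  obtain q where q: "\<And>x. sz (rs x) \<le> poly q (sz x)" using pt_size [OF assms] by blast
  have "pt (\<lambda>x. foldl log_request [] (rs x))"
  proof (rule pt_foldl [where b = "q * (2 * q + 3)"])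
    show "pt (\<lambda>z. log_request (fst (snd z)) (snd (snd z)))"
      by (intro pt_intros pt_log_request)
    fix x n
    have "sz y \<le> 2 * poly q (sz x) + 2" if y: "y \<in> set (foldl log_request [] (take n (rs x)))" for y
    proof -
      have "(fst y, fst (snd y)) \<in> set (rs x)" "snd (snd y) \<in> set (rs x)" 
        using log_subset [OF y] by (auto dest: in_set_takeD)
      then have "sz (fst y, fst (snd y)) \<le> poly q (sz x)" "sz (snd (snd y)) \<le> poly q (sz x)"
        by (auto intro: order_trans [OF sz_mem q] simp del: sz_simps)
      then show ?thesis by (cases y rule: prod_cases3) simp
    qed
    moreover have "length (foldl log_request [] (take n (rs x))) \<le> poly q (sz x)"
      using length_log [of "take n (rs x)"] length_le_sz [of "rs x"] q [of x] by simp
    ultimately have "small (2 * poly q (sz x) + 2) (poly q (sz x)) (foldl log_request [] (take n (rs x)))"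
      by (simp add: small_def)
    from small_sz [OF this] show "sz (foldl log_request [] (take n (rs x))) \<le> poly (q * (2 * q + 3)) (sz x)"
      by (simp add: algebra_simps)
  qed (intro pt_intros assms)+
  then show ?thesis unfolding entries_def by (intro pt_intros)
qed

section \<open>Prefixes, suffixes and blocks of the tape\<close>

definition prefixes :: "'a list \<Rightarrow> 'a list list" where
  "prefixes xs = snd (foldl (\<lambda>a x. (fst a @ [x], snd a @ [fst a @ [x]])) ([], []) xs)"

lemma prefixes_foldl:
  "foldl (\<lambda>a x. (fst a @ [x], snd a @ [fst a @ [x]])) ([], []) xs = (xs, map (\<lambda>t. take t xs) [1..<Suc (length xs)])"
proof (induction xs rule: rev_induct)
  case (snoc x xs)
  have "map (\<lambda>t. take t (xs @ [x])) [1..<Suc (length xs)] = map (\<lambda>t. take t xs) [1..<Suc (length xs)]"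
    by (rule map_cong) auto
  with snoc show ?case by simp
qed simp

lemma prefixes_eq: "prefixes xs = map (\<lambda>t. take t xs) [1..<Suc (length xs)]"
  unfolding prefixes_def prefixes_foldl by simp

lemma pt_prefixes [pt_intros]:
  assumes "pt xs"
  shows "pt (\<lambda>e. prefixes (xs e))"
proof -
  obtain q where q: "\<And>x. sz (xs x) \<le> poly q (sz x)" using pt_size [OF assms] by blast
  show ?thesis unfolding prefixes_def
  proof (rule pt_snd, rule pt_foldl [where b = "q + 1 + q * (1 + q)"])
    show "pt (\<lambda>z. (fst (fst (snd z)) @ [snd (snd z)], snd (fst (snd z)) @ [fst (fst (snd z)) @ [snd (snd z)]]))"
      by (intro pt_intros)
    fix e n
    have "sz y \<le> poly q (sz e)" if "y \<in> set (map (\<lambda>t. take t (take n (xs e))) [1..<Suc (length (take n (xs e)))])" for y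
    proof -
      have "\<exists>t. y = take t (xs e)" using that by auto
      then show ?thesis using sz_take q [of e] by (metis order_trans)
    qed
    moreover have "length (take n (xs e)) \<le> poly q (sz e)"
      using length_le_sz [of "xs e"] q [of e] by simp
    ultimately have "small (poly q (sz e)) (poly q (sz e)) (map (\<lambda>t. take t (take n (xs e))) [1..<Suc (length (take n (xs e)))])"
      unfolding small_def by (simp del: upt_Suc)
    from small_sz [OF this] show "sz (foldl (\<lambda>a x. (fst a @ [x], snd a @ [fst a @ [x]])) ([], []) (take n (xs e)))
        \<le> poly (q + 1 + q * (1 + q)) (sz e)"
      unfolding prefixes_foldl using sz_take [of n "xs e"] q [of e] by (simp del: upt_Suc add: algebra_simps)
  qed (intro pt_intros assms)+
qed

text \<open>Pairs each entry with those that follow it: the knowledge that the offline algorithm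
  hands to its pools.\<close>

definition futures :: "'a list \<Rightarrow> ('a \<times> 'a list) list" where
  "futures xs = snd (foldl (\<lambda>a x. (x # fst a, (x, fst a) # snd a)) ([], []) (rev xs))"

lemma futures_foldl:
  "foldl (\<lambda>a x. (x # fst a, (x, fst a) # snd a)) ([], []) (rev xs) =
     (xs, map (\<lambda>t. (xs ! t, drop (Suc t) xs)) [0..<length xs])"
proof (induction xs)
  case (Cons x xs)
  have "map (\<lambda>t. ((x # xs) ! t, drop (Suc t) (x # xs))) [0..<length (x # xs)] =
    (x, xs) # map (\<lambda>t. (xs ! t, drop (Suc t) xs)) [0..<length xs]"
    by (simp add: map_upt_Suc del: upt_Suc)
  with Cons show ?case by simp
qed simp

lemma futures_eq: "futures xs = map (\<lambda>t. (xs ! t, drop (Suc t) xs)) [0..<length xs]"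
  unfolding futures_def futures_foldl by simp

lemma pt_futures [pt_intros]:
  assumes "pt xs"
  shows "pt (\<lambda>e. futures (xs e))"
proof -
  obtain q where q: "\<And>x. sz (xs x) \<le> poly q (sz x)" using pt_size [OF assms] by blast
  show ?thesis unfolding futures_def
  proof (rule pt_snd, rule pt_foldl [where b = "q + 1 + q * (2 * q + 2)"])
    show "pt (\<lambda>z. (snd (snd z) # fst (fst (snd z)), (snd (snd z), fst (fst (snd z))) # snd (fst (snd z))))"
      by (intro pt_intros)
    fix e n
    let ?m = "length (xs e) - n"
    have tk: "take n (rev (xs e)) = rev (drop ?m (xs e))" by (rule take_rev)
    define D where "D = drop ?m (xs e)"
    have b: "sz D \<le> poly q (sz e)" unfolding D_def by (rule order_trans [OF sz_drop q])
    have "sz y \<le> 2 * poly q (sz e) + 1" if yD: "y \<in> set (map (\<lambda>t. (D ! t, drop (Suc t) D)) [0..<length D])" for y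
    proof -
      obtain t where t: "t < length D" "y = (D ! t, drop (Suc t) D)" using yD by auto
      then have "sz (D ! t) \<le> poly q (sz e)" "sz (drop (Suc t) D) \<le> poly q (sz e)"
        using sz_mem [OF nth_mem [OF t(1)]] sz_drop [of "Suc t" D] b by linarith+
      then show ?thesis using t(2) by simp
    qed
    moreover have "length D \<le> poly q (sz e)" using length_le_sz [of D] b by linarith
    ultimately have "small (2 * poly q (sz e) + 1) (poly q (sz e)) (map (\<lambda>t. (D ! t, drop (Suc t) D)) [0..<length D])"
      unfolding small_def by simp
    from small_sz [OF this] show "sz (foldl (\<lambda>a x. (x # fst a, (x, fst a) # snd a)) ([], []) (take n (rev (xs e))))
        \<le> poly (q + 1 + q * (2 * q + 2)) (sz e)"
      unfolding tk D_def [symmetric] futures_foldl using b by (simp add: algebra_simps)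
  qed (intro pt_intros assms)+
qed

text \<open>The key block of one pool, with a column for each bit position and an entry for each
  possible member. Its side is given in unary by \<open>D\<close>.\<close>

definition blocks :: "bool list \<Rightarrow> bool list \<Rightarrow> bool list \<times> bool list list" where
  "blocks D tape = foldl (\<lambda>a _. (drop (length D) (fst a), snd a @ [take (length D) (fst a)])) (tape, []) D"

lemma blocks_foldl:
  "foldl (\<lambda>a _. (drop m (fst a), snd a @ [take m (fst a)])) (tape, bs) xs =
     (drop (length xs * m) tape, bs @ map (\<lambda>b. take m (drop (b * m) tape)) [0..<length xs])"
proof (induction xs rule: rev_induct)
  case (snoc x xs)
  then show ?case by (simp add: add.commute)
qed simp

lemma blocks_eq:
  "blocks D tape = (drop (length D * length D) tape, map (\<lambda>b. take (length D) (drop (b * length D) tape)) [0..<length D])"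
  unfolding blocks_def blocks_foldl by simp

lemma sz_take_drop: "sz (take n xs) + sz (drop n xs) = sz xs"
  by (metis append_take_drop_id sz_append)

lemma sz_blocks: "sz (fst (blocks D tape)) + sz (snd (blocks D tape)) \<le> sz tape + length D"
proof -
  have "sz (fst (foldl (\<lambda>a _. (drop m (fst a), snd a @ [take m (fst a)])) a xs)) +
      sz (snd (foldl (\<lambda>a _. (drop m (fst a), snd a @ [take m (fst a)])) a xs)) \<le> sz (fst a) + sz (snd a) + length xs"
    for m and a :: "bool list \<times> bool list list" and xs :: "bool list"
  proof (induction xs arbitrary: a)
    case (Cons x xs)
    have "sz (fst (drop m (fst a), snd a @ [take m (fst a)])) + sz (snd (drop m (fst a), snd a @ [take m (fst a)]))
        \<le> sz (fst a) + sz (snd a) + 1" using sz_take_drop [of m "fst a"] by (simp add: sz_append)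
    with Cons.IH [of "(drop m (fst a), snd a @ [take m (fst a)])"] show ?case by simp
  qed simp
  from this [of "length D" "(tape, [])" D] show ?thesis by (simp add: blocks_def)
qed

lemma pt_blocks:
  assumes "pt D" "pt tape"
  shows "pt (\<lambda>e. blocks (D e) (tape e))"
  unfolding blocks_def
proof (rule pt_foldl_additive [where b = "[:2, 1:]"])
  show "pt (\<lambda>z. (drop (length (D (fst z))) (fst (fst (snd z))),
      snd (fst (snd z)) @ [take (length (D (fst z))) (fst (fst (snd z)))]))"
    by (intro pt_intros pt_comp [OF assms(1)])
  show "sz (drop (length (D e)) (fst s), snd s @ [take (length (D e)) (fst s)]) \<le> sz s + poly [:2, 1:] (sz e + sz x)"
    for e x and s :: "bool list \<times> bool list list"
    using sz_take_drop [of "length (D e)" "fst s"] by (cases s) (simp add: sz_append)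
qed (intro pt_intros assms)+

definition chop :: "bool list list \<Rightarrow> bool list \<Rightarrow> bool list list list" where
  "chop Ds tape = snd (foldl (\<lambda>a D. (fst (blocks D (fst a)), snd a @ [snd (blocks D (fst a))])) (tape, []) Ds)"

lemma pt_chop:
  assumes "pt Ds" "pt tape"
  shows "pt (\<lambda>e. chop (Ds e) (tape e))"
  unfolding chop_def
proof (rule pt_snd, rule pt_foldl_additive [where b = "[:2, 1:]"])
  show "pt (\<lambda>z. (fst (blocks (snd (snd z)) (fst (fst (snd z)))),
      snd (fst (snd z)) @ [snd (blocks (snd (snd z)) (fst (fst (snd z))))]))"
    by (intro pt_intros pt_blocks)
  show "sz (fst (blocks D (fst s)), snd s @ [snd (blocks D (fst s))]) \<le> sz s + poly [:2, 1:] (sz e + sz D)"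
    for e :: 'a and D and s :: "bool list \<times> bool list list list"
    using sz_blocks [of D "fst s"] length_le_sz [of D] by (cases s) (simp add: sz_append)
qed (intro pt_intros assms)+

interpretation bits: poly_chooser choose_bits
  by unfold_locales (rule choice_ok_bits pt_choose_bits)+

interpretation future: poly_chooser choose_future
  by unfold_locales (rule choice_ok_future pt_choose_future)+

section \<open>Random keys\<close>

lemma prob_space_coins: "prob_space coins"
  unfolding coins_def by (rule prob_space_PiM) (rule measure_pmf.prob_space_axioms)

interpretation coins: prob_space coins by (rule prob_space_coins)

lemma space_coins [simp]: "space coins = UNIV"
  by (simp add: coins_def space_PiM)

text \<open>Everything random here depends on finitely many coins, hence takes finitely many values,
  which settles measurability and integrability.\<close>

definition finitary :: "nat \<Rightarrow> ((nat \<Rightarrow> bool) \<Rightarrow> 'a) \<Rightarrow> bool" where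
  "finitary n f \<longleftrightarrow> (\<forall>\<omega> \<omega>'. (\<forall>i<n. \<omega> i = \<omega>' i) \<longrightarrow> f \<omega> = f \<omega>')"

lemma finitaryD: "finitary n f \<Longrightarrow> (\<And>i. i < n \<Longrightarrow> \<omega> i = \<omega>' i) \<Longrightarrow> f \<omega> = f \<omega>'"
  unfolding finitary_def by blast

lemma sets_coins_cylinder:
  assumes "finite J"
  shows "{\<omega>. \<forall>i\<in>J. \<omega> i = \<sigma> i} \<in> sets coins"
proof -
  have "{\<omega> \<in> space coins. \<forall>i\<in>J. \<omega> i = \<sigma> i} \<in> sets coins"
  proof (rule sets.sets_Collect_finite_All [OF _ assms])
    fix i
    have "(\<lambda>\<omega>. \<omega> i) \<in> measurable coins (measure_pmf (bernoulli_pmf (1/2)))"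
      unfolding coins_def by (rule measurable_component_singleton) simp
    from measurable_sets [OF this, of "{\<sigma> i}"] show "{\<omega> \<in> space coins. \<omega> i = \<sigma> i} \<in> sets coins"
      by (simp add: vimage_def Int_def)
  qed
  then show ?thesis by simp
qed

lemma sets_coins_finitary:
  assumes "finitary n P"
  shows "{\<omega>. P \<omega>} \<in> sets coins"
proof -
  let ?L = "{xs :: bool list. length xs = n \<and> P (\<lambda>i. i < n \<and> xs ! i)}"
  have fin: "finite ?L" by (rule finite_subset [OF _ finite_lists_length_eq [of "UNIV :: bool set" n]]) auto
  have "{\<omega>. P \<omega>} = (\<Union>xs\<in>?L. {\<omega>. \<forall>i\<in>{..<n}. \<omega> i = xs ! i})"
  proof (intro set_eqI iffI)
    fix \<omega> assume "\<omega> \<in> {\<omega>. P \<omega>}"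
    moreover have "P \<omega> = P (\<lambda>i. i < n \<and> map \<omega> [0..<n] ! i)" by (rule finitaryD [OF assms]) simp
    ultimately have "map \<omega> [0..<n] \<in> ?L" by simp
    moreover have "\<omega> \<in> {\<omega>'. \<forall>i\<in>{..<n}. \<omega>' i = map \<omega> [0..<n] ! i}" by simp
    ultimately show "\<omega> \<in> (\<Union>xs\<in>?L. {\<omega>. \<forall>i\<in>{..<n}. \<omega> i = xs ! i})" by blast
  next
    fix \<omega> assume "\<omega> \<in> (\<Union>xs\<in>?L. {\<omega>. \<forall>i\<in>{..<n}. \<omega> i = xs ! i})"
    then obtain xs where xs: "P (\<lambda>i. i < n \<and> xs ! i)" "\<forall>i\<in>{..<n}. \<omega> i = xs ! i" by blast
    have "P \<omega> = P (\<lambda>i. i < n \<and> xs ! i)" by (rule finitaryD [OF assms]) (use xs(2) in simp)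
    with xs(1) show "\<omega> \<in> {\<omega>. P \<omega>}" by simp
  qed
  also have "\<dots> \<in> sets coins" by (intro sets.finite_UN fin sets_coins_cylinder) simp
  finally show ?thesis .
qed

lemma prob_cylinder:
  assumes "finite J"
  shows "measure coins {\<omega>. \<forall>i\<in>J. \<omega> i = \<sigma> i} = (1/2) ^ card J"
proof -
  interpret P: product_prob_space "\<lambda>_ :: nat. measure_pmf (bernoulli_pmf (1/2))" UNIV
    by unfold_locales
  have b: "emeasure (measure_pmf (bernoulli_pmf (1/2))) {x} = ennreal (1/2)" for x :: bool
    by (cases x) (simp_all add: emeasure_pmf_single)
  have "emeasure coins {\<omega> \<in> space coins. \<forall>i\<in>J. \<omega> i \<in> {\<sigma> i}} = (\<Prod>i\<in>J. ennreal (1/2))"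
    unfolding coins_def by (subst P.emeasure_PiM_Collect) (use assms b in simp_all)
  also have "\<dots> = ennreal (1/2) ^ card J" by (rule prod_constant)
  also have "\<dots> = ennreal ((1/2) ^ card J)" by (rule ennreal_power) simp
  finally have "emeasure coins {\<omega>. \<forall>i\<in>J. \<omega> i = \<sigma> i} = ennreal ((1/2) ^ card J)" by simp
  then show ?thesis unfolding measure_def by (simp only: enn2real_ennreal zero_le_power zero_le_divide_1_iff zero_le_numeral)
qed

text \<open>Of the \<open>2 ^ (2 * B)\<close> equally likely patterns on the two disjoint rows,
  \<open>2 ^ B\<close> have equal rows.\<close>

lemma prob_equal_bits:
  assumes f: "inj_on f {..<B}" and g: "inj_on g {..<B}" and d: "f ` {..<B} \<inter> g ` {..<B} = {}"
  shows "measure coins {\<omega>. \<forall>b<B. \<omega> (f b) = \<omega> (g b)} \<le> (1/2) ^ B"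
proof -
  let ?L = "{xs :: bool list. length xs = B}"
  let ?J = "f ` {..<B} \<union> g ` {..<B}"
  define s where "s xs i = (\<exists>b<B. (i = f b \<or> i = g b) \<and> xs ! b)" for xs :: "bool list" and i
  have sf: "s xs (f b) = xs ! b" and sg: "s xs (g b) = xs ! b" if "b < B" for xs b
  proof -
    have "c = b" if "c < B" "f b = f c \<or> f b = g c" for c using that \<open>b < B\<close> f d by (auto simp: inj_on_def)
    then show "s xs (f b) = xs ! b" using that by (auto simp: s_def)
    have "c = b" if "c < B" "g b = f c \<or> g b = g c" for c using that \<open>b < B\<close> g d by (auto simp: inj_on_def)
    then show "s xs (g b) = xs ! b" using that by (auto simp: s_def)
  qed
  have fin: "finite ?L" and cL: "card ?L = 2 ^ B"
    using finite_lists_length_eq [of "UNIV :: bool set" B] card_lists_length_eq [of "UNIV :: bool set" B] by simp_all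
  have cJ: "card ?J = 2 * B" using f g d by (subst card_Un_disjoint) (simp_all add: card_image)
  have "{\<omega>. \<forall>b<B. \<omega> (f b) = \<omega> (g b)} \<subseteq> (\<Union>xs\<in>?L. {\<omega>. \<forall>i\<in>?J. \<omega> i = s xs i})"
  proof
    fix \<omega> :: "nat \<Rightarrow> bool" assume "\<omega> \<in> {\<omega>. \<forall>b<B. \<omega> (f b) = \<omega> (g b)}"
    then have e: "\<omega> (f b) = \<omega> (g b)" if "b < B" for b using that by simp
    define xs where "xs = map (\<lambda>b. \<omega> (f b)) [0..<B]"
    have n: "xs ! b = \<omega> (f b)" if "b < B" for b using that by (simp add: xs_def)
    have "\<forall>i\<in>?J. \<omega> i = s xs i"
    proof (intro ballI, elim UnE imageE)
      fix i b assume b: "b \<in> {..<B}" "i = f b"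
      then show "\<omega> i = s xs i" using sf [of b xs] n [of b] by simp
    next
      fix i b assume b: "b \<in> {..<B}" "i = g b"
      then show "\<omega> i = s xs i" using sg [of b xs] n [of b] e [of b] by simp
    qed
    moreover have "xs \<in> ?L" by (simp add: xs_def)
    ultimately show "\<omega> \<in> (\<Union>xs\<in>?L. {\<omega>. \<forall>i\<in>?J. \<omega> i = s xs i})" by (intro UN_I [of xs] CollectI) simp_all
  qed
  then have "measure coins {\<omega>. \<forall>b<B. \<omega> (f b) = \<omega> (g b)} \<le> measure coins (\<Union>xs\<in>?L. {\<omega>. \<forall>i\<in>?J. \<omega> i = s xs i})"
    by (rule coins.finite_measure_mono) (intro sets.finite_UN fin sets_coins_cylinder, simp)
  also have "\<dots> \<le> (\<Sum>xs\<in>?L. measure coins {\<omega>. \<forall>i\<in>?J. \<omega> i = s xs i})"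
    by (rule coins.finite_measure_subadditive_finite [OF fin]) (auto intro!: sets_coins_cylinder)
  also have "\<dots> = (\<Sum>xs\<in>?L. (1/2) ^ (2 * B))"
    by (rule sum.cong [OF refl], subst prob_cylinder) (simp_all add: cJ)
  also have "\<dots> = (1/2) ^ B" by (simp add: cL power_mult power_divide power2_eq_square field_simps flip: power_mult_distrib)
  finally show ?thesis .
qed

text \<open>Independent fair coins are exchangeable; finitarity makes the event measurable.\<close>

lemma prob_permute:
  assumes "inj \<pi>" "finitary n P"
  shows "measure coins {\<omega>. P (\<omega> \<circ> \<pi>)} = measure coins {\<omega>. P \<omega>}"
proof -
  have d: "distr coins coins (\<lambda>\<omega>. \<omega> \<circ> \<pi>) = coins"
    using distr_PiM_reindex [of UNIV "\<lambda>_. measure_pmf (bernoulli_pmf (1/2))" \<pi> UNIV] assms(1)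
    by (simp add: coins_def comp_def measure_pmf.prob_space_axioms restrict_UNIV)
  have m: "(\<lambda>\<omega>. \<omega> \<circ> \<pi>) \<in> measurable coins coins"
    unfolding coins_def by (rule measurable_PiM_single') (simp_all add: comp_def measurable_component_singleton)
  have "measure (distr coins coins (\<lambda>\<omega>. \<omega> \<circ> \<pi>)) {\<omega>. P \<omega>} = measure coins ((\<lambda>\<omega>. \<omega> \<circ> \<pi>) -` {\<omega>. P \<omega>} \<inter> space coins)"
    by (rule measure_distr [OF m sets_coins_finitary [OF assms(2)]])
  then show ?thesis by (simp add: d vimage_def)
qed

section \<open>Ties and exchanges of keys\<close>

definition wset :: "('b \<Rightarrow> 'i \<Rightarrow> bool) \<Rightarrow> 'b list \<Rightarrow> 'i set \<Rightarrow> 'i set" where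
  "wset P bs A = foldl (\<lambda>A b. if {y \<in> A. P b y} = {} then A else {y \<in> A. P b y}) A bs"

lemma wset_simps:
  "wset P [] A = A" "wset P (b # bs) A = wset P bs (if {y \<in> A. P b y} = {} then A else {y \<in> A. P b y})"
  by (simp_all add: wset_def)

lemma set_winnow: "set (winnow P bs c) = wset P bs (set c)"
proof (induction bs arbitrary: c)
  case (Cons b bs)
  have "set (if filter (P b) c = [] then c else filter (P b) c) =
      (if {y \<in> set c. P b y} = {} then set c else {y \<in> set c. P b y})"
    by (auto simp: filter_empty_conv)
  with Cons show ?case by (simp only: winnow_simps wset_simps)
qed (simp add: winnow_simps wset_simps)

lemma wset_subset: "wset P bs A \<subseteq> A"
  by (induction bs arbitrary: A) (auto simp: wset_simps split: if_splits dest!: subsetD)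

lemma wset_cong: "(\<And>b y. b \<in> set bs \<Longrightarrow> y \<in> A \<Longrightarrow> P b y = P' b y) \<Longrightarrow> wset P bs A = wset P' bs A"
proof (induction bs arbitrary: A)
  case (Cons b bs)
  have e: "{y \<in> A. P b y} = {y \<in> A. P' b y}" using Cons.prems by auto
  show ?case unfolding wset_simps e by (rule Cons.IH) (use Cons.prems in \<open>auto split: if_splits\<close>)
qed (simp add: wset_simps)

lemma wset_image:
  assumes "\<And>y. s (s y) = y"
  shows "wset (\<lambda>b y. P b (s y)) bs (s ` A) = s ` wset P bs A"
proof (induction bs arbitrary: A)
  case (Cons b bs)
  have e: "{y \<in> s ` A. P b (s y)} = s ` {y \<in> A. P b y}" using assms by force
  show ?case unfolding wset_simps e using Cons.IH by auto
qed (simp add: wset_simps)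

text \<open>A test that separated two final survivors would have eliminated one of them.\<close>

lemma wset_ties: "x \<in> wset P bs A \<Longrightarrow> y \<in> wset P bs A \<Longrightarrow> b \<in> set bs \<Longrightarrow> P b x = P b y"
proof (induction bs arbitrary: A)
  case (Cons c bs)
  let ?A = "if {y \<in> A. P c y} = {} then A else {y \<in> A. P c y}"
  have xy: "x \<in> wset P bs ?A" "y \<in> wset P bs ?A" using Cons.prems(1,2) by (simp_all only: wset_simps)
  show ?case
  proof (cases "b = c")
    case True
    have "x \<in> ?A" by (rule subsetD [OF wset_subset xy(1)])
    moreover have "y \<in> ?A" by (rule subsetD [OF wset_subset xy(2)])
    ultimately show ?thesis unfolding True by (auto split: if_splits)
  next
    case False
    then show ?thesis using Cons.IH [OF xy] Cons.prems(3) by simp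
  qed
qed simp

lemma wset_map: "wset P (map f bs) A = wset (\<lambda>b. P (f b)) bs A"
  by (simp add: wset_def foldl_map)

definition swp :: "'a \<Rightarrow> 'a \<Rightarrow> 'a \<Rightarrow> 'a" where
  "swp x y z = (if z = x then y else if z = y then x else z)"

lemma swp_swp [simp]: "swp x y (swp x y z) = z" and swp_left [simp]: "swp x y x = y" and swp_right [simp]: "swp x y y = x"
  by (simp_all add: swp_def)

text \<open>The keys of one pool: a square of \<open>W\<close> columns of \<open>W\<close> coins
  each, stored from position \<open>off\<close> on. The position of an item in \<open>N0\<close> is
  its index within every column.\<close>

locale key_block =
  fixes off W :: nat and N0 :: "'i list"
  assumes dist: "distinct N0" and len: "length N0 \<le> W"
begin

definition idx :: "'i \<Rightarrow> nat" where "idx y = (SOME j. j < length N0 \<and> N0 ! j = y)"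

lemma idx: "y \<in> set N0 \<Longrightarrow> idx y < length N0 \<and> N0 ! idx y = y"
  unfolding idx_def by (rule someI_ex) (metis in_set_conv_nth)

lemma idx_W: "y \<in> set N0 \<Longrightarrow> idx y < W" using idx len by fastforce

lemma idx_eq: "x \<in> set N0 \<Longrightarrow> y \<in> set N0 \<Longrightarrow> idx x = idx y \<Longrightarrow> x = y" using idx by metis

definition cols :: "(nat \<Rightarrow> bool) \<Rightarrow> bool list list" where
  "cols \<omega> = map (\<lambda>b. map (\<lambda>j. \<omega> (off + b * W + j)) [0..<W]) [0..<W]"

definition best :: "(nat \<Rightarrow> bool) \<Rightarrow> 'i set \<Rightarrow> 'i set" where
  "best \<omega> A = wset (\<lambda>b y. \<not> \<omega> (off + b * W + idx y)) [0..<W] A"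

lemma winnow_best:
  assumes "set c \<subseteq> set N0"
  shows "set (winnow (\<lambda>col y. (y, True) \<notin> set (zip N0 col)) (cols \<omega>) c) = best \<omega> (set c)"
  unfolding set_winnow best_def cols_def wset_map
proof (rule wset_cong)
  fix b y assume b: "b \<in> set [0..<W]" and y: "y \<in> set c"
  have yN: "y \<in> set N0" using y assms by auto
  have "(y, True) \<in> set (zip N0 (map (\<lambda>j. \<omega> (off + b * W + j)) [0..<W])) \<longleftrightarrow> \<omega> (off + b * W + idx y)"
  proof
    assume "(y, True) \<in> set (zip N0 (map (\<lambda>j. \<omega> (off + b * W + j)) [0..<W]))"
    then obtain j where j: "j < length N0" "j < W" "N0 ! j = y" "\<omega> (off + b * W + j)"
      by (auto simp: set_zip)
    then have "j = idx y" using idx [OF yN] dist by (metis nth_eq_iff_index_eq)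
    with j show "\<omega> (off + b * W + idx y)" by simp
  next
    assume "\<omega> (off + b * W + idx y)"
    then show "(y, True) \<in> set (zip N0 (map (\<lambda>j. \<omega> (off + b * W + j)) [0..<W]))"
      using idx [OF yN] idx_W [OF yN] by (auto simp: set_zip intro!: exI [of _ "idx y"])
  qed
  then show "((y, True) \<notin> set (zip N0 (map (\<lambda>j. \<omega> (off + b * W + j)) [0..<W]))) = (\<not> \<omega> (off + b * W + idx y))" by simp
qed

text \<open>Swaps the rows of \<open>x\<close> and \<open>y\<close> in all columns of the block and
  fixes every coin outside it.\<close>

definition exchange :: "'i \<Rightarrow> 'i \<Rightarrow> nat \<Rightarrow> nat" where
  "exchange x y i = (if off \<le> i \<and> i < off + W * W
     then off + ((i - off) div W) * W + swp (idx x) (idx y) ((i - off) mod W) else i)"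

lemma exchange_block:
  assumes "x \<in> set N0" "y \<in> set N0" "b < W" "j < W"
  shows "exchange x y (off + b * W + j) = off + b * W + swp (idx x) (idx y) j"
proof -
  have "b * W + j < (b + 1) * W" using assms(4) by simp
  also have "\<dots> \<le> W * W" using assms(3) by (intro mult_right_mono) auto
  finally show ?thesis using assms(4) by (simp add: exchange_def)
qed

lemma exchange_involution:
  assumes "x \<in> set N0" "y \<in> set N0"
  shows "exchange x y (exchange x y i) = i"
proof (cases "off \<le> i \<and> i < off + W * W")
  case True
  define d where "d = i - off"
  have d: "i = off + d" "d < W * W" using True by (auto simp: d_def)
  then have W: "0 < W" by (cases W) auto
  have b: "d div W < W" "d mod W < W" using d W by (auto simp: less_mult_imp_div_less)
  have t: "swp (idx x) (idx y) (d mod W) < W"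
    using b idx_W assms by (simp add: swp_def)
  have i: "i = off + (d div W) * W + d mod W" using d by simp
  show ?thesis
  proof -
    have "exchange x y i = off + (d div W) * W + swp (idx x) (idx y) (d mod W)"
      using exchange_block [OF assms b] i by simp
    then show ?thesis using exchange_block [OF assms b(1) t] i by simp
  qed
next
  case False
  then have "exchange x y i = i" unfolding exchange_def by argo
  then show ?thesis by simp
qed

lemma exchange_outside: "i \<notin> {off..<off + W * W} \<Longrightarrow> exchange x y i = i"
  by (auto simp: exchange_def)

lemma inj_exchange: "x \<in> set N0 \<Longrightarrow> y \<in> set N0 \<Longrightarrow> inj (exchange x y)"
  by (metis exchange_involution injI)

lemma best_exchange:
  assumes x: "x \<in> set N0" and y: "y \<in> set N0" and A: "A \<subseteq> set N0" "x \<in> A" "y \<in> A"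
  shows "best (\<omega> \<circ> exchange x y) A = swp x y ` best \<omega> A"
proof -
  let ?s = "swp x y"
  have sA: "?s ` A = A" using A by (auto simp: swp_def image_iff)
  have "best (\<omega> \<circ> exchange x y) A = wset (\<lambda>b z. \<not> \<omega> (off + b * W + idx (?s z))) [0..<W] A"
    unfolding best_def
  proof (rule wset_cong)
    fix b z assume b: "b \<in> set [0..<W]" and z: "z \<in> A"
    have zN: "z \<in> set N0" using z A by auto
    have "idx (?s z) = swp (idx x) (idx y) (idx z)"
      using idx_eq [OF zN x] idx_eq [OF zN y] by (auto simp: swp_def)
    moreover have "exchange x y (off + b * W + idx z) = off + b * W + swp (idx x) (idx y) (idx z)"
      using exchange_block [OF x y _ idx_W [OF zN]] b by simp
    ultimately show "(\<not> (\<omega> \<circ> exchange x y) (off + b * W + idx z)) = (\<not> \<omega> (off + b * W + idx (?s z)))" by simp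
  qed
  also have "\<dots> = wset (\<lambda>b z. \<not> \<omega> (off + b * W + idx (?s z))) [0..<W] (?s ` A)" using sA by simp
  also have "\<dots> = ?s ` wset (\<lambda>b z. \<not> \<omega> (off + b * W + idx z)) [0..<W] A"
    by (rule wset_image) simp
  finally show ?thesis unfolding best_def .
qed

lemma best_finitary: "finitary n (\<lambda>\<omega>. best \<omega> A)" if A: "A \<subseteq> set N0" and n: "off + W * W \<le> n"
  unfolding finitary_def
proof (intro allI impI)
  fix \<omega> \<omega>' :: "nat \<Rightarrow> bool" assume e: "\<forall>i<n. \<omega> i = \<omega>' i"
  show "best \<omega> A = best \<omega>' A" unfolding best_def
  proof (rule wset_cong)
    fix b y assume b: "b \<in> set [0..<W]" and y: "y \<in> A"
    have "b * W + idx y < (b + 1) * W" using idx_W y A by auto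
    also have "\<dots> \<le> W * W" using b by (intro mult_right_mono) auto
    finally show "(\<not> \<omega> (off + b * W + idx y)) = (\<not> \<omega>' (off + b * W + idx y))" using e n by simp
  qed
qed

text \<open>Exchanging two rows carries the event for \<open>x\<close> to that for any other
  candidate, and \<open>c\<close> is not affected because it does not look at the block. These
  equally likely events are disjoint parts of \<open>c \<omega> = C\<close>, so each has at most the
  share \<open>1 / m\<close>.\<close>

lemma prob_unique_best:
  assumes c: "finitary n c" and n: "off + W * W \<le> n"
    and indep: "\<And>\<omega> \<omega>'. (\<And>i. i \<notin> {off..<off + W * W} \<Longrightarrow> \<omega> i = \<omega>' i) \<Longrightarrow> c \<omega> = c \<omega>'"
    and C: "set C \<subseteq> set N0" "0 < m" "m \<le> card (set C)"
  shows "measure coins {\<omega>. c \<omega> = C \<and> best \<omega> (set C) = {x}} \<le> measure coins {\<omega>. c \<omega> = C} / real m"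
proof (cases "x \<in> set C")
  case False
  have "best \<omega> (set C) \<noteq> {x}" for \<omega> using wset_subset False unfolding best_def by fastforce
  then show ?thesis by simp
next
  case True
  let ?E = "\<lambda>y. {\<omega>. c \<omega> = C \<and> best \<omega> (set C) = {y}}"
  have bf: "finitary n (\<lambda>\<omega>. best \<omega> (set C))" by (rule best_finitary [OF C(1) n])
  have fin: "finitary n (\<lambda>\<omega>. c \<omega> = C \<and> best \<omega> (set C) = {y})" for y
    using c bf unfolding finitary_def by metis
  have meas: "?E y \<in> sets coins" for y by (rule sets_coins_finitary [OF fin])
  have mC: "{\<omega>. c \<omega> = C} \<in> sets coins" by (rule sets_coins_finitary [of n]) (use c in \<open>auto simp: finitary_def\<close>)
  have eq: "measure coins (?E y) = measure coins (?E x)" if y: "y \<in> set C" for y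
  proof -
    have xy: "x \<in> set N0" "y \<in> set N0" using True y C by auto
    let ?s = "swp x y"
    have "(c (\<omega> \<circ> exchange x y) = C \<and> best (\<omega> \<circ> exchange x y) (set C) = {x}) \<longleftrightarrow>
        (c \<omega> = C \<and> best \<omega> (set C) = {y})" for \<omega>
    proof -
      have "c (\<omega> \<circ> exchange x y) = c \<omega>" by (rule indep) (simp add: exchange_outside)
      moreover have "best (\<omega> \<circ> exchange x y) (set C) = ?s ` best \<omega> (set C)"
        by (rule best_exchange [OF xy C(1) True y])
      moreover have "(?s ` D = {x}) = (D = {y})" for D
      proof
        assume "?s ` D = {x}"
        then have "?s ` ?s ` D = {?s x}" by simp
        then show "D = {y}" by (simp add: image_image)
      qed simp
      ultimately show ?thesis by simp
    qed
    then have "?E y = {\<omega>. c (\<omega> \<circ> exchange x y) = C \<and> best (\<omega> \<circ> exchange x y) (set C) = {x}}" by simp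
    also have "measure coins \<dots> = measure coins (?E x)" by (rule prob_permute [OF inj_exchange [OF xy] fin])
    finally show ?thesis .
  qed
  have "real (card (set C)) * measure coins (?E x) = (\<Sum>y\<in>set C. measure coins (?E y))" using eq by simp
  also have "\<dots> = measure coins (\<Union>y\<in>set C. ?E y)"
    by (rule coins.finite_measure_finite_Union [symmetric]) (use meas in \<open>auto simp: disjoint_family_on_def\<close>)
  also have "\<dots> \<le> measure coins {\<omega>. c \<omega> = C}" by (rule coins.finite_measure_mono [OF _ mC]) auto
  finally have "real m * measure coins (?E x) \<le> measure coins {\<omega>. c \<omega> = C}"
    using C(3) by (meson measure_nonneg mult_right_mono of_nat_le_iff order_trans)
  then show ?thesis using C(2) by (simp add: field_simps)
qed

lemma prob_tie:
  assumes "x \<in> set N0" "y \<in> set N0" "x \<noteq> y"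
  shows "measure coins {\<omega>. \<forall>b<W. \<omega> (off + b * W + idx x) = \<omega> (off + b * W + idx y)} \<le> (1/2) ^ W"
proof (rule prob_equal_bits)
  have u: "b = b' \<and> j = j'" if "off + b * W + j = off + b' * W + j'" "j < W" "j' < W" for b b' j j'
  proof -
    have "(b * W + j) div W = (b' * W + j') div W" "(b * W + j) mod W = (b' * W + j') mod W" using that(1) by simp_all
    then show ?thesis using that by simp
  qed
  have i: "inj_on (\<lambda>b. off + b * W + idx z) {..<W}" if "z \<in> set N0" for z
  proof (rule inj_onI)
    fix b b' assume "off + b * W + idx z = off + b' * W + idx z"
    from u [OF this idx_W [OF that] idx_W [OF that]] show "b = b'" by (rule conjunct1)
  qed
  show "inj_on (\<lambda>b. off + b * W + idx x) {..<W}" by (rule i [OF assms(1)])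
  show "inj_on (\<lambda>b. off + b * W + idx y) {..<W}" by (rule i [OF assms(2)])
  show "(\<lambda>b. off + b * W + idx x) ` {..<W} \<inter> (\<lambda>b. off + b * W + idx y) ` {..<W} = {}"
  proof (rule equals0I, elim IntE imageE)
    fix i b b' assume "i = off + b * W + idx x" "i = off + b' * W + idx y"
    then have "off + b * W + idx x = off + b' * W + idx y" by simp
    from u [OF this idx_W [OF assms(1)] idx_W [OF assms(2)]] have "idx x = idx y" by (rule conjunct2)
    from idx_eq [OF assms(1,2) this] assms(3) show False by simp
  qed
qed

text \<open>Either \<open>x\<close> alone has the least key, or it shares its key with another
  member; the second term is a union bound over such ties. Summing the first case over all candidate
  lists avoids conditional probabilities.\<close>

lemma prob_pick:
  assumes c: "finitary n c" and n: "off + W * W \<le> n"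
    and indep: "\<And>\<omega> \<omega>'. (\<And>i. i \<notin> {off..<off + W * W} \<Longrightarrow> \<omega> i = \<omega>' i) \<Longrightarrow> c \<omega> = c \<omega>'"
    and C: "finite (range c)" "\<And>\<omega>. set (c \<omega>) \<subseteq> set N0" "0 < m" "\<And>\<omega>. m \<le> card (set (c \<omega>))"
  shows "measure coins {\<omega>. hd (winnow (\<lambda>col y. (y, True) \<notin> set (zip N0 col)) (cols \<omega>) (c \<omega>)) = x}
    \<le> 1 / real m + real (length N0) * (1/2) ^ W"
proof -
  let ?P = "\<lambda>\<omega>. hd (winnow (\<lambda>col y. (y, True) \<notin> set (zip N0 col)) (cols \<omega>) (c \<omega>)) = x"
  let ?E = "\<lambda>C. {\<omega>. c \<omega> = C \<and> best \<omega> (set C) = {x}}"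
  let ?T = "\<lambda>y. {\<omega>. \<forall>b<W. \<omega> (off + b * W + idx x) = \<omega> (off + b * W + idx y)}"
  let ?Y = "{y \<in> set N0. y \<noteq> x \<and> x \<in> set N0}"
  have sub: "{\<omega>. ?P \<omega>} \<subseteq> (\<Union>C\<in>range c. ?E C) \<union> (\<Union>y\<in>?Y. ?T y)"
  proof
    fix \<omega> assume "\<omega> \<in> {\<omega>. ?P \<omega>}"
    then have p: "?P \<omega>" by simp
    have ne: "c \<omega> \<noteq> []" using C(3) C(4) [of \<omega>] by auto
    have "x \<in> set (winnow (\<lambda>col y. (y, True) \<notin> set (zip N0 col)) (cols \<omega>) (c \<omega>))"
      using hd_in_set [OF winnow_nonempty [OF ne]] p by metis
    then have xb: "x \<in> best \<omega> (set (c \<omega>))" using winnow_best [OF C(2)] by simp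
    have bsub: "best \<omega> (set (c \<omega>)) \<subseteq> set N0" using wset_subset C(2) unfolding best_def by fastforce
    show "\<omega> \<in> (\<Union>C\<in>range c. ?E C) \<union> (\<Union>y\<in>?Y. ?T y)"
    proof (cases "best \<omega> (set (c \<omega>)) = {x}")
      case True
      then show ?thesis by blast
    next
      case False
      then obtain y where y: "y \<in> best \<omega> (set (c \<omega>))" "y \<noteq> x" using xb by blast
      have "\<omega> \<in> ?T y" using wset_ties [OF xb [unfolded best_def] y(1) [unfolded best_def]] by auto
      moreover have "y \<in> ?Y" using y xb bsub by auto
      ultimately show ?thesis by blast
    qed
  qed
  have bf: "finitary n (\<lambda>\<omega>. best \<omega> (set (c w)))" for w by (rule best_finitary [OF C(2) n])
  have mE: "?E (c w) \<in> sets coins" for w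
    by (rule sets_coins_finitary [of n]) (use c bf [of w] in \<open>unfold finitary_def, metis\<close>)
  have mT: "?T y \<in> sets coins" if "y \<in> ?Y" for y
  proof (rule sets_coins_finitary [of n])
    have xy: "x \<in> set N0" "y \<in> set N0" using that by auto
    have "off + b * W + idx z < n" if "b < W" "z \<in> set N0" for b z
    proof -
      have "b * W + idx z < (b + 1) * W" using idx_W that by auto
      also have "\<dots> \<le> W * W" using that by (intro mult_right_mono) auto
      finally show ?thesis using n by simp
    qed
    then show "finitary n (\<lambda>\<omega>. \<forall>b<W. \<omega> (off + b * W + idx x) = \<omega> (off + b * W + idx y))"
      using xy unfolding finitary_def by auto
  qed
  have mc: "{\<omega>. c \<omega> = C} \<in> sets coins" for C by (rule sets_coins_finitary [of n]) (use c in \<open>auto simp: finitary_def\<close>)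
  have mUE: "(\<Union>C\<in>range c. ?E C) \<in> sets coins" by (rule sets.finite_UN [OF C(1)]) (use mE in auto)
  have mUT: "(\<Union>y\<in>?Y. ?T y) \<in> sets coins" by (rule sets.finite_UN) (use mT in auto)
  have "measure coins {\<omega>. ?P \<omega>} \<le> measure coins ((\<Union>C\<in>range c. ?E C) \<union> (\<Union>y\<in>?Y. ?T y))"
    by (rule coins.finite_measure_mono [OF sub]) (rule sets.Un [OF mUE mUT])
  also have "\<dots> \<le> measure coins (\<Union>C\<in>range c. ?E C) + measure coins (\<Union>y\<in>?Y. ?T y)"
    by (rule measure_Un_le [OF mUE mUT])
  also have "measure coins (\<Union>C\<in>range c. ?E C) \<le> (\<Sum>C\<in>range c. measure coins (?E C))"
    by (rule coins.finite_measure_subadditive_finite [OF C(1)]) (use mE in auto)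
  also have "(\<Sum>C\<in>range c. measure coins (?E C)) \<le> (\<Sum>C\<in>range c. measure coins {\<omega>. c \<omega> = C} / real m)"
    by (rule sum_mono) (use prob_unique_best [OF c n indep _ C(3)] C(2,4) in blast)
  also have "\<dots> = (\<Sum>C\<in>range c. measure coins {\<omega>. c \<omega> = C}) / real m" by (simp add: sum_divide_distrib)
  also have "(\<Sum>C\<in>range c. measure coins {\<omega>. c \<omega> = C}) = measure coins (\<Union>C\<in>range c. {\<omega>. c \<omega> = C})"
    by (rule coins.finite_measure_finite_Union [symmetric, OF C(1)]) (use mc in \<open>auto simp: disjoint_family_on_def\<close>)
  also have "\<dots> / real m \<le> 1 / real m" by (intro divide_right_mono coins.prob_le_1) simp
  also have "measure coins (\<Union>y\<in>?Y. ?T y) \<le> (\<Sum>y\<in>?Y. measure coins (?T y))"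
    by (rule coins.finite_measure_subadditive_finite) (use mT in auto)
  also have "(\<Sum>y\<in>?Y. measure coins (?T y)) \<le> (\<Sum>y\<in>?Y. (1/2) ^ W)"
    by (rule sum_mono, rule prob_tie) auto
  also have "\<dots> \<le> real (length N0) * (1/2) ^ W"
  proof -
    have "card ?Y \<le> card (set N0)" by (rule card_mono) auto
    then show ?thesis using distinct_card [OF dist] by (simp add: mult_right_mono)
  qed
  finally show ?thesis by simp
qed

end

section \<open>Expected cost\<close>

text \<open>The moves store the data of a pool without reading them. So the pools can be computed
  with time stamps as data, free of randomness, and the random bits substituted afterwards.\<close>

definition map_aux :: "('x \<Rightarrow> 'y) \<Rightarrow> 'i list \<times> ('x, 'i) pool list \<Rightarrow> 'i list \<times> ('y, 'i) pool list" where
  "map_aux f st = (fst st, map (\<lambda>P. (f (fst P), snd P)) (snd st))"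

lemma prune_map_aux: "prune (map_aux f st) = map_aux f (prune st)"
  by (simp add: prune_def map_aux_def Let_def members_def [abs_def] restrict_pool_def filter_map comp_def)

lemma engine_step_map_aux: "engine_step K (f a) x (map_aux f st) = map_aux f (engine_step K a x st)"
proof -
  have "engine_move K (f a) x (map_aux f st) = map_aux f (engine_move K a x st)"
    by (simp add: engine_move_def map_aux_def comp_def restrict_pool_def)
  then show ?thesis unfolding engine_step_def by (simp add: prune_map_aux)
qed

lemma drops_map_aux: "drops ch acc (map (\<lambda>P. (f (fst P), snd P)) Ps) = drops (\<lambda>a. ch (f a)) acc Ps"
  by (induction Ps arbitrary: acc) (simp_all add: members_def Let_def cong: if_cong)

lemma miss_map_aux: "miss ch x (map_aux f st) = miss (\<lambda>a. ch (f a)) x st"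
  by (simp add: miss_def cache_def map_aux_def drops_map_aux)

lemma (in paging_lists) eng_map_aux: "eng f R t = map_aux f (eng (\<lambda>u. u) R t)"
  by (induction t) (simp_all add: engine_step_map_aux [symmetric], simp add: map_aux_def)

text \<open>Pools have distinct stamps and therefore disjoint key blocks; the support stored in a
  pool is short enough to fit into its block.\<close>

definition timed :: "nat \<Rightarrow> 'i list \<times> (nat, 'i) pool list \<Rightarrow> bool" where
  "timed t st \<longleftrightarrow> length (fst st) \<le> t \<and> sorted_wrt (<) (map fst (snd st)) \<and>
     (\<forall>P\<in>set (snd st). fst P < t \<and> distinct (fst (snd P)) \<and> length (fst (snd P)) \<le> fst P \<and>
        set (members P) \<subseteq> set (fst (snd P)))"

lemma timed_step:
  assumes "timed t st" "distinct (fst st)"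
  shows "timed (Suc t) (engine_step K t x st)"
proof -
  have pr: "timed s (prune st)" if "timed s st" for s and st :: "'a list \<times> (nat, 'a) pool list"
  proof -
    let ?E = "last_full 0 (map members (snd st)) []"
    have "map fst (map (restrict_pool (\<lambda>y. y \<notin> set ?E)) (snd st)) = map fst (snd st)" by (simp add: comp_def)
    then have s: "sorted_wrt (\<lambda>P Q. fst P < fst Q) (map (restrict_pool (\<lambda>y. y \<notin> set ?E)) (snd st))"
      using that unfolding timed_def sorted_wrt_map [symmetric, where f = fst] by metis
    have "sorted_wrt (<) (map fst (snd (prune st)))"
      unfolding prune_def Let_def snd_conv sorted_wrt_map using sorted_wrt_filter [OF s] by (simp add: sorted_wrt_map)
    moreover have "length (fst (prune st)) \<le> s"
      using that unfolding timed_def prune_def Let_def fst_conv by (meson length_filter_le order_trans)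
    moreover have "fst P < s \<and> distinct (fst (snd P)) \<and> length (fst (snd P)) \<le> fst P \<and> set (members P) \<subseteq> set (fst (snd P))"
      if P: "P \<in> set (snd (prune st))" for P
    proof -
      obtain Q where "Q \<in> set (snd st)" "P = restrict_pool (\<lambda>y. y \<notin> set ?E) Q"
        using P by (auto simp: prune_def Let_def)
      moreover from this have "fst Q < s \<and> distinct (fst (snd Q)) \<and> length (fst (snd Q)) \<le> fst Q \<and> set (members Q) \<subseteq> set (fst (snd Q))"
        using \<open>timed s st\<close> unfolding timed_def by blast
      ultimately show ?thesis by (auto simp: restrict_pool_def members_def)
    qed
    ultimately show ?thesis unfolding timed_def by blast
  qed
  have P: "fst P < t \<and> distinct (fst (snd P)) \<and> length (fst (snd P)) \<le> fst P \<and> set (members P) \<subseteq> set (fst (snd P))"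
    if "P \<in> set (snd st)" for P using assms(1) that unfolding timed_def by blast
  have "timed (Suc t) (engine_move K t x st)"
  proof (cases "x \<in> set (fst st)")
    case True
    have e: "engine_move K t x st = (fst st, map (restrict_pool (\<lambda>y. y \<noteq> x)) (snd st))" using True by (simp add: engine_move_def)
    have "map fst (map (restrict_pool (\<lambda>y. y \<noteq> x)) (snd st)) = map fst (snd st)" by (simp add: comp_def)
    moreover have "fst Q < Suc t \<and> distinct (fst (snd Q)) \<and> length (fst (snd Q)) \<le> fst Q \<and> set (members Q) \<subseteq> set (fst (snd Q))"
      if Q: "Q \<in> set (map (restrict_pool (\<lambda>y. y \<noteq> x)) (snd st))" for Q
    proof -
      obtain P' where "P' \<in> set (snd st)" "Q = restrict_pool (\<lambda>y. y \<noteq> x) P'" using Q by auto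
      with P [of P'] show ?thesis by (auto simp: restrict_pool_def members_def)
    qed
    ultimately show ?thesis using assms(1) unfolding timed_def e fst_conv snd_conv by (metis le_SucI)
  next
    case False
    have s: "sorted_wrt (<) (map fst (snd st @ [(t, fst st, fst st)]))"
      using assms(1) P unfolding timed_def by (auto simp: sorted_wrt_append)
    have l: "length (fst st) \<le> t" using assms(1) by (simp add: timed_def)
    have e: "snd (engine_move K t x st) = snd st \<or> snd (engine_move K t x st) = snd st @ [(t, fst st, fst st)]"
      and f: "fst (engine_move K t x st) = fst st @ [x]" using False by (simp_all add: engine_move_def)
    have "fst Q < Suc t \<and> distinct (fst (snd Q)) \<and> length (fst (snd Q)) \<le> fst Q \<and> set (members Q) \<subseteq> set (fst (snd Q))"
      if Q: "Q \<in> set (snd (engine_move K t x st))" for Q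
    proof -
      have "Q \<in> set (snd st) \<or> Q = (t, fst st, fst st)" using e Q by auto
      then show ?thesis using P [of Q] l assms(2) by (auto simp: members_def)
    qed
    moreover have "sorted_wrt (<) (map fst (snd (engine_move K t x st)))"
      using e s by (auto simp: sorted_wrt_append)
    ultimately show ?thesis using l f unfolding timed_def by simp
  qed
  from pr [OF this] show ?thesis by (simp add: engine_step_def)
qed

lemma drops_mem_cases:
  assumes "x \<in> set (drops ch [] Ps)"
  obtains j where "j < length Ps" "filter (\<lambda>y. y \<notin> set (drops ch [] (take j Ps))) (members (Ps ! j)) \<noteq> []"
    "x = ch (fst (Ps ! j)) (fst (snd (Ps ! j))) (filter (\<lambda>y. y \<notin> set (drops ch [] (take j Ps))) (members (Ps ! j)))"
proof -
  have "\<exists>j<length Ps. filter (\<lambda>y. y \<notin> set (drops ch [] (take j Ps))) (members (Ps ! j)) \<noteq> [] \<and>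
    x = ch (fst (Ps ! j)) (fst (snd (Ps ! j))) (filter (\<lambda>y. y \<notin> set (drops ch [] (take j Ps))) (members (Ps ! j)))"
    using assms
  proof (induction Ps rule: rev_induct)
    case (snoc P Ps)
    let ?c = "filter (\<lambda>y. y \<notin> set (drops ch [] Ps)) (members P)"
    show ?case
    proof (cases "x \<in> set (drops ch [] Ps)")
      case True
      then obtain j where "j < length Ps" "filter (\<lambda>y. y \<notin> set (drops ch [] (take j Ps))) (members (Ps ! j)) \<noteq> []"
        "x = ch (fst (Ps ! j)) (fst (snd (Ps ! j))) (filter (\<lambda>y. y \<notin> set (drops ch [] (take j Ps))) (members (Ps ! j)))"
        using snoc.IH by blast
      then show ?thesis by (intro exI [of _ j]) (simp add: nth_append)
    next
      case False
      have "drops ch [] (Ps @ [P]) = (if ?c = [] then drops ch [] Ps else ch (fst P) (fst (snd P)) ?c # drops ch [] Ps)"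
        by (simp add: drops_append Let_def)
      then have "?c \<noteq> [] \<and> x = ch (fst P) (fst (snd P)) ?c" using snoc.prems False by (auto split: if_splits)
      then show ?thesis by (intro exI [of _ "length Ps"]) simp
    qed
  qed simp
  then show ?thesis by (elim exE conjE) (rule that)
qed

lemma length_drops_le: "length (drops ch acc Ps) \<le> length acc + length Ps"
proof (induction Ps arbitrary: acc)
  case (Cons P Ps)
  let ?c = "filter (\<lambda>y. y \<notin> set acc) (members P)"
  have "length (drops ch (if ?c = [] then acc else ch (fst P) (fst (snd P)) ?c # acc) Ps)
      \<le> length (if ?c = [] then acc else ch (fst P) (fst (snd P)) ?c # acc) + length Ps" by (rule Cons)
  then show ?case by (auto simp: Let_def split: if_splits)
qed simp

lemma drops_cong: "(\<And>P. P \<in> set Ps \<Longrightarrow> ch (fst P) = ch' (fst P)) \<Longrightarrow> drops ch acc Ps = drops ch' acc Ps"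
  by (induction Ps arbitrary: acc) (simp_all add: Let_def)

lemma finitary_comp:
  assumes "finitary n f"
  shows "finitary n (\<lambda>\<omega>. h (f \<omega>))"
  unfolding finitary_def
proof (intro allI impI)
  fix \<omega> \<omega>' :: "nat \<Rightarrow> bool" assume "\<forall>i<n. \<omega> i = \<omega>' i"
  then have "f \<omega> = f \<omega>'" by (intro finitaryD [OF assms]) simp
  then show "h (f \<omega>) = h (f \<omega>')" by simp
qed

lemma integrable_finitary:
  fixes f :: "(nat \<Rightarrow> bool) \<Rightarrow> real"
  assumes "finitary n f"
  shows "integrable coins f"
proof -
  let ?L = "{xs :: bool list. length xs = n}"
  have fin: "finite ?L" using finite_lists_length_eq [of "UNIV :: bool set" n] by simp
  have m: "f \<in> borel_measurable coins"
  proof (rule measurableI)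
    fix A :: "real set"
    have "{\<omega>. f \<omega> \<in> A} \<in> sets coins" by (rule sets_coins_finitary [OF finitary_comp [OF assms]])
    then show "f -` A \<inter> space coins \<in> sets coins" by (simp add: vimage_def)
  qed simp
  have "norm (f \<omega>) \<le> (\<Sum>xs\<in>?L. norm (f (\<lambda>i. i < n \<and> xs ! i)))" for \<omega>
  proof -
    have "f \<omega> = f (\<lambda>i. i < n \<and> map \<omega> [0..<n] ! i)" by (rule finitaryD [OF assms]) simp
    then show ?thesis using member_le_sum [of "map \<omega> [0..<n]" ?L "\<lambda>xs. norm (f (\<lambda>i. i < n \<and> xs ! i))"] fin by simp
  qed
  then show ?thesis using m by (intro coins.integrable_const_bound [where B = "\<Sum>xs\<in>?L. norm (f (\<lambda>i. i < n \<and> xs ! i))"]) auto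
qed

section \<open>Expected number of misses\<close>

context paging_lists
begin

text \<open>
  Keys of \<open>width t\<close> bits are long enough for the ties between them to cost no more than a constant in
  total, over all times and all sets.
\<close>

definition width :: "nat \<Rightarrow> nat" where "width t = 2 * Suc t + 2 * k + length FL"

definition offset :: "nat \<Rightarrow> nat" where "offset t = (\<Sum>u<t. width u * width u)"

definition bits :: "(nat \<Rightarrow> bool) \<Rightarrow> nat \<Rightarrow> bool list list" where
  "bits \<omega> t = map (\<lambda>b. map (\<lambda>j. \<omega> (offset t + b * width t + j)) [0..<width t]) [0..<width t]"

lemma offset_Suc: "offset (Suc t) = offset t + width t * width t" by (simp add: offset_def)

lemma offset_mono: "s \<le> t \<Longrightarrow> offset s \<le> offset t"
  unfolding offset_def by (rule sum_mono2) auto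

lemma bits_cong:
  assumes "\<And>i. offset t \<le> i \<Longrightarrow> i < offset (Suc t) \<Longrightarrow> \<omega> i = \<omega>' i"
  shows "bits \<omega> t = bits \<omega>' t"
proof -
  have "\<omega> (offset t + b * width t + j) = \<omega>' (offset t + b * width t + j)" if "b < width t" "j < width t" for b j
  proof (rule assms)
    have "b * width t + j < (b + 1) * width t" using that by simp
    also have "\<dots> \<le> width t * width t" using that by (intro mult_right_mono) auto
    finally show "offset t + b * width t + j < offset (Suc t)" by (simp add: offset_Suc)
  qed simp
  then show ?thesis by (auto simp: bits_def)
qed

lemma eng_timed: "R \<in> set FL \<Longrightarrow> timed t (eng (\<lambda>u. u) R t)"
proof (induction t)
  case 0
  then show ?case by (simp add: timed_def)
next
  case (Suc t)
  have "distinct (fst (eng (\<lambda>u. u) R t))" using eng_inv [OF Suc.prems, of "\<lambda>u. u" t] by (simp add: engine_inv_def engine_inv0_def)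
  moreover have "timed (Suc t) st" if "timed t st" for st :: "item list \<times> (nat, item) pool list"
    using that unfolding timed_def by (auto simp: le_SucI less_SucI)
  ultimately show ?case using timed_step [of t "eng (\<lambda>u. u) R t" "length R" "item t"] Suc by simp
qed

definition noise :: "nat \<Rightarrow> real" where "noise t = real t * (1/2) ^ width t"

text \<open>Earlier pools have smaller stamps, so the candidates of pool \<open>j\<close> depend
  only on coins before its block. At most \<open>j\<close> members have been withheld by then, and
  among the remaining candidates each is equally likely up to ties.\<close>

lemma prob_drop:
  fixes st :: "item list \<times> (nat, item) pool list"
  assumes tm: "timed t st" and inv: "engine_inv K st" and j: "j < length (snd st)"
    and c: "c = (\<lambda>\<omega>. filter (\<lambda>y. y \<notin> set (drops (\<lambda>a. choose_bits R (bits \<omega> a)) [] (take j (snd st)))) (members (snd st ! j)))"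
  shows "measure coins {\<omega>. choose_bits R (bits \<omega> (fst (snd st ! j))) (fst (snd (snd st ! j))) (c \<omega>) = x}
    \<le> 1 / real (length (members (snd st ! j)) - j) + noise (fst (snd st ! j))"
proof -
  define P where "P = snd st ! j"
  define \<tau> where "\<tau> = fst P"
  define N0 where "N0 = fst (snd P)"
  define M where "M = members P"
  have Pin: "P \<in> set (snd st)" using j by (simp add: P_def)
  have F: "\<tau> < t" "distinct N0" "length N0 \<le> \<tau>" "set M \<subseteq> set N0"
    using tm Pin unfolding timed_def \<tau>_def N0_def M_def by blast+
  have dM: "distinct M" and lM: "Suc j < length M"
    using inv Pin j unfolding engine_inv_def engine_inv0_def M_def P_def by auto
  have early: "fst Q < \<tau>" if Q: "Q \<in> set (take j (snd st))" for Q
  proof -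
    obtain l where "l < j" "Q = snd st ! l" using Q j by (auto simp: in_set_conv_nth)
    moreover have "sorted_wrt (<) (map fst (snd st))" using tm by (simp add: timed_def)
    ultimately show ?thesis using j sorted_wrt_nth_less [of "(<)" "map fst (snd st)" l j] by (simp add: \<tau>_def P_def)
  qed
  interpret key_block "offset \<tau>" "width \<tau>" N0
    by unfold_locales (use F in \<open>auto simp: width_def\<close>)
  have cb: "cols \<omega> = bits \<omega> \<tau>" for \<omega> by (simp add: cols_def bits_def)
  have cc: "c \<omega> = c \<omega>'" if "\<And>a. a < \<tau> \<Longrightarrow> bits \<omega> a = bits \<omega>' a" for \<omega> \<omega>'
  proof -
    have "drops (\<lambda>a. choose_bits R (bits \<omega> a)) [] (take j (snd st)) = drops (\<lambda>a. choose_bits R (bits \<omega>' a)) [] (take j (snd st))"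
      by (rule drops_cong) (use that early in simp)
    then show ?thesis unfolding c by simp
  qed
  have "measure coins {\<omega>. hd (winnow (\<lambda>col y. (y, True) \<notin> set (zip N0 col)) (cols \<omega>) (c \<omega>)) = x}
      \<le> 1 / real (length M - j) + real (length N0) * (1/2) ^ width \<tau>"
  proof (rule prob_pick)
    show "finitary (offset t) c"
      unfolding finitary_def
    proof (intro allI impI cc bits_cong)
      fix \<omega> \<omega>' :: "nat \<Rightarrow> bool" and a i
      assume "\<forall>i<offset t. \<omega> i = \<omega>' i" "a < \<tau>" "i < offset (Suc a)"
      then show "\<omega> i = \<omega>' i" using offset_mono [of "Suc a" t] F(1) by simp
    qed
    show "offset \<tau> + width \<tau> * width \<tau> \<le> offset t"
      using offset_mono [of "Suc \<tau>" t] F(1) by (simp add: offset_Suc)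
    show "c \<omega> = c \<omega>'" if e: "\<And>i. i \<notin> {offset \<tau>..<offset \<tau> + width \<tau> * width \<tau>} \<Longrightarrow> \<omega> i = \<omega>' i" for \<omega> \<omega>'
    proof (rule cc, rule bits_cong)
      fix a i assume "a < \<tau>" "i < offset (Suc a)"
      then have "i < offset \<tau>" using offset_mono [of "Suc a" \<tau>] by simp
      then show "\<omega> i = \<omega>' i" by (intro e) simp
    qed
    have "range c \<subseteq> {xs. set xs \<subseteq> set M \<and> length xs \<le> length M}"
      unfolding c M_def P_def by (auto intro: length_filter_le)
    then show "finite (range c)" by (rule finite_subset) (rule finite_lists_length_le, simp)
    show "set (c \<omega>) \<subseteq> set N0" for \<omega> using F(4) unfolding c M_def P_def by auto
    show "0 < length M - j" using lM by simp
    show "length M - j \<le> card (set (c \<omega>))" for \<omega>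
    proof -
      let ?D = "drops (\<lambda>a. choose_bits R (bits \<omega> a)) [] (take j (snd st))"
      have "card (set M) \<le> card (set (c \<omega>)) + card (set ?D)"
        by (rule order_trans [OF card_mono card_Un_le]) (auto simp: c M_def P_def)
      moreover have "card (set ?D) \<le> j"
        using card_length [of ?D] length_drops_le [of "\<lambda>a. choose_bits R (bits \<omega> a)" "[]" "take j (snd st)"] by simp
      ultimately show ?thesis using distinct_card [OF dM] by linarith
    qed
  qed
  also have "real (length N0) * (1/2) ^ width \<tau> \<le> noise \<tau>"
    unfolding noise_def using F(3) by (intro mult_right_mono) simp_all
  finally show ?thesis
    unfolding cb choose_bits_def P_def [symmetric] \<tau>_def [symmetric] N0_def [symmetric] M_def [symmetric] by simp
qed

lemma miss_finitary:
  assumes "timed t st"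
  shows "finitary (offset t) (\<lambda>\<omega>. miss (\<lambda>a. choose_bits R (bits \<omega> a)) x st)"
  unfolding finitary_def
proof (intro allI impI)
  fix \<omega> \<omega>' :: "nat \<Rightarrow> bool" assume e: "\<forall>i<offset t. \<omega> i = \<omega>' i"
  have "drops (\<lambda>a. choose_bits R (bits \<omega> a)) [] (snd st) = drops (\<lambda>a. choose_bits R (bits \<omega>' a)) [] (snd st)"
  proof (rule drops_cong)
    fix P assume "P \<in> set (snd st)"
    then have "Suc (fst P) \<le> t" using assms unfolding timed_def by (meson Suc_leI)
    then have "bits \<omega> (fst P) = bits \<omega>' (fst P)" using e offset_mono [of "Suc (fst P)" t] by (intro bits_cong) auto
    then show "choose_bits R (bits \<omega> (fst P)) = choose_bits R (bits \<omega>' (fst P))" by simp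
  qed
  then show "miss (\<lambda>a. choose_bits R (bits \<omega> a)) x st = miss (\<lambda>a. choose_bits R (bits \<omega>' a)) x st"
    by (simp add: miss_def cache_def)
qed

text \<open>A miss inside the support means that a pool containing \<open>x\<close> withholds it;
  the sum is the union bound over these pools.\<close>

lemma expected_miss:
  fixes st :: "item list \<times> (nat, item) pool list"
  assumes tm: "timed t st" and inv: "engine_inv K st"
  shows "(LINT \<omega>|coins. real (miss (\<lambda>a. choose_bits R (bits \<omega> a)) x st)) \<le> real (fresh x st) +
    (\<Sum>j<length (snd st). if x \<in> set (members (snd st ! j))
       then 1 / real (length (members (snd st ! j)) - j) + noise (fst (snd st ! j)) else 0)"
proof -
  let ?ch = "\<lambda>\<omega> a. choose_bits R (bits \<omega> a)"
  let ?m = "\<lambda>\<omega>. miss (?ch \<omega>) x st"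
  let ?b = "\<lambda>j. 1 / real (length (members (snd st ! j)) - j) + noise (fst (snd st ! j))"
  define J where "J = {j. j < length (snd st) \<and> x \<in> set (members (snd st ! j))}"
  have nb: "0 \<le> ?b j" for j by (simp add: noise_def)
  have fm: "finitary (offset t) ?m" by (rule miss_finitary [OF tm])
  have sumJ: "(\<Sum>j<length (snd st). if x \<in> set (members (snd st ! j)) then ?b j else 0) = (\<Sum>j\<in>J. ?b j)"
    unfolding J_def by (subst sum.inter_filter [symmetric]) (auto intro!: sum.cong)
  have ind: "(\<lambda>\<omega>. real (?m \<omega>)) = indicator {\<omega>. ?m \<omega> = 1}"
    by (auto simp: miss_def indicator_def)
  have meas: "{\<omega>. ?m \<omega> = 1} \<in> sets coins" by (rule sets_coins_finitary [OF finitary_comp [OF fm]])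
  have E: "(LINT \<omega>|coins. real (?m \<omega>)) = measure coins {\<omega>. ?m \<omega> = 1}" unfolding ind by simp
  show ?thesis
  proof (cases "x \<in> set (fst st)")
    case False
    then have "real (fresh x st) = 1" by (simp add: fresh_def)
    moreover have "0 \<le> (\<Sum>j\<in>J. ?b j)" by (rule sum_nonneg) (rule nb)
    ultimately show ?thesis unfolding E sumJ using coins.prob_le_1 [of "{\<omega>. ?m \<omega> = 1}"] by linarith
  next
    case True
    let ?c = "\<lambda>j \<omega>. filter (\<lambda>y. y \<notin> set (drops (?ch \<omega>) [] (take j (snd st)))) (members (snd st ! j))"
    let ?A = "\<lambda>j. {\<omega>. choose_bits R (bits \<omega> (fst (snd st ! j))) (fst (snd (snd st ! j))) (?c j \<omega>) = x}"
    have bt: "bits \<omega> a = bits \<omega>' a" if "\<forall>i<offset t. \<omega> i = \<omega>' i" "a < t" for \<omega> \<omega>' :: "nat \<Rightarrow> bool" and a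
      using that offset_mono [of "Suc a" t] by (intro bits_cong) auto
    have mA: "?A j \<in> sets coins" if j: "j < length (snd st)" for j
    proof (rule sets_coins_finitary [of "offset t"])
      have lt: "fst P < t" if "P \<in> set (snd st)" for P using tm that unfolding timed_def by blast
      show "finitary (offset t) (\<lambda>\<omega>. choose_bits R (bits \<omega> (fst (snd st ! j))) (fst (snd (snd st ! j))) (?c j \<omega>) = x)"
        unfolding finitary_def
      proof (intro allI impI)
        fix \<omega> \<omega>' :: "nat \<Rightarrow> bool" assume e: "\<forall>i<offset t. \<omega> i = \<omega>' i"
        have "drops (?ch \<omega>) [] (take j (snd st)) = drops (?ch \<omega>') [] (take j (snd st))"
          by (rule drops_cong) (use bt [OF e] lt in \<open>auto dest: in_set_takeD\<close>)
        moreover have "bits \<omega> (fst (snd st ! j)) = bits \<omega>' (fst (snd st ! j))" by (rule bt [OF e]) (use lt j in simp)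
        ultimately show "(choose_bits R (bits \<omega> (fst (snd st ! j))) (fst (snd (snd st ! j))) (?c j \<omega>) = x) =
            (choose_bits R (bits \<omega>' (fst (snd st ! j))) (fst (snd (snd st ! j))) (?c j \<omega>') = x)" by simp
      qed
    qed
    have sub: "{\<omega>. ?m \<omega> = 1} \<subseteq> (\<Union>j\<in>J. ?A j)"
    proof
      fix \<omega> assume "\<omega> \<in> {\<omega>. ?m \<omega> = 1}"
      then have "x \<notin> set (cache (?ch \<omega>) st)" by (auto simp: miss_def)
      then have "x \<in> set (drops (?ch \<omega>) [] (snd st))" using True by (auto simp: cache_def)
      then obtain j where j: "j < length (snd st)" "?c j \<omega> \<noteq> []"
        "x = ?ch \<omega> (fst (snd st ! j)) (fst (snd (snd st ! j))) (?c j \<omega>)"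
        by (rule drops_mem_cases)
      have "x \<in> set (?c j \<omega>)" using choice_ok_bits [of R] j(2,3) unfolding choice_ok_def by metis
      then have "j \<in> J" using j(1) by (simp add: J_def)
      then show "\<omega> \<in> (\<Union>j\<in>J. ?A j)" using j(3) by blast
    qed
    have fJ: "finite J" by (simp add: J_def)
    have "measure coins {\<omega>. ?m \<omega> = 1} \<le> measure coins (\<Union>j\<in>J. ?A j)"
      by (rule coins.finite_measure_mono [OF sub], rule sets.finite_UN [OF fJ], rule mA) (simp add: J_def)
    also have "\<dots> \<le> (\<Sum>j\<in>J. measure coins (?A j))"
      by (rule coins.finite_measure_subadditive_finite [OF fJ]) (use mA in \<open>auto simp: J_def\<close>)
    also have "\<dots> \<le> (\<Sum>j\<in>J. ?b j)"
      by (rule sum_mono, rule prob_drop [OF tm inv _ refl]) (simp add: J_def)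
    finally show ?thesis unfolding E sumJ by simp
  qed
qed

text \<open>A pool of slack \<open>s\<close> chooses among at least \<open>s + 1\<close> candidates,
  so it withholds a requested member with probability at most \<open>1 / (s + 1)\<close> up to ties.
  The price \<open>harm (Suc s) - 1\<close> of the slack drops by just this amount. A fresh request
  pays one for itself and \<open>harm (length R) - 1\<close> for its pool.\<close>

lemma expected_misses:
  assumes R: "R \<in> set FL"
  shows "(\<Sum>t<length reqs. if set (S t) \<subseteq> set R
      then (LINT \<omega>|coins. real (miss (\<lambda>a. choose_bits R (bits \<omega> a)) (item t) (eng (\<lambda>u. u) R t))) else 0)
    \<le> harm (length R) * real (freshes (\<lambda>u. u) R) + (\<Sum>t<length reqs. real (length R) * noise t)"
proof -
  \<comment> \<open>The second summand prepays the error by ties for the at most \<open>s\<close>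
    further requests of members.\<close>
  define g where "g \<tau> s = harm (Suc s) - 1 + real s * noise \<tau>" for \<tau> s
  have n0: "0 \<le> noise t" for t by (simp add: noise_def)
  have "1 \<le> (harm (Suc s) :: real)" for s using harm_mono [of 1 "Suc s", where 'a = real] by (simp add: harm_def)
  then have g0: "0 \<le> g \<tau> s" for \<tau> s using n0 [of \<tau>] by (simp add: g_def)
  have gd: "g \<tau> s - g \<tau> (s - 1) = 1 / real (Suc s) + noise \<tau>" if s0: "0 < s" for \<tau> s
  proof -
    obtain n where s: "s = Suc n" using s0 by (cases s) auto
    have "(harm (Suc (Suc n)) :: real) = harm (Suc n) + inverse (real (Suc (Suc n)))" by (rule harm_Suc)
    then show ?thesis by (simp add: s g_def inverse_eq_divide algebra_simps)
  qed
  have K0: "0 < length R" using FL_ok [OF R] by simp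
  let ?E = "\<lambda>t. LINT \<omega>|coins. real (miss (\<lambda>a. choose_bits R (bits \<omega> a)) (item t) (eng (\<lambda>u. u) R t))"
  have step: "?E t + potential g (eng (\<lambda>u. u) R (Suc t)) \<le> potential g (eng (\<lambda>u. u) R t) +
      real (fresh (item t) (eng (\<lambda>u. u) R t)) * harm (length R) + real (length R) * noise t"
    if "set (S t) \<subseteq> set R" for t
  proof -
    let ?st = "eng (\<lambda>u. u) R t"
    have inv: "engine_inv (length R) ?st" by (rule eng_inv [OF R])
    have eq: "(\<Sum>j<length (snd ?st). if item t \<in> set (members (snd ?st ! j))
         then g (fst (snd ?st ! j)) (length (members (snd ?st ! j)) - Suc j) -
              g (fst (snd ?st ! j)) (length (members (snd ?st ! j)) - Suc j - 1) else 0) =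
      (\<Sum>j<length (snd ?st). if item t \<in> set (members (snd ?st ! j))
       then 1 / real (length (members (snd ?st ! j)) - j) + noise (fst (snd ?st ! j)) else 0)"
    proof (rule sum.cong [OF refl])
      fix j assume "j \<in> {..<length (snd ?st)}"
      then have lt: "Suc j < length (members (snd ?st ! j))" using inv by (simp add: engine_inv_def)
      then have "0 < length (members (snd ?st ! j)) - Suc j"
        "Suc (length (members (snd ?st ! j)) - Suc j) = length (members (snd ?st ! j)) - j" by simp_all
      then show "(if item t \<in> set (members (snd ?st ! j))
         then g (fst (snd ?st ! j)) (length (members (snd ?st ! j)) - Suc j) -
              g (fst (snd ?st ! j)) (length (members (snd ?st ! j)) - Suc j - 1) else 0) =
        (if item t \<in> set (members (snd ?st ! j))
         then 1 / real (length (members (snd ?st ! j)) - j) + noise (fst (snd ?st ! j)) else 0)"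
        using gd [of "length (members (snd ?st ! j)) - Suc j" "fst (snd ?st ! j)"] by simp
    qed
    have "?E t + potential g (engine_step (length R) t (item t) ?st) \<le> real (fresh (item t) ?st) + (potential g ?st +
        real (fresh (item t) ?st) * g t (length R - 1))"
      using expected_miss [OF eng_timed [OF R] inv, of R "item t"]
        potential_step [where g = g and a = t and x = "item t", OF inv K0 g0] unfolding eq by linarith
    also have "g t (length R - 1) = harm (length R) - 1 + real (length R - 1) * noise t" using K0 by (simp add: g_def)
    also have "real (fresh (item t) ?st) + (potential g ?st + real (fresh (item t) ?st) * (harm (length R) - 1 + real (length R - 1) * noise t))
       = potential g ?st + real (fresh (item t) ?st) * harm (length R) + real (fresh (item t) ?st) * (real (length R - 1) * noise t)"
      by (simp add: algebra_simps)
    also have "real (fresh (item t) ?st) * (real (length R - 1) * noise t) \<le> 1 * (real (length R) * noise t)"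
      using n0 [of t] by (intro mult_mono) (simp_all add: fresh_def)
    finally show ?thesis using that by simp
  qed
  have "(\<Sum>u<t. if set (S u) \<subseteq> set R then ?E u else 0) + potential g (eng (\<lambda>u. u) R t) \<le>
      harm (length R) * real (\<Sum>u<t. if set (S u) \<subseteq> set R then fresh (item u) (eng (\<lambda>u. u) R u) else 0) +
      (\<Sum>u<t. real (length R) * noise u)" for t
  proof (induction t)
    case 0
    then show ?case by (simp add: potential_def)
  next
    case (Suc t)
    show ?case
    proof (cases "set (S t) \<subseteq> set R")
      case True
      then show ?thesis using Suc step [OF True] by (simp add: algebra_simps)
    next
      case False
      have "0 \<le> real (length R) * noise t" using n0 by simp
      then show ?thesis using Suc False by simp
    qed
  qed
  from this [of "length reqs"] have "(\<Sum>u<length reqs. if set (S u) \<subseteq> set R then ?E u else 0) \<le>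
      harm (length R) * real (freshes (\<lambda>u. u) R) + (\<Sum>u<length reqs. real (length R) * noise u) - potential g (eng (\<lambda>u. u) R (length reqs))"
    unfolding freshes_def by linarith
  moreover have "0 \<le> potential g (eng (\<lambda>u. u) R (length reqs))" unfolding potential_def by (rule sum_nonneg) (rule g0)
  ultimately show ?thesis by linarith
qed

text \<open>By \<open>m \<le> 2 ^ m\<close>, parts of the exponent \<open>width t\<close> cancel the
  factors \<open>length FL\<close>, \<open>k\<close> and \<open>t\<close>; \<open>Suc t\<close> bits
  are left over and give a geometric series. The bound is independent of the instance, as an
  additive constant must be.\<close>

lemma total_noise: "real (length FL) * (\<Sum>t<n. real k * noise t) \<le> 1"
proof -
  have p: "real m \<le> 2 ^ m" for m using less_exp [of m] by (metis less_imp_le of_nat_le_iff of_nat_numeral of_nat_power)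
  have t: "real (length FL) * (real k * noise t) \<le> (1/2) ^ Suc t" for t
  proof -
    have "real (length FL) * (real k * real t) \<le> 2 ^ length FL * (2 ^ k * 2 ^ t)" by (intro mult_mono p) simp_all
    also have "\<dots> = 2 ^ (length FL + k + t)" by (simp add: power_add)
    also have "\<dots> \<le> 2 ^ (length FL + 2 * k + Suc t)" by (intro power_increasing) simp_all
    finally have le: "real (length FL) * (real k * real t) * (1/2) ^ width t \<le> 2 ^ (length FL + 2 * k + Suc t) * (1/2) ^ width t"
      by (rule mult_right_mono) simp
    have "width t = (length FL + 2 * k + Suc t) + Suc t" by (simp add: width_def)
    then have "2 ^ (length FL + 2 * k + Suc t) * (1/2) ^ width t =
        (2 ^ (length FL + 2 * k + Suc t) * (1/2) ^ (length FL + 2 * k + Suc t)) * ((1/2) ^ Suc t :: real)"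
      by (simp only: power_add mult.assoc)
    also have "\<dots> = (1/2) ^ Suc t" unfolding power_mult_distrib [symmetric] by simp
    finally show ?thesis using le unfolding noise_def by (simp only: mult.assoc)
  qed
  have "real (length FL) * (\<Sum>t<n. real k * noise t) = (\<Sum>t<n. real (length FL) * (real k * noise t))" by (rule sum_distrib_left)
  also have "\<dots> \<le> (\<Sum>t<n. (1/2) ^ Suc t)" by (rule sum_mono) (rule t)
  also have "\<dots> = 1 - (1/2) ^ n" by (induction n) (simp_all add: field_simps)
  also have "\<dots> \<le> 1" by simp
  finally show ?thesis .
qed

lemma sum_expected_misses:
  "integrable coins (\<lambda>\<omega>. real (misses choose_bits (bits \<omega>) R))"
  "(LINT \<omega>|coins. real (\<Sum>R\<in>set FL. misses choose_bits (bits \<omega>) R)) \<le> harm k * real (\<Sum>R\<in>set FL. freshes (\<lambda>u. u) R) + 1"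
proof -
  let ?m = "\<lambda>R t \<omega>. real (miss (\<lambda>a. choose_bits R (bits \<omega> a)) (item t) (eng (\<lambda>u. u) R t))"
  \<comment> \<open>The bits move from the pools into the choice, and the state of the engine no
    longer depends on the coins.\<close>
  have me: "miss (choose_bits R) (item t) (eng (bits \<omega>) R t) = miss (\<lambda>a. choose_bits R (bits \<omega> a)) (item t) (eng (\<lambda>u. u) R t)" for R t \<omega>
    by (subst eng_map_aux, rule miss_map_aux)
  have mi: "real (misses choose_bits (bits \<omega>) R) = (\<Sum>t<length reqs. if set (S t) \<subseteq> set R then ?m R t \<omega> else 0)" for R \<omega>
    unfolding misses_def me of_nat_sum by (rule sum.cong) simp_all
  have f1: "finitary (offset (length reqs)) (\<lambda>\<omega>. real (misses choose_bits (bits \<omega>) R))" for R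
    unfolding finitary_def
  proof (intro allI impI)
    fix \<omega> \<omega>' :: "nat \<Rightarrow> bool" assume e: "\<forall>i<offset (length reqs). \<omega> i = \<omega>' i"
    have b: "bits \<omega> a = bits \<omega>' a" if "a < length reqs" for a
      using e offset_mono [of "Suc a" "length reqs"] that by (intro bits_cong) auto
    have "eng (bits \<omega>) R t = eng (bits \<omega>') R t" if "t \<le> length reqs" for t
      using that by (induction t) (simp_all add: b)
    then show "real (misses choose_bits (bits \<omega>) R) = real (misses choose_bits (bits \<omega>') R)"
      unfolding misses_def by (intro arg_cong [where f = real] sum.cong) auto
  qed
  show i1: "integrable coins (\<lambda>\<omega>. real (misses choose_bits (bits \<omega>) R))" for R
    by (rule integrable_finitary [OF f1])
  have im: "integrable coins (?m R t)" if "R \<in> set FL" for R t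
    by (rule integrable_finitary [OF finitary_comp [OF miss_finitary [OF eng_timed [OF that]]]])
  have E1: "(LINT \<omega>|coins. real (misses choose_bits (bits \<omega>) R)) \<le> harm k * real (freshes (\<lambda>u. u) R) + (\<Sum>t<length reqs. real k * noise t)"
    if R: "R \<in> set FL" for R
  proof -
    have lk: "length R \<le> k" using FL_ok [OF R] by (metis card_atLeastAtMost card_mono diff_Suc_1 distinct_card finite_atLeastAtMost)
    have "(LINT \<omega>|coins. real (misses choose_bits (bits \<omega>) R)) =
        (\<Sum>t<length reqs. LINT \<omega>|coins. (if set (S t) \<subseteq> set R then ?m R t \<omega> else 0))"
      unfolding mi
    proof (rule Bochner_Integration.integral_sum)
      show "integrable coins (\<lambda>\<omega>. if set (S t) \<subseteq> set R then ?m R t \<omega> else 0)" for t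
        using im [OF R, of t] by (cases "set (S t) \<subseteq> set R") simp_all
    qed
    also have "\<dots> = (\<Sum>t<length reqs. if set (S t) \<subseteq> set R then (LINT \<omega>|coins. ?m R t \<omega>) else 0)"
      by (rule sum.cong) auto
    also have "\<dots> \<le> harm (length R) * real (freshes (\<lambda>u. u) R) + (\<Sum>t<length reqs. real (length R) * noise t)"
      by (rule expected_misses [OF R])
    also have "\<dots> \<le> harm k * real (freshes (\<lambda>u. u) R) + (\<Sum>t<length reqs. real k * noise t)"
      using lk by (intro add_mono mult_right_mono sum_mono harm_mono) (simp_all add: noise_def)
    finally show ?thesis .
  qed
  have "(LINT \<omega>|coins. real (\<Sum>R\<in>set FL. misses choose_bits (bits \<omega>) R)) =
      (\<Sum>R\<in>set FL. LINT \<omega>|coins. real (misses choose_bits (bits \<omega>) R))"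
    unfolding of_nat_sum by (rule Bochner_Integration.integral_sum) (rule i1)
  also have "\<dots> \<le> (\<Sum>R\<in>set FL. harm k * real (freshes (\<lambda>u. u) R) + (\<Sum>t<length reqs. real k * noise t))"
    by (rule sum_mono) (rule E1)
  also have "\<dots> = harm k * real (\<Sum>R\<in>set FL. freshes (\<lambda>u. u) R) + real (card (set FL)) * (\<Sum>t<length reqs. real k * noise t)"
    by (simp add: sum.distrib sum_distrib_left)
  also have "real (card (set FL)) * (\<Sum>t<length reqs. real k * noise t) \<le> real (length FL) * (\<Sum>t<length reqs. real k * noise t)"
    by (intro mult_right_mono sum_nonneg) (simp_all add: card_length noise_def)
  also have "\<dots> \<le> 1" by (rule total_noise)
  finally show "(LINT \<omega>|coins. real (\<Sum>R\<in>set FL. misses choose_bits (bits \<omega>) R)) \<le> harm k * real (\<Sum>R\<in>set FL. freshes (\<lambda>u. u) R) + 1"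
    by simp
qed

end

section \<open>The three algorithms\<close>

context paging_lists
begin

lemma misses_deterministic:
  assumes choice: "\<And>R. choice_ok (ch R)" and R: "R \<in> set FL"
  shows "misses ch aux R \<le> length R * freshes aux R"
proof -
  have K0: "0 < length R" using FL_ok [OF R] by simp
  have "real (\<Sum>u<t. if set (S u) \<subseteq> set R then miss (ch R) (item u) (eng aux R u) else 0) + potential (\<lambda>_. real) (eng aux R t) \<le>
      real (length R) * real (\<Sum>u<t. if set (S u) \<subseteq> set R then fresh (item u) (eng aux R u) else 0)" for t
  proof (induction t)
    case 0
    then show ?case by (simp add: potential_def)
  next
    case (Suc t)
    show ?case
    proof (cases "set (S t) \<subseteq> set R")
      case True
      have "real (miss (ch R) (item t) (eng aux R t)) + potential (\<lambda>_. real) (eng aux R (Suc t))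
          \<le> potential (\<lambda>_. real) (eng aux R t) + real (length R) * real (fresh (item t) (eng aux R t))"
        using miss_bound_deterministic [OF choice [of R] eng_inv [OF R] K0, of "item t" aux t "aux t"] True by simp
      then show ?thesis using Suc True by (simp add: algebra_simps del: eng.simps)
    next
      case False
      then show ?thesis using Suc by simp
    qed
  qed
  from this [of "length reqs"] have "real (misses ch aux R) + potential (\<lambda>_. real) (eng aux R (length reqs)) \<le> real (length R) * real (freshes aux R)"
    by (simp only: misses_def freshes_def)
  moreover have "0 \<le> potential (\<lambda>_. real) (eng aux R (length reqs))" unfolding potential_def by (rule sum_nonneg) simp
  ultimately have "real (misses ch aux R) \<le> real (length R * freshes aux R)" by simp
  then show ?thesis by (simp only: of_nat_le_iff)
qed

lemma length_le_k: "R \<in> set FL \<Longrightarrow> length R \<le> k"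
  using FL_ok by (metis card_atLeastAtMost card_mono diff_Suc_1 distinct_card finite_atLeastAtMost)

definition ents :: "(nat list \<times> item) list" where
  "ents = map (\<lambda>t. (S t, item t)) [0..<length reqs]"

lemma misses_future:
  assumes R: "R \<in> set FL"
  shows "misses choose_future (\<lambda>t. drop (Suc t) ents) R \<le> freshes (\<lambda>t. drop (Suc t) ents) R"
proof -
  let ?aux = "\<lambda>t. drop (Suc t) ents"
  have d: "drop t ents = (S t, item t) # drop (Suc t) ents" if "t < length reqs" for t
    using that by (subst Cons_nth_drop_Suc [symmetric]) (simp_all add: ents_def)
  have fut: "future_inv (seen_by R) (seen_by R (drop t ents)) (eng ?aux R t)" if "t \<le> length reqs" for t
    using that
  proof (induction t)
    case 0
    then show ?case by (simp add: future_inv_def)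
  next
    case (Suc t)
    then have t: "t < length reqs" and IH: "future_inv (seen_by R) (seen_by R (drop t ents)) (eng ?aux R t)" by simp_all
    show ?case
    proof (cases "set (S t) \<subseteq> set R")
      case True
      then have "seen_by R (drop t ents) = item t # seen_by R (drop (Suc t) ents)" using d [OF t] by (simp add: seen_by_def)
      from future_inv_step [OF IH [unfolded this] refl eng_inv [OF R]] show ?thesis using True by simp
    next
      case False
      then have "seen_by R (drop t ents) = seen_by R (drop (Suc t) ents)" using d [OF t] by (simp add: seen_by_def)
      then show ?thesis using IH False by simp
    qed
  qed
  have "miss (choose_future R) (item t) (eng ?aux R t) \<le> fresh (item t) (eng ?aux R t)"
    if t: "t < length reqs" and "set (S t) \<subseteq> set R" for t
  proof -
    have "seen_by R (drop t ents) = item t # seen_by R (drop (Suc t) ents)" using d [OF t] that by (simp add: seen_by_def)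
    with fut [of t] t have "future_inv (seen_by R) (item t # seen_by R (drop (Suc t) ents)) (eng ?aux R t)" by simp
    from miss_furthest [OF choice_ok_future eng_inv [OF R] furthest_future this] show ?thesis .
  qed
  then show ?thesis unfolding misses_def freshes_def by (intro sum_mono) auto
qed

lemma core_nodes_at: "core ch FL (map (\<lambda>t. (S t, item t, aux t)) [0..<n]) = nodes_at ch aux n"
  by (induction n) (simp_all add: core_def)

lemma entries_take:
  assumes "t \<le> length reqs"
  shows "entries (take t reqs) = map (\<lambda>u. (S u, item u)) [0..<t]"
proof -
  have "rev (map snd (hist t)) = map (\<lambda>u. (S u, item u)) [0..<t]" using assms
  proof (induction t)
    case (Suc t)
    then show ?case by (simp add: hist_Suc log_request_def S_def item_def)
  qed simp
  then show ?thesis by (simp add: entries_def hist_def)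
qed

text \<open>The program consumes the tape block by block, whereas the analysis addresses coins by
  absolute positions.\<close>

lemma chop_bits:
  assumes len: "\<And>t. t < length Ds \<Longrightarrow> length (Ds ! t) = width t" and m: "offset (length Ds) \<le> m"
  shows "chop Ds (map \<omega> [0..<m]) = map (bits \<omega>) [0..<length Ds]"
proof -
  let ?f = "\<lambda>a D. (fst (blocks D (fst a)), snd a @ [snd (blocks D (fst a))])"
  let ?tape = "map \<omega> [0..<m]"
  have "foldl ?f (?tape, []) (take t Ds) = (drop (offset t) ?tape, map (bits \<omega>) [0..<t])" if "t \<le> length Ds" for t
    using that
  proof (induction t)
    case 0
    then show ?case by (simp add: offset_def)
  next
    case (Suc t)
    then have t: "t < length Ds" by simp
    let ?W = "width t"
    have om: "offset t + ?W * ?W \<le> m" using m offset_mono [of "Suc t" "length Ds"] t by (simp add: offset_Suc)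
    have col: "take ?W (drop (b * ?W) (drop (offset t) ?tape)) = map (\<lambda>j. \<omega> (offset t + b * ?W + j)) [0..<?W]" if b: "b < ?W" for b
    proof (rule nth_equalityI)
      have "b * ?W + ?W = (b + 1) * ?W" by simp
      also have "\<dots> \<le> ?W * ?W" using b by (intro mult_right_mono) auto
      finally have le: "b * ?W + ?W \<le> ?W * ?W" .
      then show "length (take ?W (drop (b * ?W) (drop (offset t) ?tape))) = length (map (\<lambda>j. \<omega> (offset t + b * ?W + j)) [0..<?W])"
        using om by simp
      fix j assume "j < length (take ?W (drop (b * ?W) (drop (offset t) ?tape)))"
      then show "take ?W (drop (b * ?W) (drop (offset t) ?tape)) ! j = map (\<lambda>j. \<omega> (offset t + b * ?W + j)) [0..<?W] ! j"
        using om le by (simp add: add.assoc [symmetric] add.commute)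
    qed
    have bl: "blocks (Ds ! t) (drop (offset t) ?tape) = (drop (offset (Suc t)) ?tape, bits \<omega> t)"
      unfolding blocks_eq len [OF t] bits_def using col by (simp add: offset_Suc add.commute)
    show ?case using Suc t bl by (simp add: take_Suc_conv_app_nth)
  qed
  from this [of "length Ds"] show ?thesis by (simp add: chop_def)
qed

lemma offset_le: "offset (length reqs) \<le> length reqs * (2 * length reqs + 2 * k + length FL) ^ 2"
proof -
  have "offset (length reqs) \<le> (\<Sum>u<length reqs. (2 * length reqs + 2 * k + length FL) ^ 2)"
    unfolding offset_def power2_eq_square by (intro sum_mono mult_mono) (auto simp: width_def)
  then show ?thesis by simp
qed

end

section \<open>Encoded instances and the algorithms\<close>

definition slot_list :: "paging_instance \<Rightarrow> nat list" where
  "slot_list I = sorted_list_of_set {1..slots I}"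

definition family_list :: "paging_instance \<Rightarrow> nat list list" where
  "family_list I = map sorted_list_of_set (family I)"

definition request_list :: "paging_instance \<Rightarrow> (nat \<times> nat list) list" where
  "request_list I = map (\<lambda>r. (fst r, sorted_list_of_set (snd r))) (requests I)"

definition as_lists :: "paging_instance \<Rightarrow> nat list \<times> nat list list \<times> (nat \<times> nat list) list" where
  "as_lists I = (slot_list I, family_list I, request_list I)"

lemma enc_list_map: "enc_list e (map f xs) = enc_list (\<lambda>x. e (f x)) xs"
  by (induction xs) simp_all

text \<open>Sets are encoded by their sorted lists. As the slots are listed one by one, their number
  is at most the input size.\<close>

lemma enc_as_lists: "enc_instance I = enc (as_lists I)"
proof -
  have s: "enc_slots A = enc (sorted_list_of_set A)" for A by (simp add: enc_slots_def enc_list_def enc_nat_def)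
  have r: "(\<lambda>(p, A). Pair (enc_nat p) (enc (sorted_list_of_set A))) = (\<lambda>r. enc (fst r, sorted_list_of_set (snd r)))"
    by (auto simp: enc_prod_def enc_nat_def)
  have f: "enc_slots = (\<lambda>A. enc (sorted_list_of_set A))" using s by auto
  show ?thesis
    unfolding enc_instance_def as_lists_def slot_list_def family_list_def request_list_def f r
    by (simp add: enc_prod_def enc_list_def enc_list_map)
qed

lemma slot_list_eq: "slot_list I = [1..<Suc (slots I)]"
  unfolding slot_list_def by (metis atLeastLessThanSuc_atLeastAtMost sorted_list_of_set_range)

lemma enc_config_eq: "enc_config I C = enc (map C (slot_list I))"
  unfolding enc_config_def slot_list_eq
  by (simp add: enc_list_def enc_option_def enc_nat_def enc_list_map del: upt_Suc)

lemma instance_lists: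
  assumes "I \<in> slot_laminar"
  shows "paging_lists (slots I) (family_list I) (request_list I)" "set ` set (family_list I) = set (family I)"
    "requests I = map (\<lambda>r. (fst r, set (snd r))) (request_list I)"
proof -
  have F: "distinct (family I)" "\<And>A. A \<in> set (family I) \<Longrightarrow> A \<noteq> {} \<and> A \<subseteq> {1..slots I}"
    "\<And>r. r \<in> set (requests I) \<Longrightarrow> snd r \<in> set (family I)" "laminar (set (family I))"
    using assms by (auto simp: slot_laminar_def slot_heterogenous_def)
  have fin: "finite A" if "A \<in> set (family I)" for A using F(2) [OF that] finite_subset by blast
  have m: "map set (family_list I) = family I"
    unfolding family_list_def map_map by (rule map_idI) (use fin in simp)
  then show s: "set ` set (family_list I) = set (family I)" by (metis list.set_map)
  show "requests I = map (\<lambda>r. (fst r, set (snd r))) (request_list I)"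
    unfolding request_list_def map_map by (rule map_idI [symmetric]) (use fin F(3) in \<open>simp add: comp_def\<close>)
  show "paging_lists (slots I) (family_list I) (request_list I)"
  proof
    fix R assume "R \<in> set (family_list I)"
    then obtain A where A: "A \<in> set (family I)" "R = sorted_list_of_set A" by (auto simp: family_list_def)
    then show "R \<noteq> [] \<and> distinct R \<and> set R \<subseteq> {1..slots I}" using F(2) [OF A(1)] fin [OF A(1)] by auto
  next
    fix r assume "r \<in> set (request_list I)"
    then show "snd r \<in> set (family_list I)" using F(3) by (auto simp: request_list_def family_list_def)
  qed (use m s F in simp_all)
qed

text \<open>\<open>LEAST\<close> is meaningful only if some solution exists; the run of the
  algorithm itself provides one.\<close>

lemma opt_attained:
  assumes "solution I Cs"
  obtains Cs' where "solution I Cs'" "cost I Cs' = opt I"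
proof -
  have "\<exists>Cs'. solution I Cs' \<and> cost I Cs' = opt I"
    unfolding opt_def by (rule LeastI_ex) (use assms in blast)
  then show ?thesis using that by blast
qed

definition tagged :: "(nat list \<times> item) list \<Rightarrow> 'x list \<Rightarrow> (nat list \<times> item \<times> 'x) list" where
  "tagged es as = map (\<lambda>x. (fst (fst x), snd (fst x), snd x)) (zip es as)"

lemma tagged_map: "tagged (map (\<lambda>t. (f t, g t)) ts) (map h ts) = map (\<lambda>t. (f t, g t, h t)) ts"
  by (induction ts) (simp_all add: tagged_def)

text \<open>With empty keys every pool withholds its first candidate.\<close>

definition deterministic_alg :: online_alg where
  "deterministic_alg I = config_of (core choose_bits (family_list I)
     (tagged (entries (request_list I)) (map (\<lambda>_. []) (request_list I))))"

text \<open>The position of a key on the tape is determined by the index of the request, the number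
  of slots and the length of the family. So recomputing from a longer history reproduces all earlier
  choices.\<close>

definition random_alg :: rand_online_alg where
  "random_alg \<omega> I = config_of (core choose_bits (family_list I) (tagged (entries (request_list I))
     (map (paging_lists.bits (slots I) (family_list I) \<omega>) [0..<length (request_list I)])))"

definition offline_alg :: "paging_instance \<Rightarrow> config list" where
  "offline_alg I = map (\<lambda>pre. config_of (core choose_future (family_list I) pre))
     (prefixes (map (\<lambda>x. (fst (fst x), snd (fst x), snd x)) (futures (entries (request_list I)))))"

lemma revealed_lists:
  "family_list (revealed I t) = family_list I" "slots (revealed I t) = slots I"
  "request_list (revealed I t) = take t (request_list I)"
  by (simp_all add: family_list_def request_list_def revealed_def take_map)

lemma length_request_list [simp]: "length (request_list I) = length (requests I)"
  by (simp add: request_list_def)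

text \<open>The algorithm starts afresh on every history. Items depend only on earlier requests, so
  the results are the successive states of a single run.\<close>

lemma deterministic_run:
  assumes "I \<in> slot_laminar"
  shows "online_run deterministic_alg I = map (\<lambda>t. config_of (paging_lists.nodes_at (family_list I) (request_list I)
      choose_bits (\<lambda>_. []) t)) [1..<Suc (length (request_list I))]"
proof -
  interpret paging_lists "slots I" "family_list I" "request_list I" by (rule instance_lists [OF assms])
  have "deterministic_alg (revealed I t) = config_of (nodes_at choose_bits (\<lambda>_. []) t)" if "t \<le> length (request_list I)" for t
  proof -
    have "map (\<lambda>_. []) (take t (request_list I)) = map (\<lambda>_. [] :: bool list list) [0..<t]"
      using that by (simp add: list_eq_iff_nth_eq)
    then show ?thesis
      unfolding deterministic_alg_def revealed_lists entries_take [OF that] by (simp add: tagged_map core_nodes_at)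
  qed
  then show ?thesis unfolding online_run_def by (simp del: upt_Suc)
qed

lemma random_run:
  assumes "I \<in> slot_laminar"
  shows "online_run (random_alg \<omega>) I = map (\<lambda>t. config_of (paging_lists.nodes_at (family_list I) (request_list I)
      choose_bits (paging_lists.bits (slots I) (family_list I) \<omega>) t)) [1..<Suc (length (request_list I))]"
proof -
  interpret paging_lists "slots I" "family_list I" "request_list I" by (rule instance_lists [OF assms])
  have "random_alg \<omega> (revealed I t) = config_of (nodes_at choose_bits (bits \<omega>) t)" if "t \<le> length (request_list I)" for t
    using that unfolding random_alg_def revealed_lists entries_take [OF that] by (simp add: tagged_map core_nodes_at)
  then show ?thesis unfolding online_run_def by (simp del: upt_Suc)
qed

lemma offline_run:
  assumes "I \<in> slot_laminar"
  shows "offline_alg I = map (\<lambda>t. config_of (paging_lists.nodes_at (family_list I) (request_list I)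
      choose_future (\<lambda>t. drop (Suc t) (paging_lists.ents (request_list I))) t)) [1..<Suc (length (request_list I))]"
proof -
  interpret paging_lists "slots I" "family_list I" "request_list I" by (rule instance_lists [OF assms])
  let ?n = "length (request_list I)"
  let ?rs = "map (\<lambda>t. (S t, item t, drop (Suc t) ents)) [0..<?n]"
  have e: "entries (request_list I) = ents" using entries_take [of ?n] by (simp add: ents_def)
  have rs: "map (\<lambda>x. (fst (fst x), snd (fst x), snd x)) (futures (entries (request_list I))) = ?rs"
    unfolding e futures_eq by (simp add: ents_def)
  have "take t ?rs = map (\<lambda>t. (S t, item t, drop (Suc t) ents)) [0..<t]" if "t \<le> ?n" for t
    using that by (simp add: take_map)
  then have "core choose_future (family_list I) (take t ?rs) = nodes_at choose_future (\<lambda>t. drop (Suc t) ents) t" if "t \<le> ?n" for t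
    using that core_nodes_at by simp
  then show ?thesis unfolding offline_alg_def rs prefixes_eq by (simp del: upt_Suc)
qed

lemma deterministic_competitive:
  "competitive (\<lambda>I. 3 * real (laminar_height (set (family I))) ^ 2 * real (slots I)) deterministic_alg"
  unfolding competitive_def
proof (intro exI [of _ 0] ballI)
  fix I assume I: "I \<in> slot_laminar"
  interpret paging_lists "slots I" "family_list I" "request_list I" by (rule instance_lists [OF I])
  let ?h = "laminar_height (set (family I))"
  note rc = run_cost [OF choice_ok_bits refl instance_lists(3) [OF I] deterministic_run [OF I]]
  obtain Cs where Cs: "solution I Cs" "cost I Cs = opt I" by (rule opt_attained [OF rc(1)])
  have "(\<Sum>R\<in>set (family_list I). misses choose_bits (\<lambda>_. []) R) \<le> (\<Sum>R\<in>set (family_list I). slots I * freshes (\<lambda>_. [] :: bool list list) R)"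
  proof (rule sum_mono)
    fix R assume R: "R \<in> set (family_list I)"
    show "misses choose_bits (\<lambda>_. []) R \<le> slots I * freshes (\<lambda>_. [] :: bool list list) R"
      by (rule order_trans [OF misses_deterministic [OF choice_ok_bits R] mult_le_mono1 [OF length_le_k [OF R]]])
  qed
  also have "\<dots> = slots I * (\<Sum>R\<in>set (family_list I). freshes (\<lambda>_. [] :: bool list list) R)" by (rule sum_distrib_left [symmetric])
  also have "\<dots> \<le> slots I * (?h\<^sup>2 * opt I)"
    using sum_freshes_le [OF refl instance_lists(3) [OF I] Cs(1), of "\<lambda>_. [] :: bool list list"] instance_lists(2) [OF I] Cs(2) by simp
  finally have "cost I (online_run deterministic_alg I) \<le> 3 * (slots I * (?h\<^sup>2 * opt I))" using rc(2) by linarith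
  then have "real (cost I (online_run deterministic_alg I)) \<le> real (3 * (slots I * (?h\<^sup>2 * opt I)))" by (simp only: of_nat_le_iff)
  then show "solution I (online_run deterministic_alg I) \<and>
      real (cost I (online_run deterministic_alg I)) \<le> 3 * real ?h ^ 2 * real (slots I) * real (opt I) + 0"
    using rc(1) by (simp add: mult_ac)
qed

lemma offline_approximation:
  "approximation (\<lambda>I. 3 * real (laminar_height (set (family I))) ^ 2) offline_alg"
  unfolding approximation_def
proof
  fix I assume I: "I \<in> slot_laminar"
  interpret paging_lists "slots I" "family_list I" "request_list I" by (rule instance_lists [OF I])
  let ?h = "laminar_height (set (family I))"
  let ?aux = "\<lambda>t. drop (Suc t) ents"
  note rc = run_cost [OF choice_ok_future refl instance_lists(3) [OF I] offline_run [OF I]]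
  obtain Cs where Cs: "solution I Cs" "cost I Cs = opt I" by (rule opt_attained [OF rc(1)])
  have "(\<Sum>R\<in>set (family_list I). misses choose_future ?aux R) \<le> (\<Sum>R\<in>set (family_list I). freshes ?aux R)"
    by (rule sum_mono) (rule misses_future)
  also have "\<dots> \<le> ?h\<^sup>2 * opt I"
    using sum_freshes_le [OF refl instance_lists(3) [OF I] Cs(1), of ?aux] instance_lists(2) [OF I] Cs(2) by simp
  finally have "cost I (offline_alg I) \<le> 3 * (?h\<^sup>2 * opt I)" using rc(2) by linarith
  then have "real (cost I (offline_alg I)) \<le> real (3 * (?h\<^sup>2 * opt I))" by (simp only: of_nat_le_iff)
  then show "solution I (offline_alg I) \<and> real (cost I (offline_alg I)) \<le> 3 * real ?h ^ 2 * real (opt I)"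
    using rc(1) by simp
qed

lemma random_competitive:
  "rand_competitive (\<lambda>I. 3 * real (laminar_height (set (family I))) ^ 2 * harm (slots I)) random_alg"
  unfolding rand_competitive_def
\<comment> \<open>Ties cause at most one expected miss in total, and a miss costs at most three
  retrievals.\<close>
proof (intro exI [of _ 3] ballI conjI allI)
  fix I assume I: "I \<in> slot_laminar"
  interpret paging_lists "slots I" "family_list I" "request_list I" by (rule instance_lists [OF I])
  let ?h = "laminar_height (set (family I))"
  let ?run = "\<lambda>\<omega>. online_run (random_alg \<omega>) I"
  note rc = run_cost [OF choice_ok_bits refl instance_lists(3) [OF I] random_run [OF I]]
  show "solution I (?run \<omega>)" for \<omega> by (rule rc(1))
  obtain Cs where Cs: "solution I Cs" "cost I Cs = opt I" by (rule opt_attained [OF rc(1)])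
  have fin: "finitary (offset (length (request_list I))) (\<lambda>\<omega>. real (cost I (?run \<omega>)))"
    unfolding finitary_def
  proof (intro allI impI)
    fix \<omega> \<omega>' :: "nat \<Rightarrow> bool" assume e: "\<forall>i<offset (length (request_list I)). \<omega> i = \<omega>' i"
    have b: "bits \<omega> a = bits \<omega>' a" if "a < length (request_list I)" for a
      using e offset_mono [of "Suc a" "length (request_list I)"] that by (intro bits_cong) auto
    have "nodes_at choose_bits (bits \<omega>) t = nodes_at choose_bits (bits \<omega>') t" if "t \<le> length (request_list I)" for t
      using that by (induction t) (simp_all add: b)
    then have "?run \<omega> = ?run \<omega>'" unfolding random_run [OF I] by (simp del: upt_Suc)
    then show "real (cost I (?run \<omega>)) = real (cost I (?run \<omega>'))" by simp
  qed
  show i: "integrable coins (\<lambda>\<omega>. real (cost I (?run \<omega>)))" by (rule integrable_finitary [OF fin])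
  have im: "integrable coins (\<lambda>\<omega>. real (\<Sum>R\<in>set (family_list I). misses choose_bits (bits \<omega>) R))"
    unfolding of_nat_sum by (rule Bochner_Integration.integrable_sum) (rule sum_expected_misses(1))
  have "(LINT \<omega>|coins. real (cost I (?run \<omega>))) \<le> (LINT \<omega>|coins. 3 * real (\<Sum>R\<in>set (family_list I). misses choose_bits (bits \<omega>) R))"
  proof (rule integral_mono [OF i])
    show "integrable coins (\<lambda>\<omega>. 3 * real (\<Sum>R\<in>set (family_list I). misses choose_bits (bits \<omega>) R))" using im by (rule integrable_mult_right)
    fix \<omega>
    have "real (cost I (?run \<omega>)) \<le> real (3 * (\<Sum>R\<in>set (family_list I). misses choose_bits (bits \<omega>) R))"
      unfolding of_nat_le_iff by (rule rc(2))
    then show "real (cost I (?run \<omega>)) \<le> 3 * real (\<Sum>R\<in>set (family_list I). misses choose_bits (bits \<omega>) R)" by simp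
  qed
  also have "\<dots> = 3 * (LINT \<omega>|coins. real (\<Sum>R\<in>set (family_list I). misses choose_bits (bits \<omega>) R))" by simp
  also have "\<dots> \<le> 3 * (harm (slots I) * real (\<Sum>R\<in>set (family_list I). freshes (\<lambda>u. u) R) + 1)"
    by (rule mult_left_mono [OF sum_expected_misses(2)]) simp
  also have "\<dots> \<le> 3 * (harm (slots I) * real (?h\<^sup>2 * opt I) + 1)"
  proof -
    have "(\<Sum>R\<in>set (family_list I). freshes (\<lambda>u. u) R) \<le> ?h\<^sup>2 * opt I"
      using sum_freshes_le [OF refl instance_lists(3) [OF I] Cs(1), of "\<lambda>u. u"] instance_lists(2) [OF I] Cs(2) by simp
    then have le: "real (\<Sum>R\<in>set (family_list I). freshes (\<lambda>u. u) R) \<le> real (?h\<^sup>2 * opt I)"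
      by (simp only: of_nat_le_iff)
    show ?thesis by (intro mult_left_mono add_right_mono harm_nonneg le) simp
  qed
  also have "\<dots> = 3 * real ?h ^ 2 * harm (slots I) * real (opt I) + 3" by (simp add: algebra_simps)
  finally show "(LINT \<omega>|coins. real (cost I (?run \<omega>))) \<le> 3 * real ?h ^ 2 * harm (slots I) * real (opt I) + 3" .
qed

lemma poly_time_deterministic: "poly_time_online deterministic_alg"
  unfolding poly_time_online_def
proof (rule poly_time_pt)
  show "pt (\<lambda>z. map (config_of (core choose_bits (fst (snd z)) (tagged (entries (snd (snd z))) (map (\<lambda>_. []) (snd (snd z)))))) (fst z))"
    unfolding tagged_def by (intro pt_intros bits.pt_pages)
  show "enc_instance I = enc (as_lists I)" for I by (rule enc_as_lists)
  show "enc_config I (deterministic_alg I) = enc (map (config_of (core choose_bits (fst (snd (as_lists I)))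
      (tagged (entries (snd (snd (as_lists I)))) (map (\<lambda>_. []) (snd (snd (as_lists I))))))) (fst (as_lists I)))" for I
    by (simp add: enc_config_eq deterministic_alg_def as_lists_def)
qed

lemma poly_time_offline_alg: "poly_time_offline offline_alg"
  unfolding poly_time_offline_def
proof (rule poly_time_pt)
  show "pt (\<lambda>z. map (\<lambda>pre. map (config_of (core choose_future (fst (snd z)) pre)) (fst z))
      (prefixes (map (\<lambda>x. (fst (fst x), snd (fst x), snd x)) (futures (entries (snd (snd z)))))))"
    by (intro pt_intros future.pt_pages)
  show "enc_instance I = enc (as_lists I)" for I by (rule enc_as_lists)
  show "enc_list (enc_config I) (offline_alg I) = enc (map (\<lambda>pre. map (config_of (core choose_future (fst (snd (as_lists I))) pre)) (fst (as_lists I)))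
      (prefixes (map (\<lambda>x. (fst (fst x), snd (fst x), snd x)) (futures (entries (snd (snd (as_lists I))))))))" for I
    unfolding offline_alg_def enc_list_map as_lists_def fst_conv snd_conv enc_config_eq
    by (simp add: enc_list_map Submission.enc_list_def)
qed

text \<open>The numbers \<open>width t\<close> in unary: the prefix for time \<open>t\<close> has
  length \<open>Suc t\<close> and is used twice, as are the slots, and the family once.\<close>

definition bit_counts :: "nat list \<Rightarrow> nat list list \<Rightarrow> (nat \<times> nat list) list \<Rightarrow> bool list list" where
  "bit_counts ss FL rs = map (\<lambda>pre. map (\<lambda>_. True) pre @ map (\<lambda>_. True) pre @ map (\<lambda>_. True) ss @ map (\<lambda>_. True) ss @
     map (\<lambda>_. True) FL) (prefixes rs)"

lemma poly_time_random: "poly_time_rand_online random_alg"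
  unfolding poly_time_rand_online_def
\<comment> \<open>Requests, slots and family each have length at most the input size
  \<open>s\<close>, so the blocks need at most \<open>s * (5 * s) ^ 2\<close> coins.\<close>
proof (rule exI [of _ "[:0, 0, 0, 25:]"], rule poly_time_pt)
  let ?r = "[:0, 0, 0, 25:] :: nat poly"
  let ?f = "\<lambda>z. map (config_of (core choose_bits (fst (snd (fst z))) (tagged (entries (snd (snd (fst z))))
      (chop (bit_counts (fst (fst z)) (fst (snd (fst z))) (snd (snd (fst z)))) (snd z))))) (fst (fst z))"
  show "pt ?f"
    unfolding tagged_def bit_counts_def by (intro pt_intros bits.pt_pages pt_chop)
  let ?g = "\<lambda>x. (as_lists (snd x), map (fst x) [0..<poly ?r (size (enc_instance (snd x)))])"
  show "(case x of (\<omega>, I) \<Rightarrow> Pair (enc_instance I) (enc_list enc_bool (map \<omega> [0..<poly ?r (size (enc_instance I))]))) = enc (?g x)" for x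
    by (cases x) (simp add: enc_as_lists enc_prod_def Submission.enc_list_def Submission.enc_bool_def)
  fix x :: "(nat \<Rightarrow> bool) \<times> paging_instance"
  assume "x \<in> UNIV \<times> slot_laminar"
  then obtain \<omega> I where x: "x = (\<omega>, I)" and I: "I \<in> slot_laminar" by auto
  interpret paging_lists "slots I" "family_list I" "request_list I" by (rule instance_lists [OF I])
  let ?n = "length (request_list I)" and ?s = "size (enc_instance I)"
  have szs: "sz (slot_list I) \<le> ?s" "sz (family_list I) \<le> ?s" "sz (request_list I) \<le> ?s"
    by (simp_all add: enc_as_lists as_lists_def)
  then have le: "slots I \<le> ?s" "length (family_list I) \<le> ?s" "?n \<le> ?s"
    using length_le_sz [of "slot_list I"] length_le_sz [of "family_list I"] length_le_sz [of "request_list I"]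
    by (simp_all add: slot_list_eq del: upt_Suc)
  have "offset ?n \<le> ?n * (2 * ?n + 2 * slots I + length (family_list I)) ^ 2" by (rule offset_le)
  also have "\<dots> \<le> ?s * (5 * ?s) ^ 2" using le by (intro mult_le_mono power_mono) simp_all
  also have "\<dots> = poly ?r ?s" by (simp add: power2_eq_square)
  finally have off: "offset ?n \<le> poly ?r ?s" .
  let ?Ds = "bit_counts (slot_list I) (family_list I) (request_list I)"
  have lD: "length ?Ds = ?n" by (simp add: bit_counts_def prefixes_eq del: upt_Suc)
  have "length (?Ds ! t) = width t" if "t < length ?Ds" for t
    using that lD by (simp add: bit_counts_def prefixes_eq width_def slot_list_eq del: upt_Suc)
  from chop_bits [of ?Ds "poly ?r ?s" \<omega>, OF this] off lD
  have "chop ?Ds (map \<omega> [0..<poly ?r ?s]) = map (bits \<omega>) [0..<?n]" by simp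
  then show "(case x of (\<omega>, I) \<Rightarrow> enc_config I (random_alg \<omega> I)) = enc (?f (?g x))"
    unfolding x by (simp add: enc_config_eq random_alg_def as_lists_def)
qed

theorem theorem5:
  "(\<exists>A. poly_time_online A \<and>
      competitive (\<lambda>I. 3 * real (laminar_height (set (family I))) ^ 2 * real (slots I)) A) \<and>
   (\<exists>A. poly_time_rand_online A \<and>
      rand_competitive (\<lambda>I. 3 * real (laminar_height (set (family I))) ^ 2 * harm (slots I)) A) \<and>
   (\<exists>A. poly_time_offline A \<and>
      approximation (\<lambda>I. 3 * real (laminar_height (set (family I))) ^ 2) A)"
  using poly_time_deterministic deterministic_competitive poly_time_random random_competitive
    poly_time_offline_alg offline_approximation by blast

end
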